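(* Let $K$ be a field. Then $K$ is large if and only if $K$ is elementarily equivalent (in the first-order language of rings) to the fraction field of a henselian local domain which is not a field.
   Context: A field $K$ is large if every smooth one-dimensional $K$-variety (separated reduced scheme of finite type over $K$) with a $K$-point has infinitely many $K$-points; equivalently, whenever $f\in K[x,y]$ and $(a,b)\in K^2$ satisfy $f(a,b)=0\neq \partial f/\partial y(a,b)$, $f$ has infinitely many zeros in $K^2$. A local ring $R$ with maximal ideal $\mathfrak m$ is henselian if every simple root in $R/\mathfrak m$ of the reduction of a polynomial $f\in R[x]$ lifts to a root of $f$ in $R$. *)

theory Defs
  imports "HOL-Algebra.UnivPoly" "HOL-Algebra.QuotRing"
begin

section \<open>First-order language of rings\<close>

datatype rterm =
    Var nat
  | Zero
  | One
  | Add rterm rterm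
  | Minus rterm
  | Mult rterm rterm

datatype rform =
    Eq rterm rterm
  | Neg rform
  | Conj rform rform
  | Exists nat rform

primrec tvars :: "rterm \<Rightarrow> nat set" where
  "tvars (Var n) = {n}"
| "tvars Zero = {}"
| "tvars One = {}"
| "tvars (Add s t) = tvars s \<union> tvars t"
| "tvars (Minus t) = tvars t"
| "tvars (Mult s t) = tvars s \<union> tvars t"

primrec fvars :: "rform \<Rightarrow> nat set" where
  "fvars (Eq s t) = tvars s \<union> tvars t"
| "fvars (Neg p) = fvars p"
| "fvars (Conj p q) = fvars p \<union> fvars q"
| "fvars (Exists n p) = fvars p - {n}"

primrec tval :: "('a, 'm) ring_scheme \<Rightarrow> (nat \<Rightarrow> 'a) \<Rightarrow> rterm \<Rightarrow> 'a" where
  "tval K e (Var n) = e n"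
| "tval K e Zero = \<zero>\<^bsub>K\<^esub>"
| "tval K e One = \<one>\<^bsub>K\<^esub>"
| "tval K e (Add s t) = tval K e s \<oplus>\<^bsub>K\<^esub> tval K e t"
| "tval K e (Minus t) = \<ominus>\<^bsub>K\<^esub> tval K e t"
| "tval K e (Mult s t) = tval K e s \<otimes>\<^bsub>K\<^esub> tval K e t"

primrec sat :: "('a, 'm) ring_scheme \<Rightarrow> (nat \<Rightarrow> 'a) \<Rightarrow> rform \<Rightarrow> bool" where
  "sat K e (Eq s t) \<longleftrightarrow> tval K e s = tval K e t"
| "sat K e (Neg p) \<longleftrightarrow> \<not> sat K e p"
| "sat K e (Conj p q) \<longleftrightarrow> sat K e p \<and> sat K e q"
| "sat K e (Exists n p) \<longleftrightarrow> (\<exists>x\<in>carrier K. sat K (e(n := x)) p)"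

definition sentence :: "rform \<Rightarrow> bool" where
  "sentence p \<longleftrightarrow> fvars p = {}"

definition models :: "('a, 'm) ring_scheme \<Rightarrow> rform \<Rightarrow> bool" where
  "models K p \<longleftrightarrow> (\<forall>e \<in> UNIV \<rightarrow> carrier K. sat K e p)"

definition elem_equiv :: "('a, 'm) ring_scheme \<Rightarrow> ('b, 'n) ring_scheme \<Rightarrow> bool" where
  "elem_equiv K L \<longleftrightarrow> (\<forall>p. sentence p \<longrightarrow> (models K p \<longleftrightarrow> models L p))"

lemma tval_cong: "(\<And>n. n \<in> tvars t \<Longrightarrow> e n = e' n) \<Longrightarrow> tval K e t = tval K e' t"
  by (induction t) auto

lemma sat_cong: "(\<And>n. n \<in> fvars p \<Longrightarrow> e n = e' n) \<Longrightarrow> sat K e p \<longleftrightarrow> sat K e' p"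
proof (induction p arbitrary: e e')
  case (Eq s t)
  have "tval K e s = tval K e' s" "tval K e t = tval K e' t"
    using Eq by (auto intro: tval_cong)
  then show ?case by simp
next
  case (Neg p)
  have "sat K e p = sat K e' p" by (rule Neg.IH) (use Neg.prems in auto)
  then show ?case by simp
next
  case (Conj p q)
  have "sat K e p = sat K e' p" by (rule Conj.IH(1)) (use Conj.prems in auto)
  moreover have "sat K e q = sat K e' q" by (rule Conj.IH(2)) (use Conj.prems in auto)
  ultimately show ?case by simp
next
  case (Exists n p)
  have "sat K (e(n := x)) p = sat K (e'(n := x)) p" for x
    by (rule Exists.IH) (use Exists.prems in auto)
  then show ?case by simp
qed

lemma models_iff_sat:
  assumes "sentence p" "e \<in> UNIV \<rightarrow> carrier K"
  shows "models K p \<longleftrightarrow> sat K e p"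
  using assms sat_cong[of p e _ K] by (auto simp: models_def sentence_def)


section \<open>Polynomials\<close>

definition up_eval :: "('a, 'm) ring_scheme \<Rightarrow> 'a \<Rightarrow> (nat \<Rightarrow> 'a) \<Rightarrow> 'a" where
  "up_eval R a f = UnivPoly.eval R R id a f"

definition up_deriv :: "('a, 'm) ring_scheme \<Rightarrow> (nat \<Rightarrow> 'a) \<Rightarrow> nat \<Rightarrow> 'a" where
  "up_deriv R f = (\<lambda>n. [Suc n] \<cdot>\<^bsub>R\<^esub> coeff (UP R) f (Suc n))"

definition up_map :: "('a, 'm) ring_scheme \<Rightarrow> ('a \<Rightarrow> 'b) \<Rightarrow> (nat \<Rightarrow> 'a) \<Rightarrow> nat \<Rightarrow> 'b" where
  "up_map R h f = (\<lambda>n. h (coeff (UP R) f n))"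

definition simple_root :: "('a, 'm) ring_scheme \<Rightarrow> (nat \<Rightarrow> 'a) \<Rightarrow> 'a \<Rightarrow> bool" where
  "simple_root R f a \<longleftrightarrow> a \<in> carrier R \<and> up_eval R a f = \<zero>\<^bsub>R\<^esub>
     \<and> up_eval R a (up_deriv R f) \<noteq> \<zero>\<^bsub>R\<^esub>"

lemma up_deriv_closed:
  assumes "ring R" "f \<in> carrier (UP R)"
  shows "up_deriv R f \<in> carrier (UP R)"
proof -
  interpret ring R by fact
  have f: "f \<in> up R" using assms by (simp add: UP_def)
  then obtain n where n: "bound \<zero>\<^bsub>R\<^esub> n f" by (auto simp: up_def)
  have "bound \<zero>\<^bsub>R\<^esub> n (\<lambda>i. [Suc i] \<cdot>\<^bsub>R\<^esub> f (Suc i))"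
    using n by (auto simp: bound_def)
  then have "(\<lambda>i. [Suc i] \<cdot>\<^bsub>R\<^esub> f (Suc i)) \<in> up R"
    using f by (intro mem_upI) auto
  then show ?thesis using f by (simp add: up_deriv_def UP_def)
qed

lemma up_map_closed:
  assumes "h \<in> ring_hom R S" "ring R" "ring S" "f \<in> carrier (UP R)"
  shows "up_map R h f \<in> carrier (UP S)"
proof -
  have f: "f \<in> up R" using assms by (simp add: UP_def)
  then obtain n where n: "bound \<zero>\<^bsub>R\<^esub> n f" by (auto simp: up_def)
  have "bound \<zero>\<^bsub>S\<^esub> n (\<lambda>i. h (f i))"
    using n ring_hom_zero[OF assms(1-3)] by (auto simp: bound_def)
  then have "(\<lambda>i. h (f i)) \<in> up S"
    using f by (intro mem_upI) (auto intro: ring_hom_closed[OF assms(1)])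
  then show ?thesis using f by (simp add: up_map_def UP_def)
qed


section \<open>Large fields\<close>

text \<open>
  Polynomials in $K[x,y]$ are elements of $K[x][y]$, so the inner variable is $x$ and
  the formal derivative of the outer polynomial is the partial derivative in $y$.
  A field is large if every smooth curve over it with a rational point has infinitely many;
  this is stated through plane curves: a zero at which the derivative in $y$ does not vanish is
  accompanied by infinitely many zeros.
\<close>

definition eval2 :: "('a, 'm) ring_scheme \<Rightarrow> 'a \<Rightarrow> 'a \<Rightarrow> (nat \<Rightarrow> nat \<Rightarrow> 'a) \<Rightarrow> 'a" where
  "eval2 K a b f = UnivPoly.eval (UP K) K (up_eval K a) b f"

definition large_field :: "('a, 'm) ring_scheme \<Rightarrow> bool" where
  "large_field K \<longleftrightarrow> field K \<and>
     (\<forall>f \<in> carrier (UP (UP K)). \<forall>a \<in> carrier K. \<forall>b \<in> carrier K.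
        eval2 K a b f = \<zero>\<^bsub>K\<^esub> \<and> eval2 K a b (up_deriv (UP K) f) \<noteq> \<zero>\<^bsub>K\<^esub> \<longrightarrow>
        infinite {(x, y). x \<in> carrier K \<and> y \<in> carrier K \<and> eval2 K x y f = \<zero>\<^bsub>K\<^esub>})"


section \<open>Henselian local rings\<close>

definition local_ring :: "('a, 'm) ring_scheme \<Rightarrow> bool" where
  "local_ring R \<longleftrightarrow> cring R \<and> (\<exists>!m. maximalideal m R)"

definition henselian_local_ring :: "('a, 'm) ring_scheme \<Rightarrow> bool" where
  "henselian_local_ring R \<longleftrightarrow> local_ring R \<and>
     (\<forall>m. maximalideal m R \<longrightarrow>
       (\<forall>f \<in> carrier (UP R). \<forall>\<alpha>.
          simple_root (R Quot m) (up_map R (\<lambda>r. m +>\<^bsub>R\<^esub> r) f) \<alpha> \<longrightarrow>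
          (\<exists>a \<in> carrier R. up_eval R a f = \<zero>\<^bsub>R\<^esub> \<and> m +>\<^bsub>R\<^esub> a = \<alpha>)))"


section \<open>Fraction fields\<close>

definition frac_rel :: "('a, 'm) ring_scheme \<Rightarrow> (('a \<times> 'a) \<times> ('a \<times> 'a)) set" where
  "frac_rel R = {((a, b), (c, d)).
     a \<in> carrier R \<and> b \<in> carrier R - {\<zero>\<^bsub>R\<^esub>} \<and> c \<in> carrier R \<and> d \<in> carrier R - {\<zero>\<^bsub>R\<^esub>} \<and>
     a \<otimes>\<^bsub>R\<^esub> d = c \<otimes>\<^bsub>R\<^esub> b}"

definition frac :: "('a, 'm) ring_scheme \<Rightarrow> 'a \<Rightarrow> 'a \<Rightarrow> ('a \<times> 'a) set" where
  "frac R a b = frac_rel R `` {(a, b)}"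

definition frac_field :: "('a, 'm) ring_scheme \<Rightarrow> ('a \<times> 'a) set ring" where
  "frac_field R = \<lparr>
     carrier = (carrier R \<times> (carrier R - {\<zero>\<^bsub>R\<^esub>})) // frac_rel R,
     monoid.mult = (\<lambda>X Y. \<Union>(a, b)\<in>X. \<Union>(c, d)\<in>Y. frac R (a \<otimes>\<^bsub>R\<^esub> c) (b \<otimes>\<^bsub>R\<^esub> d)),
     one = frac R \<one>\<^bsub>R\<^esub> \<one>\<^bsub>R\<^esub>,
     zero = frac R \<zero>\<^bsub>R\<^esub> \<one>\<^bsub>R\<^esub>,
     add = (\<lambda>X Y. \<Union>(a, b)\<in>X. \<Union>(c, d)\<in>Y.
              frac R (a \<otimes>\<^bsub>R\<^esub> d \<oplus>\<^bsub>R\<^esub> c \<otimes>\<^bsub>R\<^esub> b) (b \<otimes>\<^bsub>R\<^esub> d))\<rparr>"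

context domain
begin

abbreviation "frac_pairs \<equiv> carrier R \<times> (carrier R - {\<zero>})"

lemma frac_rel_equiv: "equiv frac_pairs (frac_rel R)"
proof (rule equivI)
  show "frac_rel R \<subseteq> frac_pairs \<times> frac_pairs" by (auto simp: frac_rel_def)
  show "refl_on frac_pairs (frac_rel R)" by (auto simp: refl_on_def frac_rel_def)
  show "sym (frac_rel R)" by (auto simp: sym_def frac_rel_def)
  show "trans (frac_rel R)"
  proof (rule transI, clarsimp simp: frac_rel_def)
    fix a b c d e f
    assume R: "a \<in> carrier R" "b \<in> carrier R" "c \<in> carrier R" "d \<in> carrier R" "e \<in> carrier R"
        "f \<in> carrier R" and d: "d \<noteq> \<zero>"
      and eqs: "a \<otimes> d = c \<otimes> b" "c \<otimes> f = e \<otimes> d"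
    have "d \<otimes> (a \<otimes> f) = (a \<otimes> d) \<otimes> f" using R by (simp add: m_ac)
    also have "\<dots> = (c \<otimes> b) \<otimes> f" by (simp only: eqs)
    also have "\<dots> = (c \<otimes> f) \<otimes> b" using R by (simp add: m_ac)
    also have "\<dots> = (e \<otimes> d) \<otimes> b" by (simp only: eqs)
    also have "\<dots> = d \<otimes> (e \<otimes> b)" using R by (simp add: m_ac)
    finally show "a \<otimes> f = e \<otimes> b" using R d by (simp add: m_lcancel)
  qed
qed

lemma frac_eq_iff:
  assumes "a \<in> carrier R" "b \<in> carrier R - {\<zero>}" "c \<in> carrier R" "d \<in> carrier R - {\<zero>}"
  shows "frac R a b = frac R c d \<longleftrightarrow> a \<otimes> d = c \<otimes> b"
proof -
  have "frac R a b = frac R c d \<longleftrightarrow> ((a, b), (c, d)) \<in> frac_rel R"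
    unfolding frac_def using assms by (intro eq_equiv_class_iff[OF frac_rel_equiv]) auto
  also have "\<dots> \<longleftrightarrow> a \<otimes> d = c \<otimes> b" using assms by (auto simp: frac_rel_def)
  finally show ?thesis .
qed

lemma frac_eqI:
  "a \<in> carrier R \<Longrightarrow> b \<in> carrier R - {\<zero>} \<Longrightarrow> c \<in> carrier R \<Longrightarrow> d \<in> carrier R - {\<zero>} \<Longrightarrow>
   a \<otimes> d = c \<otimes> b \<Longrightarrow> frac R a b = frac R c d"
  by (simp only: frac_eq_iff)

lemma nonzero_mult:
  "b \<in> carrier R - {\<zero>} \<Longrightarrow> d \<in> carrier R - {\<zero>} \<Longrightarrow> b \<otimes> d \<in> carrier R - {\<zero>}"
  by (auto simp: integral_iff)

lemma frac_closed:
  "a \<in> carrier R \<Longrightarrow> b \<in> carrier R - {\<zero>} \<Longrightarrow> frac R a b \<in> carrier (frac_field R)"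
  by (auto simp: frac_field_def frac_def intro!: quotientI)

lemma frac_cases:
  assumes "X \<in> carrier (frac_field R)"
  obtains a b where "a \<in> carrier R" "b \<in> carrier R" "b \<noteq> \<zero>" "X = frac R a b"
  using assms by (auto simp: frac_field_def frac_def elim!: quotientE)

lemma UN_frac:
  assumes ab: "a \<in> carrier R" "b \<in> carrier R - {\<zero>}"
    and const: "\<And>a' b'. a' \<in> carrier R \<Longrightarrow> b' \<in> carrier R - {\<zero>} \<Longrightarrow> a \<otimes> b' = a' \<otimes> b \<Longrightarrow>
                  g a' b' = g a b"
  shows "(\<Union>(x, y)\<in>frac R a b. g x y) = g a b"
proof -
  have "(a, b) \<in> frac R a b" using ab by (auto simp: frac_def frac_rel_def)
  moreover have "g x y = g a b" if "(x, y) \<in> frac R a b" for x y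
    using that by (intro const) (auto simp: frac_def frac_rel_def)
  then have "(\<Union>(x, y)\<in>frac R a b. g x y) = (\<Union>p\<in>frac R a b. g a b)"
    by (intro SUP_cong refl) (simp only: split_paired_all prod.case)
  ultimately show ?thesis by (metis UN_constant empty_iff)
qed

lemma frac_mult:
  assumes R: "a \<in> carrier R" "b \<in> carrier R - {\<zero>}" "c \<in> carrier R" "d \<in> carrier R - {\<zero>}"
  shows "frac R a b \<otimes>\<^bsub>frac_field R\<^esub> frac R c d = frac R (a \<otimes> c) (b \<otimes> d)"
proof -
  have 1: "(\<Union>(x, y)\<in>frac R c d. frac R (a' \<otimes> x) (b' \<otimes> y)) = frac R (a' \<otimes> c) (b' \<otimes> d)"
    if "a' \<in> carrier R" "b' \<in> carrier R - {\<zero>}" for a' b'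
  proof (rule UN_frac[OF R(3,4)])
    fix x y assume xy: "x \<in> carrier R" "y \<in> carrier R - {\<zero>}" "c \<otimes> y = x \<otimes> d"
    have "(a' \<otimes> x) \<otimes> (b' \<otimes> d) = (a' \<otimes> b') \<otimes> (x \<otimes> d)" using that xy(1,2) R by (simp add: m_ac)
    also have "\<dots> = (a' \<otimes> b') \<otimes> (c \<otimes> y)" by (simp only: xy(3))
    also have "\<dots> = (a' \<otimes> c) \<otimes> (b' \<otimes> y)" using that xy(1,2) R by (simp add: m_ac)
    finally show "frac R (a' \<otimes> x) (b' \<otimes> y) = frac R (a' \<otimes> c) (b' \<otimes> d)"
      using that xy(1,2) R by (intro frac_eqI nonzero_mult m_closed a_closed) auto
  qed
  have "frac R a b \<otimes>\<^bsub>frac_field R\<^esub> frac R c d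
      = (\<Union>(a', b')\<in>frac R a b. \<Union>(x, y)\<in>frac R c d. frac R (a' \<otimes> x) (b' \<otimes> y))"
    by (simp add: frac_field_def)
  also have "\<dots> = (\<Union>(x, y)\<in>frac R c d. frac R (a \<otimes> x) (b \<otimes> y))"
  proof (rule UN_frac[OF R(1,2)])
    fix x y assume xy: "x \<in> carrier R" "y \<in> carrier R - {\<zero>}" "a \<otimes> y = x \<otimes> b"
    have "(x \<otimes> c) \<otimes> (b \<otimes> d) = (x \<otimes> b) \<otimes> (c \<otimes> d)" using xy(1,2) R by (simp add: m_ac)
    also have "\<dots> = (a \<otimes> y) \<otimes> (c \<otimes> d)" by (simp only: xy(3))
    also have "\<dots> = (a \<otimes> c) \<otimes> (y \<otimes> d)" using xy(1,2) R by (simp add: m_ac)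
    finally have "frac R (x \<otimes> c) (y \<otimes> d) = frac R (a \<otimes> c) (b \<otimes> d)"
      using xy(1,2) R by (intro frac_eqI nonzero_mult m_closed a_closed) auto
    then show "(\<Union>(x', y')\<in>frac R c d. frac R (x \<otimes> x') (y \<otimes> y'))
        = (\<Union>(x', y')\<in>frac R c d. frac R (a \<otimes> x') (b \<otimes> y'))"
      using 1 xy(1,2) R by simp
  qed
  also have "\<dots> = frac R (a \<otimes> c) (b \<otimes> d)" using 1 R by simp
  finally show ?thesis .
qed

lemma frac_add:
  assumes R: "a \<in> carrier R" "b \<in> carrier R - {\<zero>}" "c \<in> carrier R" "d \<in> carrier R - {\<zero>}"
  shows "frac R a b \<oplus>\<^bsub>frac_field R\<^esub> frac R c d = frac R (a \<otimes> d \<oplus> c \<otimes> b) (b \<otimes> d)"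
proof -
  have 1: "(\<Union>(x, y)\<in>frac R c d. frac R (a' \<otimes> y \<oplus> x \<otimes> b') (b' \<otimes> y))
      = frac R (a' \<otimes> d \<oplus> c \<otimes> b') (b' \<otimes> d)"
    if "a' \<in> carrier R" "b' \<in> carrier R - {\<zero>}" for a' b'
  proof (rule UN_frac[OF R(3,4)])
    fix x y assume xy: "x \<in> carrier R" "y \<in> carrier R - {\<zero>}" "c \<otimes> y = x \<otimes> d"
    have "(a' \<otimes> y \<oplus> x \<otimes> b') \<otimes> (b' \<otimes> d) = a' \<otimes> b' \<otimes> (y \<otimes> d) \<oplus> b' \<otimes> b' \<otimes> (x \<otimes> d)"
      using that xy(1,2) R by (simp add: m_ac a_ac l_distr r_distr)
    also have "\<dots> = a' \<otimes> b' \<otimes> (y \<otimes> d) \<oplus> b' \<otimes> b' \<otimes> (c \<otimes> y)" by (simp only: xy(3))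
    also have "\<dots> = (a' \<otimes> d \<oplus> c \<otimes> b') \<otimes> (b' \<otimes> y)"
      using that xy(1,2) R by (simp add: m_ac a_ac l_distr r_distr)
    finally show "frac R (a' \<otimes> y \<oplus> x \<otimes> b') (b' \<otimes> y) = frac R (a' \<otimes> d \<oplus> c \<otimes> b') (b' \<otimes> d)"
      using that xy(1,2) R by (intro frac_eqI nonzero_mult m_closed a_closed) auto
  qed
  have "frac R a b \<oplus>\<^bsub>frac_field R\<^esub> frac R c d
      = (\<Union>(a', b')\<in>frac R a b. \<Union>(x, y)\<in>frac R c d. frac R (a' \<otimes> y \<oplus> x \<otimes> b') (b' \<otimes> y))"
    by (simp add: frac_field_def)
  also have "\<dots> = (\<Union>(x, y)\<in>frac R c d. frac R (a \<otimes> y \<oplus> x \<otimes> b) (b \<otimes> y))"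
  proof (rule UN_frac[OF R(1,2)])
    fix x y assume xy: "x \<in> carrier R" "y \<in> carrier R - {\<zero>}" "a \<otimes> y = x \<otimes> b"
    have "(x \<otimes> d \<oplus> c \<otimes> y) \<otimes> (b \<otimes> d) = (x \<otimes> b) \<otimes> (d \<otimes> d) \<oplus> c \<otimes> y \<otimes> (b \<otimes> d)"
      using xy(1,2) R by (simp add: m_ac a_ac l_distr r_distr)
    also have "\<dots> = (a \<otimes> y) \<otimes> (d \<otimes> d) \<oplus> c \<otimes> y \<otimes> (b \<otimes> d)" by (simp only: xy(3))
    also have "\<dots> = (a \<otimes> d \<oplus> c \<otimes> b) \<otimes> (y \<otimes> d)"
      using xy(1,2) R by (simp add: m_ac a_ac l_distr r_distr)
    finally have "frac R (x \<otimes> d \<oplus> c \<otimes> y) (y \<otimes> d) = frac R (a \<otimes> d \<oplus> c \<otimes> b) (b \<otimes> d)"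
      using xy(1,2) R by (intro frac_eqI nonzero_mult m_closed a_closed) auto
    then show "(\<Union>(x', y')\<in>frac R c d. frac R (x \<otimes> y' \<oplus> x' \<otimes> y) (y \<otimes> y'))
        = (\<Union>(x', y')\<in>frac R c d. frac R (a \<otimes> y' \<oplus> x' \<otimes> b) (b \<otimes> y'))"
      using 1 xy(1,2) R by simp
  qed
  also have "\<dots> = frac R (a \<otimes> d \<oplus> c \<otimes> b) (b \<otimes> d)" using 1 R by simp
  finally show ?thesis .
qed

lemma frac_field_one: "\<one>\<^bsub>frac_field R\<^esub> = frac R \<one> \<one>"
  and frac_field_zero: "\<zero>\<^bsub>frac_field R\<^esub> = frac R \<zero> \<one>"
  by (simp_all add: frac_field_def)

lemma frac_field_is_field: "field (frac_field R)"
proof -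
  let ?F = "frac_field R"
  have cr: "cring ?F"
  proof (intro cringI abelian_groupI comm_monoidI)
    fix x y z assume x: "x \<in> carrier ?F" and y: "y \<in> carrier ?F" and z: "z \<in> carrier ?F"
    obtain a b where ab: "a \<in> carrier R" "b \<in> carrier R" "b \<noteq> \<zero>" "x = frac R a b"
      using x by (rule frac_cases)
    obtain c d where cd: "c \<in> carrier R" "d \<in> carrier R" "d \<noteq> \<zero>" "y = frac R c d"
      using y by (rule frac_cases)
    obtain e f where ef: "e \<in> carrier R" "f \<in> carrier R" "f \<noteq> \<zero>" "z = frac R e f"
      using z by (rule frac_cases)
    note R = ab cd ef
    show "x \<oplus>\<^bsub>?F\<^esub> y \<oplus>\<^bsub>?F\<^esub> z = x \<oplus>\<^bsub>?F\<^esub> (y \<oplus>\<^bsub>?F\<^esub> z)"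
      using R by (simp add: frac_add integral_iff m_ac a_ac l_distr r_distr)
    show "x \<otimes>\<^bsub>?F\<^esub> y \<otimes>\<^bsub>?F\<^esub> z = x \<otimes>\<^bsub>?F\<^esub> (y \<otimes>\<^bsub>?F\<^esub> z)"
      using R by (simp add: frac_mult integral_iff m_ac)
    have "frac R ((a \<otimes> d \<oplus> c \<otimes> b) \<otimes> e) (b \<otimes> d \<otimes> f) =
        frac R ((a \<otimes> e) \<otimes> (d \<otimes> f) \<oplus> (c \<otimes> e) \<otimes> (b \<otimes> f)) ((b \<otimes> f) \<otimes> (d \<otimes> f))"
      by (rule frac_eqI) (use R in \<open>simp_all add: integral_iff m_ac a_ac l_distr r_distr\<close>)
    then show "(x \<oplus>\<^bsub>?F\<^esub> y) \<otimes>\<^bsub>?F\<^esub> z = x \<otimes>\<^bsub>?F\<^esub> z \<oplus>\<^bsub>?F\<^esub> y \<otimes>\<^bsub>?F\<^esub> z"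
      using R by (simp add: frac_mult frac_add integral_iff)
  next
    fix x y assume x: "x \<in> carrier ?F" and y: "y \<in> carrier ?F"
    obtain a b where ab: "a \<in> carrier R" "b \<in> carrier R" "b \<noteq> \<zero>" "x = frac R a b"
      using x by (rule frac_cases)
    obtain c d where cd: "c \<in> carrier R" "d \<in> carrier R" "d \<noteq> \<zero>" "y = frac R c d"
      using y by (rule frac_cases)
    note R = ab cd
    show "x \<oplus>\<^bsub>?F\<^esub> y \<in> carrier ?F"
      using R by (simp add: frac_add frac_closed integral_iff)
    show "x \<otimes>\<^bsub>?F\<^esub> y \<in> carrier ?F"
      using R by (simp add: frac_mult frac_closed integral_iff)
    show "x \<oplus>\<^bsub>?F\<^esub> y = y \<oplus>\<^bsub>?F\<^esub> x"
      using R by (simp add: frac_add m_comm a_comm)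
    show "x \<otimes>\<^bsub>?F\<^esub> y = y \<otimes>\<^bsub>?F\<^esub> x"
      using R by (simp add: frac_mult m_comm)
  next
    fix x assume x: "x \<in> carrier ?F"
    obtain a b where R: "a \<in> carrier R" "b \<in> carrier R" "b \<noteq> \<zero>" "x = frac R a b"
      using x by (rule frac_cases)
    show "\<zero>\<^bsub>?F\<^esub> \<oplus>\<^bsub>?F\<^esub> x = x"
      using R by (simp add: frac_field_zero frac_add)
    show "\<one>\<^bsub>?F\<^esub> \<otimes>\<^bsub>?F\<^esub> x = x"
      using R by (simp add: frac_field_one frac_mult)
    have "frac R (\<ominus> a) b \<oplus>\<^bsub>?F\<^esub> x = frac R (\<ominus> a \<otimes> b \<oplus> a \<otimes> b) (b \<otimes> b)"
      using R by (simp add: frac_add)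
    also have "\<dots> = \<zero>\<^bsub>?F\<^esub>"
      unfolding frac_field_zero
      by (rule frac_eqI) (use R in \<open>simp_all add: integral_iff l_minus l_neg\<close>)
    finally show "\<exists>y\<in>carrier ?F. y \<oplus>\<^bsub>?F\<^esub> x = \<zero>\<^bsub>?F\<^esub>"
      using R by (intro bexI[of _ "frac R (\<ominus> a) b"] frac_closed) auto
  qed (auto simp: frac_field_zero frac_field_one intro!: frac_closed)
  show ?thesis
  proof (rule cring.cring_fieldI2[OF cr])
    show "\<zero>\<^bsub>?F\<^esub> \<noteq> \<one>\<^bsub>?F\<^esub>" by (simp add: frac_field_zero frac_field_one frac_eq_iff)
    fix x assume x: "x \<in> carrier ?F" "x \<noteq> \<zero>\<^bsub>?F\<^esub>"
    obtain a b where R: "a \<in> carrier R" "b \<in> carrier R" "b \<noteq> \<zero>" "x = frac R a b"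
      using x(1) by (rule frac_cases)
    have a: "a \<noteq> \<zero>" using x(2) R by (auto simp: frac_field_zero frac_eq_iff)
    have "x \<otimes>\<^bsub>?F\<^esub> frac R b a = frac R (a \<otimes> b) (b \<otimes> a)"
      using R a by (simp add: frac_mult)
    also have "\<dots> = \<one>\<^bsub>?F\<^esub>"
      unfolding frac_field_one
      by (rule frac_eqI) (use R a in \<open>simp_all add: integral_iff m_comm\<close>)
    finally show "\<exists>y\<in>carrier ?F. x \<otimes>\<^bsub>?F\<^esub> y = \<one>\<^bsub>?F\<^esub>"
      using R a by (intro bexI[of _ "frac R b a"] frac_closed) auto
  qed
qed

end

end

theory Submission
  imports Defs "HOL-Algebra.Subrings" "HOL-Library.Countable_Set"
begin

text \<open>
  Over the fraction field of a henselian domain that is not a field, a point of a plane curve at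
  which the \<open>y\<close>-derivative does not vanish can be moved: after clearing denominators, Hensel's lemma
  solves for \<open>y\<close> for every sufficiently divisible perturbation of the \<open>x\<close>-coordinate. Largeness is
  expressed by sentences, hence passes to elementarily equivalent fields.

  Conversely, replace \<open>K\<close> by a sufficiently saturated elementary extension \<open>F\<close> (an ultrapower). The
  power series algebraic over \<open>F(X)\<close> and lying in the henselisation of \<open>F[X]\<close> at the origin form a
  henselian local ring. Finitely many of them are regular functions near a smooth rational point of a
  plane curve, so largeness of \<open>F\<close> provides points at which finitely many given nonzero series do
  not vanish, and saturation turns these into an embedding over \<open>F\<close>, into \<open>F\<close> itself, of any
  countable set of such series. If \<open>R\<close> is a henselian subring of a countable elementary subfield
  \<open>L\<close>, the series with constant term in \<open>R\<close> again form a henselian ring; a countable henselian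
  subring of it that contains \<open>R\<close>, \<open>X\<close> and \<open>XL\<close> embeds into \<open>F\<close>, and every element of \<open>L\<close> is a fraction
  over the image. The union of an \<open>\<omega>\<close>-chain of such extensions is a henselian domain whose fraction
  field is an elementary subfield of \<open>F\<close>. As it is countable, it can be copied to any infinite type.
\<close>

section \<open>Polynomials as coefficient lists\<close>

text \<open>Largeness is a statement about curves, so only series algebraic over F(X) are
  specialised: finitely many of them are functions on one curve. To obtain a plane model of that
  curve without a primitive element theorem, each finite algebra carries an element \<open>e\<close>
  separating the origin from the rest of its fibre; \<open>X\<close> and \<open>1 - e\<close> then
  generate the local ring. Saturation of an ultrapower over the natural numbers handles countably
  many formulas with countably many parameters, so only countable sets of series can be embedded.
  This is why elementary subfields are kept countable. One embedding is not enough. Its image R'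
  contains a nonzero multiplier, the image of X, and that multiplier times every element of L, so L
  lies in the fractions of R'; but the fractions of R' need not form an elementary subfield.
  Enlarging L to contain R' and repeating makes the two conditions alternate, and they meet in the
  limit. Each new maximal ideal cuts out the old one on the old ring, so non-units stay non-units
  and the union is again local.\<close>

primrec horner :: "('a, 'm) ring_scheme \<Rightarrow> 'a list \<Rightarrow> 'a \<Rightarrow> 'a" where
  "horner R [] x = \<zero>\<^bsub>R\<^esub>"
| "horner R (c # cs) x = c \<oplus>\<^bsub>R\<^esub> x \<otimes>\<^bsub>R\<^esub> horner R cs x"

text \<open>The derivative follows the product rule along Horner's scheme, so no integer multiples
  of coefficients appear. Lists are convenient because the same list can be read in a ring or a
  subring, sent through a homomorphism by \<open>map\<close>, and turned into a first-order
  term.\<close>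

primrec dhorner :: "('a, 'm) ring_scheme \<Rightarrow> 'a list \<Rightarrow> 'a \<Rightarrow> 'a" where
  "dhorner R [] x = \<zero>\<^bsub>R\<^esub>"
| "dhorner R (c # cs) x = horner R cs x \<oplus>\<^bsub>R\<^esub> x \<otimes>\<^bsub>R\<^esub> dhorner R cs x"

context cring
begin

lemma horner_closed [simp]:
  "set cs \<subseteq> carrier R \<Longrightarrow> x \<in> carrier R \<Longrightarrow> horner R cs x \<in> carrier R"
  by (induction cs) auto

lemma dhorner_closed [simp]:
  "set cs \<subseteq> carrier R \<Longrightarrow> x \<in> carrier R \<Longrightarrow> dhorner R cs x \<in> carrier R"
  by (induction cs) auto

lemma horner_snoc:
  assumes "set cs \<subseteq> carrier R" "d \<in> carrier R" "x \<in> carrier R"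
  shows "horner R (cs @ [d]) x = horner R cs x \<oplus> d \<otimes> x [^] length cs"
  using assms
proof (induction cs)
  case (Cons c cs)
  then have "horner R ((c # cs) @ [d]) x = c \<oplus> x \<otimes> (horner R cs x \<oplus> d \<otimes> x [^] length cs)"
    by simp
  also have "\<dots> = c \<oplus> x \<otimes> horner R cs x \<oplus> d \<otimes> (x [^] length cs \<otimes> x)"
    using Cons.prems by (simp add: r_distr a_ac m_ac)
  finally show ?case by simp
qed simp

lemma dhorner_snoc:
  assumes "set cs \<subseteq> carrier R" "d \<in> carrier R" "x \<in> carrier R"
  shows "dhorner R (cs @ [d]) x
    = dhorner R cs x \<oplus> [length cs] \<cdot> d \<otimes> x [^] (length cs - 1)"
  using assms
proof (induction cs)
  case (Cons c cs)
  have *: "x \<otimes> ([length cs] \<cdot> d \<otimes> x [^] (length cs - Suc 0)) = [length cs] \<cdot> d \<otimes> x [^] length cs"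
  proof (cases "length cs = 0")
    case False
    then obtain k where k: "length cs = Suc k" using not0_implies_Suc by blast
    have "x \<otimes> (e \<otimes> x [^] k) = e \<otimes> (x [^] k \<otimes> x)" if "e \<in> carrier R" for e
      using that Cons.prems by (simp add: m_ac)
    from this[of "[length cs] \<cdot> d"] show ?thesis
      unfolding k using Cons.prems by (simp del: add.nat_pow_Suc)
  next
    case True
    then show ?thesis using Cons.prems by simp
  qed
  have "dhorner R ((c # cs) @ [d]) x = horner R cs x \<oplus> d \<otimes> x [^] length cs
      \<oplus> x \<otimes> (dhorner R cs x \<oplus> [length cs] \<cdot> d \<otimes> x [^] (length cs - 1))"
    using Cons by (simp add: horner_snoc)
  also have "\<dots> = dhorner R (c # cs) x \<oplus> (d \<otimes> x [^] length cs \<oplus> [length cs] \<cdot> d \<otimes> x [^] length cs)"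
    using Cons.prems by (simp add: r_distr a_ac * )
  also have "d \<otimes> x [^] length cs \<oplus> [length cs] \<cdot> d \<otimes> x [^] length cs
      = [Suc (length cs)] \<cdot> d \<otimes> x [^] length cs"
    using Cons.prems by (simp add: l_distr a_ac)
  finally show ?case by simp
qed simp

lemma horner_sum:
  assumes "\<And>i. c i \<in> carrier R" "x \<in> carrier R"
  shows "horner R (map c [0..<n]) x = (\<Oplus>i\<in>{..<n}. c i \<otimes> x [^] i)"
proof (induction n)
  case (Suc n)
  have "horner R (map c [0..<n] @ [c n]) x
      = horner R (map c [0..<n]) x \<oplus> c n \<otimes> x [^] length (map c [0..<n])"
    by (rule horner_snoc) (use assms in auto)
  with Suc assms show ?case by (simp add: lessThan_Suc a_comm Pi_def)
qed simp

lemma horner_deriv: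
  assumes "\<And>i. c i \<in> carrier R" "x \<in> carrier R"
  shows "horner R (map (\<lambda>i. [Suc i] \<cdot> c (Suc i)) [0..<n]) x = dhorner R (map c [0..<Suc n]) x"
proof (induction n)
  case (Suc n)
  let ?c = "\<lambda>i. [Suc i] \<cdot> c (Suc i)"
  have "horner R (map ?c [0..<Suc n]) x = horner R (map ?c [0..<n] @ [?c n]) x" by simp
  also have "\<dots> = horner R (map ?c [0..<n]) x \<oplus> ?c n \<otimes> x [^] length (map ?c [0..<n])"
    by (rule horner_snoc) (use assms in auto)
  also have "\<dots> = dhorner R (map c [0..<Suc n]) x \<oplus> [length (map c [0..<Suc n])] \<cdot> c (Suc n)
      \<otimes> x [^] (length (map c [0..<Suc n]) - 1)"
    by (simp only: Suc) simp
  also have "\<dots> = dhorner R (map c [0..<Suc n] @ [c (Suc n)]) x"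
    by (rule dhorner_snoc[symmetric]) (use assms in auto)
  finally show ?case by simp
qed (use assms in simp)

end

lemma horner_cong:
  fixes R :: "('a, 'm) ring_scheme" and S :: "('a, 'n) ring_scheme"
  shows "monoid.mult R = monoid.mult S \<Longrightarrow> add R = add S \<Longrightarrow> ring.zero R = ring.zero S \<Longrightarrow> horner R cs x = horner S cs x"
  by (induction cs) auto

lemma dhorner_cong:
  fixes R :: "('a, 'm) ring_scheme" and S :: "('a, 'n) ring_scheme"
  shows "monoid.mult R = monoid.mult S \<Longrightarrow> add R = add S \<Longrightarrow> ring.zero R = ring.zero S \<Longrightarrow> dhorner R cs x = dhorner S cs x"
  by (induction cs) (auto simp: horner_cong[of R S])

lemma (in ring_hom_cring) hom_horner:
  "set cs \<subseteq> carrier R \<Longrightarrow> x \<in> carrier R \<Longrightarrow> h (horner R cs x) = horner S (map h cs) (h x)"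
  by (induction cs) auto

lemma (in ring_hom_cring) hom_dhorner:
  "set cs \<subseteq> carrier R \<Longrightarrow> x \<in> carrier R \<Longrightarrow> h (dhorner R cs x) = dhorner S (map h cs) (h x)"
  by (induction cs) (auto simp: hom_horner)

lemma (in ring_hom_cring) hom_add_pow:
  "x \<in> carrier R \<Longrightarrow> h ([(n::nat)] \<cdot>\<^bsub>R\<^esub> x) = [n] \<cdot>\<^bsub>S\<^esub> h x"
  by (induction n) auto

context UP_pre_univ_prop
begin

text \<open>Any \<open>n\<close> beyond the support may replace the degree. Both sums are compared
  with the sum over the union of their index sets, where the extra terms vanish.\<close>

lemma eval_horner:
  assumes p: "p \<in> carrier P" and s: "s \<in> carrier S" and n: "\<And>i. i \<ge> n \<Longrightarrow> p i = \<zero>"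
  shows "UnivPoly.eval R S h s p = horner S (map (\<lambda>i. h (p i)) [0..<n]) s"
proof -
  have cl: "p i \<in> carrier R" for i
    using p by (auto simp: P_def UP_def)
  have co: "coeff P p i = p i" for i using p by (simp add: P_def UP_def)
  let ?f = "\<lambda>i. h (p i) \<otimes>\<^bsub>S\<^esub> s [^]\<^bsub>S\<^esub> i"
  have f: "?f \<in> A \<rightarrow> carrier S" for A using cl s by auto
  have "UnivPoly.eval R S h s p = (\<Oplus>\<^bsub>S\<^esub>i\<in>{..deg R p}. ?f i)"
    using p by (simp add: eval_on_carrier co)
  also have "\<dots> = (\<Oplus>\<^bsub>S\<^esub>i\<in>{..deg R p} \<union> {..<n}. ?f i)"
  proof (rule S.add.finprod_mono_neutral_cong_left)
    show "?f i = \<zero>\<^bsub>S\<^esub>" if "i \<in> ({..deg R p} \<union> {..<n}) - {..deg R p}" for i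
      using that deg_aboveD[of p, unfolded co] p s by auto
  qed (use f in auto)
  also have "\<dots> = (\<Oplus>\<^bsub>S\<^esub>i\<in>{..<n}. ?f i)"
  proof (rule S.add.finprod_mono_neutral_cong_left[symmetric])
    show "?f i = \<zero>\<^bsub>S\<^esub>" if "i \<in> ({..deg R p} \<union> {..<n}) - {..<n}" for i
      using that n s by auto
  qed (use f in auto)
  also have "\<dots> = horner S (map (\<lambda>i. h (p i)) [0..<n]) s"
    using cl s by (intro S.horner_sum[symmetric]) auto
  finally show ?thesis .
qed

lemma eval_up_deriv_horner:
  assumes p: "p \<in> carrier P" and s: "s \<in> carrier S" and n: "\<And>i. i \<ge> n \<Longrightarrow> p i = \<zero>"
  shows "UnivPoly.eval R S h s (up_deriv R p) = dhorner S (map (\<lambda>i. h (p i)) [0..<n]) s"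
proof -
  have cl: "p i \<in> carrier R" for i
    using p by (auto simp: P_def UP_def)
  have co: "coeff (UP R) p i = p i" for i using p by (simp add: P_def UP_def)
  have d: "up_deriv R p \<in> carrier P"
    unfolding P_def by (rule up_deriv_closed) (use p in \<open>auto simp: P_def intro: R.ring_axioms\<close>)
  show ?thesis
  proof (cases n)
    case 0
    have "UnivPoly.eval R S h s (up_deriv R p) = horner S (map (\<lambda>i. h (up_deriv R p i)) [0..<0]) s"
      by (rule eval_horner[OF d s]) (use n 0 in \<open>simp add: up_deriv_def co\<close>)
    then show ?thesis using 0 by simp
  next
    case (Suc m)
    have "UnivPoly.eval R S h s (up_deriv R p) = horner S (map (\<lambda>i. h (up_deriv R p i)) [0..<m]) s"
      by (rule eval_horner[OF d s]) (use n Suc in \<open>simp add: up_deriv_def co\<close>)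
    also have "map (\<lambda>i. h (up_deriv R p i)) [0..<m] = map (\<lambda>i. [Suc i] \<cdot>\<^bsub>S\<^esub> h (p (Suc i))) [0..<m]"
      using cl by (simp only: up_deriv_def co) (simp add: hom_add_pow del: R.add.nat_pow_Suc S.add.nat_pow_Suc add_pow_def)
    also have "horner S \<dots> s = dhorner S (map (\<lambda>i. h (p i)) [0..<Suc m]) s"
      using cl s by (intro S.horner_deriv) auto
    finally show ?thesis using Suc by simp
  qed
qed

end

lemma (in UP_cring) coeffs_obtain:
  assumes "f \<in> carrier P"
  obtains n where "\<And>i. i \<ge> n \<Longrightarrow> f i = \<zero>" "\<And>i. f i \<in> carrier R"
proof -
  have "f i \<in> carrier R" for i using assms by (auto simp: P_def UP_def)
  moreover have "coeff P f i = f i" for i using assms by (simp add: P_def UP_def)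
  ultimately show ?thesis
    using deg_aboveD[of f] assms by (intro that[of "Suc (deg R f)"]) auto
qed

definition list_poly :: "('a, 'm) ring_scheme \<Rightarrow> 'a list \<Rightarrow> nat \<Rightarrow> 'a" where
  "list_poly R cs = (\<lambda>i. if i < length cs then cs ! i else \<zero>\<^bsub>R\<^esub>)"

lemma (in ring) list_poly_closed:
  assumes "set cs \<subseteq> carrier R"
  shows "list_poly R cs \<in> carrier (UP R)"
proof -
  have "bound \<zero> (length cs) (list_poly R cs)" by (auto simp: bound_def list_poly_def)
  moreover have "list_poly R cs i \<in> carrier R" for i
    using assms nth_mem[of i cs] by (auto simp: list_poly_def)
  ultimately show ?thesis by (auto simp: UP_def intro: mem_upI)
qed

lemma list_poly_map:
  "map (\<lambda>i. h (list_poly R cs i)) [0..<length cs] = map h cs"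
  by (auto simp: list_poly_def intro: nth_equalityI)

context cring
begin

lemma UP_pre_univ_prop_id: "UP_pre_univ_prop R R id"
  by (intro UP_pre_univ_prop.intro ring_hom_cringI UP_cring.intro cring_axioms) auto

lemma up_eval_horner:
  assumes "p \<in> carrier (UP R)" "s \<in> carrier R" "\<And>i. i \<ge> n \<Longrightarrow> p i = \<zero>"
  shows "up_eval R s p = horner R (map p [0..<n]) s"
    and "up_eval R s (up_deriv R p) = dhorner R (map p [0..<n]) s"
  using UP_pre_univ_prop.eval_horner[OF UP_pre_univ_prop_id assms]
    UP_pre_univ_prop.eval_up_deriv_horner[OF UP_pre_univ_prop_id assms]
  by (simp_all add: up_eval_def)

lemma up_eval_hom: "s \<in> carrier R \<Longrightarrow> up_eval R s \<in> ring_hom (UP R) R"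
  using UP_pre_univ_prop.eval_ring_hom[OF UP_pre_univ_prop_id] by (simp add: up_eval_def[abs_def])

lemma UP_is_cring: "cring (UP R)"
  by (rule UP_cring.UP_cring) (intro UP_cring.intro cring_axioms)

lemma UP_pre_univ_prop_up_eval:
  "s \<in> carrier R \<Longrightarrow> UP_pre_univ_prop (UP R) R (up_eval R s)"
  by (intro UP_pre_univ_prop.intro ring_hom_cringI UP_cring.intro up_eval_hom cring_axioms UP_is_cring)

lemma eval2_horner:
  assumes "f \<in> carrier (UP (UP R))" "a \<in> carrier R" "b \<in> carrier R"
    and "\<And>i. i \<ge> n \<Longrightarrow> f i = \<zero>\<^bsub>UP R\<^esub>"
  shows "eval2 R a b f = horner R (map (\<lambda>i. up_eval R a (f i)) [0..<n]) b"
    and "eval2 R a b (up_deriv (UP R) f) = dhorner R (map (\<lambda>i. up_eval R a (f i)) [0..<n]) b"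
  using UP_pre_univ_prop.eval_horner[OF UP_pre_univ_prop_up_eval[OF assms(2)] assms(1,3,4)]
    UP_pre_univ_prop.eval_up_deriv_horner[OF UP_pre_univ_prop_up_eval[OF assms(2)] assms(1,3,4)]
  by (simp_all add: eval2_def)

lemma eval2_hom: "a \<in> carrier R \<Longrightarrow> b \<in> carrier R \<Longrightarrow> eval2 R a b \<in> ring_hom (UP (UP R)) R"
  using UP_pre_univ_prop.eval_ring_hom[OF UP_pre_univ_prop_up_eval]
  by (simp add: eval2_def[abs_def])

end

definition horner2 :: "('a, 'm) ring_scheme \<Rightarrow> 'a list list \<Rightarrow> 'a \<Rightarrow> 'a \<Rightarrow> 'a" where
  "horner2 R css a b = horner R (map (\<lambda>cs. horner R cs a) css) b"

definition dhorner2 :: "('a, 'm) ring_scheme \<Rightarrow> 'a list list \<Rightarrow> 'a \<Rightarrow> 'a \<Rightarrow> 'a" where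
  "dhorner2 R css a b = dhorner R (map (\<lambda>cs. horner R cs a) css) b"

lemma (in cring) eval2_lists:
  assumes f: "f \<in> carrier (UP (UP R))"
  obtains css where "set css \<subseteq> lists (carrier R)"
    "\<And>a b. a \<in> carrier R \<Longrightarrow> b \<in> carrier R \<Longrightarrow> eval2 R a b f = horner2 R css a b"
    "\<And>a b. a \<in> carrier R \<Longrightarrow> b \<in> carrier R \<Longrightarrow> eval2 R a b (up_deriv (UP R) f) = dhorner2 R css a b"
proof -
  interpret U: cring "UP R" by (rule UP_is_cring)
  obtain n where n: "\<And>i. i \<ge> n \<Longrightarrow> f i = \<zero>\<^bsub>UP R\<^esub>" and fc: "\<And>i. f i \<in> carrier (UP R)"
    using UP_cring.coeffs_obtain[OF UP_cring.intro[OF U.cring_axioms] f] by metis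
  have "\<exists>m. \<forall>j\<ge>m. f i j = \<zero>" for i
    using UP_cring.coeffs_obtain[OF UP_cring.intro[OF cring_axioms] fc[of i]] by metis
  then obtain m where m: "\<And>i j. j \<ge> m i \<Longrightarrow> f i j = \<zero>" by metis
  have fcc: "f i j \<in> carrier R" for i j
    using fc[of i] by (auto simp: UP_def)
  define css where "css = map (\<lambda>i. map (f i) [0..<m i]) [0..<n]"
  have "map (\<lambda>i. up_eval R a (f i)) [0..<n] = map (\<lambda>cs. horner R cs a) css"
    if "a \<in> carrier R" for a
    using up_eval_horner(1)[OF fc that m] by (simp add: css_def)
  moreover have "set css \<subseteq> lists (carrier R)"
    using fcc by (auto simp: css_def)
  ultimately show ?thesis
    using eval2_horner[OF f _ _ n]
    by (intro that[of css]) (simp_all add: horner2_def dhorner2_def)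
qed

lemma (in cring) eval2_of_lists:
  assumes css: "set css \<subseteq> lists (carrier R)"
  obtains f where "f \<in> carrier (UP (UP R))"
    "\<And>a b. a \<in> carrier R \<Longrightarrow> b \<in> carrier R \<Longrightarrow> eval2 R a b f = horner2 R css a b"
    "\<And>a b. a \<in> carrier R \<Longrightarrow> b \<in> carrier R \<Longrightarrow> eval2 R a b (up_deriv (UP R) f) = dhorner2 R css a b"
proof -
  interpret U: cring "UP R" by (rule UP_is_cring)
  define f where "f = list_poly (UP R) (map (list_poly R) css)"
  have f: "f \<in> carrier (UP (UP R))"
    unfolding f_def using css by (intro U.list_poly_closed) (auto intro!: list_poly_closed)
  have n: "\<And>i. i \<ge> length css \<Longrightarrow> f i = \<zero>\<^bsub>UP R\<^esub>" by (simp add: f_def list_poly_def)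
  have ev: "up_eval R a (list_poly R cs) = horner R cs a" if "a \<in> carrier R" "cs \<in> set css" for a cs
  proof -
    have "up_eval R a (list_poly R cs) = horner R (map (list_poly R cs) [0..<length cs]) a"
      using that css by (intro up_eval_horner list_poly_closed) (auto simp: list_poly_def)
    also have "map (list_poly R cs) [0..<length cs] = cs"
      using list_poly_map[of id R cs] by simp
    finally show ?thesis .
  qed
  have "map (\<lambda>i. up_eval R a (f i)) [0..<length css] = map (\<lambda>cs. horner R cs a) css"
    if "a \<in> carrier R" for a
    using ev[OF that] list_poly_map[of "up_eval R a" "UP R" "map (list_poly R) css"]
    by (simp add: f_def)
  then show ?thesis
    using eval2_horner[OF f _ _ n] f
    by (intro that[of f]) (simp_all add: horner2_def dhorner2_def)
qed

text \<open>Largeness becomes a condition on finite tuples of coefficients. In this form it can be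
  written with first-order formulas and attacked by explicit changes of variable.\<close>

lemma large_field_iff_lists:
  "large_field K \<longleftrightarrow> field K \<and>
     (\<forall>css. \<forall>a\<in>carrier K. \<forall>b\<in>carrier K. set css \<subseteq> lists (carrier K) \<longrightarrow>
        horner2 K css a b = \<zero>\<^bsub>K\<^esub> \<and> dhorner2 K css a b \<noteq> \<zero>\<^bsub>K\<^esub> \<longrightarrow>
        infinite {(x, y). x \<in> carrier K \<and> y \<in> carrier K \<and> horner2 K css x y = \<zero>\<^bsub>K\<^esub>})"
  (is "_ \<longleftrightarrow> _ \<and> ?L")
proof (cases "field K")
  case True
  then interpret field K .
  show ?thesis
  proof
    assume L: "large_field K"
    have ?L
    proof (intro allI ballI impI, elim conjE)
      fix css a b
      assume ab: "a \<in> carrier K" "b \<in> carrier K" and css: "set css \<subseteq> lists (carrier K)"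
        and s: "horner2 K css a b = \<zero>\<^bsub>K\<^esub>" "dhorner2 K css a b \<noteq> \<zero>\<^bsub>K\<^esub>"
      obtain f where f: "f \<in> carrier (UP (UP K))"
        "\<And>a b. a \<in> carrier K \<Longrightarrow> b \<in> carrier K \<Longrightarrow> eval2 K a b f = horner2 K css a b"
        "\<And>a b. a \<in> carrier K \<Longrightarrow> b \<in> carrier K \<Longrightarrow> eval2 K a b (up_deriv (UP K) f) = dhorner2 K css a b"
        using eval2_of_lists[OF css] by blast
      show "infinite {(x, y). x \<in> carrier K \<and> y \<in> carrier K \<and> horner2 K css x y = \<zero>\<^bsub>K\<^esub>}"
      proof -
        have "eval2 K a b f = \<zero>\<^bsub>K\<^esub>" "eval2 K a b (up_deriv (UP K) f) \<noteq> \<zero>\<^bsub>K\<^esub>"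
          using s f(2,3)[OF ab] by simp_all
        then have "infinite {(x, y). x \<in> carrier K \<and> y \<in> carrier K \<and> eval2 K x y f = \<zero>\<^bsub>K\<^esub>}"
          using L ab f(1) unfolding large_field_def by blast
        moreover have "{(x, y). x \<in> carrier K \<and> y \<in> carrier K \<and> eval2 K x y f = \<zero>\<^bsub>K\<^esub>}
            = {(x, y). x \<in> carrier K \<and> y \<in> carrier K \<and> horner2 K css x y = \<zero>\<^bsub>K\<^esub>}"
          using f(2) by auto
        ultimately show ?thesis by simp
      qed
    qed
    with True show "field K \<and> ?L" by blast
  next
    assume L: "field K \<and> ?L"
    show "large_field K" unfolding large_field_def
    proof (intro conjI True ballI impI, elim conjE)
      fix f a b
      assume ab: "a \<in> carrier K" "b \<in> carrier K" and f: "f \<in> carrier (UP (UP K))"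
        and s: "eval2 K a b f = \<zero>\<^bsub>K\<^esub>" "eval2 K a b (up_deriv (UP K) f) \<noteq> \<zero>\<^bsub>K\<^esub>"
      obtain css where css: "set css \<subseteq> lists (carrier K)"
        "\<And>a b. a \<in> carrier K \<Longrightarrow> b \<in> carrier K \<Longrightarrow> eval2 K a b f = horner2 K css a b"
        "\<And>a b. a \<in> carrier K \<Longrightarrow> b \<in> carrier K \<Longrightarrow> eval2 K a b (up_deriv (UP K) f) = dhorner2 K css a b"
        using eval2_lists[OF f] by blast
      show "infinite {(x, y). x \<in> carrier K \<and> y \<in> carrier K \<and> eval2 K x y f = \<zero>\<^bsub>K\<^esub>}"
      proof -
        have "horner2 K css a b = \<zero>\<^bsub>K\<^esub>" "dhorner2 K css a b \<noteq> \<zero>\<^bsub>K\<^esub>"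
          using s css(2,3)[OF ab] by simp_all
        then have "infinite {(x, y). x \<in> carrier K \<and> y \<in> carrier K \<and> horner2 K css x y = \<zero>\<^bsub>K\<^esub>}"
          using L ab css(1) by blast
        moreover have "{(x, y). x \<in> carrier K \<and> y \<in> carrier K \<and> eval2 K x y f = \<zero>\<^bsub>K\<^esub>}
            = {(x, y). x \<in> carrier K \<and> y \<in> carrier K \<and> horner2 K css x y = \<zero>\<^bsub>K\<^esub>}"
          using css(2) by auto
        ultimately show ?thesis by simp
      qed
    qed
  qed
qed (simp add: large_field_def)

section \<open>Henselian subrings\<close>

text \<open>A henselian local ring \<open>S\<close> with maximal ideal \<open>M\<close>, kept as a
  pair of subsets of a fixed ring. Extensions, images and increasing unions can then be formed
  without changing the type or the operations. Residue classes are replaced by differences in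
  \<open>M\<close>.\<close>

locale henselian_subring = cring A for A (structure) +
  fixes S M
  assumes sub: "subring S A"
    and M_subset: "M \<subseteq> S"
    and M_zero: "\<zero> \<in> M"
    and M_add: "\<And>x y. x \<in> M \<Longrightarrow> y \<in> M \<Longrightarrow> x \<oplus> y \<in> M"
    and M_mult: "\<And>x y. x \<in> S \<Longrightarrow> y \<in> M \<Longrightarrow> x \<otimes> y \<in> M"
    and one_notin_M: "\<one> \<notin> M"
    and unit: "\<And>x. x \<in> S \<Longrightarrow> x \<notin> M \<Longrightarrow> \<exists>y\<in>S. x \<otimes> y = \<one>"
    and hensel: "\<And>cs r. set cs \<subseteq> S \<Longrightarrow> r \<in> S \<Longrightarrow> horner A cs r \<in> M \<Longrightarrow> dhorner A cs r \<notin> M \<Longrightarrow>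
      \<exists>a\<in>S. horner A cs a = \<zero> \<and> a \<ominus> r \<in> M"
begin

lemmas S = subringE[OF sub]

lemma M_carrier: "x \<in> M \<Longrightarrow> x \<in> carrier A"
  using M_subset S(1) by auto

lemma M_uminus: "x \<in> M \<Longrightarrow> \<ominus> x \<in> M"
  using M_mult[of "\<ominus> \<one>" x] S(3,5) M_carrier[of x] by (simp add: l_minus)

end

lemma (in cring) horner_subring:
  assumes "subring S R" "set cs \<subseteq> S" "x \<in> S"
  shows "horner R cs x \<in> S"
  using assms(2,3) subringE[OF assms(1)] by (induction cs) auto

lemma (in cring) dhorner_subring:
  assumes "subring S R" "set cs \<subseteq> S" "x \<in> S"
  shows "dhorner R cs x \<in> S"
  using assms(2,3) subringE[OF assms(1)] horner_subring[OF assms(1)] by (induction cs) auto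

lemma (in cring) subring_cring:
  assumes "subring S R" shows "cring (R\<lparr>carrier := S\<rparr>)"
  using subcring_iff[OF subringE(1)[OF assms]] subcringI'[OF assms] by blast

text \<open>All the conditions speak about elements of \<open>S\<close> only, so an injective
  homomorphism carries them over. It serves for specialising series, for changing the ambient ring
  and for copying to another type.\<close>

lemma henselian_subring_image:
  assumes hs: "henselian_subring A S M" and B: "cring B"
    and h: "ring_hom_cring (A\<lparr>carrier := S\<rparr>) B h" and inj: "inj_on h S"
  shows "henselian_subring B (h ` S) (h ` M)"
proof -
  interpret henselian_subring A S M by fact
  interpret h: ring_hom_cring "A\<lparr>carrier := S\<rparr>" B h by fact
  have S_sub: "x \<in> M \<Longrightarrow> x \<in> S" for x using M_subset by auto
  have hmem: "h x \<in> h ` M \<longleftrightarrow> x \<in> M" if "x \<in> S" for x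
    using inj_on_image_mem_iff[OF inj that M_subset] .
  have add: "h (x \<oplus>\<^bsub>A\<^esub> y) = h x \<oplus>\<^bsub>B\<^esub> h y" if "x \<in> S" "y \<in> S" for x y
    using h.hom_add that by simp
  have mult: "h (x \<otimes>\<^bsub>A\<^esub> y) = h x \<otimes>\<^bsub>B\<^esub> h y" if "x \<in> S" "y \<in> S" for x y
    using h.hom_mult that by simp
  have one: "h \<one>\<^bsub>A\<^esub> = \<one>\<^bsub>B\<^esub>" and zero: "h \<zero>\<^bsub>A\<^esub> = \<zero>\<^bsub>B\<^esub>"
    using h.hom_one h.hom_zero by simp_all
  have cl: "h x \<in> carrier B" if "x \<in> S" for x
    using h.hom_closed that by simp
  have uminus: "h (\<ominus>\<^bsub>A\<^esub> x) = \<ominus>\<^bsub>B\<^esub> h x" if "x \<in> S" for x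
  proof (rule h.S.minus_equality[symmetric])
    have "h (\<ominus>\<^bsub>A\<^esub> x) \<oplus>\<^bsub>B\<^esub> h x = h (\<ominus>\<^bsub>A\<^esub> x \<oplus>\<^bsub>A\<^esub> x)" using S that add by simp
    also have "\<dots> = \<zero>\<^bsub>B\<^esub>" using S(1) that zero by (simp add: l_neg subset_iff)
    finally show "h (\<ominus>\<^bsub>A\<^esub> x) \<oplus>\<^bsub>B\<^esub> h x = \<zero>\<^bsub>B\<^esub>" .
  qed (use S that cl in auto)
  have minus: "h (x \<ominus>\<^bsub>A\<^esub> y) = h x \<ominus>\<^bsub>B\<^esub> h y" if "x \<in> S" "y \<in> S" for x y
    using that S by (simp add: a_minus_def add uminus)
  have hor: "h (horner A cs x) = horner B (map h cs) (h x)" if "set cs \<subseteq> S" "x \<in> S" for cs x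
    using h.hom_horner[of cs x] horner_cong[of A "A\<lparr>carrier := S\<rparr>"] that by simp
  have dhor: "h (dhorner A cs x) = dhorner B (map h cs) (h x)" if "set cs \<subseteq> S" "x \<in> S" for cs x
    using h.hom_dhorner[of cs x] dhorner_cong[of A "A\<lparr>carrier := S\<rparr>"] that by simp
  show ?thesis
  proof (intro henselian_subring.intro henselian_subring_axioms.intro B)
    show "subring (h ` S) B"
    proof (rule ring.subringI)
      show "h ` S \<subseteq> carrier B" using cl by auto
      show "\<one>\<^bsub>B\<^esub> \<in> h ` S" using one S(3) by (metis image_eqI)
      show "\<ominus>\<^bsub>B\<^esub> x \<in> h ` S" if "x \<in> h ` S" for x
        using that S(5) by (auto simp: uminus[symmetric])
      show "x \<otimes>\<^bsub>B\<^esub> y \<in> h ` S" if "x \<in> h ` S" "y \<in> h ` S" for x y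
        using that S(6) by (auto simp: mult[symmetric])
      show "x \<oplus>\<^bsub>B\<^esub> y \<in> h ` S" if "x \<in> h ` S" "y \<in> h ` S" for x y
        using that S(7) by (auto simp: add[symmetric])
    qed (rule h.S.ring_axioms)
    show "h ` M \<subseteq> h ` S" using M_subset by auto
    show "\<zero>\<^bsub>B\<^esub> \<in> h ` M" using zero M_zero by (metis image_eqI)
    show "x \<oplus>\<^bsub>B\<^esub> y \<in> h ` M" if "x \<in> h ` M" "y \<in> h ` M" for x y
      using that M_add S_sub by (auto simp: add[symmetric])
    show "x \<otimes>\<^bsub>B\<^esub> y \<in> h ` M" if "x \<in> h ` S" "y \<in> h ` M" for x y
      using that M_mult S_sub by (auto simp: mult[symmetric])
    show "\<one>\<^bsub>B\<^esub> \<notin> h ` M" using hmem[OF S(3)] one one_notin_M by simp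
    show "\<exists>y\<in>h ` S. x \<otimes>\<^bsub>B\<^esub> y = \<one>\<^bsub>B\<^esub>" if x: "x \<in> h ` S" "x \<notin> h ` M" for x
    proof -
      from x obtain z where z: "x = h z" "z \<in> S" "z \<notin> M" by auto
      from unit[OF z(2,3)] obtain y where "y \<in> S" "z \<otimes>\<^bsub>A\<^esub> y = \<one>\<^bsub>A\<^esub>" by auto
      then show ?thesis using mult[OF z(2)] z(1) one by (metis image_eqI)
    qed
    show "\<exists>a\<in>h ` S. horner B cs a = \<zero>\<^bsub>B\<^esub> \<and> a \<ominus>\<^bsub>B\<^esub> r \<in> h ` M"
      if cs: "set cs \<subseteq> h ` S" and r: "r \<in> h ` S"
        and 1: "horner B cs r \<in> h ` M" "dhorner B cs r \<notin> h ` M" for cs r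
    proof -
      \<comment> \<open>The coefficients are pulled back one by one, so that Hensel's property is
        applied in the source ring.\<close>
      obtain cs' where cs': "cs = map h cs'" "set cs' \<subseteq> S"
        proof -
          have "\<forall>c\<in>set cs. \<exists>x. x \<in> S \<and> c = h x" using cs by auto
          then obtain k where k: "\<forall>c\<in>set cs. k c \<in> S \<and> c = h (k c)" by metis
          show ?thesis
            by (rule that[of "map k cs"]) (use k in \<open>auto simp: map_idI\<close>)
        qed
      obtain r' where r': "r = h r'" "r' \<in> S" using r by auto
      have "horner A cs' r' \<in> M" "dhorner A cs' r' \<notin> M"
        using 1 hor[OF cs'(2) r'(2)] dhor[OF cs'(2) r'(2)] cs' r'
          hmem[OF horner_subring[OF sub cs'(2) r'(2)]] hmem[OF dhorner_subring[OF sub cs'(2) r'(2)]]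
        by simp_all
      from hensel[OF cs'(2) r'(2) this] obtain a where
        a: "a \<in> S" "horner A cs' a = \<zero>\<^bsub>A\<^esub>" "a \<ominus>\<^bsub>A\<^esub> r' \<in> M" by auto
      show ?thesis
      proof (intro bexI conjI)
        show "horner B cs (h a) = \<zero>\<^bsub>B\<^esub>" using hor[OF cs'(2) a(1)] a(2) zero cs' by simp
        show "h a \<ominus>\<^bsub>B\<^esub> r \<in> h ` M"
          using minus[OF a(1) r'(2)] a(3) r'(1) by (metis image_eqI)
      qed (use a in simp)
    qed
  qed
qed

section \<open>Henselian local rings without quotient rings\<close>

lemma (in ideal) Quot_eq_zero_iff:
  assumes "x \<in> carrier R"
  shows "I +> x = \<zero>\<^bsub>R Quot I\<^esub> \<longleftrightarrow> x \<in> I"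
proof -
  have z: "\<zero>\<^bsub>R Quot I\<^esub> = I" by (simp add: FactRing_def)
  show ?thesis
  proof
    assume "I +> x = \<zero>\<^bsub>R Quot I\<^esub>"
    then show "x \<in> I" unfolding z by (rule rcos_const_imp_mem[OF assms])
  next
    assume "x \<in> I"
    then show "I +> x = \<zero>\<^bsub>R Quot I\<^esub>" unfolding z by (rule a_rcos_zero[OF is_ideal])
  qed
qed

text \<open>Evaluating a polynomial and its derivative commutes with the residue map, and a residue
  class is zero exactly on \<open>M\<close>.\<close>

lemma (in cring) simple_root_Quot_iff:
  assumes M: "ideal M R" and f: "f \<in> carrier (UP R)" and n: "\<And>i. i \<ge> n \<Longrightarrow> f i = \<zero>"
    and r: "r \<in> carrier R"
  shows "simple_root (R Quot M) (up_map R (\<lambda>r. M +> r) f) (M +> r) \<longleftrightarrow>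
    horner R (map f [0..<n]) r \<in> M \<and> dhorner R (map f [0..<n]) r \<notin> M"
proof -
  interpret I: ideal M R by fact
  interpret Q: cring "R Quot M" by (rule I.quotient_is_cring) (rule cring_axioms)
  interpret h: ring_hom_cring R "R Quot M" "(+>) M"
    by (rule I.rcos_ring_hom_cring) (rule cring_axioms)
  let ?f = "up_map R (\<lambda>r. M +> r) f"
  have co: "coeff (UP R) f i = f i" for i using f by (simp add: UP_def)
  have fc: "f i \<in> carrier R" for i using f by (auto simp: UP_def)
  have f': "?f \<in> carrier (UP (R Quot M))"
    by (rule up_map_closed[OF I.rcos_ring_hom ring_axioms Q.ring_axioms f])
  have n': "\<And>i. i \<ge> n \<Longrightarrow> ?f i = \<zero>\<^bsub>R Quot M\<^esub>"
    using n by (simp add: up_map_def co)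
  have m: "map ?f [0..<n] = map ((+>) M) (map f [0..<n])"
    by (simp add: up_map_def co)
  have fs: "set (map f [0..<n]) \<subseteq> carrier R" using fc by auto
  have z: "M +> x = \<zero>\<^bsub>R Quot M\<^esub> \<longleftrightarrow> x \<in> M" if "x \<in> carrier R" for x
    using that by (rule I.Quot_eq_zero_iff)
  have rQ: "M +> r \<in> carrier (R Quot M)" using r by (rule h.hom_closed)
  have "up_eval (R Quot M) (M +> r) ?f = horner (R Quot M) (map ?f [0..<n]) (M +> r)"
    by (rule Q.up_eval_horner(1)[OF f' rQ]) (rule n')
  also have "\<dots> = M +> horner R (map f [0..<n]) r"
    unfolding m by (rule h.hom_horner[OF fs r, symmetric])
  finally have 1: "up_eval (R Quot M) (M +> r) ?f = M +> horner R (map f [0..<n]) r" .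
  have "up_eval (R Quot M) (M +> r) (up_deriv (R Quot M) ?f) = dhorner (R Quot M) (map ?f [0..<n]) (M +> r)"
    by (rule Q.up_eval_horner(2)[OF f' rQ]) (rule n')
  also have "\<dots> = M +> dhorner R (map f [0..<n]) r"
    unfolding m by (rule h.hom_dhorner[OF fs r, symmetric])
  finally have 2: "up_eval (R Quot M) (M +> r) (up_deriv (R Quot M) ?f) = M +> dhorner R (map f [0..<n]) r" .
  show ?thesis
    unfolding simple_root_def 1 2 z[OF horner_closed[OF fs r]] z[OF dhorner_closed[OF fs r]]
    using rQ by blast
qed

lemma henselian_local_ringD:
  assumes R: "henselian_local_ring R"
  obtains M where "henselian_subring R (carrier R) M"
    "\<And>J. ideal J R \<Longrightarrow> M \<subseteq> J \<Longrightarrow> J = M \<or> J = carrier R"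
proof -
  from R interpret cring R by (simp add: henselian_local_ring_def local_ring_def)
  from R obtain M where M: "maximalideal M R"
    by (auto simp: henselian_local_ring_def local_ring_def)
  interpret M: maximalideal M R by fact
  interpret Q: field "R Quot M" by (rule M.quotient_is_field) (rule cring_axioms)
  have Q_cases: "\<exists>r\<in>carrier R. X = M +>\<^bsub>R\<^esub> r" if "X \<in> carrier (R Quot M)" for X
    using that by (auto simp: FactRing_def A_RCOSETS_def')
  have z: "M +>\<^bsub>R\<^esub> x = \<zero>\<^bsub>R Quot M\<^esub> \<longleftrightarrow> x \<in> M" if "x \<in> carrier R" for x
    using that by (rule M.Quot_eq_zero_iff)
  have hensel: "\<exists>a\<in>carrier R. horner R cs a = \<zero>\<^bsub>R\<^esub> \<and> a \<ominus>\<^bsub>R\<^esub> r \<in> M"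
    if cs: "set cs \<subseteq> carrier R" and r: "r \<in> carrier R" and
      1: "horner R cs r \<in> M" "dhorner R cs r \<notin> M" for cs r
  proof -
    let ?f = "list_poly R cs"
    have f: "?f \<in> carrier (UP R)" using cs by (rule list_poly_closed)
    have n: "\<And>i. i \<ge> length cs \<Longrightarrow> ?f i = \<zero>\<^bsub>R\<^esub>" by (simp add: list_poly_def)
    have mf: "map ?f [0..<length cs] = cs" using list_poly_map[of id R cs] by simp
    have "simple_root (R Quot M) (up_map R (\<lambda>r. M +>\<^bsub>R\<^esub> r) ?f) (M +>\<^bsub>R\<^esub> r)"
      using simple_root_Quot_iff[OF M.is_ideal f n r] 1 by (simp add: mf)
    with R M f obtain a where a: "a \<in> carrier R" "up_eval R a ?f = \<zero>\<^bsub>R\<^esub>" "M +>\<^bsub>R\<^esub> a = M +>\<^bsub>R\<^esub> r"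
      unfolding henselian_local_ring_def by blast
    have "a \<ominus>\<^bsub>R\<^esub> r \<in> M"
      using quotient_eq_iff_same_a_r_cos[OF M.is_ideal a(1) r] a(3) by simp
    then show ?thesis using a up_eval_horner(1)[OF f a(1) n] by (auto simp: mf)
  qed
  have one: "\<one>\<^bsub>R\<^esub> \<notin> M"
    using M.one_imp_carrier M.I_notcarr by auto
  show ?thesis
  proof (rule that)
    show "henselian_subring R (carrier R) M"
    proof (intro henselian_subring.intro henselian_subring_axioms.intro hensel)
      show "cring R" by (rule cring_axioms)
      show "subring (carrier R) R" by (rule carrier_is_subring)
      show "\<one>\<^bsub>R\<^esub> \<notin> M" by (rule one)
      show "\<exists>y\<in>carrier R. x \<otimes>\<^bsub>R\<^esub> y = \<one>\<^bsub>R\<^esub>" if x: "x \<in> carrier R" "x \<notin> M" for x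
      proof -
        have "M +>\<^bsub>R\<^esub> x \<in> carrier (R Quot M)" "M +>\<^bsub>R\<^esub> x \<noteq> \<zero>\<^bsub>R Quot M\<^esub>"
          using x ring_hom_closed[OF M.rcos_ring_hom] z by auto
        then obtain Y where Y: "Y \<in> carrier (R Quot M)" "(M +>\<^bsub>R\<^esub> x) \<otimes>\<^bsub>R Quot M\<^esub> Y = \<one>\<^bsub>R Quot M\<^esub>"
          using Q.field_Units Q.Units_r_inv_ex[of "M +>\<^bsub>R\<^esub> x"] by auto
        then obtain r where r: "r \<in> carrier R" "Y = M +>\<^bsub>R\<^esub> r" using Q_cases by blast
        have "M +>\<^bsub>R\<^esub> (r \<otimes>\<^bsub>R\<^esub> x) = M +>\<^bsub>R\<^esub> \<one>\<^bsub>R\<^esub>"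
          using Y(2) r x(1) ring_hom_mult[OF M.rcos_ring_hom, of x r] ring_hom_one[OF M.rcos_ring_hom]
          by (simp add: m_comm)
        then have rx: "r \<otimes>\<^bsub>R\<^esub> x \<ominus>\<^bsub>R\<^esub> \<one>\<^bsub>R\<^esub> \<in> M"
          using quotient_eq_iff_same_a_r_cos[OF M.is_ideal, of "r \<otimes>\<^bsub>R\<^esub> x" "\<one>\<^bsub>R\<^esub>"] r x by simp
        \<comment> \<open>Units are found by Hensel's lemma itself: \<open>r\<close> lifts the
          inverse residue of \<open>x\<close>, and the linear polynomial with coefficients -1 and
          \<open>x\<close> has derivative \<open>x\<close>, which is outside
          \<open>M\<close>.\<close>
        have "horner R [\<ominus>\<^bsub>R\<^esub> \<one>\<^bsub>R\<^esub>, x] r = r \<otimes>\<^bsub>R\<^esub> x \<ominus>\<^bsub>R\<^esub> \<one>\<^bsub>R\<^esub>"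
          using r x by (simp add: a_minus_def a_comm)
        with rx have "horner R [\<ominus>\<^bsub>R\<^esub> \<one>\<^bsub>R\<^esub>, x] r \<in> M" by simp
        moreover have "dhorner R [\<ominus>\<^bsub>R\<^esub> \<one>\<^bsub>R\<^esub>, x] r \<notin> M"
          using r x by simp
        ultimately obtain a where a: "a \<in> carrier R" "horner R [\<ominus>\<^bsub>R\<^esub> \<one>\<^bsub>R\<^esub>, x] a = \<zero>\<^bsub>R\<^esub>"
          using hensel[of "[\<ominus>\<^bsub>R\<^esub> \<one>\<^bsub>R\<^esub>, x]" r] x r by auto
        then have "x \<otimes>\<^bsub>R\<^esub> a \<ominus>\<^bsub>R\<^esub> \<one>\<^bsub>R\<^esub> = \<zero>\<^bsub>R\<^esub>"
          using x by (simp add: a_minus_def a_comm m_comm)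
        then show ?thesis using a x r_right_minus_eq[of "x \<otimes>\<^bsub>R\<^esub> a" "\<one>\<^bsub>R\<^esub>"] by auto
      qed
    qed (use M.a_subset M.zero_closed M.I_l_closed in auto)
    show "J = M \<or> J = carrier R" if "ideal J R" "M \<subseteq> J" for J
      using M.I_maximal[OF that] ideal.Icarr[OF that(1)] by auto
  qed
qed

lemma henselian_local_ringI:
  assumes "henselian_subring R (carrier R) M"
  shows "henselian_local_ring R"
proof -
  interpret H: henselian_subring R "carrier R" M by fact
  interpret I: ideal M R
  proof (rule idealI[OF H.ring_axioms])
    show "subgroup M (add_monoid R)"
      by (rule H.add.subgroupI) (use H.M_carrier H.M_zero H.M_add H.M_uminus in \<open>auto simp: a_inv_def[symmetric]\<close>)
    show "x \<otimes>\<^bsub>R\<^esub> a \<in> M" if "a \<in> M" "x \<in> carrier R" for a x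
      using H.M_mult that by blast
    then show "a \<otimes>\<^bsub>R\<^esub> x \<in> M" if "a \<in> M" "x \<in> carrier R" for a x
      using that H.M_carrier by (simp add: H.m_comm)
  qed
  \<comment> \<open>An ideal that leaves \<open>M\<close> contains a unit; both the maximality and
    the uniqueness of \<open>M\<close> follow from this.\<close>
  have big: "J = carrier R" if "ideal J R" "x \<in> J" "x \<notin> M" for J x
  proof -
    interpret J: ideal J R by fact
    have xc: "x \<in> carrier R" using that J.Icarr by auto
    from H.unit[OF xc that(3)] obtain y where "y \<in> carrier R" "x \<otimes>\<^bsub>R\<^esub> y = \<one>\<^bsub>R\<^esub>" by auto
    then show ?thesis using J.I_r_closed[OF that(2)] J.one_imp_carrier by metis
  qed
  have max: "maximalideal M R"
    by (rule maximalidealI) (use I.is_ideal H.one_notin_M big in auto)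
  have uniq: "J = M" if J: "maximalideal J R" for J
  proof -
    interpret J: maximalideal J R by fact
    have "J \<subseteq> M" using big[OF J.is_ideal] J.I_notcarr by auto
    then show ?thesis using J.I_maximal[OF I.is_ideal] H.M_carrier H.one_notin_M by blast
  qed
  have "\<exists>a\<in>carrier R. up_eval R a f = \<zero>\<^bsub>R\<^esub> \<and> M +>\<^bsub>R\<^esub> a = \<alpha>"
    if f: "f \<in> carrier (UP R)" and s: "simple_root (R Quot M) (up_map R (\<lambda>r. M +>\<^bsub>R\<^esub> r) f) \<alpha>" for f \<alpha>
  proof -
    obtain n where n: "\<And>i. i \<ge> n \<Longrightarrow> f i = \<zero>\<^bsub>R\<^esub>" and fc: "\<And>i. f i \<in> carrier R"
      using UP_cring.coeffs_obtain[OF UP_cring.intro[OF H.cring_axioms] f] by metis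
    obtain r where r: "r \<in> carrier R" "\<alpha> = M +>\<^bsub>R\<^esub> r"
      using s by (auto simp: simple_root_def FactRing_def A_RCOSETS_def')
    have "horner R (map f [0..<n]) r \<in> M \<and> dhorner R (map f [0..<n]) r \<notin> M"
      using H.simple_root_Quot_iff[OF I.is_ideal f n r(1)] s r(2) by simp
    then obtain a where a: "a \<in> carrier R" "horner R (map f [0..<n]) a = \<zero>\<^bsub>R\<^esub>" "a \<ominus>\<^bsub>R\<^esub> r \<in> M"
      using H.hensel[of "map f [0..<n]" r] fc r by (auto simp: image_subset_iff)
    have "up_eval R a f = horner R (map f [0..<n]) a"
      by (rule H.up_eval_horner(1)[OF f a(1)]) (rule n)
    then show ?thesis
      using a r H.quotient_eq_iff_same_a_r_cos[OF I.is_ideal a(1) r(1)]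
      by auto
  qed
  with max uniq show ?thesis
    unfolding henselian_local_ring_def local_ring_def using H.cring_axioms by blast
qed

section \<open>Fraction fields of henselian rings are large\<close>

text \<open>The coefficient list of p(qT) in terms of that of p(T).\<close>

primrec scale :: "('a, 'm) ring_scheme \<Rightarrow> 'a \<Rightarrow> 'a list \<Rightarrow> 'a list" where
  "scale R q [] = []"
| "scale R q (c # cs) = c # map (\<lambda>x. q \<otimes>\<^bsub>R\<^esub> x) (scale R q cs)"

context cring
begin

lemma horner_map_mult:
  assumes "set cs \<subseteq> carrier R" "q \<in> carrier R" "x \<in> carrier R"
  shows "horner R (map (\<lambda>y. q \<otimes> y) cs) x = q \<otimes> horner R cs x"
  using assms by (induction cs) (auto simp: r_distr m_ac)

lemma scale_subset:
  assumes "subring S R" "set cs \<subseteq> S" "q \<in> S"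
  shows "set (scale R q cs) \<subseteq> S"
  using assms(2,3) subringE(6)[OF assms(1)] by (induction cs) auto

lemma horner_scale:
  assumes "set cs \<subseteq> carrier R" "q \<in> carrier R" "x \<in> carrier R"
  shows "horner R (scale R q cs) x = horner R cs (q \<otimes> x)"
  using assms
proof (induction cs)
  case (Cons c cs)
  have "set (scale R q cs) \<subseteq> carrier R"
    using Cons.prems by (intro scale_subset carrier_is_subring) auto
  with Cons show ?case by (simp add: horner_map_mult m_ac)
qed simp

end

text \<open>Coefficients are functions of a parameter, so a sum of polynomials can be formed before
  the parameter is chosen. This keeps the result of \<open>tame_shift\<close> uniform in
  \<open>s\<close>.\<close>

primrec fun_list_add :: "('a, 'm) ring_scheme \<Rightarrow> ('b \<Rightarrow> 'a) list \<Rightarrow> ('b \<Rightarrow> 'a) list \<Rightarrow> ('b \<Rightarrow> 'a) list" where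
  "fun_list_add R [] gs = gs"
| "fun_list_add R (f # fs) gs = (case gs of [] \<Rightarrow> f # fs
     | g # gs \<Rightarrow> (\<lambda>s. f s \<oplus>\<^bsub>R\<^esub> g s) # fun_list_add R fs gs)"

context cring
begin

lemma horner_fun_list_add:
  assumes "\<And>f. f \<in> set fs \<Longrightarrow> f s \<in> carrier R" "\<And>g. g \<in> set gs \<Longrightarrow> g s \<in> carrier R"
    and x: "x \<in> carrier R"
  shows "horner R (map (\<lambda>f. f s) (fun_list_add R fs gs)) x
      = horner R (map (\<lambda>f. f s) fs) x \<oplus> horner R (map (\<lambda>f. f s) gs) x \<and>
    dhorner R (map (\<lambda>f. f s) (fun_list_add R fs gs)) x
      = dhorner R (map (\<lambda>f. f s) fs) x \<oplus> dhorner R (map (\<lambda>f. f s) gs) x"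
  using assms(1,2)
proof (induction fs arbitrary: gs)
  case Nil
  have "set (map (\<lambda>f. f s) gs) \<subseteq> carrier R" using Nil by auto
  from horner_closed[OF this x] dhorner_closed[OF this x] show ?case by simp_all
next
  case (Cons f fs)
  show ?case
  proof (cases gs)
    case Nil
    have "set (map (\<lambda>f. f s) (f # fs)) \<subseteq> carrier R" using Cons(2) by auto
    from horner_closed[OF this x] dhorner_closed[OF this x] Nil show ?thesis by simp_all
  next
    case gs: (Cons g gs')
    have F: "set (map (\<lambda>f. f s) fs) \<subseteq> carrier R" "set (map (\<lambda>f. f s) gs') \<subseteq> carrier R"
      "f s \<in> carrier R" "g s \<in> carrier R"
      using Cons(2,3) gs by auto
    note cl = horner_closed[OF F(1) x] horner_closed[OF F(2) x] dhorner_closed[OF F(1) x]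
      dhorner_closed[OF F(2) x] F(3,4) x
    have IH: "horner R (map (\<lambda>f. f s) (fun_list_add R fs gs')) x
        = horner R (map (\<lambda>f. f s) fs) x \<oplus> horner R (map (\<lambda>f. f s) gs') x"
      "dhorner R (map (\<lambda>f. f s) (fun_list_add R fs gs')) x
        = dhorner R (map (\<lambda>f. f s) fs) x \<oplus> dhorner R (map (\<lambda>f. f s) gs') x"
      using Cons gs by simp_all
    show ?thesis
      using cl by (simp_all add: gs IH r_distr a_ac)
  qed
qed

lemma dhorner_map_mult:
  assumes "set cs \<subseteq> carrier R" "q \<in> carrier R" "x \<in> carrier R"
  shows "dhorner R (map (\<lambda>y. q \<otimes> y) cs) x = q \<otimes> dhorner R cs x"
  using assms
proof (induction cs)
  case (Cons c cs)
  then show ?case by (simp add: horner_map_mult r_distr m_lcomm)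
qed simp

end

section \<open>Moving a smooth point over a field of fractions\<close>

locale henselian_fractions = field A + H: henselian_subring A S M for A (structure) and S M +
  assumes fractions: "\<And>x. x \<in> carrier A \<Longrightarrow> \<exists>d\<in>S. d \<noteq> \<zero> \<and> d \<otimes> x \<in> S"
begin

text \<open>
  A \<open>tame\<close> function becomes, after clearing one denominator, Lipschitz at the origin
  with respect to the ideal-adic topology of \<open>S\<close>.
\<close>

definition tame :: "'a \<Rightarrow> ('a \<Rightarrow> 'a) \<Rightarrow> bool" where
  "tame D f \<longleftrightarrow> (\<forall>s\<in>S. f s \<in> carrier A \<and> D \<otimes> f s \<in> S \<and> (\<exists>d\<in>S. D \<otimes> (f s \<ominus> f \<zero>) = s \<otimes> d))"

lemma S_carrier: "x \<in> S \<Longrightarrow> x \<in> carrier A"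
  using H.S(1) by auto

lemmas S_closed = H.S(2,3,5,6,7)

lemma tame_closed: "tame D f \<Longrightarrow> s \<in> S \<Longrightarrow> f s \<in> carrier A"
  by (auto simp: tame_def)

lemma tame_mult_denominator:
  assumes f: "tame D f" and D: "D \<in> S" "D' \<in> S"
  shows "tame (D' \<otimes> D) f"
  unfolding tame_def
proof (intro ballI conjI)
  fix s assume s: "s \<in> S"
  note c = tame_closed[OF f s] tame_closed[OF f S_closed(1)] D[THEN S_carrier] S_carrier[OF s]
  show "f s \<in> carrier A" by (rule c)
  show "D' \<otimes> D \<otimes> f s \<in> S"
    using f s S_closed(4)[OF D(2)] c by (auto simp: tame_def m_assoc)
  obtain d where d: "d \<in> S" "D \<otimes> (f s \<ominus> f \<zero>) = s \<otimes> d" using f s by (auto simp: tame_def)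
  show "\<exists>d\<in>S. D' \<otimes> D \<otimes> (f s \<ominus> f \<zero>) = s \<otimes> d"
  proof (rule bexI)
    show "D' \<otimes> D \<otimes> (f s \<ominus> f \<zero>) = s \<otimes> (D' \<otimes> d)"
      using c S_carrier[OF d(1)] d(2) by (simp add: m_assoc m_lcomm)
  qed (use d D S_closed in auto)
qed

lemma tame_const:
  assumes "c \<in> carrier A"
  shows "\<exists>D\<in>S. D \<noteq> \<zero> \<and> tame D (\<lambda>s. c)"
proof -
  obtain D where D: "D \<in> S" "D \<noteq> \<zero>" "D \<otimes> c \<in> S" using fractions[OF assms] by auto
  have "\<exists>d\<in>S. D \<otimes> (c \<ominus> c) = s \<otimes> d" if "s \<in> S" for s
    using S_closed(1) S_carrier[OF that] S_carrier[OF D(1)] assms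
    by (intro bexI[of _ \<zero>]) (auto simp: a_minus_def r_neg)
  with D assms show ?thesis by (intro bexI[of _ D]) (auto simp: tame_def)
qed

lemma tame_add_const:
  assumes "a \<in> carrier A"
  shows "\<exists>D\<in>S. D \<noteq> \<zero> \<and> tame D (\<lambda>s. a \<oplus> s)"
proof -
  obtain D where D: "D \<in> S" "D \<noteq> \<zero>" "D \<otimes> a \<in> S" using fractions[OF assms] by auto
  have "tame D (\<lambda>s. a \<oplus> s)" unfolding tame_def
  proof (intro ballI conjI)
    fix s assume s: "s \<in> S"
    note c = S_carrier[OF s] S_carrier[OF D(1)] assms
    show "a \<oplus> s \<in> carrier A" using c by simp
    show "D \<otimes> (a \<oplus> s) \<in> S" using c D s S_closed by (simp add: r_distr)
    have "D \<otimes> ((a \<oplus> s) \<ominus> (a \<oplus> \<zero>)) = s \<otimes> D" using c by algebra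
    with D show "\<exists>d\<in>S. D \<otimes> ((a \<oplus> s) \<ominus> (a \<oplus> \<zero>)) = s \<otimes> d" by blast
  qed
  with D show ?thesis by blast
qed

lemma tame_add:
  assumes f: "tame D f" "D \<in> S" "D \<noteq> \<zero>" and g: "tame E g" "E \<in> S" "E \<noteq> \<zero>"
  shows "\<exists>D\<in>S. D \<noteq> \<zero> \<and> tame D (\<lambda>s. f s \<oplus> g s)"
proof (intro bexI conjI)
  let ?D = "E \<otimes> D"
  have D: "?D \<in> S" using f g S_closed by simp
  show "?D \<noteq> \<zero>" using f g S_carrier integral_iff by simp
  have f': "tame ?D f" by (rule tame_mult_denominator[OF f(1,2) g(2)])
  have g': "tame ?D g"
    using tame_mult_denominator[OF g(1,2) f(2)] f(2) g(2) S_carrier by (simp add: m_comm)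
  show "tame ?D (\<lambda>s. f s \<oplus> g s)"
    unfolding tame_def
  proof (intro ballI conjI)
    fix s assume s: "s \<in> S"
    note c = tame_closed[OF f(1) s] tame_closed[OF f(1) S_closed(1)] tame_closed[OF g(1) s]
      tame_closed[OF g(1) S_closed(1)] S_carrier[OF D] S_carrier[OF s]
    show "f s \<oplus> g s \<in> carrier A" using c by simp
    show "?D \<otimes> (f s \<oplus> g s) \<in> S" using f' g' s S_closed(5) c by (auto simp: tame_def r_distr)
    obtain d where d: "d \<in> S" "?D \<otimes> (f s \<ominus> f \<zero>) = s \<otimes> d" using f' s unfolding tame_def by blast
    obtain e where e: "e \<in> S" "?D \<otimes> (g s \<ominus> g \<zero>) = s \<otimes> e" using g' s unfolding tame_def by blast
    have "X \<otimes> ((f s \<oplus> g s) \<ominus> (f \<zero> \<oplus> g \<zero>)) = X \<otimes> (f s \<ominus> f \<zero>) \<oplus> X \<otimes> (g s \<ominus> g \<zero>)"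
      if "X \<in> carrier A" for X
      using c that by algebra
    then have "?D \<otimes> ((f s \<oplus> g s) \<ominus> (f \<zero> \<oplus> g \<zero>)) = s \<otimes> (d \<oplus> e)"
      using d(2) e(2) c d(1)[THEN S_carrier] e(1)[THEN S_carrier] S_carrier[OF D] by (simp add: r_distr)
    then show "\<exists>d\<in>S. ?D \<otimes> ((f s \<oplus> g s) \<ominus> (f \<zero> \<oplus> g \<zero>)) = s \<otimes> d"
      using d(1) e(1) S_closed(5) by blast
  qed
  show "?D \<in> S" by (rule D)
qed

lemma tame_mult:
  assumes f: "tame D f" "D \<in> S" "D \<noteq> \<zero>" and g: "tame E g" "E \<in> S" "E \<noteq> \<zero>"
  shows "\<exists>D\<in>S. D \<noteq> \<zero> \<and> tame D (\<lambda>s. f s \<otimes> g s)"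
proof (intro bexI conjI)
  let ?D = "E \<otimes> D"
  have D: "?D \<in> S" using f g S_closed by simp
  show "?D \<noteq> \<zero>" using f g S_carrier integral_iff by simp
  show "tame ?D (\<lambda>s. f s \<otimes> g s)"
    unfolding tame_def
  proof (intro ballI conjI)
    fix s assume s: "s \<in> S"
    note c = tame_closed[OF f(1) s] tame_closed[OF f(1) S_closed(1)] tame_closed[OF g(1) s]
      tame_closed[OF g(1) S_closed(1)] S_carrier[OF f(2)] S_carrier[OF g(2)] S_carrier[OF s]
    show "f s \<otimes> g s \<in> carrier A" using c by simp
    have 1: "D \<otimes> f s \<in> S" "E \<otimes> g s \<in> S" "D \<otimes> f \<zero> \<in> S"
      using f g s S_closed(1) by (auto simp: tame_def)
    have "?D \<otimes> (f s \<otimes> g s) = (D \<otimes> f s) \<otimes> (E \<otimes> g s)" using c by algebra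
    then show "?D \<otimes> (f s \<otimes> g s) \<in> S" using 1 S_closed(4) by simp
    obtain d where d: "d \<in> S" "D \<otimes> (f s \<ominus> f \<zero>) = s \<otimes> d" using f s unfolding tame_def by blast
    obtain e where e: "e \<in> S" "E \<otimes> (g s \<ominus> g \<zero>) = s \<otimes> e" using g s unfolding tame_def by blast
    \<comment> \<open>The increment of a product is split by the product rule, so that each summand
      absorbs one of the denominators \<open>D\<close> and \<open>E\<close> in each of its two
      factors.\<close>
    have "?D \<otimes> ((f s \<otimes> g s) \<ominus> (f \<zero> \<otimes> g \<zero>))
        = (D \<otimes> (f s \<ominus> f \<zero>)) \<otimes> (E \<otimes> g s) \<oplus> (D \<otimes> f \<zero>) \<otimes> (E \<otimes> (g s \<ominus> g \<zero>))"
      using c by algebra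
    also have "\<dots> = s \<otimes> (d \<otimes> (E \<otimes> g s) \<oplus> (D \<otimes> f \<zero>) \<otimes> e)"
      using d(2) e(2) c d(1)[THEN S_carrier] e(1)[THEN S_carrier]
      by (simp only: d(2) e(2)) algebra
    finally show "\<exists>d\<in>S. ?D \<otimes> ((f s \<otimes> g s) \<ominus> (f \<zero> \<otimes> g \<zero>)) = s \<otimes> d"
      using d(1) e(1) 1 S_closed(4,5) by blast
  qed
  show "?D \<in> S" by (rule D)
qed

definition is_tame :: "('a \<Rightarrow> 'a) \<Rightarrow> bool" where
  "is_tame f \<longleftrightarrow> (\<exists>D\<in>S. D \<noteq> \<zero> \<and> tame D f)"

lemma is_tame_intros:
  "c \<in> carrier A \<Longrightarrow> is_tame (\<lambda>s. c)"
  "a \<in> carrier A \<Longrightarrow> is_tame (\<lambda>s. a \<oplus> s)"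
  "is_tame f \<Longrightarrow> is_tame g \<Longrightarrow> is_tame (\<lambda>s. f s \<oplus> g s)"
  "is_tame f \<Longrightarrow> is_tame g \<Longrightarrow> is_tame (\<lambda>s. f s \<otimes> g s)"
  using tame_const tame_add_const tame_add tame_mult by (auto simp: is_tame_def)

lemma is_tame_closed: "is_tame f \<Longrightarrow> s \<in> S \<Longrightarrow> f s \<in> carrier A"
  by (auto simp: is_tame_def tame_def)

lemma is_tame_horner:
  "set cs \<subseteq> carrier A \<Longrightarrow> a \<in> carrier A \<Longrightarrow> is_tame (\<lambda>s. horner A cs (a \<oplus> s))"
  by (induction cs) (auto intro!: is_tame_intros)

lemma is_tame_fun_list_add:
  "\<forall>f\<in>set fs. is_tame f \<Longrightarrow> \<forall>g\<in>set gs. is_tame g \<Longrightarrow> \<forall>h\<in>set (fun_list_add A fs gs). is_tame h"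
proof (induction fs arbitrary: gs)
  case (Cons f fs)
  then show ?case by (cases gs) (auto intro!: is_tame_intros)
qed simp

text \<open>Taylor expansion at \<open>b\<close> by one Horner step at a time: if G is the shifted
  tail, then f + (b + y) G(y) is the sum of b G(y) and f + y G(y), and the latter has coefficient
  list \<open>f # gs\<close>.\<close>

lemma tame_shift:
  assumes "\<forall>f\<in>set fs. is_tame f" and b: "b \<in> carrier A"
  shows "\<exists>gs. (\<forall>g\<in>set gs. is_tame g) \<and> (\<forall>s\<in>S. \<forall>y\<in>carrier A.
    horner A (map (\<lambda>g. g s) gs) y = horner A (map (\<lambda>f. f s) fs) (b \<oplus> y) \<and>
    dhorner A (map (\<lambda>g. g s) gs) y = dhorner A (map (\<lambda>f. f s) fs) (b \<oplus> y))"
  using assms(1)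
proof (induction fs)
  case Nil
  then show ?case by (intro exI[of _ "[]"]) simp
next
  case (Cons f fs)
  then obtain gs where gs: "\<forall>g\<in>set gs. is_tame g"
    "\<And>s y. s \<in> S \<Longrightarrow> y \<in> carrier A \<Longrightarrow> horner A (map (\<lambda>g. g s) gs) y = horner A (map (\<lambda>f. f s) fs) (b \<oplus> y)"
    "\<And>s y. s \<in> S \<Longrightarrow> y \<in> carrier A \<Longrightarrow> dhorner A (map (\<lambda>g. g s) gs) y = dhorner A (map (\<lambda>f. f s) fs) (b \<oplus> y)"
    by auto
  let ?bgs = "map (\<lambda>g s. b \<otimes> g s) gs"
  let ?hs = "fun_list_add A ?bgs (f # gs)"
  have t: "\<forall>h\<in>set ?bgs. is_tame h" "\<forall>h\<in>set (f # gs). is_tame h"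
    using gs(1) b Cons.prems by (auto intro!: is_tame_intros)
  show ?case
  proof (intro exI[of _ ?hs] conjI ballI)
    show "is_tame h" if "h \<in> set ?hs" for h
      using is_tame_fun_list_add[OF t] that by blast
    fix s y assume s: "s \<in> S" and y: "y \<in> carrier A"
    have cl: "set (map (\<lambda>g. g s) gs) \<subseteq> carrier A" "f s \<in> carrier A"
      using gs(1) Cons.prems is_tame_closed[OF _ s] by auto
    have m: "map (\<lambda>g. g s) ?bgs = map (\<lambda>x. b \<otimes> x) (map (\<lambda>g. g s) gs)" by simp
    note c = horner_closed[OF cl(1) y] dhorner_closed[OF cl(1) y] cl(2) b y
    have t': "\<And>h. h \<in> set ?bgs \<Longrightarrow> h s \<in> carrier A" "\<And>h. h \<in> set (f # gs) \<Longrightarrow> h s \<in> carrier A"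
      using t is_tame_closed[OF _ s] by blast+
    have fla: "horner A (map (\<lambda>g. g s) ?hs) y
          = horner A (map (\<lambda>g. g s) ?bgs) y \<oplus> horner A (map (\<lambda>g. g s) (f # gs)) y"
        "dhorner A (map (\<lambda>g. g s) ?hs) y
          = dhorner A (map (\<lambda>g. g s) ?bgs) y \<oplus> dhorner A (map (\<lambda>g. g s) (f # gs)) y"
      using horner_fun_list_add[of ?bgs s "f # gs" y] t' y by blast+
    let ?H = "horner A (map (\<lambda>g. g s) gs) y" and ?D = "dhorner A (map (\<lambda>g. g s) gs) y"
    have "horner A (map (\<lambda>g. g s) ?hs) y = b \<otimes> ?H \<oplus> (f s \<oplus> y \<otimes> ?H)"
      unfolding fla(1) m horner_map_mult[OF cl(1) b y] by simp
    also have "\<dots> = f s \<oplus> (b \<oplus> y) \<otimes> ?H" using c by (simp add: l_distr a_ac)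
    finally show "horner A (map (\<lambda>g. g s) ?hs) y = horner A (map (\<lambda>f. f s) (f # fs)) (b \<oplus> y)"
      using gs(2)[OF s y] by simp
    have "dhorner A (map (\<lambda>g. g s) ?hs) y = b \<otimes> ?D \<oplus> (?H \<oplus> y \<otimes> ?D)"
      unfolding fla(2) m dhorner_map_mult[OF cl(1) b y] by simp
    also have "\<dots> = ?H \<oplus> (b \<oplus> y) \<otimes> ?D" using c by (simp add: l_distr a_ac)
    finally show "dhorner A (map (\<lambda>g. g s) ?hs) y = dhorner A (map (\<lambda>f. f s) (f # fs)) (b \<oplus> y)"
      using gs(2,3)[OF s y] by simp
  qed
qed

lemma common_denominator:
  assumes "\<forall>f\<in>set fs. is_tame f"
  shows "\<exists>D\<in>S. D \<noteq> \<zero> \<and> (\<forall>f\<in>set fs. tame D f)"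
  using assms
proof (induction fs)
  case Nil
  then show ?case using S_closed(2) by (intro bexI[of _ \<one>]) auto
next
  case (Cons f fs)
  then obtain D E where D: "D \<in> S" "D \<noteq> \<zero>" "\<forall>f\<in>set fs. tame D f" and E: "E \<in> S" "E \<noteq> \<zero>" "tame E f"
    by (auto simp: is_tame_def)
  have "tame (E \<otimes> D) f"
    using tame_mult_denominator[OF E(3,1) D(1)] S_carrier D(1) E(1) by (simp add: m_comm)
  moreover have "\<forall>f\<in>set fs. tame (E \<otimes> D) f" using tame_mult_denominator D E by blast
  ultimately show ?case
    using D E S_closed(4) S_carrier integral_iff by (intro bexI[of _ "E \<otimes> D"]) auto
qed

text \<open>The powers of \<open>m\<close> are distinct, because a coincidence would cancel to a
  positive power of \<open>m\<close> being 1, which is not in \<open>M\<close>.\<close>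

lemma infinite_M:
  assumes m: "m \<in> M" "m \<noteq> \<zero>"
  shows "infinite M"
proof -
  have mc: "m \<in> carrier A" using m H.M_carrier by auto
  have pow: "m [^] Suc k \<in> M" for k :: nat
  proof (induction k)
    case (Suc k)
    then show ?case using m H.M_subset H.M_mult[OF _ m(1), of "m [^] Suc k"] by auto
  qed (use m mc in simp)
  have nz: "m [^] k \<noteq> \<zero>" for k :: nat
    using m(2) mc by (induction k) (auto simp: integral_iff)
  have "i = j" if ij: "m [^] Suc i = m [^] Suc j" "i \<le> j" for i j
  proof (rule ccontr)
    assume "i \<noteq> j"
    then obtain k where k: "j = i + Suc k" using ij(2) by (metis add_Suc_right le_neq_implies_less less_imp_Suc_add)
    have "m [^] Suc i \<otimes> \<one> = m [^] Suc i \<otimes> m [^] Suc k"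
      using ij(1) mc nat_pow_mult[of m "Suc i" "Suc k"] k by simp
    then have "\<one> = m [^] Suc k" using nz[of "Suc i"] mc m_lcancel[of "m [^] Suc i" \<one> "m [^] Suc k"] by blast
    then show False using pow[of k] H.one_notin_M by simp
  qed
  then have "inj (\<lambda>k::nat. m [^] Suc k)"
    by (intro linorder_injI) (metis less_imp_le less_irrefl)
  moreover have "range (\<lambda>k::nat. m [^] Suc k) \<subseteq> M" using pow by blast
  ultimately show ?thesis using infinite_super range_inj_infinite by metis
qed

text \<open>Let \<open>D\<close> be a common denominator and \<delta> be \<open>D\<close> times the
  derivative at the point. Perturbing x by \<delta>^2 m and y by \<delta> z makes \<open>D\<close>
  times the polynomial divisible by \<delta>^2. The quotient has constant term in \<open>M\<close>
  and linear coefficient in 1 + \<open>M\<close>, so Hensel's lemma at 0 gives a zero for every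
  \<open>m\<close> in \<open>M\<close>.\<close>

theorem large:
  assumes m0: "m0 \<in> M" "m0 \<noteq> \<zero>"
  shows "large_field A"
  unfolding large_field_iff_lists
proof (intro conjI allI ballI impI field_axioms, elim conjE)
  fix css a b
  assume css: "set css \<subseteq> lists (carrier A)" and a: "a \<in> carrier A" and b: "b \<in> carrier A"
    and root: "horner2 A css a b = \<zero>" and simple: "dhorner2 A css a b \<noteq> \<zero>"
  let ?fs = "map (\<lambda>cs s. horner A cs (a \<oplus> s)) css"
  have fs: "\<forall>f\<in>set ?fs. is_tame f"
    using css by (auto intro!: is_tame_horner[OF _ a])
  have fs_map: "map (\<lambda>f. f s) ?fs = map (\<lambda>cs. horner A cs (a \<oplus> s)) css" for s by simp
  obtain gs where gs: "\<forall>g\<in>set gs. is_tame g"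
    and gs_root: "\<And>s y. s \<in> S \<Longrightarrow> y \<in> carrier A \<Longrightarrow>
      horner A (map (\<lambda>g. g s) gs) y = horner A (map (\<lambda>f. f s) ?fs) (b \<oplus> y) \<and>
      dhorner A (map (\<lambda>g. g s) gs) y = dhorner A (map (\<lambda>f. f s) ?fs) (b \<oplus> y)"
    using tame_shift[OF fs b] by blast
  have gs0: "horner A (map (\<lambda>g. g \<zero>) gs) \<zero> = \<zero>" "dhorner A (map (\<lambda>g. g \<zero>) gs) \<zero> \<noteq> \<zero>"
    using gs_root[OF S_closed(1) zero_closed] root simple a b
    unfolding fs_map horner2_def dhorner2_def by simp_all
  \<comment> \<open>A list with fewer than two entries has zero derivative at 0.\<close>
  have "\<exists>e0 e1 es. gs = e0 # e1 # es"
    using gs0(2) by (cases gs; cases "tl gs") auto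
  then obtain e0 e1 es where gs_eq: "gs = e0 # e1 # es" by blast
  obtain D where D: "D \<in> S" "D \<noteq> \<zero>" "\<forall>g\<in>set gs. tame D g" using common_denominator[OF gs] by blast
  have t: "tame D e0" "tame D e1" "\<forall>e\<in>set es. tame D e" using D(3) by (auto simp: gs_eq)
  have z: "e0 \<zero> \<in> carrier A" "e1 \<zero> \<in> carrier A" "set (map (\<lambda>g. g \<zero>) es) \<subseteq> carrier A"
    using t tame_closed S_closed(1) by auto
  have e0: "e0 \<zero> = \<zero>" and e1: "e1 \<zero> \<noteq> \<zero>"
    using gs0 z by (simp_all add: gs_eq)
  \<comment> \<open>The derivative at the point, multiplied by \<open>D\<close> to bring it into
    \<open>S\<close>. It need not be a unit, which is why the perturbation of x uses its
    square.\<close>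
  define \<delta> where "\<delta> = D \<otimes> e1 \<zero>"
  have \<delta>: "\<delta> \<in> S" "\<delta> \<noteq> \<zero>"
    using t(2) S_closed(1) e1 D z by (auto simp: \<delta>_def tame_def integral_iff S_carrier)
  note Dc = S_carrier[OF D(1)] and \<delta>c = S_carrier[OF \<delta>(1)]
  have point: "\<exists>z\<in>S. horner2 A css (a \<oplus> \<delta> \<otimes> \<delta> \<otimes> m) (b \<oplus> \<delta> \<otimes> z) = \<zero>" if m: "m \<in> M" for m
  proof -
    have mS: "m \<in> S" using m H.M_subset by auto
    define s where "s = \<delta> \<otimes> \<delta> \<otimes> m"
    have s: "s \<in> S" using \<delta> mS S_closed by (simp add: s_def)
    note mc = S_carrier[OF mS] and sc = S_carrier[OF s]
    obtain d0 where d0: "d0 \<in> S" "D \<otimes> (e0 s \<ominus> e0 \<zero>) = s \<otimes> d0" using t(1) s unfolding tame_def by blast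
    obtain d1 where d1: "d1 \<in> S" "D \<otimes> (e1 s \<ominus> e1 \<zero>) = s \<otimes> d1" using t(2) s unfolding tame_def by blast
    note d0c = S_carrier[OF d0(1)] and d1c = S_carrier[OF d1(1)]
    have e0c: "e0 s \<in> carrier A" and e1c: "e1 s \<in> carrier A" and esc: "set (map (\<lambda>g. g s) es) \<subseteq> carrier A"
      using t s tame_closed by auto
    have De0: "D \<otimes> e0 s = \<delta> \<otimes> \<delta> \<otimes> (m \<otimes> d0)"
    proof -
      have "D \<otimes> e0 s = s \<otimes> d0" using d0(2) e0 e0c by (simp add: a_minus_def)
      also have "\<dots> = \<delta> \<otimes> \<delta> \<otimes> (m \<otimes> d0)" unfolding s_def using \<delta>c mc d0c by (simp add: m_assoc)
      finally show ?thesis .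
    qed
    have De1: "D \<otimes> e1 s = \<delta> \<otimes> (\<one> \<oplus> \<delta> \<otimes> (m \<otimes> d1))"
    proof -
      have "D \<otimes> e1 s = D \<otimes> (e1 s \<ominus> e1 \<zero>) \<oplus> D \<otimes> e1 \<zero>" using Dc e1c z(2) by algebra
      also have "\<dots> = s \<otimes> d1 \<oplus> \<delta>" by (simp only: d1(2) \<delta>_def)
      also have "\<dots> = \<delta> \<otimes> (\<one> \<oplus> \<delta> \<otimes> (m \<otimes> d1))" unfolding s_def using \<delta>c mc d1c by algebra
      finally show ?thesis .
    qed
    let ?es = "map (\<lambda>e. D \<otimes> e s) es"
    have esS: "set ?es \<subseteq> S" using t(3) s by (auto simp: tame_def)
    \<comment> \<open>The polynomial in \<open>z\<close> after division by \<delta>^2. Scaling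
      accounts for the terms of degree at least two, which are evaluated at
      \<open>\<delta> \<otimes> z\<close>.\<close>
    let ?cs = "(m \<otimes> d0) # (\<one> \<oplus> \<delta> \<otimes> (m \<otimes> d1)) # scale A \<delta> ?es"
    have md: "m \<otimes> d0 \<in> M" "\<delta> \<otimes> (m \<otimes> d1) \<in> M"
      using H.M_mult[OF d0(1) m] H.M_mult[OF \<delta>(1) H.M_mult[OF d1(1) m]] mc d0c d1c by (simp_all add: m_comm)
    have sc': "set (scale A \<delta> ?es) \<subseteq> S" by (rule scale_subset[OF H.sub esS \<delta>(1)])
    have cs: "set ?cs \<subseteq> S"
      using md H.M_subset S_closed sc' by auto
    have h0: "horner A ?cs \<zero> = m \<otimes> d0" "dhorner A ?cs \<zero> = \<one> \<oplus> \<delta> \<otimes> (m \<otimes> d1)"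
      using mc d0c d1c \<delta>c sc' S_carrier by (simp_all add: subset_iff)
    have nM: "\<one> \<oplus> \<delta> \<otimes> (m \<otimes> d1) \<notin> M"
    proof
      assume "\<one> \<oplus> \<delta> \<otimes> (m \<otimes> d1) \<in> M"
      from H.M_add[OF this H.M_uminus[OF md(2)]] have "\<one> \<in> M"
        using \<delta>c mc d1c by (simp add: a_assoc r_neg)
      then show False using H.one_notin_M by simp
    qed
    from H.hensel[OF cs S_closed(1)] obtain z where z: "z \<in> S" "horner A ?cs z = \<zero>"
      unfolding h0 using md(1) nM by blast
    note zc = S_carrier[OF z(1)]
    let ?X = "horner A ?es (\<delta> \<otimes> z)"
    have esc': "set ?es \<subseteq> carrier A" using esS S_carrier by auto
    have Xc: "?X \<in> carrier A" using \<delta>c zc esc' by (intro horner_closed) auto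
    have X: "?X = D \<otimes> horner A (map (\<lambda>g. g s) es) (\<delta> \<otimes> z)"
      using horner_map_mult[OF esc Dc, of "\<delta> \<otimes> z"] \<delta>c zc by (simp add: comp_def)
    let ?Y = "horner A (map (\<lambda>g. g s) es) (\<delta> \<otimes> z)"
    have Yc: "?Y \<in> carrier A" using \<delta>c zc esc by (intro horner_closed) auto
    have z0: "m \<otimes> d0 \<oplus> z \<otimes> (\<one> \<oplus> \<delta> \<otimes> (m \<otimes> d1) \<oplus> z \<otimes> ?X) = \<zero>"
      using z(2) horner_scale[OF esc' \<delta>c zc] by simp
    have "D \<otimes> horner A (map (\<lambda>g. g s) gs) (\<delta> \<otimes> z)
        = D \<otimes> e0 s \<oplus> (\<delta> \<otimes> z) \<otimes> (D \<otimes> e1 s \<oplus> (\<delta> \<otimes> z) \<otimes> (D \<otimes> ?Y))"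
    proof -
      have "D \<otimes> (e0 s \<oplus> (\<delta> \<otimes> z) \<otimes> (e1 s \<oplus> (\<delta> \<otimes> z) \<otimes> Y))
        = D \<otimes> e0 s \<oplus> (\<delta> \<otimes> z) \<otimes> (D \<otimes> e1 s \<oplus> (\<delta> \<otimes> z) \<otimes> (D \<otimes> Y))" if "Y \<in> carrier A" for Y
        using that Dc e0c e1c \<delta>c zc by algebra
      from this[OF Yc] show ?thesis by (simp add: gs_eq)
    qed
    also have "\<dots> = \<delta> \<otimes> \<delta> \<otimes> (m \<otimes> d0 \<oplus> z \<otimes> (\<one> \<oplus> \<delta> \<otimes> (m \<otimes> d1) \<oplus> z \<otimes> ?X))"
    proof -
      have "\<delta> \<otimes> \<delta> \<otimes> (m \<otimes> d0) \<oplus> (\<delta> \<otimes> z) \<otimes> (\<delta> \<otimes> (\<one> \<oplus> \<delta> \<otimes> (m \<otimes> d1)) \<oplus> (\<delta> \<otimes> z) \<otimes> X)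
        = \<delta> \<otimes> \<delta> \<otimes> (m \<otimes> d0 \<oplus> z \<otimes> (\<one> \<oplus> \<delta> \<otimes> (m \<otimes> d1) \<oplus> z \<otimes> X))" if "X \<in> carrier A" for X
        using that \<delta>c zc mc d0c d1c by algebra
      from this[OF Xc] show ?thesis unfolding X[symmetric] De0 De1 .
    qed
    also have "\<dots> = \<zero>" unfolding z0 using \<delta>c by simp
    finally have "horner A (map (\<lambda>g. g s) gs) (\<delta> \<otimes> z) = \<zero>"
      using D(2) Dc \<delta>c zc esc e0c e1c by (simp add: integral_iff gs_eq)
    then have "horner2 A css (a \<oplus> s) (b \<oplus> \<delta> \<otimes> z) = \<zero>"
      using gs_root[OF s, of "\<delta> \<otimes> z"] \<delta>c zc unfolding fs_map horner2_def by simp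
    then show ?thesis using z(1) unfolding s_def by blast
  qed
  then obtain \<zeta> where \<zeta>: "\<And>m. m \<in> M \<Longrightarrow> \<zeta> m \<in> S"
    "\<And>m. m \<in> M \<Longrightarrow> horner2 A css (a \<oplus> \<delta> \<otimes> \<delta> \<otimes> m) (b \<oplus> \<delta> \<otimes> \<zeta> m) = \<zero>"
    by metis
  let ?p = "\<lambda>m. (a \<oplus> \<delta> \<otimes> \<delta> \<otimes> m, b \<oplus> \<delta> \<otimes> \<zeta> m)"
  \<comment> \<open>Distinct \<open>m\<close> already differ in the first coordinate.\<close>
  have "inj_on ?p M"
  proof (rule inj_onI)
    fix m n assume mn: "m \<in> M" "n \<in> M" "?p m = ?p n"
    then have "\<delta> \<otimes> \<delta> \<otimes> m = \<delta> \<otimes> \<delta> \<otimes> n" using a \<delta>c H.M_carrier by simp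
    then show "m = n"
      using mn \<delta>c \<delta>(2) H.M_carrier m_lcancel[of "\<delta> \<otimes> \<delta>" m n] by (simp add: integral_iff)
  qed
  then have "infinite (?p ` M)" using infinite_M[OF m0] finite_imageD by blast
  moreover have "?p ` M \<subseteq> {(x, y). x \<in> carrier A \<and> y \<in> carrier A \<and> horner2 A css x y = \<zero>}"
    using \<zeta> a b \<delta>c H.M_carrier S_carrier by auto
  ultimately show "infinite {(x, y). x \<in> carrier A \<and> y \<in> carrier A \<and> horner2 A css x y = \<zero>}"
    using infinite_super by blast
qed

end

section \<open>Formal power series\<close>

text \<open>No support condition is imposed on functions into the carrier, so the polynomials of
  \<open>UP R\<close> are literally series with the same operations.\<close>

definition PS :: "('a, 'm) ring_scheme \<Rightarrow> (nat \<Rightarrow> 'a) ring" where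
  "PS R = \<lparr>
     carrier = UNIV \<rightarrow> carrier R,
     monoid.mult = (\<lambda>f g n. \<Oplus>\<^bsub>R\<^esub>i\<in>{..n}. f i \<otimes>\<^bsub>R\<^esub> g (n - i)),
     one = (\<lambda>n. if n = 0 then \<one>\<^bsub>R\<^esub> else \<zero>\<^bsub>R\<^esub>),
     zero = (\<lambda>n. \<zero>\<^bsub>R\<^esub>),
     add = (\<lambda>f g n. f n \<oplus>\<^bsub>R\<^esub> g n)\<rparr>"

definition ps_const :: "('a, 'm) ring_scheme \<Rightarrow> 'a \<Rightarrow> nat \<Rightarrow> 'a" where
  "ps_const R c = (\<lambda>n. if n = 0 then c else \<zero>\<^bsub>R\<^esub>)"

definition ps_X :: "('a, 'm) ring_scheme \<Rightarrow> nat \<Rightarrow> 'a" where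
  "ps_X R = (\<lambda>n. if n = 1 then \<one>\<^bsub>R\<^esub> else \<zero>\<^bsub>R\<^esub>)"

lemma PS_simps:
  "f \<in> carrier (PS R) \<longleftrightarrow> (\<forall>n. f n \<in> carrier R)"
  "(f \<oplus>\<^bsub>PS R\<^esub> g) n = f n \<oplus>\<^bsub>R\<^esub> g n"
  "\<zero>\<^bsub>PS R\<^esub> n = \<zero>\<^bsub>R\<^esub>"
  "\<one>\<^bsub>PS R\<^esub> n = (if n = 0 then \<one>\<^bsub>R\<^esub> else \<zero>\<^bsub>R\<^esub>)"
  by (auto simp: PS_def)

lemma PS_mult: "(f \<otimes>\<^bsub>PS R\<^esub> g) n = (\<Oplus>\<^bsub>R\<^esub>i\<in>{..n}. f i \<otimes>\<^bsub>R\<^esub> g (n - i))"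
  by (simp add: PS_def)

context cring
begin

lemma PS_mult_cong:
  assumes "\<And>i. i \<le> n \<Longrightarrow> f i = f' i" "\<And>i. i \<le> n \<Longrightarrow> g i = g' i"
    and "\<And>i. f' i \<in> carrier R" "\<And>i. g' i \<in> carrier R"
  shows "(f \<otimes>\<^bsub>PS R\<^esub> g) n = (f' \<otimes>\<^bsub>PS R\<^esub> g') n"
  unfolding PS_mult using assms by (intro add.finprod_cong') auto

lemma PS_mult_closed [simp]:
  assumes "f \<in> carrier (PS R)" "g \<in> carrier (PS R)"
  shows "f \<otimes>\<^bsub>PS R\<^esub> g \<in> carrier (PS R)"
  using assms by (auto simp: PS_simps PS_mult intro!: finsum_closed)

lemma PS_mult_UP:
  "f \<in> carrier (UP R) \<Longrightarrow> g \<in> carrier (UP R) \<Longrightarrow> f \<otimes>\<^bsub>PS R\<^esub> g = f \<otimes>\<^bsub>UP R\<^esub> g"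
  by (auto simp: UP_def PS_mult fun_eq_iff)

lemma UP_subset_PS: "carrier (UP R) \<subseteq> carrier (PS R)"
  by (auto simp: UP_def PS_simps)

definition ps_trunc :: "nat \<Rightarrow> (nat \<Rightarrow> 'a) \<Rightarrow> nat \<Rightarrow> 'a" where
  "ps_trunc n f = (\<lambda>i. if i \<le> n then f i else \<zero>)"

lemma ps_trunc_UP: "f \<in> carrier (PS R) \<Longrightarrow> ps_trunc n f \<in> carrier (UP R)"
proof -
  assume f: "f \<in> carrier (PS R)"
  have "bound \<zero> n (ps_trunc n f)" by (auto simp: bound_def ps_trunc_def)
  with f show ?thesis by (auto simp: UP_def PS_simps ps_trunc_def intro!: mem_upI)
qed

lemma ps_trunc_mult:
  assumes "f \<in> carrier (PS R)" "g \<in> carrier (PS R)" "k \<le> n"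
  shows "(f \<otimes>\<^bsub>PS R\<^esub> g) k = (ps_trunc n f \<otimes>\<^bsub>UP R\<^esub> ps_trunc n g) k"
proof -
  have "(f \<otimes>\<^bsub>PS R\<^esub> g) k = (ps_trunc n f \<otimes>\<^bsub>PS R\<^esub> ps_trunc n g) k"
    using assms by (intro PS_mult_cong) (auto simp: ps_trunc_def PS_simps)
  then show ?thesis using assms by (simp add: PS_mult_UP ps_trunc_UP)
qed

text \<open>A coefficient of a product depends only on the coefficients up to the same index.
  Commutativity and associativity are therefore inherited from \<open>UP R\<close> through
  truncations.\<close>

lemma PS_cring: "cring (PS R)"
proof -
  interpret U: cring "UP R" by (rule UP_is_cring)
  have tr: "(f \<otimes>\<^bsub>PS R\<^esub> g) n = (ps_trunc n f \<otimes>\<^bsub>UP R\<^esub> ps_trunc n g) n"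
    if "f \<in> carrier (PS R)" "g \<in> carrier (PS R)" for f g n
    by (rule ps_trunc_mult[OF that]) simp
  have UP_cong: "(a \<otimes>\<^bsub>UP R\<^esub> b) n = (a' \<otimes>\<^bsub>UP R\<^esub> b') n"
    if "a \<in> carrier (UP R)" "b \<in> carrier (UP R)" "a' \<in> carrier (UP R)" "b' \<in> carrier (UP R)"
      "\<And>i. i \<le> n \<Longrightarrow> a i = a' i" "\<And>i. i \<le> n \<Longrightarrow> b i = b' i" for a b a' b' n
  proof -
    have "(a \<otimes>\<^bsub>PS R\<^esub> b) n = (a' \<otimes>\<^bsub>PS R\<^esub> b') n"
      using that UP_subset_PS by (intro PS_mult_cong) (auto simp: PS_simps subset_iff)
    then show ?thesis using that by (simp add: PS_mult_UP)
  qed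
  show ?thesis
  proof (intro cringI abelian_groupI comm_monoidI)
    fix x y z assume x: "x \<in> carrier (PS R)" and y: "y \<in> carrier (PS R)" and z: "z \<in> carrier (PS R)"
    show "x \<oplus>\<^bsub>PS R\<^esub> y \<in> carrier (PS R)" using x y by (auto simp: PS_simps)
    show "x \<oplus>\<^bsub>PS R\<^esub> y = y \<oplus>\<^bsub>PS R\<^esub> x" using x y by (auto simp: PS_simps fun_eq_iff a_comm)
    show "x \<oplus>\<^bsub>PS R\<^esub> y \<oplus>\<^bsub>PS R\<^esub> z = x \<oplus>\<^bsub>PS R\<^esub> (y \<oplus>\<^bsub>PS R\<^esub> z)"
      using x y z by (auto simp: PS_simps fun_eq_iff a_assoc)
    show "\<zero>\<^bsub>PS R\<^esub> \<oplus>\<^bsub>PS R\<^esub> x = x" using x by (auto simp: PS_simps fun_eq_iff)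
    show "\<exists>y\<in>carrier (PS R). y \<oplus>\<^bsub>PS R\<^esub> x = \<zero>\<^bsub>PS R\<^esub>"
      using x by (intro bexI[of _ "\<lambda>n. \<ominus> x n"]) (auto simp: PS_simps fun_eq_iff l_neg)
    show "x \<otimes>\<^bsub>PS R\<^esub> y \<in> carrier (PS R)" using x y by simp
    show "x \<otimes>\<^bsub>PS R\<^esub> y = y \<otimes>\<^bsub>PS R\<^esub> x"
      using x y by (auto simp: fun_eq_iff tr U.m_comm ps_trunc_UP)
    show "x \<otimes>\<^bsub>PS R\<^esub> y \<otimes>\<^bsub>PS R\<^esub> z = x \<otimes>\<^bsub>PS R\<^esub> (y \<otimes>\<^bsub>PS R\<^esub> z)"
    proof
      fix n
      let ?x = "ps_trunc n x" and ?y = "ps_trunc n y" and ?z = "ps_trunc n z"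
      note u = ps_trunc_UP[OF x, of n] ps_trunc_UP[OF y, of n] ps_trunc_UP[OF z, of n]
      have "(x \<otimes>\<^bsub>PS R\<^esub> y \<otimes>\<^bsub>PS R\<^esub> z) n = (ps_trunc n (x \<otimes>\<^bsub>PS R\<^esub> y) \<otimes>\<^bsub>UP R\<^esub> ?z) n"
        using x y z by (intro tr) auto
      also have "\<dots> = ((?x \<otimes>\<^bsub>UP R\<^esub> ?y) \<otimes>\<^bsub>UP R\<^esub> ?z) n"
        using x y z u by (intro UP_cong U.m_closed ps_trunc_UP PS_mult_closed)
          (simp_all add: ps_trunc_def ps_trunc_mult[where n = n, symmetric] ps_trunc_mult[OF x y, unfolded ps_trunc_def])
      also have "\<dots> = (?x \<otimes>\<^bsub>UP R\<^esub> (?y \<otimes>\<^bsub>UP R\<^esub> ?z)) n"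
        using u by (simp add: U.m_assoc)
      also have "\<dots> = (?x \<otimes>\<^bsub>UP R\<^esub> ps_trunc n (y \<otimes>\<^bsub>PS R\<^esub> z)) n"
        using x y z u by (intro UP_cong U.m_closed ps_trunc_UP PS_mult_closed)
          (simp_all add: ps_trunc_def ps_trunc_mult[OF y z, unfolded ps_trunc_def])
      also have "\<dots> = (x \<otimes>\<^bsub>PS R\<^esub> (y \<otimes>\<^bsub>PS R\<^esub> z)) n"
        using x y z by (intro tr[symmetric]) auto
      finally show "(x \<otimes>\<^bsub>PS R\<^esub> y \<otimes>\<^bsub>PS R\<^esub> z) n = (x \<otimes>\<^bsub>PS R\<^esub> (y \<otimes>\<^bsub>PS R\<^esub> z)) n" .
    qed
    show "(x \<oplus>\<^bsub>PS R\<^esub> y) \<otimes>\<^bsub>PS R\<^esub> z = x \<otimes>\<^bsub>PS R\<^esub> z \<oplus>\<^bsub>PS R\<^esub> y \<otimes>\<^bsub>PS R\<^esub> z"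
      using x y z by (auto simp: fun_eq_iff PS_simps PS_mult l_distr finsum_addf Pi_def)
    show "\<one>\<^bsub>PS R\<^esub> \<otimes>\<^bsub>PS R\<^esub> x = x"
    proof
      fix n
      have "(\<one>\<^bsub>PS R\<^esub> \<otimes>\<^bsub>PS R\<^esub> x) n = (\<Oplus>i\<in>{..n}. if 0 = i then x (n - i) else \<zero>)"
        unfolding PS_mult using x by (intro add.finprod_cong') (auto simp: PS_simps)
      also have "\<dots> = x n" using x by (subst add.finprod_singleton) (auto simp: PS_simps)
      finally show "(\<one>\<^bsub>PS R\<^esub> \<otimes>\<^bsub>PS R\<^esub> x) n = x n" .
    qed
  qed (auto simp: PS_simps)
qed

lemma UP_PS_hom: "id \<in> ring_hom (UP R) (PS R)"
  using UP_subset_PS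
  by (intro ring_hom_memI) (auto simp: PS_mult_UP, simp_all add: UP_def PS_def)

lemma ps_residue_hom: "(\<lambda>f. f 0) \<in> ring_hom (PS R) R"
  by (intro ring_hom_memI) (auto simp: PS_simps PS_mult)

lemma ps_mult_0: "f \<in> carrier (PS R) \<Longrightarrow> g \<in> carrier (PS R) \<Longrightarrow> (f \<otimes>\<^bsub>PS R\<^esub> g) 0 = f 0 \<otimes> g 0"
  by (auto simp: PS_simps PS_mult)

lemma ps_const_hom: "ps_const R \<in> ring_hom R (PS R)"
proof (intro ring_hom_memI)
  fix x y assume x: "x \<in> carrier R" and y: "y \<in> carrier R"
  show "ps_const R (x \<otimes> y) = ps_const R x \<otimes>\<^bsub>PS R\<^esub> ps_const R y"
  proof
    fix n
    have "(ps_const R x \<otimes>\<^bsub>PS R\<^esub> ps_const R y) n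
        = (\<Oplus>i\<in>{..n}. if 0 = i then x \<otimes> (if n = 0 then y else \<zero>) else \<zero>)"
      unfolding PS_mult using x y by (intro add.finprod_cong') (auto simp: ps_const_def)
    also have "\<dots> = x \<otimes> (if n = 0 then y else \<zero>)"
      using x y by (subst add.finprod_singleton) auto
    finally show "ps_const R (x \<otimes> y) n = (ps_const R x \<otimes>\<^bsub>PS R\<^esub> ps_const R y) n"
      using x by (simp add: ps_const_def)
  qed
qed (auto simp: ps_const_def PS_simps fun_eq_iff)

lemma ps_const_0 [simp]: "ps_const R c 0 = c"
  by (simp add: ps_const_def)

lemma ps_X_closed [simp]: "ps_X R \<in> carrier (PS R)"
  by (auto simp: ps_X_def PS_simps)

lemma ps_X_0 [simp]: "ps_X R 0 = \<zero>"
  by (simp add: ps_X_def)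

lemma ps_X_UP: "ps_X R \<in> carrier (UP R)"
proof -
  have "bound \<zero> 1 (ps_X R)" by (auto simp: bound_def ps_X_def)
  moreover have "ps_X R i \<in> carrier R" for i by (simp add: ps_X_def)
  ultimately show ?thesis by (auto simp: UP_def intro!: mem_upI)
qed

lemma ps_const_UP: "c \<in> carrier R \<Longrightarrow> ps_const R c \<in> carrier (UP R)"
proof -
  assume "c \<in> carrier R"
  then have "ps_const R c i \<in> carrier R" for i by (simp add: ps_const_def)
  moreover have "bound \<zero> 0 (ps_const R c)" by (auto simp: bound_def ps_const_def)
  ultimately show ?thesis by (auto simp: UP_def intro!: mem_upI)
qed

lemma ps_X_mult:
  assumes f: "f \<in> carrier (PS R)"
  shows "(ps_X R \<otimes>\<^bsub>PS R\<^esub> f) n = (case n of 0 \<Rightarrow> \<zero> | Suc m \<Rightarrow> f m)"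
proof (cases n)
  case 0
  then show ?thesis using f by (simp add: PS_mult PS_simps)
next
  case (Suc m)
  have "(ps_X R \<otimes>\<^bsub>PS R\<^esub> f) n = (\<Oplus>i\<in>{..n}. if 1 = i then f (n - i) else \<zero>)"
    unfolding PS_mult using f by (intro add.finprod_cong') (auto simp: ps_X_def PS_simps)
  also have "\<dots> = f m" using f Suc by (subst add.finprod_singleton) (auto simp: PS_simps)
  finally show ?thesis using Suc by simp
qed

lemma ps_divide_X:
  assumes f: "f \<in> carrier (PS R)" and "f 0 = \<zero>"
  obtains g where "g \<in> carrier (PS R)" "f = ps_X R \<otimes>\<^bsub>PS R\<^esub> g"
proof (rule that)
  show g: "(\<lambda>n. f (Suc n)) \<in> carrier (PS R)" using f by (auto simp: PS_simps)
  show "f = ps_X R \<otimes>\<^bsub>PS R\<^esub> (\<lambda>n. f (Suc n))"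
    unfolding fun_eq_iff ps_X_mult[OF g] using assms(2) by (auto split: nat.split)
qed

text \<open>Congruence modulo the n-th power of X.\<close>

definition agree :: "nat \<Rightarrow> (nat \<Rightarrow> 'a) \<Rightarrow> (nat \<Rightarrow> 'a) \<Rightarrow> bool" where
  "agree n f g \<longleftrightarrow> f \<in> carrier (PS R) \<and> g \<in> carrier (PS R) \<and> (\<forall>k<n. f k = g k)"

lemma agree_refl: "f \<in> carrier (PS R) \<Longrightarrow> agree n f f"
  by (simp add: agree_def)

lemma agree_add:
  "agree n f f' \<Longrightarrow> agree n g g' \<Longrightarrow> agree n (f \<oplus>\<^bsub>PS R\<^esub> g) (f' \<oplus>\<^bsub>PS R\<^esub> g')"
  by (auto simp: agree_def PS_simps)

lemma agree_mult:
  "agree n f f' \<Longrightarrow> agree n g g' \<Longrightarrow> agree n (f \<otimes>\<^bsub>PS R\<^esub> g) (f' \<otimes>\<^bsub>PS R\<^esub> g')"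
  unfolding agree_def
  by (intro conjI allI impI PS_mult_closed PS_mult_cong) (auto simp: PS_simps(1))

text \<open>A series without constant term is a multiple of X, and multiplication by X shifts
  coefficients, so one order of agreement is gained.\<close>

lemma agree_mult_Suc:
  assumes m: "m \<in> carrier (PS R)" "m 0 = \<zero>" and f: "agree n f f'"
  shows "agree (Suc n) (m \<otimes>\<^bsub>PS R\<^esub> f) (m \<otimes>\<^bsub>PS R\<^esub> f')"
proof -
  interpret P: cring "PS R" by (rule PS_cring)
  obtain g where g: "g \<in> carrier (PS R)" "m = ps_X R \<otimes>\<^bsub>PS R\<^esub> g" using ps_divide_X[OF m] .
  have 1: "m \<otimes>\<^bsub>PS R\<^esub> h = ps_X R \<otimes>\<^bsub>PS R\<^esub> (g \<otimes>\<^bsub>PS R\<^esub> h)" if "h \<in> carrier (PS R)" for h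
    using g that by (simp add: P.m_assoc)
  have "agree n (g \<otimes>\<^bsub>PS R\<^esub> f) (g \<otimes>\<^bsub>PS R\<^esub> f')" by (rule agree_mult[OF agree_refl[OF g(1)] f])
  then have "(m \<otimes>\<^bsub>PS R\<^esub> f) k = (m \<otimes>\<^bsub>PS R\<^esub> f') k" if "k < Suc n" for k
  proof -
    have "f \<in> carrier (PS R)" "f' \<in> carrier (PS R)" using f by (auto simp: agree_def)
    note c = this P.m_closed[OF g(1) this(1)] P.m_closed[OF g(1) this(2)]
    show ?thesis
      unfolding 1[OF c(1)] 1[OF c(2)] ps_X_mult[OF c(3)] ps_X_mult[OF c(4)]
      using \<open>agree n (g \<otimes>\<^bsub>PS R\<^esub> f) (g \<otimes>\<^bsub>PS R\<^esub> f')\<close> that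
      by (auto simp: agree_def split: nat.split)
  qed
  then show ?thesis using f m by (auto simp: agree_def)
qed

text \<open>X-adic completeness: the iterates of \<open>G\<close> from 0 stabilise coefficient by
  coefficient, and each application of \<open>G\<close> settles one more coefficient.\<close>

lemma contraction_fixpoint:
  assumes G: "\<And>f. f \<in> carrier (PS R) \<Longrightarrow> G f \<in> carrier (PS R)"
    and contr: "\<And>n f g. agree n f g \<Longrightarrow> agree (Suc n) (G f) (G g)"
  obtains f where "f \<in> carrier (PS R)" "G f = f"
proof -
  interpret P: cring "PS R" by (rule PS_cring)
  define F where "F i = (G ^^ i) \<zero>\<^bsub>PS R\<^esub>" for i
  have F: "F i \<in> carrier (PS R)" for i by (induction i) (auto simp: F_def G)
  have step: "agree i (F i) (F (Suc i))" for i
  proof (induction i)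
    case (Suc i)
    from contr[OF this] show ?case by (simp add: F_def)
  qed (use F in \<open>auto simp: agree_def\<close>)
  have stable: "F (i + j) k = F i k" if "k < i" for i j k
  proof (induction j)
    case (Suc j)
    have "F (i + j) k = F (Suc (i + j)) k" using step[of "i + j"] that by (auto simp: agree_def)
    with Suc show ?case by simp
  qed simp
  \<comment> \<open>Coefficient \<open>k\<close> is settled only from iterate \<open>Suc k\<close>
    on, since agreement to order n covers the indices below n.\<close>
  define f where "f k = F (Suc k) k" for k
  have f: "f \<in> carrier (PS R)" using F by (auto simp: f_def PS_simps)
  have fF: "agree i f (F i)" for i
    unfolding agree_def
  proof (intro conjI allI impI f F)
    fix k assume "k < i"
    then obtain j where "i = Suc k + j" using less_iff_Suc_add by auto
    then show "f k = F i k" using stable[of k "Suc k" j] by (simp add: f_def)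
  qed
  have "G f = f"
  proof
    fix k
    have "G f k = F (Suc k) k" using contr[OF fF[of k]] by (auto simp: agree_def F_def)
    then show "G f k = f k" by (simp add: f_def)
  qed
  with f show ?thesis by (rule that)
qed

lemma horner_small_0:
  assumes "set bs \<subseteq> {f \<in> carrier (PS R). f 0 = \<zero>}" "f \<in> carrier (PS R)"
  shows "horner (PS R) bs f 0 = \<zero>"
  using assms(1)
proof (induction bs)
  case (Cons c cs)
  interpret P: cring "PS R" by (rule PS_cring)
  have "set cs \<subseteq> carrier (PS R)" using Cons.prems by auto
  then have "horner (PS R) cs f \<in> carrier (PS R)" using assms(2) by simp
  moreover have "f 0 \<in> carrier R" using assms(2) by (simp add: PS_simps(1))
  ultimately show ?case using Cons assms(2) by (simp add: PS_simps(2) ps_mult_0)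
qed (simp add: PS_simps)

lemma horner_small:
  assumes "set bs \<subseteq> {f \<in> carrier (PS R). f 0 = \<zero>}" "agree n f g"
  shows "agree (Suc n) (horner (PS R) bs f) (horner (PS R) bs g)"
  using assms(1)
proof (induction bs)
  case Nil
  then show ?case using cring.cring_simprules(2)[OF PS_cring] by (simp add: agree_refl)
next
  case (Cons b bs)
  interpret P: cring "PS R" by (rule PS_cring)
  have fg: "f \<in> carrier (PS R)" "g \<in> carrier (PS R)" "agree n f g" using assms(2) by (auto simp: agree_def)
  have bs: "set bs \<subseteq> carrier (PS R)" using Cons.prems by auto
  have H0: "horner (PS R) bs f 0 = \<zero>" if "f \<in> carrier (PS R)" for f
    using horner_small_0[OF _ that] Cons.prems by auto
  have Hc: "horner (PS R) bs h \<in> carrier (PS R)" if "h \<in> carrier (PS R)" for h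
    using bs that by simp
  have "agree (Suc n) (f \<otimes>\<^bsub>PS R\<^esub> horner (PS R) bs f) (g \<otimes>\<^bsub>PS R\<^esub> horner (PS R) bs g)"
  proof -
    have "agree (Suc n) (horner (PS R) bs f \<otimes>\<^bsub>PS R\<^esub> f) (horner (PS R) bs f \<otimes>\<^bsub>PS R\<^esub> g)"
      by (rule agree_mult_Suc[OF Hc[OF fg(1)] H0[OF fg(1)] fg(3)])
    moreover have "agree (Suc n) (horner (PS R) bs f \<otimes>\<^bsub>PS R\<^esub> g) (horner (PS R) bs g \<otimes>\<^bsub>PS R\<^esub> g)"
      using Cons by (intro agree_mult agree_refl fg) auto
    ultimately show ?thesis
      using fg Hc by (simp add: P.m_comm agree_def)
  qed
  then show ?case using Cons.prems by (auto intro!: agree_add agree_refl)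
qed

text \<open>A normal form for Hensel's lemma: every simple-root problem over the algebraic series is
  reduced to this equation. The right-hand side is a contraction because all coefficients in
  \<open>bs\<close> vanish at the origin.\<close>

lemma ps_one_plus_fixpoint:
  assumes bs: "set bs \<subseteq> {f \<in> carrier (PS R). f 0 = \<zero>}"
  obtains Y where "Y \<in> carrier (PS R)" "Y 0 = \<one>"
    "Y = \<one>\<^bsub>PS R\<^esub> \<oplus>\<^bsub>PS R\<^esub> Y \<otimes>\<^bsub>PS R\<^esub> Y \<otimes>\<^bsub>PS R\<^esub> horner (PS R) bs Y"
proof -
  interpret P: cring "PS R" by (rule PS_cring)
  have H0: "horner (PS R) bs f 0 = \<zero>" if "f \<in> carrier (PS R)" for f
    by (rule horner_small_0[OF bs that])
  have bsc: "set bs \<subseteq> carrier (PS R)" using bs by auto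
  define G where "G f = \<one>\<^bsub>PS R\<^esub> \<oplus>\<^bsub>PS R\<^esub> horner (PS R) bs f \<otimes>\<^bsub>PS R\<^esub> (f \<otimes>\<^bsub>PS R\<^esub> f)" for f
  obtain Y where Y: "Y \<in> carrier (PS R)" "G Y = Y"
  proof (rule contraction_fixpoint)
    show "G f \<in> carrier (PS R)" if "f \<in> carrier (PS R)" for f
      using that bsc by (simp add: G_def)
    show "agree (Suc n) (G f) (G g)" if fg: "agree n f g" for n f g
    proof -
      have c: "f \<in> carrier (PS R)" "g \<in> carrier (PS R)" using fg by (auto simp: agree_def)
      have Hc: "horner (PS R) bs f \<in> carrier (PS R)" using c bsc by simp
      have "agree (Suc n) (horner (PS R) bs f \<otimes>\<^bsub>PS R\<^esub> (f \<otimes>\<^bsub>PS R\<^esub> f)) (horner (PS R) bs f \<otimes>\<^bsub>PS R\<^esub> (g \<otimes>\<^bsub>PS R\<^esub> g))"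
        by (rule agree_mult_Suc[OF Hc H0[OF c(1)] agree_mult[OF fg fg]])
      moreover have "agree (Suc n) (horner (PS R) bs f \<otimes>\<^bsub>PS R\<^esub> (g \<otimes>\<^bsub>PS R\<^esub> g)) (horner (PS R) bs g \<otimes>\<^bsub>PS R\<^esub> (g \<otimes>\<^bsub>PS R\<^esub> g))"
        using c by (intro agree_mult horner_small[OF bs fg] agree_refl) auto
      ultimately have "agree (Suc n) (horner (PS R) bs f \<otimes>\<^bsub>PS R\<^esub> (f \<otimes>\<^bsub>PS R\<^esub> f)) (horner (PS R) bs g \<otimes>\<^bsub>PS R\<^esub> (g \<otimes>\<^bsub>PS R\<^esub> g))"
        by (auto simp: agree_def)
      then show ?thesis unfolding G_def by (intro agree_add agree_refl P.one_closed)
    qed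
  qed
  have c: "horner (PS R) bs Y \<in> carrier (PS R)" using Y bsc by simp
  show ?thesis
  proof (rule that[OF Y(1)])
    have "Y 0 = G Y 0" by (simp only: Y(2))
    also have "\<dots> = \<one> \<oplus> \<zero> \<otimes> (Y \<otimes>\<^bsub>PS R\<^esub> Y) 0"
      using Y(1) c H0[OF Y(1)] by (simp add: G_def PS_simps(2,4) ps_mult_0)
    also have "\<dots> = \<one>"
      using PS_mult_closed[OF Y(1) Y(1)] by (simp add: PS_simps(1))
    finally show "Y 0 = \<one>" .
    show "Y = \<one>\<^bsub>PS R\<^esub> \<oplus>\<^bsub>PS R\<^esub> Y \<otimes>\<^bsub>PS R\<^esub> Y \<otimes>\<^bsub>PS R\<^esub> horner (PS R) bs Y"
      using Y c by (simp add: G_def P.m_ac)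
  qed
qed

end

context field
begin

text \<open>After normalising the constant term to 1 with \<open>c\<close>, the inverse is the
  geometric series in \<open>?m\<close>, obtained as the fixed point of Y = 1 + m Y.\<close>

lemma ps_unit:
  assumes f: "f \<in> carrier (PS R)" "f 0 \<noteq> \<zero>"
  obtains g where "g \<in> carrier (PS R)" "f \<otimes>\<^bsub>PS R\<^esub> g = \<one>\<^bsub>PS R\<^esub>"
proof -
  interpret P: cring "PS R" by (rule PS_cring)
  interpret k: ring_hom_cring R "PS R" "ps_const R"
    by (intro ring_hom_cringI cring_axioms P.cring_axioms ps_const_hom)
  have f0: "f 0 \<in> Units R" using f field_Units by (auto simp: PS_simps)
  define c where "c = ps_const R (inv (f 0))"
  have c: "c \<in> carrier (PS R)" "c 0 = inv (f 0)" using f0 by (simp_all add: c_def)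
  let ?u = "c \<otimes>\<^bsub>PS R\<^esub> f"
  let ?m = "\<one>\<^bsub>PS R\<^esub> \<ominus>\<^bsub>PS R\<^esub> ?u"
  have u0: "?u 0 = \<one>" using f c f0 by (simp add: ps_mult_0)
  have m: "?m \<in> carrier (PS R)" using f c by simp
  have m0: "?m 0 = \<zero>"
  proof -
    have "(?m \<oplus>\<^bsub>PS R\<^esub> ?u) 0 = \<one>\<^bsub>PS R\<^esub> 0" using f c by (simp add: P.minus_eq P.a_assoc P.l_neg)
    then have "?m 0 \<oplus> \<one> = \<one>" by (simp add: PS_simps(2,4) u0)
    then show ?thesis using m by (simp add: PS_simps(1))
  qed
  obtain Y where Y: "Y \<in> carrier (PS R)" "\<one>\<^bsub>PS R\<^esub> \<oplus>\<^bsub>PS R\<^esub> ?m \<otimes>\<^bsub>PS R\<^esub> Y = Y"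
  proof (rule contraction_fixpoint[where G = "\<lambda>Y. \<one>\<^bsub>PS R\<^esub> \<oplus>\<^bsub>PS R\<^esub> ?m \<otimes>\<^bsub>PS R\<^esub> Y"])
    show "agree (Suc n) (\<one>\<^bsub>PS R\<^esub> \<oplus>\<^bsub>PS R\<^esub> ?m \<otimes>\<^bsub>PS R\<^esub> Y) (\<one>\<^bsub>PS R\<^esub> \<oplus>\<^bsub>PS R\<^esub> ?m \<otimes>\<^bsub>PS R\<^esub> Z)"
      if "agree n Y Z" for n Y Z
      by (intro agree_add agree_refl agree_mult_Suc m m0 that P.one_closed)
  qed (use m in auto)
  have "\<one>\<^bsub>PS R\<^esub> \<oplus>\<^bsub>PS R\<^esub> ?m \<otimes>\<^bsub>PS R\<^esub> Y = \<one>\<^bsub>PS R\<^esub> \<oplus>\<^bsub>PS R\<^esub> (Y \<ominus>\<^bsub>PS R\<^esub> f \<otimes>\<^bsub>PS R\<^esub> (c \<otimes>\<^bsub>PS R\<^esub> Y))"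
    using f(1) c(1) Y(1) by algebra
  then have 2: "Y = Y \<oplus>\<^bsub>PS R\<^esub> (\<one>\<^bsub>PS R\<^esub> \<ominus>\<^bsub>PS R\<^esub> f \<otimes>\<^bsub>PS R\<^esub> (c \<otimes>\<^bsub>PS R\<^esub> Y))"
    using f(1) c(1) Y by (simp add: P.minus_eq P.a_ac)
  have "\<one>\<^bsub>PS R\<^esub> \<ominus>\<^bsub>PS R\<^esub> f \<otimes>\<^bsub>PS R\<^esub> (c \<otimes>\<^bsub>PS R\<^esub> Y) = \<zero>\<^bsub>PS R\<^esub>"
    using P.add.l_cancel_one'[of Y "\<one>\<^bsub>PS R\<^esub> \<ominus>\<^bsub>PS R\<^esub> f \<otimes>\<^bsub>PS R\<^esub> (c \<otimes>\<^bsub>PS R\<^esub> Y)"] 2 f(1) c(1) Y(1) by simp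
  then have "f \<otimes>\<^bsub>PS R\<^esub> (c \<otimes>\<^bsub>PS R\<^esub> Y) = \<one>\<^bsub>PS R\<^esub>"
    using P.r_right_minus_eq[of "\<one>\<^bsub>PS R\<^esub>" "f \<otimes>\<^bsub>PS R\<^esub> (c \<otimes>\<^bsub>PS R\<^esub> Y)"] f(1) c(1) Y(1) by simp
  then show ?thesis using c Y by (intro that[of "c \<otimes>\<^bsub>PS R\<^esub> Y"]) auto
qed

lemma PS_domain: "domain (PS R)"
proof -
  interpret P: cring "PS R" by (rule PS_cring)
  show ?thesis
  proof (intro domain.intro domain_axioms.intro PS_cring)
    show "\<one>\<^bsub>PS R\<^esub> \<noteq> \<zero>\<^bsub>PS R\<^esub>"
      using one_not_zero PS_simps(3,4)[of R 0] by metis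
    fix f g assume fg: "f \<otimes>\<^bsub>PS R\<^esub> g = \<zero>\<^bsub>PS R\<^esub>" and f: "f \<in> carrier (PS R)" and g: "g \<in> carrier (PS R)"
    have fc: "f n \<in> carrier R" and gc: "g n \<in> carrier R" for n using f g by (auto simp: PS_simps)
    show "f = \<zero>\<^bsub>PS R\<^esub> \<or> g = \<zero>\<^bsub>PS R\<^esub>"
    proof (rule disjCI)
      assume "g \<noteq> \<zero>\<^bsub>PS R\<^esub>"
      then have "\<exists>j. g j \<noteq> \<zero>" by (auto simp: fun_eq_iff PS_simps)
      define j where "j = (LEAST j. g j \<noteq> \<zero>)"
      have j: "g j \<noteq> \<zero>" "\<And>i. i < j \<Longrightarrow> g i = \<zero>"
        using LeastI_ex[OF \<open>\<exists>j. g j \<noteq> \<zero>\<close>] not_less_Least unfolding j_def by auto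
      \<comment> \<open>With \<open>j\<close> the order of \<open>g\<close>, coefficient n + j of
        the product reduces to the single term f_n g_j once the lower coefficients of
        \<open>f\<close> are known to vanish.\<close>
      have "f n = \<zero>" for n
      proof (induction n rule: less_induct)
        case (less n)
        have "\<zero> = (\<Oplus>i\<in>{..n + j}. f i \<otimes> g (n + j - i))"
          using fg PS_mult[of R f g "n + j"] by (simp add: PS_simps)
        also have "\<dots> = (\<Oplus>i\<in>{..n + j}. if n = i then f i \<otimes> g (n + j - i) else \<zero>)"
        proof (rule add.finprod_cong')
          show "f i \<otimes> g (n + j - i) = (if n = i then f i \<otimes> g (n + j - i) else \<zero>)" if "i \<in> {..n + j}" for i
            using less[of i] j(2)[of "n + j - i"] fc gc that by (cases i n rule: linorder_cases) auto
        qed (use fc gc in auto)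
        also have "\<dots> = f n \<otimes> g j" using fc gc by (subst add.finprod_singleton) auto
        finally show ?case using fc gc j(1) integral_iff by metis
      qed
      then show "f = \<zero>\<^bsub>PS R\<^esub>" by (auto simp: fun_eq_iff PS_simps)
    qed
  qed
qed

end

section \<open>Algebraic power series\<close>

context cring
begin

text \<open>The coefficient set \<open>B\<close> is arbitrary: it will be the polynomials, a finite
  algebra, the elements of it that vanish at the origin, or just the constants.\<close>

primrec lin :: "'a set \<Rightarrow> 'a list \<Rightarrow> 'a set" where
  "lin B [] = {\<zero>}"
| "lin B (g # gs) = {b \<otimes> g \<oplus> s | b s. b \<in> B \<and> s \<in> lin B gs}"

lemma lin_least:
  assumes "\<zero> \<in> M" "\<And>b g s. b \<in> B \<Longrightarrow> g \<in> set gs \<Longrightarrow> s \<in> M \<Longrightarrow> b \<otimes> g \<oplus> s \<in> M"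
  shows "lin B gs \<subseteq> M"
  using assms by (induction gs) auto

lemma lin_closed: "B \<subseteq> carrier R \<Longrightarrow> set gs \<subseteq> carrier R \<Longrightarrow> lin B gs \<subseteq> carrier R"
  by (rule lin_least) auto

lemma lin_mono: "B \<subseteq> C \<Longrightarrow> lin B gs \<subseteq> lin C gs"
  by (induction gs) auto

lemma lin_add:
  assumes B: "B \<subseteq> carrier R" "\<And>x y. x \<in> B \<Longrightarrow> y \<in> B \<Longrightarrow> x \<oplus> y \<in> B" and gs: "set gs \<subseteq> carrier R"
  shows "x \<in> lin B gs \<Longrightarrow> y \<in> lin B gs \<Longrightarrow> x \<oplus> y \<in> lin B gs"
  using gs
proof (induction gs arbitrary: x y)
  case (Cons g gs)
  obtain b s where x: "x = b \<otimes> g \<oplus> s" "b \<in> B" "s \<in> lin B gs" using Cons.prems by auto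
  obtain c r where y: "y = c \<otimes> g \<oplus> r" "c \<in> B" "r \<in> lin B gs" using Cons.prems by auto
  have cl: "b \<in> carrier R" "c \<in> carrier R" "g \<in> carrier R" "s \<in> carrier R" "r \<in> carrier R"
    using x y B(1) Cons.prems(3) lin_closed[OF B(1), of gs] by auto
  have "x \<oplus> y = (b \<oplus> c) \<otimes> g \<oplus> (s \<oplus> r)" unfolding x(1) y(1) using cl by algebra
  moreover have "s \<oplus> r \<in> lin B gs" using Cons.IH[OF x(3) y(3)] Cons.prems(3) by simp
  ultimately show ?case using B(2)[OF x(2) y(2)] by auto
qed simp

text \<open>The coefficient set may change from \<open>B\<close> to \<open>C\<close>; multiplication
  by an element vanishing at the origin can thus move coefficients into the maximal ideal.\<close>

lemma lin_mult:
  assumes B: "B \<subseteq> carrier R" and a: "a \<in> carrier R" "\<And>x. x \<in> B \<Longrightarrow> a \<otimes> x \<in> C" and gs: "set gs \<subseteq> carrier R"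
  shows "x \<in> lin B gs \<Longrightarrow> a \<otimes> x \<in> lin C gs"
  using gs
proof (induction gs arbitrary: x)
  case (Cons g gs)
  obtain b s where x: "x = b \<otimes> g \<oplus> s" "b \<in> B" "s \<in> lin B gs" using Cons.prems by auto
  have cl: "b \<in> carrier R" "g \<in> carrier R" "s \<in> carrier R"
    using x B Cons.prems(2) lin_closed[OF B, of gs] by auto
  have "a \<otimes> x = (a \<otimes> b) \<otimes> g \<oplus> a \<otimes> s" unfolding x(1) using cl a(1) by algebra
  moreover have "a \<otimes> s \<in> lin C gs" using Cons.IH[OF x(3)] Cons.prems(2) by simp
  ultimately show ?case using a(2)[OF x(2)] by auto
qed (use a in simp)

lemma lin_gen:
  assumes B: "B \<subseteq> carrier R" "\<zero> \<in> B" and gs: "set gs \<subseteq> carrier R"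
  shows "b \<in> B \<Longrightarrow> g \<in> set gs \<Longrightarrow> b \<otimes> g \<in> lin B gs"
  using gs
proof (induction gs)
  case (Cons h gs)
  have z: "\<zero> \<in> lin B gs'" if "set gs' \<subseteq> carrier R" for gs'
    using that B by (induction gs') force+
  show ?case
  proof (cases "g = h")
    case True
    have "b \<otimes> g = b \<otimes> h \<oplus> \<zero>" using True Cons.prems B by auto
    then show ?thesis using z[of gs] Cons.prems by auto
  next
    case False
    then have "b \<otimes> g \<in> lin B gs" using Cons by auto
    moreover have "b \<otimes> g = \<zero> \<otimes> h \<oplus> b \<otimes> g"
    proof -
      have "b \<in> carrier R" "g \<in> carrier R" "h \<in> carrier R" using Cons.prems B by auto
      then show ?thesis by simp
    qed
    ultimately show ?thesis using B(2) by auto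
  qed
qed simp

lemma lin_zero: "B \<subseteq> carrier R \<Longrightarrow> \<zero> \<in> B \<Longrightarrow> set gs \<subseteq> carrier R \<Longrightarrow> \<zero> \<in> lin B gs"
  by (induction gs) force+

text \<open>Finite over finite is finite, with the products of the two generating lists as
  generators.\<close>

lemma lin_trans:
  assumes T: "T \<subseteq> carrier R" "\<zero> \<in> T" "\<And>x y. x \<in> T \<Longrightarrow> y \<in> T \<Longrightarrow> x \<oplus> y \<in> T"
    and hs: "set hs \<subseteq> carrier R" and gs: "set gs \<subseteq> carrier R" and B: "B \<subseteq> lin T hs"
  shows "lin B gs \<subseteq> lin T [h \<otimes> g. h \<leftarrow> hs, g \<leftarrow> gs]"
proof (rule lin_least)
  let ?ps = "[h \<otimes> g. h \<leftarrow> hs, g \<leftarrow> gs]"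
  have ps: "set ?ps \<subseteq> carrier R" using hs gs by auto
  show "\<zero> \<in> lin T ?ps" by (rule lin_zero[OF T(1,2) ps])
  fix b g s assume b: "b \<in> B" and g: "g \<in> set gs" and s: "s \<in> lin T ?ps"
  have gc: "g \<in> carrier R" using g gs by auto
  have "x \<otimes> g \<in> lin T ?ps" if "x \<in> lin T hs'" "set hs' \<subseteq> set hs" for x hs'
    using that
  proof (induction hs' arbitrary: x)
    case Nil
    then show ?case using lin_zero[OF T(1,2) ps] gc by simp
  next
    case (Cons h hs')
    then obtain c r where x: "x = c \<otimes> h \<oplus> r" "c \<in> T" "r \<in> lin T hs'" by auto
    have cl: "c \<in> carrier R" "h \<in> carrier R" "r \<in> carrier R"
      using x T(1) hs Cons.prems(2) lin_closed[OF T(1), of hs'] by auto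
    have "h \<otimes> g \<in> set ?ps" using Cons.prems(2) g by auto
    then have "c \<otimes> (h \<otimes> g) \<in> lin T ?ps" by (rule lin_gen[OF T(1,2) ps x(2)])
    moreover have "r \<otimes> g \<in> lin T ?ps" using Cons x by auto
    moreover have "x \<otimes> g = c \<otimes> (h \<otimes> g) \<oplus> r \<otimes> g" unfolding x(1) using cl gc by algebra
    ultimately show ?case using lin_add[OF T(1,3) ps] by simp
  qed
  then have "b \<otimes> g \<in> lin T ?ps" using b B by auto
  then show "b \<otimes> g \<oplus> s \<in> lin T ?ps" using lin_add[OF T(1,3) ps] s by simp
qed

text \<open>By bilinearity, closure under multiplication needs checking only on generators. The
  induction first treats a combination times a generator, then two combinations.\<close>

lemma lin_subring:
  assumes B: "subring B R" and gs: "set gs \<subseteq> carrier R" and one: "\<one> \<in> lin B gs"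
    and prod: "\<And>g h. g \<in> set gs \<Longrightarrow> h \<in> set gs \<Longrightarrow> g \<otimes> h \<in> lin B gs"
  shows "subring (lin B gs) R" "B \<subseteq> lin B gs" "set gs \<subseteq> lin B gs"
proof -
  note S = subringE[OF B]
  have cl: "lin B gs \<subseteq> carrier R" by (rule lin_closed[OF S(1) gs])
  have smult: "b \<otimes> x \<in> lin B gs" if "b \<in> B" "x \<in> lin B gs" for b x
    using lin_mult[OF S(1) _ _ gs that(2), of b B] S that by auto
  have gmult: "x \<otimes> g \<in> lin B gs" if "x \<in> lin B gs'" "set gs' \<subseteq> set gs" "g \<in> set gs" for x g gs'
    using that
  proof (induction gs' arbitrary: x)
    case Nil
    then show ?case using lin_zero[OF S(1,2) gs] gs by auto
  next
    case (Cons h gs')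
    then obtain c r where x: "x = c \<otimes> h \<oplus> r" "c \<in> B" "r \<in> lin B gs'" by auto
    have cl: "c \<in> carrier R" "h \<in> carrier R" "r \<in> carrier R" "g \<in> carrier R"
      using x S(1) gs Cons.prems lin_closed[OF S(1), of gs'] by auto
    have "x \<otimes> g = c \<otimes> (h \<otimes> g) \<oplus> r \<otimes> g" unfolding x(1) using cl by algebra
    moreover have "c \<otimes> (h \<otimes> g) \<in> lin B gs" using smult[OF x(2) prod] Cons.prems by auto
    moreover have "r \<otimes> g \<in> lin B gs" using Cons x by auto
    ultimately show ?case using lin_add[OF S(1,7) gs] by simp
  qed
  have mult: "x \<otimes> y \<in> lin B gs" if "x \<in> lin B gs" "y \<in> lin B gs'" "set gs' \<subseteq> set gs" for x y gs'
    using that(2,3)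
  proof (induction gs' arbitrary: y)
    case Nil
    then show ?case using lin_zero[OF S(1,2) gs] that(1) cl by auto
  next
    case (Cons h gs')
    then obtain c r where y: "y = c \<otimes> h \<oplus> r" "c \<in> B" "r \<in> lin B gs'" by auto
    have cl: "c \<in> carrier R" "h \<in> carrier R" "r \<in> carrier R" "x \<in> carrier R"
      using y S(1) gs Cons.prems lin_closed[OF S(1), of gs'] that(1) cl by auto
    have "x \<otimes> y = c \<otimes> (x \<otimes> h) \<oplus> x \<otimes> r" unfolding y(1) using cl by algebra
    moreover have "c \<otimes> (x \<otimes> h) \<in> lin B gs" using smult[OF y(2) gmult[OF that(1)]] Cons.prems by auto
    moreover have "x \<otimes> r \<in> lin B gs" using Cons y by auto
    ultimately show ?case using lin_add[OF S(1,7) gs] by simp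
  qed
  show "subring (lin B gs) R"
  proof (rule subringI[OF cl one])
    show "\<ominus> h \<in> lin B gs" if "h \<in> lin B gs" for h
      using smult[OF S(5)[OF S(3)] that] that cl by (auto simp: l_minus)
    show "h1 \<otimes> h2 \<in> lin B gs" if "h1 \<in> lin B gs" "h2 \<in> lin B gs" for h1 h2
      using mult[OF that] by simp
  qed (rule lin_add[OF S(1,7) gs])
  show "B \<subseteq> lin B gs" using smult[OF _ one] S(1) by (metis r_one subset_iff)
  show "set gs \<subseteq> lin B gs" using lin_gen[OF S(1,2) gs S(3)] gs by (metis l_one subset_iff)
qed

section \<open>Addition and Taylor shift of coefficient lists\<close>

lemma list_add_ex:
  assumes S: "subring S R"
  shows "set xs \<subseteq> S \<Longrightarrow> set ys \<subseteq> S \<Longrightarrow> \<exists>zs. set zs \<subseteq> S \<and> (\<forall>x\<in>carrier R.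
    horner R zs x = horner R xs x \<oplus> horner R ys x \<and> dhorner R zs x = dhorner R xs x \<oplus> dhorner R ys x)"
proof (induction xs arbitrary: ys)
  case Nil
  have "set ys \<subseteq> carrier R" using Nil subringE(1)[OF S] by auto
  with Nil show ?case by (intro exI[of _ ys]) auto
next
  case (Cons x xs)
  show ?case
  proof (cases ys)
    case Nil
    have "set (x # xs) \<subseteq> carrier R" using Cons subringE(1)[OF S] by auto
    with Cons Nil show ?thesis
      by (intro exI[of _ "x # xs"]) (auto simp del: horner.simps(2) dhorner.simps(2))
  next
    case ys: (Cons y ys')
    from Cons.IH[of ys'] Cons.prems ys obtain zs where zs: "set zs \<subseteq> S"
      "\<forall>x\<in>carrier R. horner R zs x = horner R xs x \<oplus> horner R ys' x \<and>
        dhorner R zs x = dhorner R xs x \<oplus> dhorner R ys' x" by auto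
    have cl: "x \<in> carrier R" "y \<in> carrier R" "set xs \<subseteq> carrier R" "set ys' \<subseteq> carrier R"
      using Cons.prems ys subringE(1)[OF S] by auto
    show ?thesis
    proof (intro exI[of _ "(x \<oplus> y) # zs"] conjI ballI)
      show "set ((x \<oplus> y) # zs) \<subseteq> S" using zs Cons.prems ys subringE(7)[OF S] by auto
    qed (use zs cl ys in \<open>auto simp: r_distr a_ac\<close>)
  qed
qed

text \<open>The same Horner recursion as in \<open>tame_shift\<close>, now tracking that the
  coefficients stay in the subring.\<close>

lemma taylor_shift:
  assumes S: "subring S R" and b: "b \<in> S"
  shows "set cs \<subseteq> S \<Longrightarrow> \<exists>ds. set ds \<subseteq> S \<and> (\<forall>y\<in>carrier R.
    horner R ds y = horner R cs (b \<oplus> y) \<and> dhorner R ds y = dhorner R cs (b \<oplus> y))"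
proof (induction cs)
  case Nil
  then show ?case by (intro exI[of _ "[]"]) simp
next
  case (Cons c cs)
  note SE = subringE[OF S]
  from Cons obtain ds where ds: "set ds \<subseteq> S" "\<And>y. y \<in> carrier R \<Longrightarrow> horner R ds y = horner R cs (b \<oplus> y)"
    "\<And>y. y \<in> carrier R \<Longrightarrow> dhorner R ds y = dhorner R cs (b \<oplus> y)" by auto
  have "set (map (\<lambda>d. b \<otimes> d) ds) \<subseteq> S" "set (c # ds) \<subseteq> S" using ds(1) Cons.prems b SE(6) by auto
  from list_add_ex[OF S this] obtain es where es: "set es \<subseteq> S" "\<And>x. x \<in> carrier R \<Longrightarrow>
      horner R es x = horner R (map (\<lambda>d. b \<otimes> d) ds) x \<oplus> horner R (c # ds) x \<and>
      dhorner R es x = dhorner R (map (\<lambda>d. b \<otimes> d) ds) x \<oplus> dhorner R (c # ds) x" by blast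
  have cl: "set ds \<subseteq> carrier R" "b \<in> carrier R" "c \<in> carrier R" using ds(1) b Cons.prems SE(1) by auto
  show ?case
  proof (intro exI[of _ es] conjI ballI es(1))
    fix y assume y: "y \<in> carrier R"
    note c = horner_closed[OF cl(1) y] dhorner_closed[OF cl(1) y] cl y
    show "horner R es y = horner R (c # cs) (b \<oplus> y)"
      using es(2)[OF y] c by (simp add: horner_map_mult ds(2)[OF y, symmetric] l_distr a_ac)
    show "dhorner R es y = dhorner R (c # cs) (b \<oplus> y)"
      using es(2)[OF y] c by (simp add: dhorner_map_mult ds(2,3)[OF y, symmetric] l_distr a_ac)
  qed
qed

end

section \<open>Finite algebras over F[X] that are unramified at the origin\<close>

locale power_series = F: field F for F :: "('a, 'm) ring_scheme" +
  fixes P :: "(nat \<Rightarrow> 'a) ring" (structure)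
  defines P_def: "P \<equiv> PS F"

sublocale power_series \<subseteq> P?: "domain" P
  unfolding P_def by (rule F.PS_domain)

context power_series
begin

abbreviation "T \<equiv> carrier (UP F)"
abbreviation "X \<equiv> ps_X F"
abbreviation "\<kappa> \<equiv> ps_const F"

lemma in_P: "f \<in> carrier P \<longleftrightarrow> (\<forall>n. f n \<in> carrier F)"
  by (simp add: P_def PS_simps)

lemma coeff_0 [simp]: "f \<in> carrier P \<Longrightarrow> f n \<in> carrier F"
  by (simp add: in_P)

lemma residue_hom: "ring_hom_cring P F (\<lambda>f. f 0)"
  unfolding P_def by (intro ring_hom_cringI F.PS_cring F.cring_axioms F.ps_residue_hom)

sublocale res: ring_hom_cring P F "\<lambda>f. f 0"
  by (rule residue_hom)

lemma const_hom: "ring_hom_cring F P \<kappa>"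
  unfolding P_def by (intro ring_hom_cringI F.PS_cring F.cring_axioms F.ps_const_hom)

sublocale const: ring_hom_cring F P \<kappa>
  by (rule const_hom)

lemma X_closed [simp]: "X \<in> carrier P"
  by (simp add: P_def)

lemma T_subset: "T \<subseteq> carrier P"
  unfolding P_def by (rule F.UP_subset_PS)

lemma T_hom: "ring_hom_cring (UP F) P id"
  unfolding P_def by (intro ring_hom_cringI F.PS_cring F.UP_is_cring F.UP_PS_hom)

lemma T_subring: "subring T P"
proof -
  interpret U: cring "UP F" by (rule F.UP_is_cring)
  have "ring_hom_ring (UP F) P id"
    unfolding P_def by (intro ring_hom_ringI2 U.ring_axioms cring.axioms(1) F.PS_cring F.UP_PS_hom)
  from ring_hom_ring.img_is_subring[OF this U.carrier_is_subring] show ?thesis by simp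
qed

lemma X_T: "X \<in> T"
  by (rule F.ps_X_UP)

lemma const_T: "c \<in> carrier F \<Longrightarrow> \<kappa> c \<in> T"
  by (rule F.ps_const_UP)

lemma divide_X:
  assumes "f \<in> carrier P" "f 0 = \<zero>\<^bsub>F\<^esub>"
  obtains g where "g \<in> carrier P" "f = X \<otimes> g"
  using F.ps_divide_X[of f] assms by (auto simp: P_def)

lemma T_divide_X:
  assumes "f \<in> T" "f 0 = \<zero>\<^bsub>F\<^esub>"
  shows "\<exists>g\<in>T. f = X \<otimes> g"
proof -
  obtain g where g: "g \<in> carrier P" "f = X \<otimes> g" using divide_X[of f] assms T_subset by auto
  have fg: "f (Suc n) = g n" for n
    using F.ps_X_mult[of g "Suc n"] g by (simp add: P_def)
  obtain n where "bound \<zero>\<^bsub>F\<^esub> n f" using assms by (auto simp: UP_def up_def)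
  then have "bound \<zero>\<^bsub>F\<^esub> n g" using fg by (auto simp: bound_def) (metis less_SucI)
  then have "g \<in> T" using g(1) by (auto simp: UP_def in_P intro!: mem_upI)
  with g show ?thesis by blast
qed

lemma unit_inverse:
  assumes "f \<in> carrier P" "f 0 \<noteq> \<zero>\<^bsub>F\<^esub>"
  obtains g where "g \<in> carrier P" "f \<otimes> g = \<one>"
  using F.ps_unit[of f] assms by (auto simp: P_def)

text \<open>
  \<open>etale_at e B\<close> says that \<open>B\<close> is a finite algebra over \<open>F[X]\<close> inside \<open>F[[X]]\<close> whose localisation at the
  origin is unramified over \<open>F[X]\<close>: the element \<open>e\<close> witnesses that \<open>X\<close> generates the maximal ideal
  of that localisation.
\<close>

definition etale_at :: "(nat \<Rightarrow> 'a) \<Rightarrow> (nat \<Rightarrow> 'a) set \<Rightarrow> bool" where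
  "etale_at e B \<longleftrightarrow> subring B P \<and> T \<subseteq> B \<and> (\<exists>gs. set gs \<subseteq> B \<and> B \<subseteq> lin T gs) \<and>
     e \<in> B \<and> e 0 = \<one>\<^bsub>F\<^esub> \<and> (\<forall>g\<in>B. g 0 = \<zero>\<^bsub>F\<^esub> \<longrightarrow> (\<exists>b\<in>B. e \<otimes> g = X \<otimes> b))"

lemma etale_T: "etale_at \<one> T"
  unfolding etale_at_def
proof (intro conjI)
  note T = subringE[OF T_subring]
  show "\<exists>gs. set gs \<subseteq> T \<and> T \<subseteq> lin T gs"
  proof (intro exI conjI subsetI)
    show "x \<in> T" if "x \<in> set [\<one>]" for x using that T(3) by simp
    show "x \<in> lin T [\<one>]" if x: "x \<in> T" for x
    proof -
      have "x = x \<otimes> \<one> \<oplus> \<zero>" using x T(1) by auto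
      with x show ?thesis by auto
    qed
  qed
  show "\<one> \<in> T" by (rule T(3))
  show "\<forall>g\<in>T. g 0 = \<zero>\<^bsub>F\<^esub> \<longrightarrow> (\<exists>b\<in>T. \<one> \<otimes> g = X \<otimes> b)"
  proof (intro ballI impI)
    fix g assume g: "g \<in> T" "g 0 = \<zero>\<^bsub>F\<^esub>"
    then have "\<one> \<otimes> g = g" using T(1) by auto
    then show "\<exists>b\<in>T. \<one> \<otimes> g = X \<otimes> b" using T_divide_X[OF g] by simp
  qed
qed (simp_all add: T_subring)

text \<open>Unramifiedness has to be tested only on constant combinations of \<open>hs\<close>:
  since \<open>e\<close> times b - b(0) is divisible by X in \<open>B\<close>, every coefficient may
  be replaced by its constant term. The factor \<open>q\<close> of the new witness takes care of
  these combinations.\<close>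

lemma etale_extend:
  assumes B: "etale_at e B" and hs: "set hs \<subseteq> carrier P" and C: "C = lin B hs"
    and one: "\<one> \<in> C" and prod: "\<And>g h. g \<in> set hs \<Longrightarrow> h \<in> set hs \<Longrightarrow> g \<otimes> h \<in> C"
    and q: "q \<in> C" "q 0 = \<one>\<^bsub>F\<^esub>"
    and small: "\<And>s. s \<in> lin (\<kappa> ` carrier F) hs \<Longrightarrow> s 0 = \<zero>\<^bsub>F\<^esub> \<Longrightarrow> \<exists>c\<in>C. e \<otimes> (q \<otimes> s) = X \<otimes> c"
  shows "etale_at (e \<otimes> q) C" "B \<subseteq> C" "set hs \<subseteq> C"
proof -
  from B have sB: "subring B P" and TB: "T \<subseteq> B" and e: "e \<in> B" "e 0 = \<one>\<^bsub>F\<^esub>"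
    and et: "\<And>g. g \<in> B \<Longrightarrow> g 0 = \<zero>\<^bsub>F\<^esub> \<Longrightarrow> \<exists>b\<in>B. e \<otimes> g = X \<otimes> b"
    by (auto simp: etale_at_def)
  obtain gs where gs: "set gs \<subseteq> B" "B \<subseteq> lin T gs" using B by (auto simp: etale_at_def)
  note SB = subringE[OF sB]
  have sC: "subring C P" and BC: "B \<subseteq> C" and hC: "set hs \<subseteq> C"
    using lin_subring[OF sB hs] one prod unfolding C by auto
  note SC = subringE[OF sC]
  have ec: "e \<in> carrier P" using e SB by auto
  have qc: "q \<in> carrier P" using q SC by auto
  have kB: "\<kappa> c \<in> B" if "c \<in> carrier F" for c using const_T[OF that] TB by auto
  \<comment> \<open>Replacing all coefficients of \<open>g\<close> by their constant terms changes
    \<open>e \<otimes> g\<close> only by a multiple of X in \<open>C\<close>.\<close>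
  have decomp: "\<exists>s\<in>lin (\<kappa> ` carrier F) hs'. \<exists>c\<in>C. e \<otimes> (g \<ominus> s) = X \<otimes> c"
    if "g \<in> lin B hs'" "set hs' \<subseteq> set hs" for g hs'
    using that
  proof (induction hs' arbitrary: g)
    case Nil
    have "e \<otimes> (\<zero> \<ominus> \<zero>) = X \<otimes> \<zero>" using ec X_closed by algebra
    then show ?case using Nil SC(2) by (auto intro!: bexI[of _ \<zero>])
  next
    case (Cons h hs')
    then obtain b g' where g: "g = b \<otimes> h \<oplus> g'" "b \<in> B" "g' \<in> lin B hs'" by auto
    then obtain s c where s: "s \<in> lin (\<kappa> ` carrier F) hs'" "c \<in> C" "e \<otimes> (g' \<ominus> s) = X \<otimes> c"
      using Cons by (metis insert_subset list.simps(15))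
    have bc: "b \<in> carrier P" and b0: "b 0 \<in> carrier F" using g(2) SB by auto
    have "b \<ominus> \<kappa> (b 0) \<in> B" using g(2) SB kB[OF b0] by (simp add: a_minus_def)
    moreover have "(b \<ominus> \<kappa> (b 0)) 0 = \<zero>\<^bsub>F\<^esub>"
      using bc b0 by (simp add: a_minus_def F.r_neg)
    ultimately obtain b' where b': "b' \<in> B" "e \<otimes> (b \<ominus> \<kappa> (b 0)) = X \<otimes> b'" using et by blast
    have cl: "h \<in> carrier P" "b' \<in> carrier P" "g' \<in> carrier P" "s \<in> carrier P" "c \<in> carrier P" "\<kappa> (b 0) \<in> carrier P"
    proof -
      show "h \<in> carrier P" using Cons.prems hs by auto
      show "b' \<in> carrier P" using b' SB by auto
      show "g' \<in> carrier P" using lin_closed[OF SB(1), of hs'] g(3) Cons.prems hs by auto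
      show "s \<in> carrier P" using lin_closed[of "\<kappa> ` carrier F" hs'] s(1) Cons.prems hs by auto
    qed (use s(2) SC(1) b0 in auto)
    have "e \<otimes> (g \<ominus> (\<kappa> (b 0) \<otimes> h \<oplus> s)) = (e \<otimes> (b \<ominus> \<kappa> (b 0))) \<otimes> h \<oplus> e \<otimes> (g' \<ominus> s)"
      unfolding g(1) using ec bc cl by algebra
    also have "\<dots> = X \<otimes> (b' \<otimes> h \<oplus> c)" unfolding b'(2) s(3) using cl X_closed by algebra
    finally have "e \<otimes> (g \<ominus> (\<kappa> (b 0) \<otimes> h \<oplus> s)) = X \<otimes> (b' \<otimes> h \<oplus> c)" .
    moreover have "b' \<in> C" "h \<in> C" using b'(1) BC hC Cons.prems(2) by auto
    then have "b' \<otimes> h \<oplus> c \<in> C" using s(2) SC(6,7) by simp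
    moreover have "\<kappa> (b 0) \<otimes> h \<oplus> s \<in> lin (\<kappa> ` carrier F) (h # hs')" using b0 s(1) by auto
    ultimately show ?case by blast
  qed
  have etC: "\<exists>c\<in>C. e \<otimes> q \<otimes> g = X \<otimes> c" if g: "g \<in> C" "g 0 = \<zero>\<^bsub>F\<^esub>" for g
  proof -
    obtain s c where s: "s \<in> lin (\<kappa> ` carrier F) hs" "c \<in> C" "e \<otimes> (g \<ominus> s) = X \<otimes> c"
      using decomp[of g hs] g(1) C by auto
    have sc: "s \<in> carrier P" using lin_closed[of "\<kappa> ` carrier F" hs] s(1) hs by auto
    have cc: "c \<in> carrier P" and gc: "g \<in> carrier P" using s(2) g(1) SC(1) by auto
    have "(e \<otimes> (g \<ominus> s)) 0 = \<zero>\<^bsub>F\<^esub>" unfolding s(3) using cc by simp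
    then have "s 0 = \<zero>\<^bsub>F\<^esub>" using ec gc sc e(2) g(2) by (simp add: a_minus_def)
    then obtain d where d: "d \<in> C" "e \<otimes> (q \<otimes> s) = X \<otimes> d" using small[OF s(1)] by blast
    have dc: "d \<in> carrier P" using d SC(1) by auto
    have "e \<otimes> q \<otimes> g = q \<otimes> (e \<otimes> (g \<ominus> s)) \<oplus> e \<otimes> (q \<otimes> s)" using ec qc gc sc by algebra
    also have "\<dots> = X \<otimes> (q \<otimes> c \<oplus> d)" unfolding s(3) d(2) using qc cc dc X_closed by algebra
    finally show ?thesis using q(1) s(2) d(1) SC(6,7) by blast
  qed
  have gsc: "set gs \<subseteq> carrier P" using gs(1) SB(1) by auto
  note ST = subringE[OF T_subring]
  have "\<exists>ps. set ps \<subseteq> C \<and> C \<subseteq> lin T ps"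
  proof (intro exI conjI)
    show "C \<subseteq> lin T [h \<otimes> g. h \<leftarrow> gs, g \<leftarrow> hs]"
      unfolding C by (rule lin_trans[OF ST(1,2,7) gsc hs gs(2)])
    show "set [h \<otimes> g. h \<leftarrow> gs, g \<leftarrow> hs] \<subseteq> C"
      using gs(1) BC hC by (auto intro!: SC(6) simp: subset_iff)
  qed
  moreover have "e \<otimes> q \<in> C" using e q BC SC(6) by auto
  moreover have "(e \<otimes> q) 0 = \<one>\<^bsub>F\<^esub>" using ec qc e q by simp
  ultimately show "etale_at (e \<otimes> q) C"
    unfolding etale_at_def using sC BC TB etC by blast
  show "B \<subseteq> C" "set hs \<subseteq> C" by (rule BC, rule hC)
qed

text \<open>The compositum is the span over \<open>B1\<close> of generators of \<open>B2\<close>.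
  Constant combinations of those generators lie in \<open>B2\<close>, where \<open>e2\<close>
  already does the work, so the product of the two witnesses suffices.\<close>

lemma etale_compositum:
  assumes B1: "etale_at e1 B1" and B2: "etale_at e2 B2"
  shows "\<exists>e C. etale_at e C \<and> B1 \<subseteq> C \<and> B2 \<subseteq> C"
proof -
  from B2 have sB: "subring B2 P" and TB: "T \<subseteq> B2" and e: "e2 \<in> B2" "e2 0 = \<one>\<^bsub>F\<^esub>"
    and et: "\<And>g. g \<in> B2 \<Longrightarrow> g 0 = \<zero>\<^bsub>F\<^esub> \<Longrightarrow> \<exists>b\<in>B2. e2 \<otimes> g = X \<otimes> b"
    by (auto simp: etale_at_def)
  from B1 have sB1: "subring B1 P" and TB1: "T \<subseteq> B1" and e1: "e1 \<in> B1" by (auto simp: etale_at_def)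
  obtain hs where hs: "set hs \<subseteq> B2" "B2 \<subseteq> lin T hs" using B2 by (auto simp: etale_at_def)
  note SB = subringE[OF sB]
  define C where "C = lin B1 hs"
  have B2C: "B2 \<subseteq> C" using hs(2) lin_mono[OF TB1] by (auto simp: C_def)
  have hsc: "set hs \<subseteq> carrier P" using hs(1) SB(1) by auto
  have one: "\<one> \<in> C" and e2C: "e2 \<in> C" using SB(3) e B2C by auto
  have prod: "\<And>g h. g \<in> set hs \<Longrightarrow> h \<in> set hs \<Longrightarrow> g \<otimes> h \<in> C"
    using hs(1) SB(6) B2C by blast
  have sC: "subring C P" "B1 \<subseteq> C"
    using lin_subring[OF sB1 hsc] one prod unfolding C_def by blast+
  have small: "\<exists>c\<in>C. e1 \<otimes> (e2 \<otimes> s) = X \<otimes> c" if s: "s \<in> lin (\<kappa> ` carrier F) hs" "s 0 = \<zero>\<^bsub>F\<^esub>" for s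
  proof -
    have "lin (\<kappa> ` carrier F) hs \<subseteq> B2"
    proof (rule lin_least)
      show "b \<otimes> g \<oplus> s \<in> B2" if "b \<in> \<kappa> ` carrier F" "g \<in> set hs" "s \<in> B2" for b g s
      proof -
        have "b \<in> B2" using that(1) const_T TB by auto
        then show ?thesis using that hs(1) SB(6,7) by blast
      qed
    qed (rule SB(2))
    then obtain b where b: "b \<in> B2" "e2 \<otimes> s = X \<otimes> b" using et s by blast
    have "e1 \<in> carrier P" "b \<in> carrier P" using e1 b(1) subringE(1)[OF sB1] SB(1) by auto
    then have "e1 \<otimes> (e2 \<otimes> s) = X \<otimes> (e1 \<otimes> b)" unfolding b(2) by (simp add: m_lcomm)
    moreover have "e1 \<otimes> b \<in> C" using e1 b(1) B2C sC(2) subringE(6)[OF sC(1)] by blast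
    ultimately show ?thesis by blast
  qed
  have "etale_at (e1 \<otimes> e2) C"
    by (rule etale_extend(1)[OF B1 hsc C_def one prod e2C e(2) small])
  with B2C sC(2) show ?thesis by blast
qed

text \<open>On the fibre over the origin the relation reads z^n (z - 1) = 0, so z = 1 is a simple
  root there and inverting z^n isolates it; this is why the new witness is
  \<open>e \<otimes> z [^] n\<close>. A constant combination of powers that vanishes at the origin
  is a multiple of z - 1, and multiplying it by z^n yields coefficients vanishing at the origin,
  which \<open>e\<close> makes divisible by X.\<close>

lemma etale_adjoin:
  assumes B: "etale_at e B" and z: "z \<in> carrier P" "z 0 = \<one>\<^bsub>F\<^esub>"
    and w: "w \<in> B" "w 0 = \<one>\<^bsub>F\<^esub>"
    and v: "v \<in> lin {b \<in> B. b 0 = \<zero>\<^bsub>F\<^esub>} (map (\<lambda>i. z [^] i) [0..<Suc n])"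
    and eq: "z [^] Suc n = w \<otimes> z [^] n \<oplus> v"
  shows "\<exists>e C. etale_at e C \<and> B \<subseteq> C \<and> z \<in> C"
proof -
  define m where "m = {b \<in> B. b 0 = \<zero>\<^bsub>F\<^esub>}"
  define hs where "hs = map (\<lambda>i. z [^] i) [0..<Suc n]"
  define C where "C = lin B hs"
  from B have sB: "subring B P" and TB: "T \<subseteq> B" and e: "e \<in> B"
    and et: "\<And>g. g \<in> m \<Longrightarrow> \<exists>b\<in>B. e \<otimes> g = X \<otimes> b"
    by (auto simp: etale_at_def m_def)
  note SB = subringE[OF sB]
  have hsc: "set hs \<subseteq> carrier P" using z by (auto simp: hs_def)
  have mB: "m \<subseteq> B" and mc: "m \<subseteq> carrier P" using SB(1) by (auto simp: m_def)
  have m0: "\<zero> \<in> m" using SB(2) by (simp add: m_def)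
  have madd: "x \<oplus> y \<in> m" if "x \<in> m" "y \<in> m" for x y
  proof -
    have "x \<in> carrier P" "y \<in> carrier P" using that mc by auto
    then show ?thesis using that SB(7) by (auto simp: m_def)
  qed
  have wc: "w \<in> carrier P" and ec: "e \<in> carrier P" using w e SB(1) by auto
  have vm: "v \<in> lin m hs" using v unfolding m_def hs_def .
  have vC: "v \<in> C" using vm lin_mono[OF mB] by (auto simp: C_def)
  have vc: "v \<in> carrier P" using lin_closed[OF mc hsc] vm by auto
  have Cc: "C \<subseteq> carrier P" unfolding C_def by (rule lin_closed[OF SB(1) hsc])
  have pow_hs: "z [^] i \<in> set hs" if "i \<le> n" for i
    using that unfolding hs_def set_map set_upt by (intro image_eqI[of _ _ i]) auto
  have gen: "b \<otimes> z [^] i \<in> C" if "i \<le> n" "b \<in> B" for i b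
    unfolding C_def by (rule lin_gen[OF SB(1,2) hsc that(2) pow_hs[OF that(1)]])
  have pow_C: "z [^] i \<in> C" if "i \<le> n" for i
    using gen[OF that SB(3)] z by simp
  have addC: "x \<oplus> y \<in> C" if "x \<in> C" "y \<in> C" for x y
    using lin_add[OF SB(1,7) hsc] that unfolding C_def by blast
  \<comment> \<open>Multiplication by \<open>z\<close> stays inside the span; only the top power
    \<open>z [^] n\<close> needs the monic relation.\<close>
  have zC: "z \<otimes> x \<in> C" if "x \<in> lin B hs'" "set hs' \<subseteq> set hs" for x hs'
    using that
  proof (induction hs' arbitrary: x)
    case Nil
    then show ?case using lin_zero[OF SB(1,2) hsc] z by (auto simp: C_def)
  next
    case (Cons h hs')
    then obtain b r where x: "x = b \<otimes> h \<oplus> r" "b \<in> B" "r \<in> lin B hs'" by auto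
    from Cons.prems(2) obtain i where i: "h = z [^] i" "i \<le> n" by (auto simp: hs_def)
    have cl: "b \<in> carrier P" "r \<in> carrier P"
      using x SB(1) Cons.prems(2) hsc lin_closed[OF SB(1), of hs'] by auto
    have "z \<otimes> x = b \<otimes> z [^] Suc i \<oplus> z \<otimes> r"
      unfolding x(1) i(1) using cl z by (simp add: r_distr m_ac)
    moreover have "z \<otimes> r \<in> C" using Cons x by auto
    moreover have "b \<otimes> z [^] Suc i \<in> C"
    proof (cases "i = n")
      case True
      have "b \<otimes> z [^] Suc i = (b \<otimes> w) \<otimes> z [^] n \<oplus> b \<otimes> v"
        unfolding True eq using cl wc vc z by (simp add: r_distr m_assoc)
      moreover have "b \<otimes> v \<in> C"
        using lin_mult[OF SB(1) cl(1) _ hsc, of B v] SB(6) x(2) vC unfolding C_def by blast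
      ultimately show ?thesis using gen[of n "b \<otimes> w"] SB(6)[OF x(2) w(1)] addC by simp
    next
      case False
      then show ?thesis using gen[of "Suc i" b] i x(2) by simp
    qed
    ultimately show ?case using addC by simp
  qed
  have pow_C': "z [^] i \<in> C" for i :: nat
  proof (induction i)
    case (Suc i)
    have "z [^] Suc i = z \<otimes> z [^] i" using z by (simp add: m_comm)
    then show ?case using zC[of "z [^] i" hs] Suc by (simp add: C_def)
  qed (use pow_C[of 0] in simp)
  have one: "\<one> \<in> C" using pow_C'[of 0] by simp
  have prod: "g \<otimes> h \<in> C" if "g \<in> set hs" "h \<in> set hs" for g h
    using that pow_C' z by (auto simp: hs_def nat_pow_mult)
  have sC: "subring C P" and BC: "B \<subseteq> C"
    using lin_subring[OF sB hsc] one prod unfolding C_def by blast+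
  note SC = subringE[OF sC]
  have q0: "(z [^] i) 0 = \<one>\<^bsub>F\<^esub>" for i :: nat
    using z by (induction i) simp_all
  have kc: "\<kappa> ` carrier F \<subseteq> carrier P" by auto
  have z1: "z \<ominus> \<one> \<in> C" using pow_C'[of 1] one SC(5,7) z(1) by (simp add: a_minus_def)
  have pow1: "\<exists>c\<in>C. z [^] i = \<one> \<oplus> (z \<ominus> \<one>) \<otimes> c" for i :: nat
  proof (induction i)
    case 0
    have "\<one> = \<one> \<oplus> (z \<ominus> \<one>) \<otimes> \<zero>" using z by simp
    then show ?case using SC(2) by auto
  next
    case (Suc i)
    then obtain c where c: "c \<in> C" "z [^] i = \<one> \<oplus> (z \<ominus> \<one>) \<otimes> c" by blast
    have "c \<in> carrier P" using c Cc by auto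
    then have "(\<one> \<oplus> (z \<ominus> \<one>) \<otimes> c) \<otimes> z = \<one> \<oplus> (z \<ominus> \<one>) \<otimes> (\<one> \<oplus> c \<otimes> z)" using z(1) by algebra
    moreover have "\<one> \<oplus> c \<otimes> z \<in> C" using c(1) one pow_C'[of 1] SC(6,7) z(1) by simp
    ultimately show ?case using c(2) by auto
  qed
  \<comment> \<open>A polynomial in \<open>z\<close> with constant coefficients differs from its
    value at z = 1 by a multiple of z - 1, and that value is \<open>s 0\<close> because
    \<open>z 0\<close> is 1.\<close>
  have fact: "\<exists>c\<in>C. s = \<kappa> (s 0) \<oplus> (z \<ominus> \<one>) \<otimes> c" if "s \<in> lin (\<kappa> ` carrier F) hs'" "set hs' \<subseteq> set hs" for s hs'
    using that
  proof (induction hs' arbitrary: s)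
    case Nil
    have "\<zero> = \<kappa> (\<zero> 0) \<oplus> (z \<ominus> \<one>) \<otimes> \<zero>" using z by simp
    then show ?case using Nil SC(2) by auto
  next
    case (Cons h hs')
    then obtain a r where s: "s = \<kappa> a \<otimes> h \<oplus> r" "a \<in> carrier F" "r \<in> lin (\<kappa> ` carrier F) hs'" by auto
    then obtain c where c: "c \<in> C" "r = \<kappa> (r 0) \<oplus> (z \<ominus> \<one>) \<otimes> c" using Cons by auto
    from Cons.prems(2) obtain i :: nat where i: "h = z [^] i" by (auto simp: hs_def)
    obtain d where d: "d \<in> C" "h = \<one> \<oplus> (z \<ominus> \<one>) \<otimes> d" using pow1[of i] i by auto
    have cl: "c \<in> carrier P" "d \<in> carrier P" "r \<in> carrier P" "\<kappa> a \<in> carrier P"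
      using c d Cc s lin_closed[OF kc, of hs'] Cons.prems(2) hsc by auto
    have h0: "h 0 = \<one>\<^bsub>F\<^esub>" and hc: "h \<in> carrier P" using i q0 z by simp_all
    have r0: "r 0 \<in> carrier F" "\<kappa> (r 0) \<in> carrier P" using cl by simp_all
    have s0: "s 0 = a \<oplus>\<^bsub>F\<^esub> r 0" unfolding s(1) using cl hc h0 s(2) by simp
    have "\<kappa> a \<otimes> (\<one> \<oplus> (z \<ominus> \<one>) \<otimes> d) \<oplus> (\<kappa> (r 0) \<oplus> (z \<ominus> \<one>) \<otimes> c)
        = (\<kappa> a \<oplus> \<kappa> (r 0)) \<oplus> (z \<ominus> \<one>) \<otimes> (\<kappa> a \<otimes> d \<oplus> c)"
      using z(1) cl r0 by algebra
    then have "s = \<kappa> (s 0) \<oplus> (z \<ominus> \<one>) \<otimes> (\<kappa> a \<otimes> d \<oplus> c)"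
      using s(1) c(2) d(2) s0 s(2) r0 by simp
    moreover have "\<kappa> a \<in> C" using const_T[OF s(2)] TB BC by auto
    then have "\<kappa> a \<otimes> d \<oplus> c \<in> C" using c(1) d(1) SC(6,7) by blast
    ultimately show ?case by blast
  qed
  have em: "\<exists>c\<in>C. e \<otimes> x = X \<otimes> c" if "x \<in> lin m hs'" "set hs' \<subseteq> set hs" for x hs'
    using that
  proof (induction hs' arbitrary: x)
    case Nil
    have "e \<otimes> \<zero> = X \<otimes> \<zero>" using ec by simp
    then show ?case using Nil SC(2) by (auto intro!: bexI[of _ \<zero>])
  next
    case (Cons h hs')
    then obtain b r where x: "x = b \<otimes> h \<oplus> r" "b \<in> m" "r \<in> lin m hs'" by auto
    then obtain c where c: "c \<in> C" "e \<otimes> r = X \<otimes> c" using Cons by auto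
    obtain b' where b': "b' \<in> B" "e \<otimes> b = X \<otimes> b'" using et[OF x(2)] by blast
    have cl: "c \<in> carrier P" "b' \<in> carrier P" "b \<in> carrier P" "r \<in> carrier P" "h \<in> carrier P"
      using c b' Cc SB(1) x mc lin_closed[OF mc subset_trans[OF _ hsc], of hs'] Cons.prems(2) hsc by auto
    have "e \<otimes> x = (e \<otimes> b) \<otimes> h \<oplus> e \<otimes> r" unfolding x(1) using ec cl by algebra
    also have "\<dots> = X \<otimes> (b' \<otimes> h \<oplus> c)" unfolding b'(2) c(2) using cl X_closed by algebra
    finally have "e \<otimes> x = X \<otimes> (b' \<otimes> h \<oplus> c)" .
    moreover have "h \<in> C" using Cons.prems(2) pow_C by (auto simp: hs_def)
    then have "b' \<otimes> h \<oplus> c \<in> C" using b'(1) BC c(1) SC(6,7) by blast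
    ultimately show ?case by blast
  qed
  have small: "\<exists>c\<in>C. e \<otimes> (z [^] n \<otimes> s) = X \<otimes> c"
    if s: "s \<in> lin (\<kappa> ` carrier F) hs" "s 0 = \<zero>\<^bsub>F\<^esub>" for s
  proof -
    obtain c where c: "c \<in> C" "s = \<kappa> (s 0) \<oplus> (z \<ominus> \<one>) \<otimes> c" using fact[OF s(1)] by blast
    have cc: "c \<in> carrier P" using c Cc by auto
    have sz: "s = (z \<ominus> \<one>) \<otimes> c" using c(2) s(2) cc z(1) by simp
    have w1: "w \<ominus> \<one> \<in> m"
      using w SB(3,5,7) wc by (simp add: m_def a_minus_def F.r_neg)
    have "(w \<ominus> \<one>) \<otimes> z [^] n \<in> lin m hs"
      by (rule lin_gen[OF mc m0 hsc w1 pow_hs]) simp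
    then have "v \<oplus> (w \<ominus> \<one>) \<otimes> z [^] n \<in> lin m hs"
      using lin_add[OF mc madd hsc vm] by simp
    then obtain d where d: "d \<in> C" "e \<otimes> (v \<oplus> (w \<ominus> \<one>) \<otimes> z [^] n) = X \<otimes> d" using em[of _ hs] by blast
    have dc: "d \<in> carrier P" using d Cc by auto
    have zn: "z [^] n \<in> carrier P" using z by simp
    \<comment> \<open>The relation rearranged: both \<open>v\<close> and
      \<open>w \<ominus> \<one>\<close> contribute only coefficients that vanish at the
      origin.\<close>
    have "z [^] n \<otimes> (z \<ominus> \<one>) = z [^] Suc n \<ominus> z [^] n" using zn z(1) by (simp add: a_minus_def r_distr r_minus)
    also have "\<dots> = v \<oplus> (w \<ominus> \<one>) \<otimes> z [^] n" unfolding eq using zn wc vc by algebra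
    finally have zz: "z [^] n \<otimes> (z \<ominus> \<one>) = v \<oplus> (w \<ominus> \<one>) \<otimes> z [^] n" .
    have "e \<otimes> (z [^] n \<otimes> s) = e \<otimes> (z [^] n \<otimes> (z \<ominus> \<one>)) \<otimes> c"
      unfolding sz using ec zn z(1) cc by (simp add: m_assoc)
    also have "\<dots> = X \<otimes> (d \<otimes> c)" unfolding zz d(2) using dc cc by (simp add: m_assoc)
    finally show ?thesis using d(1) c(1) SC(6) by blast
  qed
  have "etale_at (e \<otimes> z [^] n) C"
    by (rule etale_extend(1)[OF B hsc C_def one prod pow_C' q0 small])
  then show ?thesis using BC pow_C'[of 1] z(1) by auto
qed

subsection \<open>The henselian ring of algebraic power series\<close>

text \<open>The union of the localisations at the origin of all algebras \<open>B\<close>.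
  Denominators are normalised to constant term 1, at no loss since every \<open>B\<close> contains
  the constants.\<close>

definition alg_series :: "(nat \<Rightarrow> 'a) set" where
  "alg_series = {f \<in> carrier P. \<exists>e B u w. etale_at e B \<and> u \<in> B \<and> w \<in> B \<and> w 0 = \<one>\<^bsub>F\<^esub> \<and> f \<otimes> w = u}"

lemma etale_subring: "etale_at e B \<Longrightarrow> subring B P"
  by (simp add: etale_at_def)

lemma alg_seriesI:
  assumes "etale_at e B" "f \<in> carrier P" "w \<in> B" "w 0 = \<one>\<^bsub>F\<^esub>" "f \<otimes> w \<in> B"
  shows "f \<in> alg_series"
  using assms unfolding alg_series_def by blast

lemma etale_alg_series:
  assumes "etale_at e B"
  shows "B \<subseteq> alg_series"
proof
  note S = subringE[OF etale_subring[OF assms]]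
  fix f assume f: "f \<in> B"
  then show "f \<in> alg_series"
    using S by (intro alg_seriesI[OF assms, of f \<one>]) auto
qed

text \<open>Composita bring finitely many series into one algebra, and the product of their
  denominators serves all of them.\<close>

lemma alg_series_common:
  assumes "set fs \<subseteq> alg_series"
  shows "\<exists>e B w. etale_at e B \<and> w \<in> B \<and> w 0 = \<one>\<^bsub>F\<^esub> \<and> (\<forall>f\<in>set fs. f \<otimes> w \<in> B)"
  using assms
proof (induction fs)
  case Nil
  then show ?case using etale_T subringE(3)[OF T_subring] by (intro exI[of _ \<one>] exI[of _ T]) simp
next
  case (Cons f fs)
  then obtain e B w where B: "etale_at e B" "w \<in> B" "w 0 = \<one>\<^bsub>F\<^esub>" "\<forall>f\<in>set fs. f \<otimes> w \<in> B" by auto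
  from Cons.prems obtain e' B' w' where B': "etale_at e' B'" "w' \<in> B'" "w' 0 = \<one>\<^bsub>F\<^esub>" "f \<otimes> w' \<in> B'"
    by (auto simp: alg_series_def)
  from etale_compositum[OF B(1) B'(1)] obtain e'' C where C: "etale_at e'' C" "B \<subseteq> C" "B' \<subseteq> C" by blast
  note SC = subringE[OF etale_subring[OF C(1)]]
  have wc: "w \<in> carrier P" "w' \<in> carrier P" using B B' C SC(1) by auto
  have fc: "g \<in> carrier P" if "g \<in> set (f # fs)" for g
    using Cons.prems that by (auto simp: alg_series_def)
  have 1: "g \<otimes> (w \<otimes> w') \<in> C" if "g \<in> set fs" for g
  proof -
    have "g \<otimes> (w \<otimes> w') = (g \<otimes> w) \<otimes> w'" using fc[of g] wc that by (simp add: m_assoc)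
    moreover have "g \<otimes> w \<in> C" "w' \<in> C" using B(4) B'(2) that C by blast+
    ultimately show ?thesis using SC(6) by simp
  qed
  have 2: "f \<otimes> (w \<otimes> w') \<in> C"
  proof -
    have "f \<otimes> (w \<otimes> w') = w \<otimes> (f \<otimes> w')" using fc[of f] wc by (simp add: m_lcomm)
    moreover have "w \<in> C" "f \<otimes> w' \<in> C" using B(2) B'(4) C by blast+
    ultimately show ?thesis using SC(6) by simp
  qed
  have "w \<in> C" "w' \<in> C" using B(2) B'(2) C by blast+
  then have "w \<otimes> w' \<in> C" by (rule SC(6))
  moreover have "(w \<otimes> w') 0 = \<one>\<^bsub>F\<^esub>" using B B' wc by simp
  ultimately have "w \<otimes> w' \<in> C" "(w \<otimes> w') 0 = \<one>\<^bsub>F\<^esub>" by simp_all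
  with C(1) 1 2 show ?case by auto
qed

lemma alg_series_subring: "subring alg_series P"
proof (rule subringI)
  show "alg_series \<subseteq> carrier P" by (auto simp: alg_series_def)
  show "\<one> \<in> alg_series" using etale_alg_series[OF etale_T] subringE(3)[OF T_subring] by auto
  show "\<ominus> f \<in> alg_series" if "f \<in> alg_series" for f
  proof -
    from that obtain e B w where B: "etale_at e B" "w \<in> B" "w 0 = \<one>\<^bsub>F\<^esub>" "f \<otimes> w \<in> B" "f \<in> carrier P"
      by (auto simp: alg_series_def)
    note S = subringE[OF etale_subring[OF B(1)]]
    have "\<ominus> f \<otimes> w = \<ominus> (f \<otimes> w)" using B S(1) by (auto simp: l_minus)
    moreover have "\<ominus> (f \<otimes> w) \<in> B" by (rule S(5)[OF B(4)])
    ultimately show ?thesis using B by (intro alg_seriesI[OF B(1) _ B(2,3)]) simp_all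
  qed
  fix f g assume fg: "f \<in> alg_series" "g \<in> alg_series"
  obtain e B w where B: "etale_at e B" "w \<in> B" "w 0 = \<one>\<^bsub>F\<^esub>" "f \<otimes> w \<in> B" "g \<otimes> w \<in> B"
    using alg_series_common[of "[f, g]"] fg by auto
  note S = subringE[OF etale_subring[OF B(1)]]
  have c: "f \<in> carrier P" "g \<in> carrier P" "w \<in> carrier P" using fg B S(1) by (auto simp: alg_series_def)
  have "(f \<oplus> g) \<otimes> w = f \<otimes> w \<oplus> g \<otimes> w" using c by (simp add: l_distr)
  then show "f \<oplus> g \<in> alg_series"
    using c S(7)[OF B(4,5)] by (intro alg_seriesI[OF B(1) _ B(2,3)]) simp_all
  have "(f \<otimes> g) \<otimes> (w \<otimes> w) = (f \<otimes> w) \<otimes> (g \<otimes> w)" using c by algebra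
  moreover have "w \<otimes> w \<in> B" "(w \<otimes> w) 0 = \<one>\<^bsub>F\<^esub>" "(f \<otimes> w) \<otimes> (g \<otimes> w) \<in> B" using B S(6) c by auto
  ultimately show "f \<otimes> g \<in> alg_series" using B(1) c unfolding alg_series_def by blast
qed

lemma alg_series_inverse:
  assumes f: "f \<in> alg_series" "f 0 \<noteq> \<zero>\<^bsub>F\<^esub>"
  obtains g where "g \<in> alg_series" "f \<otimes> g = \<one>"
proof -
  from f obtain e B w where B: "etale_at e B" "w \<in> B" "w 0 = \<one>\<^bsub>F\<^esub>" "f \<otimes> w \<in> B" "f \<in> carrier P"
    by (auto simp: alg_series_def)
  note S = subringE[OF etale_subring[OF B(1)]]
  obtain g where g: "g \<in> carrier P" "f \<otimes> g = \<one>" using unit_inverse[OF B(5) f(2)] .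
  have f0: "f 0 \<in> carrier F" and g0: "g 0 \<in> carrier F" using B g by auto
  have fg0: "f 0 \<otimes>\<^bsub>F\<^esub> g 0 = \<one>\<^bsub>F\<^esub>" using arg_cong[OF g(2), of "\<lambda>h. h 0"] B(5) g(1) by simp
  \<comment> \<open>This constant rescales the numerator of \<open>f\<close> to constant term 1, so
    that it can act as the denominator of the inverse.\<close>
  define c where "c = \<kappa> (g 0)"
  have c: "c \<in> B" "c \<in> carrier P" "c 0 = g 0"
    using const_T[OF g0] B(1) g0 by (auto simp: c_def etale_at_def)
  have wc: "w \<in> carrier P" using B S(1) by auto
  have "g \<otimes> (c \<otimes> (f \<otimes> w)) = c \<otimes> w \<otimes> (f \<otimes> g)" using g(1) c(2) B(5) wc by algebra
  also have "\<dots> = c \<otimes> w" using g(2) c(2) wc by simp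
  finally have 1: "g \<otimes> (c \<otimes> (f \<otimes> w)) = c \<otimes> w" .
  have "c \<otimes> (f \<otimes> w) \<in> B" "c \<otimes> w \<in> B" using S(6) B c by auto
  moreover have "(c \<otimes> (f \<otimes> w)) 0 = \<one>\<^bsub>F\<^esub>" using c B wc f0 g0 fg0 by (simp add: F.m_comm)
  ultimately have "g \<in> alg_series" using 1 B(1) g(1) unfolding alg_series_def by blast
  with g(2) show ?thesis by (rule that[rotated])
qed

text \<open>The equation for \<open>Y\<close> is not monic, but V = 1/Y satisfies V^(n+1) = V^n -
  sum of b_j V^(n-1-j), with n the length of \<open>bs\<close>. Passing to z = w V clears the
  denominator \<open>w\<close> and keeps the equation monic, in the shape required by
  \<open>etale_adjoin\<close>. Finally \<open>Y\<close> is the inverse of V.\<close>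

lemma fixpoint_alg_series:
  assumes bs: "set bs \<subseteq> {f \<in> alg_series. f 0 = \<zero>\<^bsub>F\<^esub>}"
    and Y: "Y \<in> carrier P" "Y 0 = \<one>\<^bsub>F\<^esub>" "Y = \<one> \<oplus> Y \<otimes> Y \<otimes> horner P bs Y"
  shows "Y \<in> alg_series"
proof (cases "bs = []")
  case True
  then have "Y = \<one>" using Y by simp
  then show ?thesis using subringE(3)[OF alg_series_subring] by simp
next
  case False
  obtain e B w where B: "etale_at e B" "w \<in> B" "w 0 = \<one>\<^bsub>F\<^esub>" "\<forall>b\<in>set bs. b \<otimes> w \<in> B"
    using alg_series_common[of bs] bs by auto
  note S = subringE[OF etale_subring[OF B(1)]]
  have wc: "w \<in> carrier P" using B S(1) by auto
  have bsc: "set bs \<subseteq> carrier P" using bs subringE(1)[OF alg_series_subring] by auto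
  obtain V where V: "V \<in> carrier P" "Y \<otimes> V = \<one>"
    using unit_inverse[OF Y(1)] Y(2) by auto
  have V0: "V 0 = \<one>\<^bsub>F\<^esub>" using arg_cong[OF V(2), of "\<lambda>h. h 0"] V(1) Y(1,2) by simp
  define z where "z = w \<otimes> V"
  have z: "z \<in> carrier P" "z 0 = \<one>\<^bsub>F\<^esub>" using wc V B(3) V0 by (simp_all add: z_def)
  define n where "n = length bs"
  define m where "m = {b \<in> B. b 0 = \<zero>\<^bsub>F\<^esub>}"
  define hs where "hs = map (\<lambda>i. z [^] i) [0..<Suc n]"
  have mc: "m \<subseteq> carrier P" using S(1) by (auto simp: m_def)
  have m0: "\<zero> \<in> m" using S(2) by (simp add: m_def)
  have hsc: "set hs \<subseteq> carrier P" using z by (auto simp: hs_def)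
  have madd: "x \<oplus> y \<in> m" if "x \<in> m" "y \<in> m" for x y
  proof -
    have "x \<in> carrier P" "y \<in> carrier P" using that mc by auto
    then show ?thesis using that S(7) by (auto simp: m_def)
  qed
  have mmult: "x \<otimes> y \<in> m" if "x \<in> B" "y \<in> m" for x y
  proof -
    have "x \<in> carrier P" "y \<in> carrier P" using that mc S(1) by auto
    then show ?thesis using that S(6) by (auto simp: m_def)
  qed
  have pow_hs: "z [^] i \<in> set hs" if "i \<le> n" for i
    using that unfolding hs_def set_map set_upt by (intro image_eqI[of _ _ i]) auto
  \<comment> \<open>Peeling off the leading entry b of \<open>cs\<close> and cancelling Y with one V
    leaves w (b w) z^(k+1) plus w times the instance for the tail; b w lies in
    \<open>m\<close>.\<close>
  have key: "w [^] Suc (Suc k) \<otimes> V [^] k \<otimes> horner P cs Y \<in> lin m hs"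
    if "length cs = Suc k" "set cs \<subseteq> set bs" "Suc k \<le> n" for k cs
    using that
  proof (induction k arbitrary: cs)
    case 0
    then obtain b where b: "cs = [b]" by (cases cs) auto
    have bc: "b \<in> carrier P" using 0 b bsc by auto
    have "b \<otimes> w \<in> m" using 0 b bs B bc wc by (auto simp: m_def)
    then have "w \<otimes> (b \<otimes> w) \<in> m" by (rule mmult[OF B(2)])
    from lin_gen[OF mc m0 hsc this pow_hs[of 0]]
    have "w \<otimes> (b \<otimes> w) \<otimes> \<one> \<in> lin m hs" by simp
    moreover have "w [^] Suc (Suc 0) \<otimes> V [^] (0::nat) \<otimes> horner P cs Y = w \<otimes> (b \<otimes> w) \<otimes> \<one>"
      using b bc wc Y(1) by (simp add: m_ac)
    ultimately show ?case by simp
  next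
    case (Suc k)
    then obtain b cs' where cs: "cs = b # cs'" "length cs' = Suc k" by (cases cs) auto
    have bc: "b \<in> carrier P" and csc: "set cs' \<subseteq> carrier P" using Suc.prems cs bsc by auto
    have hc: "horner P cs' Y \<in> carrier P" using csc Y(1) by simp
    have IH: "w [^] Suc (Suc k) \<otimes> V [^] k \<otimes> horner P cs' Y \<in> lin m hs"
      using Suc cs by auto
    have "b \<otimes> w \<in> m" using Suc.prems cs bs B bc wc by (auto simp: m_def)
    then have 1: "w \<otimes> (b \<otimes> w) \<in> m" by (rule mmult[OF B(2)])
    from lin_gen[OF mc m0 hsc 1 pow_hs[of "Suc k"]] Suc.prems have 2: "w \<otimes> (b \<otimes> w) \<otimes> z [^] Suc k \<in> lin m hs" by simp
    have 3: "w \<otimes> (w [^] Suc (Suc k) \<otimes> V [^] k \<otimes> horner P cs' Y) \<in> lin m hs"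
      by (rule lin_mult[OF mc wc _ hsc IH]) (rule mmult[OF B(2)])
    have W: "w [^] k \<in> carrier P" "V [^] k \<in> carrier P" using wc V by simp_all
    have zk: "z [^] k = w [^] k \<otimes> V [^] k" unfolding z_def using wc V(1) by (simp add: nat_pow_distrib)
    have gen: "W \<otimes> w \<otimes> w \<otimes> w \<otimes> (U \<otimes> V) \<otimes> (b \<oplus> Y \<otimes> H)
        = w \<otimes> (b \<otimes> w) \<otimes> ((W \<otimes> U) \<otimes> (w \<otimes> V)) \<oplus> w \<otimes> (W \<otimes> w \<otimes> w \<otimes> U \<otimes> H) \<otimes> (Y \<otimes> V)"
      if "W \<in> carrier P" "U \<in> carrier P" "H \<in> carrier P" for W U H
      using that wc V(1) Y(1) bc by algebra
    have "w [^] Suc (Suc (Suc k)) \<otimes> V [^] Suc k \<otimes> horner P cs Y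
        = w \<otimes> (b \<otimes> w) \<otimes> z [^] Suc k \<oplus> w \<otimes> (w [^] Suc (Suc k) \<otimes> V [^] k \<otimes> horner P cs' Y)"
      using gen[OF W hc] W hc wc V Y(1) bc by (simp add: cs(1) zk) (simp add: z_def)
    then show ?case using lin_add[OF mc madd hsc 2 3] by simp
  qed
  obtain k where k: "n = Suc k" using False by (cases n) (auto simp: n_def)
  define H where "H = horner P bs Y"
  have Hc: "H \<in> carrier P" using bsc Y(1) by (simp add: H_def)
  define u where "u = w [^] Suc (Suc k) \<otimes> V [^] k \<otimes> H"
  have u: "u \<in> lin m hs" using key[of bs k] k by (simp add: u_def H_def n_def)
  have uc: "u \<in> carrier P" using u lin_closed[OF mc hsc] by auto
  have v: "\<ominus> u \<in> lin m hs"
  proof -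
    have "\<ominus> \<one> \<otimes> u \<in> lin m hs"
      by (rule lin_mult[OF mc _ _ hsc u]) (use mmult S(3,5) in auto)
    then show ?thesis using uc by (simp add: l_minus)
  qed
  \<comment> \<open>This is the equation for \<open>Y\<close> multiplied by w^(n+1) V^(n+1).\<close>
  have "z [^] Suc n = w \<otimes> z [^] n \<oplus> \<ominus> u"
  proof -
    have W: "w [^] k \<in> carrier P" "V [^] k \<in> carrier P" using wc V by simp_all
    have zk: "z [^] k = w [^] k \<otimes> V [^] k" unfolding z_def using wc V(1) by (simp add: nat_pow_distrib)
    have gen: "w \<otimes> ((W \<otimes> U) \<otimes> (w \<otimes> V)) \<otimes> (Y \<otimes> V)
        = ((W \<otimes> U) \<otimes> (w \<otimes> V)) \<otimes> (w \<otimes> V) \<oplus> (W \<otimes> w \<otimes> w \<otimes> U \<otimes> H) \<otimes> (Y \<otimes> V) \<otimes> (Y \<otimes> V)"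
      if "W \<in> carrier P" "U \<in> carrier P" for W U
    proof -
      have "w \<otimes> ((W \<otimes> U) \<otimes> (w \<otimes> V)) \<otimes> ((\<one> \<oplus> Y \<otimes> Y \<otimes> H) \<otimes> V)
          = ((W \<otimes> U) \<otimes> (w \<otimes> V)) \<otimes> (w \<otimes> V) \<oplus> (W \<otimes> w \<otimes> w \<otimes> U \<otimes> H) \<otimes> (Y \<otimes> V) \<otimes> (Y \<otimes> V)"
        using that wc V(1) Y(1) Hc by algebra
      then show ?thesis using Y(3) by (simp add: H_def)
    qed
    have "w \<otimes> z [^] Suc k = z [^] Suc (Suc k) \<oplus> u"
      using gen[OF W] W Hc wc V by (simp add: zk u_def) (simp add: z_def)
    moreover have "z [^] Suc (Suc k) \<in> carrier P" using z by simp
    ultimately show ?thesis unfolding k using uc by (simp add: a_assoc r_neg del: nat_pow_Suc)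
  qed
  from etale_adjoin[OF B(1) z B(2,3) v[unfolded m_def hs_def] this]
  obtain e' C where C: "etale_at e' C" "B \<subseteq> C" "z \<in> C" by blast
  have "V \<otimes> w = z" using wc V by (simp add: z_def m_comm)
  then have VO: "V \<in> alg_series" using C B V(1) unfolding alg_series_def by blast
  obtain Z where Z: "Z \<in> alg_series" "V \<otimes> Z = \<one>"
    using alg_series_inverse[OF VO] V0 by auto
  have Zc: "Z \<in> carrier P" using Z subringE(1)[OF alg_series_subring] by auto
  have "Z = Y \<otimes> V \<otimes> Z" using V Zc by simp
  also have "\<dots> = Y \<otimes> (V \<otimes> Z)" by (rule m_assoc[OF Y(1) V(1) Zc])
  also have "\<dots> = Y" using Z(2) Y(1) by simp
  finally show ?thesis using Z by simp
qed

text \<open>After a Taylor shift at \<open>r\<close> the polynomial is c0 + c1 y + y^2 R(y) with c1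
  a unit and c0 vanishing at the origin. Substituting y = -(c0/c1) Y turns it into c0 times 1 - Y +
  (c0/c1^2) Y^2 R(-(c0/c1) Y), whose second factor is the normal form solved by
  \<open>ps_one_plus_fixpoint\<close>.\<close>

lemma alg_series_henselian:
  "henselian_subring P alg_series {f \<in> alg_series. f 0 = \<zero>\<^bsub>F\<^esub>}"
proof (intro henselian_subring.intro henselian_subring_axioms.intro)
  let ?m = "{f \<in> alg_series. f 0 = \<zero>\<^bsub>F\<^esub>}"
  note S = subringE[OF alg_series_subring]
  have Sc: "f \<in> carrier P" if "f \<in> alg_series" for f using that S(1) by auto
  show "cring P" by (rule is_cring)
  show "subring alg_series P" by (rule alg_series_subring)
  show "?m \<subseteq> alg_series" by auto
  show "\<zero> \<in> ?m" using S(2) by simp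
  show "\<one> \<notin> ?m" by simp
  show "x \<oplus> y \<in> ?m" if "x \<in> ?m" "y \<in> ?m" for x y
    using that S(7) Sc by auto
  show "x \<otimes> y \<in> ?m" if "x \<in> alg_series" "y \<in> ?m" for x y
    using that S(6) Sc by auto
  show "\<exists>y\<in>alg_series. x \<otimes> y = \<one>" if "x \<in> alg_series" "x \<notin> ?m" for x
    using alg_series_inverse[of x] that by blast
  show "\<exists>a\<in>alg_series. horner P cs a = \<zero> \<and> a \<ominus> r \<in> ?m"
    if cs: "set cs \<subseteq> alg_series" and r: "r \<in> alg_series" and h: "horner P cs r \<in> ?m" "dhorner P cs r \<notin> ?m" for cs r
  proof -
    from taylor_shift[OF alg_series_subring r cs] obtain ds where ds: "set ds \<subseteq> alg_series"
      "\<And>y. y \<in> carrier P \<Longrightarrow> horner P ds y = horner P cs (r \<oplus> y)"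
      "\<And>y. y \<in> carrier P \<Longrightarrow> dhorner P ds y = dhorner P cs (r \<oplus> y)" by blast
    have rc: "r \<in> carrier P" using Sc r by simp
    have h': "horner P ds \<zero> \<in> ?m" "dhorner P ds \<zero> \<notin> ?m"
      using h ds(2,3)[of \<zero>] rc by simp_all
    have "\<exists>c0 c1 rest. ds = c0 # c1 # rest"
      using h'(2) S(2) by (cases ds; cases "tl ds") auto
    then obtain c0 c1 rest where dseq: "ds = c0 # c1 # rest" by blast
    have cO: "c0 \<in> alg_series" "c1 \<in> alg_series" "set rest \<subseteq> alg_series" using ds(1) dseq by auto
    have restc: "set rest \<subseteq> carrier P" using cO S(1) by auto
    have cc: "c0 \<in> carrier P" "c1 \<in> carrier P" using cO Sc by auto
    have c00: "c0 0 = \<zero>\<^bsub>F\<^esub>" and c10: "c1 0 \<noteq> \<zero>\<^bsub>F\<^esub>"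
      using h' cc restc cO by (simp_all add: dseq)
    obtain i where i: "i \<in> alg_series" "c1 \<otimes> i = \<one>" using alg_series_inverse[OF cO(2) c10] .
    have ic: "i \<in> carrier P" using i Sc by simp
    \<comment> \<open>The approximate root given by the linear part; \<open>i\<close> is the inverse
      of \<open>c1\<close>.\<close>
    define q where "q = \<ominus> (c0 \<otimes> i)"
    have q: "q \<in> alg_series" using S(5,6) cO i by (simp add: q_def)
    have qc: "q \<in> carrier P" using q Sc by simp
    have q0: "q 0 = \<zero>\<^bsub>F\<^esub>" using cc ic c00 by (simp add: q_def)
    define a where "a = c0 \<otimes> i \<otimes> i"
    have aO: "a \<in> alg_series" using S(6) cO i by (simp add: a_def)
    have ac: "a \<in> carrier P" using aO Sc by simp
    have a0: "a 0 = \<zero>\<^bsub>F\<^esub>" using cc ic c00 by (simp add: a_def)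
    define rs where "rs = scale P q rest"
    have rs: "set rs \<subseteq> alg_series" unfolding rs_def by (rule scale_subset[OF alg_series_subring cO(3) q])
    have rsc: "set rs \<subseteq> carrier P" using rs S(1) by auto
    define bs where "bs = map (\<lambda>x. a \<otimes> x) rs"
    have bs: "set bs \<subseteq> ?m" using rs S(6) aO a0 ac rsc by (auto simp: bs_def subset_iff)
    then have bs': "set bs \<subseteq> {f \<in> carrier (PS F). f 0 = \<zero>\<^bsub>F\<^esub>}" using Sc by (auto simp: P_def)
    obtain Y where Y: "Y \<in> carrier P" "Y 0 = \<one>\<^bsub>F\<^esub>" "Y = \<one> \<oplus> Y \<otimes> Y \<otimes> horner P bs Y"
      using F.ps_one_plus_fixpoint[OF bs'] unfolding P_def by blast
    have YO: "Y \<in> alg_series" by (rule fixpoint_alg_series[OF bs Y])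
    let ?h = "horner P rs Y"
    have hc: "?h \<in> carrier P" using rsc Y by simp
    have bsY: "horner P bs Y = a \<otimes> ?h" unfolding bs_def by (rule horner_map_mult[OF rsc ac Y(1)])
    have Yeq: "Y = \<one> \<oplus> Y \<otimes> Y \<otimes> (a \<otimes> ?h)" using Y(3) unfolding bsY .
    have rest: "horner P rest (q \<otimes> Y) = ?h" unfolding rs_def by (rule horner_scale[OF restc qc Y(1), symmetric])
    have gen: "c0 \<oplus> (\<ominus> (c0 \<otimes> i) \<otimes> Y) \<otimes> (c1 \<oplus> (\<ominus> (c0 \<otimes> i) \<otimes> Y) \<otimes> h)
      = c0 \<otimes> (\<one> \<oplus> Y \<otimes> Y \<otimes> (c0 \<otimes> i \<otimes> i \<otimes> h) \<ominus> (c1 \<otimes> i) \<otimes> Y)" if "h \<in> carrier P" for h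
      using that cc ic Y(1) by algebra
    have "horner P ds (q \<otimes> Y) = c0 \<oplus> (q \<otimes> Y) \<otimes> (c1 \<oplus> (q \<otimes> Y) \<otimes> ?h)"
      unfolding dseq using rest by simp
    also have "\<dots> = c0 \<otimes> (\<one> \<oplus> Y \<otimes> Y \<otimes> (a \<otimes> ?h) \<ominus> (c1 \<otimes> i) \<otimes> Y)"
      unfolding q_def a_def by (rule gen[OF hc])
    also have "\<dots> = c0 \<otimes> (Y \<ominus> Y)" unfolding Yeq[symmetric] i(2) using Y(1) by simp
    also have "\<dots> = \<zero>" using Y(1) cc by (simp add: a_minus_def r_neg)
    finally have root: "horner P cs (r \<oplus> q \<otimes> Y) = \<zero>" using ds(2)[of "q \<otimes> Y"] qc Y(1) by simp
    have qY: "q \<otimes> Y \<in> ?m" using S(6)[OF q YO] qc Y(1) q0 Y(2) by simp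
    have "r \<oplus> q \<otimes> Y \<ominus> r = q \<otimes> Y" using rc qc Y(1) by algebra
    with root qY S(7) r show ?thesis by (intro bexI[of _ "r \<oplus> q \<otimes> Y"]) auto
  qed
qed

end

section \<open>Points on plane curves over a large field\<close>

context UP_domain
begin

lemma finite_roots:
  assumes "f \<in> carrier P" "f \<noteq> \<zero>\<^bsub>P\<^esub>"
  shows "finite {a \<in> carrier R. eval R R id a f = \<zero>}"
  using assms
proof (induction "deg R f" arbitrary: f rule: less_induct)
  case less
  interpret UP_pre_univ_prop R R id P by standard simp
  show ?case
  proof (cases "\<exists>a\<in>carrier R. eval R R id a f = \<zero>")
    case True
    then obtain a where a: "a \<in> carrier R" "eval R R id a f = \<zero>" by blast
    have nt: "carrier R \<noteq> {\<zero>}" by (metis R.one_zeroI R.zero_not_one)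
    let ?g = "monom P \<one> 1 \<ominus>\<^bsub>P\<^esub> monom P a 0"
    obtain q where q: "q \<in> carrier P" "f = ?g \<otimes>\<^bsub>P\<^esub> q \<oplus>\<^bsub>P\<^esub> monom P (eval R R id a f) 0"
      using remainder_theorem[OF less.prems(1) a(1) nt] by auto
    have g: "?g \<in> carrier P" using a by simp
    have f: "f = ?g \<otimes>\<^bsub>P\<^esub> q" using q g a(2) by simp
    have g_deg: "deg R ?g = 1" by (rule deg_minus_monom[OF a(1) nt])
    have nz: "?g \<noteq> \<zero>\<^bsub>P\<^esub>" "q \<noteq> \<zero>\<^bsub>P\<^esub>" using less.prems(2) f g q(1) by auto
    have "deg R f = Suc (deg R q)" using deg_mult[OF nz g q(1)] f g_deg by simp
    then have "finite {a \<in> carrier R. eval R R id a q = \<zero>}" using less.hyps[of q] q(1) nz by simp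
    moreover have "{b \<in> carrier R. eval R R id b f = \<zero>} \<subseteq> insert a {b \<in> carrier R. eval R R id b q = \<zero>}"
    proof (rule subsetI, rule ccontr)
      fix b assume "b \<in> {b \<in> carrier R. eval R R id b f = \<zero>}"
        and nb: "b \<notin> insert a {b \<in> carrier R. eval R R id b q = \<zero>}"
      then have b: "b \<in> carrier R" "eval R R id b f = \<zero>" "eval R R id b q \<noteq> \<zero>" by auto
      have "eval R R id b f = (b \<ominus> a) \<otimes> eval R R id b q"
        unfolding f using b a q(1) by (simp add: evalRR_simps)
      then have "(b \<ominus> a) \<otimes> eval R R id b q = \<zero>" using b(2) by simp
      then have "b \<ominus> a = \<zero>"
        using R.integral[OF _ R.minus_closed[OF b(1) a(1)] ring_hom_closed[OF eval_ring_hom[OF b(1)] q(1)]] b(3)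
        by blast
      then show False using a b nb by simp
    qed
    ultimately show ?thesis using finite_subset by blast
  next
    case False
    then have "{a \<in> carrier R. eval R R id a f = \<zero>} = {}" by blast
    then show ?thesis by (simp only: finite.emptyI)
  qed
qed

text \<open>Division in the second variable works over F[X] only up to a nonzero factor
  \<open>c\<close> in F[X]. The roots of such factors become the finitely many excluded
  abscissas.\<close>

lemma pseudo_division:
  assumes g: "g \<in> carrier P" "g \<noteq> \<zero>\<^bsub>P\<^esub>" and f: "f \<in> carrier P"
  obtains q r c where "q \<in> carrier P" "r \<in> carrier P" "c \<in> carrier R" "c \<noteq> \<zero>"
    "monom P c 0 \<otimes>\<^bsub>P\<^esub> f = g \<otimes>\<^bsub>P\<^esub> q \<oplus>\<^bsub>P\<^esub> r" "r = \<zero>\<^bsub>P\<^esub> \<or> deg R r < deg R g"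
proof -
  obtain q r k where *: "q \<in> carrier P" "r \<in> carrier P"
    "lcoeff g [^] (k::nat) \<odot>\<^bsub>P\<^esub> f = g \<otimes>\<^bsub>P\<^esub> q \<oplus>\<^bsub>P\<^esub> r" "r = \<zero>\<^bsub>P\<^esub> \<or> deg R r < deg R g"
    using long_div_theorem[OF g(1) f g(2)] by blast
  have lc: "lcoeff g \<in> carrier R" using g(1) by simp
  have "lcoeff g [^] k \<noteq> \<zero>" using lcoeff_nonzero2[OF g] lc by (induction k) (auto simp: R.integral_iff)
  moreover have "lcoeff g [^] k \<in> carrier R" using lc by simp
  ultimately show ?thesis using that[OF *(1,2) _ _ _ *(4)] *(3) f by (simp add: monom_mult_is_smult)
qed

lemma coeff_eq: "p \<in> carrier P \<Longrightarrow> coeff P p i = p i"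
  by (simp add: P_def UP_def)

end

section \<open>Bivariate polynomials evaluated at a pair of series\<close>

locale plane_param = power_series +
  fixes x
  assumes x: "x \<in> carrier P" "x 0 = \<zero>\<^bsub>F\<^esub>"
begin

abbreviation "V \<equiv> UP F"
abbreviation "W \<equiv> UP (UP F)"
abbreviation "C c \<equiv> monom W c 0"

definition subst :: "(nat \<Rightarrow> nat \<Rightarrow> 'a) \<Rightarrow> nat \<Rightarrow> 'a" where
  "subst = UnivPoly.eval V P id x"

sublocale V: UP_domain F V
  by (intro UP_domain.intro F.domain_axioms) simp_all

sublocale W: UP_domain V W
  by (intro UP_domain.intro V.domain_axioms) simp_all

sublocale S: UP_pre_univ_prop V P id W
  by (intro UP_pre_univ_prop.intro T_hom UP_cring.intro V.cring_axioms) simp_all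

sublocale s: ring_hom_cring W P subst
  unfolding subst_def
  by (intro ring_hom_cringI W.cring_axioms is_cring S.eval_ring_hom x)

lemma subst_C [simp]: "c \<in> carrier V \<Longrightarrow> subst (C c) = c"
  using S.eval_const[OF x(1), of c] by (simp add: subst_def)

lemma coeff_V: "p \<in> carrier V \<Longrightarrow> p i \<in> carrier F"
  by (auto simp: UP_def)

lemma coeff_W: "Q \<in> carrier W \<Longrightarrow> Q i \<in> carrier V"
  using W.coeff_closed[of Q i] W.coeff_eq[of Q i] by simp

lemma V_zero [simp]: "\<zero>\<^bsub>V\<^esub> i = \<zero>\<^bsub>F\<^esub>"
  by (simp add: UP_def)

lemma V_zero_eq: "\<zero>\<^bsub>V\<^esub> = \<zero>"
  using T_hom ring_hom_cring.hom_zero by fastforce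

lemma const_coeff_hom: "ring_hom_cring V F (\<lambda>p. p 0)"
proof (intro ring_hom_cringI V.cring_axioms F.cring_axioms ring_hom_memI)
  fix p q assume pq: "p \<in> carrier V" "q \<in> carrier V"
  show "p 0 \<in> carrier F" using coeff_V pq by blast
  show "(p \<otimes>\<^bsub>V\<^esub> q) 0 = p 0 \<otimes>\<^bsub>F\<^esub> q 0"
    using F.PS_mult_UP[OF pq, symmetric] F.ps_mult_0[of p q] pq T_subset by (auto simp: P_def)
  show "(p \<oplus>\<^bsub>V\<^esub> q) 0 = p 0 \<oplus>\<^bsub>F\<^esub> q 0" using pq by (simp add: UP_def)
next
  show "\<one>\<^bsub>V\<^esub> 0 = \<one>\<^bsub>F\<^esub>" by (simp add: UP_def)
qed

sublocale k: ring_hom_cring V F "\<lambda>p. p 0"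
  by (rule const_coeff_hom)

text \<open>Both X and \<open>x\<close> vanish at the origin, so only the coefficient of degree
  (0,0) survives.\<close>

lemma residue_subst:
  assumes Q: "Q \<in> carrier W"
  shows "subst Q 0 = Q 0 0"
proof -
  obtain n where n: "\<And>i. i \<ge> n \<Longrightarrow> Q i = \<zero>\<^bsub>V\<^esub>"
    using UP_cring.coeffs_obtain[OF W.is_UP_cring Q] by metis
  have "subst Q = horner P (map (\<lambda>i. id (Q i)) [0..<Suc n]) x"
    unfolding subst_def by (rule S.eval_horner[OF Q x(1)]) (use n in auto)
  also have "\<dots> = horner P (map Q [0..<Suc n]) x" by simp
  finally have eq: "subst Q = horner P (map Q [0..<Suc n]) x" .
  have Qc: "set (map Q [0..<Suc n]) \<subseteq> carrier P" using coeff_W[OF Q] T_subset by auto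
  have "subst Q 0 = horner F (map (\<lambda>f. f 0) (map Q [0..<Suc n])) (x 0)"
    unfolding eq by (rule res.hom_horner[OF Qc x(1)])
  also have "map (\<lambda>f. f 0) (map Q [0..<Suc n]) = Q 0 0 # map (\<lambda>i. Q (Suc i) 0) [0..<n]"
    by (simp only: upt_conv_Cons[OF zero_less_Suc] list.map map_map o_def map_Suc_upt[symmetric])
  also have "horner F \<dots> (x 0) = Q 0 0"
    using coeff_W[OF Q, THEN coeff_V] by (simp add: x(2) image_subset_iff)
  finally show ?thesis .
qed

lemma up_eval_zero:
  assumes pV: "p \<in> carrier V"
  shows "up_eval F \<zero>\<^bsub>F\<^esub> p = p 0"
proof -
  obtain n where n: "\<And>i. i \<ge> n \<Longrightarrow> p i = \<zero>\<^bsub>F\<^esub>"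
    using UP_cring.coeffs_obtain[OF V.is_UP_cring pV] by metis
  have "up_eval F \<zero>\<^bsub>F\<^esub> p = horner F (map p [0..<Suc n]) \<zero>\<^bsub>F\<^esub>"
    by (rule F.up_eval_horner(1)[OF pV]) (use n in auto)
  also have "map p [0..<Suc n] = p 0 # map p [Suc 0..<Suc n]"
    by (simp only: upt_conv_Cons[OF zero_less_Suc] list.map)
  also have "horner F \<dots> \<zero>\<^bsub>F\<^esub> = p 0"
    using coeff_V[OF pV] F.horner_closed[of "map p [Suc 0..<Suc n]" "\<zero>\<^bsub>F\<^esub>"]
    by (simp add: image_subset_iff del: upt_Suc)
  finally show ?thesis .
qed

lemma W_mult_coeff:
  assumes f: "f \<in> carrier W" and g: "g \<in> carrier W"
  shows "(f \<otimes>\<^bsub>W\<^esub> g) n = (\<Oplus>\<^bsub>V\<^esub>i\<in>{..n}. f i \<otimes>\<^bsub>V\<^esub> g (n - i))"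
  using W.coeff_mult[OF f g, of n]
  by (simp only: W.coeff_eq[OF f] W.coeff_eq[OF g] W.coeff_eq[OF W.UP_mult_closed[OF f g]])

lemma C_mult_coeff:
  assumes c: "c \<in> carrier V" and f: "f \<in> carrier W"
  shows "(C c \<otimes>\<^bsub>W\<^esub> f) n = c \<otimes>\<^bsub>V\<^esub> f n"
  unfolding W.monom_mult_is_smult[OF c f]
  using W.coeff_smult[OF c f, of n]
  by (simp only: W.coeff_eq[OF f] W.coeff_eq[OF W.UP_smult_closed[OF c f]])

lemma W_mult_coeff1:
  assumes f: "f \<in> carrier W" and g: "g \<in> carrier W"
  shows "(f \<otimes>\<^bsub>W\<^esub> g) 1 0 = f 0 0 \<otimes>\<^bsub>F\<^esub> g 1 0 \<oplus>\<^bsub>F\<^esub> f 1 0 \<otimes>\<^bsub>F\<^esub> g 0 0"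
proof -
  have c: "f i \<in> carrier V" "g i \<in> carrier V" for i using coeff_W f g by auto
  have "{..1::nat} = {0, 1}" by auto
  then have "(f \<otimes>\<^bsub>W\<^esub> g) 1 = f 0 \<otimes>\<^bsub>V\<^esub> g 1 \<oplus>\<^bsub>V\<^esub> f 1 \<otimes>\<^bsub>V\<^esub> g 0"
    unfolding W_mult_coeff[OF f g] using c by simp
  then show ?thesis using c coeff_V by simp
qed

lemma C_coeff: "c \<in> carrier V \<Longrightarrow> C c i = (if i = 0 then c else \<zero>\<^bsub>V\<^esub>)"
  using W.coeff_eq[of "C c" i] by (simp add: W.coeff_monom)

text \<open>The linear polynomial X - a. It divides every coefficient of a bivariate polynomial
  exactly when the curve contains the vertical line over \<open>a\<close>.\<close>

definition content_at :: "'a \<Rightarrow> nat \<Rightarrow> 'a" where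
  "content_at a = monom V \<one>\<^bsub>F\<^esub> 1 \<ominus>\<^bsub>V\<^esub> monom V a 0"

lemma F_nontrivial: "carrier F \<noteq> {\<zero>\<^bsub>F\<^esub>}"
  by (metis F.one_closed F.one_not_zero singletonD)

lemma content_at:
  assumes "a \<in> carrier F"
  shows "content_at a \<in> carrier V" "deg F (content_at a) = 1" "content_at a \<noteq> \<zero>\<^bsub>V\<^esub>"
proof -
  show "content_at a \<in> carrier V" using assms by (simp add: content_at_def)
  show "deg F (content_at a) = 1"
    unfolding content_at_def by (rule V.deg_minus_monom[OF assms F_nontrivial])
  then show "content_at a \<noteq> \<zero>\<^bsub>V\<^esub>" using V.deg_zero by auto
qed

lemma divide_content:
  assumes a: "a \<in> carrier F" and Q: "Q \<in> carrier W" and z: "\<And>i. up_eval F a (Q i) = \<zero>\<^bsub>F\<^esub>"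
  obtains Q' where "Q' \<in> carrier W" "Q = C (content_at a) \<otimes>\<^bsub>W\<^esub> Q'"
proof -
  have "\<exists>q\<in>carrier V. Q i = content_at a \<otimes>\<^bsub>V\<^esub> q" for i
    using V.remainder_theorem[OF coeff_W[OF Q] a F_nontrivial, of i] z[of i] content_at(1)[OF a]
    by (auto simp: content_at_def up_eval_def)
  then obtain q where q: "\<And>i. q i \<in> carrier V" "\<And>i. Q i = content_at a \<otimes>\<^bsub>V\<^esub> q i" by metis
  obtain n where n: "bound \<zero>\<^bsub>V\<^esub> n Q" using Q by (auto simp: UP_def[of V] up_def)
  have "q i = \<zero>\<^bsub>V\<^esub>" if "Q i = \<zero>\<^bsub>V\<^esub>" for i
    using q that content_at(1,3)[OF a] V.integral_iff by metis
  then have "bound \<zero>\<^bsub>V\<^esub> n q" using n by (auto simp: bound_def)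
  then have qW: "q \<in> carrier W" using q(1) by (auto simp: UP_def[of V] intro!: mem_upI)
  moreover have "Q = C (content_at a) \<otimes>\<^bsub>W\<^esub> q"
  proof
    fix i
    show "Q i = (C (content_at a) \<otimes>\<^bsub>W\<^esub> q) i"
      using C_mult_coeff[OF content_at(1)[OF a] qW] q(2) by simp
  qed
  ultimately show ?thesis by (rule that)
qed

definition rels :: "(nat \<Rightarrow> nat \<Rightarrow> 'a) set" where
  "rels = {Q \<in> carrier W. subst Q = \<zero>}"

text \<open>The kernel of \<open>subst\<close> is prime because power series form a domain.\<close>

lemma rels_mult_iff:
  "f \<in> carrier W \<Longrightarrow> g \<in> carrier W \<Longrightarrow> f \<otimes>\<^bsub>W\<^esub> g \<in> rels \<longleftrightarrow> f \<in> rels \<or> g \<in> rels"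
  by (auto simp: rels_def integral_iff)

lemma C_rels: "c \<in> carrier V \<Longrightarrow> C c \<in> rels \<longleftrightarrow> c = \<zero>\<^bsub>V\<^esub>"
  by (auto simp: rels_def V_zero_eq)

lemma C_nonzero: "c \<in> carrier V \<Longrightarrow> c \<noteq> \<zero>\<^bsub>V\<^esub> \<Longrightarrow> C c \<noteq> \<zero>\<^bsub>W\<^esub>"
proof
  assume c: "c \<in> carrier V" "c \<noteq> \<zero>\<^bsub>V\<^esub>" and z: "C c = \<zero>\<^bsub>W\<^esub>"
  have "C c 0 = \<zero>\<^bsub>V\<^esub>" unfolding z by (simp add: UP_def[of V])
  then show False using C_coeff[OF c(1), of 0] c(2) by simp
qed

lemma eval2_C:
  assumes "a \<in> carrier F" "b \<in> carrier F" "c \<in> carrier V"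
  shows "eval2 F a b (C c) = up_eval F a c"
  unfolding eval2_def
  by (rule UP_pre_univ_prop.eval_const[OF F.UP_pre_univ_prop_up_eval[OF assms(1)] assms(2,3)])

lemma content_finite:
  assumes "c \<in> carrier V" "c \<noteq> \<zero>\<^bsub>V\<^esub>"
  shows "finite {a \<in> carrier F. up_eval F a c = \<zero>\<^bsub>F\<^esub>}"
  using V.finite_roots[OF assms] by (simp add: up_eval_def)

end

text \<open>
  The variables of the bivariate polynomials in \<open>UP (UP F)\<close> are mapped to the power series
  \<open>X\<close> and \<open>x\<close>; the relation \<open>h\<close> says that \<open>x\<close> is a regular branch at the origin.
\<close>

locale plane_branch = plane_param +
  fixes h
  assumes h: "h \<in> carrier W" "subst h = \<zero>" "h 1 0 \<noteq> \<zero>\<^bsub>F\<^esub>"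
begin

text \<open>A double minimum replaces Gauss's lemma: first the degree in the second variable, then
  the degree of the leading coefficient. If X - a divided all coefficients, the quotient would still
  be a relation of the same outer degree, but with a leading coefficient of smaller degree.\<close>

lemma minimal_relation:
  obtains \<rho> where "\<rho> \<in> rels" "\<rho> \<noteq> \<zero>\<^bsub>W\<^esub>"
    "\<And>Q. Q \<in> rels \<Longrightarrow> Q \<noteq> \<zero>\<^bsub>W\<^esub> \<Longrightarrow> deg V \<rho> \<le> deg V Q"
    "\<And>a. a \<in> carrier F \<Longrightarrow> \<exists>i. up_eval F a (\<rho> i) \<noteq> \<zero>\<^bsub>F\<^esub>"
proof -
  have hr: "h \<in> rels" "h \<noteq> \<zero>\<^bsub>W\<^esub>"
    using h by (auto simp: rels_def subst_def UP_def[of V])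
  define A where "A = {Q \<in> rels. Q \<noteq> \<zero>\<^bsub>W\<^esub> \<and> (\<forall>Q'\<in>rels. Q' \<noteq> \<zero>\<^bsub>W\<^esub> \<longrightarrow> deg V Q \<le> deg V Q')}"
  have "\<exists>Q. Q \<in> A"
    using ex_has_least_nat[of "\<lambda>Q. Q \<in> rels \<and> Q \<noteq> \<zero>\<^bsub>W\<^esub>" h "deg V"] hr by (auto simp: A_def)
  then obtain \<rho> where \<rho>: "\<rho> \<in> A" "\<And>Q. Q \<in> A \<Longrightarrow> deg F (coeff W \<rho> (deg V \<rho>)) \<le> deg F (coeff W Q (deg V Q))"
    using ex_has_least_nat[of "\<lambda>Q. Q \<in> A" _ "\<lambda>Q. deg F (coeff W Q (deg V Q))"] by blast
  show ?thesis
  proof (rule that)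
    show "\<rho> \<in> rels" "\<rho> \<noteq> \<zero>\<^bsub>W\<^esub>" "\<And>Q. Q \<in> rels \<Longrightarrow> Q \<noteq> \<zero>\<^bsub>W\<^esub> \<Longrightarrow> deg V \<rho> \<le> deg V Q"
      using \<rho>(1) by (auto simp: A_def)
    fix a assume a: "a \<in> carrier F"
    show "\<exists>i. up_eval F a (\<rho> i) \<noteq> \<zero>\<^bsub>F\<^esub>"
    proof (rule ccontr)
      assume "\<not> (\<exists>i. up_eval F a (\<rho> i) \<noteq> \<zero>\<^bsub>F\<^esub>)"
      then obtain Q where Q: "Q \<in> carrier W" "\<rho> = C (content_at a) \<otimes>\<^bsub>W\<^esub> Q"
        using divide_content[OF a, of \<rho>] \<rho>(1) by (auto simp: A_def rels_def)
      note c = content_at[OF a]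
      have Cn: "C (content_at a) \<noteq> \<zero>\<^bsub>W\<^esub>" by (rule C_nonzero[OF c(1,3)])
      have Qn: "Q \<noteq> \<zero>\<^bsub>W\<^esub>" using \<rho>(1) Q c(1) by (auto simp: A_def)
      have Qr: "Q \<in> rels" using \<rho>(1) Q c rels_mult_iff[of "C (content_at a)" Q] C_rels by (auto simp: A_def)
      have d: "deg V \<rho> = deg V Q" using W.deg_mult[OF Cn Qn] Q c by simp
      have "Q \<in> A" using \<rho>(1) Qr Qn d by (auto simp: A_def)
      moreover have "coeff W \<rho> (deg V \<rho>) = content_at a \<otimes>\<^bsub>V\<^esub> coeff W Q (deg V Q)"
        unfolding d using Q c by (simp add: W.monom_mult_is_smult)
      moreover have "coeff W Q (deg V Q) \<noteq> \<zero>\<^bsub>V\<^esub>" by (rule W.lcoeff_nonzero2[OF Q(1) Qn])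
      ultimately have "deg F (coeff W \<rho> (deg V \<rho>)) = Suc (deg F (coeff W Q (deg V Q)))"
        using V.deg_mult[OF c(3) _ c(1), of "coeff W Q (deg V Q)"] Q c(2) by simp
      with \<rho>(2)[OF \<open>Q \<in> A\<close>] show False by simp
    qed
  qed
qed

context
  fixes \<rho>
  assumes \<rho>: "\<rho> \<in> rels" "\<rho> \<noteq> \<zero>\<^bsub>W\<^esub>"
    "\<And>Q. Q \<in> rels \<Longrightarrow> Q \<noteq> \<zero>\<^bsub>W\<^esub> \<Longrightarrow> deg V \<rho> \<le> deg V Q"
    "\<And>a. a \<in> carrier F \<Longrightarrow> \<exists>i. up_eval F a (\<rho> i) \<noteq> \<zero>\<^bsub>F\<^esub>"
begin

lemma \<rho>W: "\<rho> \<in> carrier W"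
  using \<rho>(1) by (simp add: rels_def)

text \<open>The pseudo-remainder is again a relation, of smaller degree than \<rho>, hence
  zero.\<close>

lemma rels_divisible:
  assumes Q: "Q \<in> rels"
  obtains c q where "c \<in> carrier V" "c \<noteq> \<zero>\<^bsub>V\<^esub>" "q \<in> carrier W" "C c \<otimes>\<^bsub>W\<^esub> Q = \<rho> \<otimes>\<^bsub>W\<^esub> q"
proof -
  have QW: "Q \<in> carrier W" "subst Q = \<zero>" using Q by (auto simp: rels_def)
  obtain q r c where *: "q \<in> carrier W" "r \<in> carrier W" "c \<in> carrier V" "c \<noteq> \<zero>\<^bsub>V\<^esub>"
    "C c \<otimes>\<^bsub>W\<^esub> Q = \<rho> \<otimes>\<^bsub>W\<^esub> q \<oplus>\<^bsub>W\<^esub> r" "r = \<zero>\<^bsub>W\<^esub> \<or> deg V r < deg V \<rho>"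
    using W.pseudo_division[OF \<rho>W \<rho>(2) QW(1)] by blast
  have "subst (\<rho> \<otimes>\<^bsub>W\<^esub> q \<oplus>\<^bsub>W\<^esub> r) = subst r" using *(1,2) \<rho>W \<rho>(1) by (simp add: rels_def)
  moreover have "subst (C c \<otimes>\<^bsub>W\<^esub> Q) = \<zero>" using *(3) QW T_subset by auto
  ultimately have "r \<in> rels" using *(2,5) by (simp add: rels_def)
  then have "r = \<zero>\<^bsub>W\<^esub>" using *(6) \<rho>(3)[of r] by (metis leD)
  then show ?thesis using * \<rho>W by (intro that[of c q]) auto
qed

text \<open>Bezout over F(X) with denominators cleared. An element \<delta> of least degree in the
  ideal generated by \<open>d\<close> and \<rho> divides both up to factors from F[X]. As \<delta>
  is not a relation, its cofactor in \<rho> is one and has at least the degree of \<rho>; so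
  \<delta> has degree 0.\<close>

lemma non_rels_coprime:
  assumes d: "d \<in> carrier W" "d \<notin> rels"
  obtains c p q where "c \<in> carrier V" "c \<noteq> \<zero>\<^bsub>V\<^esub>" "p \<in> carrier W" "q \<in> carrier W"
    "C c = d \<otimes>\<^bsub>W\<^esub> p \<oplus>\<^bsub>W\<^esub> \<rho> \<otimes>\<^bsub>W\<^esub> q"
proof -
  define J where "J = {d \<otimes>\<^bsub>W\<^esub> p \<oplus>\<^bsub>W\<^esub> \<rho> \<otimes>\<^bsub>W\<^esub> q | p q. p \<in> carrier W \<and> q \<in> carrier W}"
  have JW: "f \<in> carrier W" if "f \<in> J" for f using that d \<rho>W by (auto simp: J_def)
  have Jsub: "f \<ominus>\<^bsub>W\<^esub> g \<otimes>\<^bsub>W\<^esub> k \<in> J" if "f \<in> J" "g \<in> J" and k: "k \<in> carrier W" for f g k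
  proof -
    obtain p q p' q' where f: "f = d \<otimes>\<^bsub>W\<^esub> p \<oplus>\<^bsub>W\<^esub> \<rho> \<otimes>\<^bsub>W\<^esub> q" "p \<in> carrier W" "q \<in> carrier W"
      and g: "g = d \<otimes>\<^bsub>W\<^esub> p' \<oplus>\<^bsub>W\<^esub> \<rho> \<otimes>\<^bsub>W\<^esub> q'" "p' \<in> carrier W" "q' \<in> carrier W"
      using \<open>f \<in> J\<close> \<open>g \<in> J\<close> by (auto simp: J_def)
    have "f \<ominus>\<^bsub>W\<^esub> g \<otimes>\<^bsub>W\<^esub> k = d \<otimes>\<^bsub>W\<^esub> (p \<ominus>\<^bsub>W\<^esub> p' \<otimes>\<^bsub>W\<^esub> k) \<oplus>\<^bsub>W\<^esub> \<rho> \<otimes>\<^bsub>W\<^esub> (q \<ominus>\<^bsub>W\<^esub> q' \<otimes>\<^bsub>W\<^esub> k)"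
      unfolding f(1) g(1) using f(2,3) g(2,3) k d(1) \<rho>W by algebra
    then show ?thesis using f(2,3) g(2,3) k unfolding J_def by blast
  qed
  have CJ: "C c \<otimes>\<^bsub>W\<^esub> f \<in> J" if "f \<in> J" and c: "c \<in> carrier V" for f c
  proof -
    obtain p q where f: "f = d \<otimes>\<^bsub>W\<^esub> p \<oplus>\<^bsub>W\<^esub> \<rho> \<otimes>\<^bsub>W\<^esub> q" "p \<in> carrier W" "q \<in> carrier W"
      using \<open>f \<in> J\<close> by (auto simp: J_def)
    have "C c \<otimes>\<^bsub>W\<^esub> f = d \<otimes>\<^bsub>W\<^esub> (C c \<otimes>\<^bsub>W\<^esub> p) \<oplus>\<^bsub>W\<^esub> \<rho> \<otimes>\<^bsub>W\<^esub> (C c \<otimes>\<^bsub>W\<^esub> q)"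
      unfolding f(1) using f(2,3) c d(1) \<rho>W by (simp add: W.P.r_distr W.P.m_lcomm)
    moreover have "C c \<otimes>\<^bsub>W\<^esub> p \<in> carrier W" "C c \<otimes>\<^bsub>W\<^esub> q \<in> carrier W" using f(2,3) c by simp_all
    ultimately show ?thesis unfolding J_def by blast
  qed
  have dJ: "d \<in> J"
  proof -
    have "d = d \<otimes>\<^bsub>W\<^esub> \<one>\<^bsub>W\<^esub> \<oplus>\<^bsub>W\<^esub> \<rho> \<otimes>\<^bsub>W\<^esub> \<zero>\<^bsub>W\<^esub>" using d \<rho>W by simp
    then show ?thesis unfolding J_def by blast
  qed
  have \<rho>J: "\<rho> \<in> J"
  proof -
    have "\<rho> = d \<otimes>\<^bsub>W\<^esub> \<zero>\<^bsub>W\<^esub> \<oplus>\<^bsub>W\<^esub> \<rho> \<otimes>\<^bsub>W\<^esub> \<one>\<^bsub>W\<^esub>" using d \<rho>W by simp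
    then show ?thesis unfolding J_def by blast
  qed
  obtain \<delta> where \<delta>: "\<delta> \<in> J" "\<delta> \<noteq> \<zero>\<^bsub>W\<^esub>" "\<And>f. f \<in> J \<Longrightarrow> f \<noteq> \<zero>\<^bsub>W\<^esub> \<Longrightarrow> deg V \<delta> \<le> deg V f"
    using ex_has_least_nat[of "\<lambda>f. f \<in> J \<and> f \<noteq> \<zero>\<^bsub>W\<^esub>" \<rho> "deg V"] \<rho>J \<rho>(2) by blast
  note \<delta>W = JW[OF \<delta>(1)]
  have div: "\<exists>c q. c \<in> carrier V \<and> c \<noteq> \<zero>\<^bsub>V\<^esub> \<and> q \<in> carrier W \<and> C c \<otimes>\<^bsub>W\<^esub> f = \<delta> \<otimes>\<^bsub>W\<^esub> q" if f: "f \<in> J" for f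
  proof -
    obtain q r c where *: "q \<in> carrier W" "r \<in> carrier W" "c \<in> carrier V" "c \<noteq> \<zero>\<^bsub>V\<^esub>"
      "C c \<otimes>\<^bsub>W\<^esub> f = \<delta> \<otimes>\<^bsub>W\<^esub> q \<oplus>\<^bsub>W\<^esub> r" "r = \<zero>\<^bsub>W\<^esub> \<or> deg V r < deg V \<delta>"
      using W.pseudo_division[OF \<delta>W \<delta>(2) JW[OF f]] by blast
    have "r = C c \<otimes>\<^bsub>W\<^esub> f \<ominus>\<^bsub>W\<^esub> \<delta> \<otimes>\<^bsub>W\<^esub> q" unfolding *(5) using *(1,2) \<delta>W by algebra
    then have "r \<in> J" using Jsub[OF CJ[OF f *(3)] \<delta>(1) *(1)] by simp
    then have "r = \<zero>\<^bsub>W\<^esub>" using \<delta>(3)[of r] *(6) by (metis leD)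
    then show ?thesis using * \<delta>W by auto
  qed
  obtain c1 q1 where 1: "c1 \<in> carrier V" "c1 \<noteq> \<zero>\<^bsub>V\<^esub>" "q1 \<in> carrier W" "C c1 \<otimes>\<^bsub>W\<^esub> \<rho> = \<delta> \<otimes>\<^bsub>W\<^esub> q1"
    using div[OF \<rho>J] by blast
  obtain c2 q2 where 2: "c2 \<in> carrier V" "c2 \<noteq> \<zero>\<^bsub>V\<^esub>" "q2 \<in> carrier W" "C c2 \<otimes>\<^bsub>W\<^esub> d = \<delta> \<otimes>\<^bsub>W\<^esub> q2"
    using div[OF dJ] by blast
  \<comment> \<open>Otherwise \<open>d\<close>, up to a nonzero factor from F[X] a multiple of
    \<delta>, would be a relation too.\<close>
  have \<delta>n: "\<delta> \<notin> rels"
  proof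
    assume "\<delta> \<in> rels"
    then have "C c2 \<otimes>\<^bsub>W\<^esub> d \<in> rels" using rels_mult_iff[OF \<delta>W 2(3)] 2(4) by simp
    then show False using rels_mult_iff[of "C c2" d] 2 d C_rels by simp
  qed
  have "q1 \<in> rels"
    using rels_mult_iff[OF \<delta>W 1(3)] rels_mult_iff[of "C c1" \<rho>] \<rho>(1) \<rho>W 1 \<delta>n by auto
  have q1n: "q1 \<noteq> \<zero>\<^bsub>W\<^esub>"
    using 1 \<delta>W C_nonzero[OF 1(1,2)] \<rho>(2) \<rho>W domain.integral_iff[OF W.UP_domain, of "C c1" \<rho>] by auto
  have "deg V \<rho> = deg V \<delta> + deg V q1"
    using W.deg_mult[OF \<delta>(2) q1n \<delta>W 1(3)] W.deg_mult[OF C_nonzero[OF 1(1,2)] \<rho>(2) _ \<rho>W] 1 by simp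
  then have "deg V \<delta> = 0" using \<rho>(3)[OF \<open>q1 \<in> rels\<close> q1n] by simp
  define c where "c = coeff W \<delta> 0"
  have \<delta>c: "\<delta> = C c" unfolding c_def by (rule W.deg_zero_impl_monom[OF \<delta>W \<open>deg V \<delta> = 0\<close>])
  have c: "c \<in> carrier V" using \<delta>W by (simp add: c_def)
  have cn: "c \<noteq> \<zero>\<^bsub>V\<^esub>"
  proof
    assume "c = \<zero>\<^bsub>V\<^esub>"
    then show False using \<delta>(2) \<delta>c by simp
  qed
  obtain p q where "p \<in> carrier W" "q \<in> carrier W" "\<delta> = d \<otimes>\<^bsub>W\<^esub> p \<oplus>\<^bsub>W\<^esub> \<rho> \<otimes>\<^bsub>W\<^esub> q"
    using \<delta>(1) unfolding J_def by blast
  then show ?thesis using that[OF c cn] \<delta>c by metis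
qed

text \<open>Write c h = \<rho> q with \<open>c\<close> of least degree. Then c(0) is nonzero:
  otherwise X divides \<rho> q but not \<rho>, hence divides q, and can be cancelled. Comparing the
  coefficient of degree 1 in the second variable at X = 0 now shows that smoothness of
  \<open>h\<close> at the origin passes to \<rho>.\<close>

lemma \<rho>_smooth: "\<rho> 0 0 = \<zero>\<^bsub>F\<^esub>" "\<rho> 1 0 \<noteq> \<zero>\<^bsub>F\<^esub>"
proof -
  show \<rho>00: "\<rho> 0 0 = \<zero>\<^bsub>F\<^esub>" using residue_subst[OF \<rho>W] \<rho>(1) by (simp add: rels_def)
  have hr: "h \<in> rels" using h by (auto simp: rels_def subst_def)
  define A where "A = {(c, q). c \<in> carrier V \<and> c \<noteq> \<zero>\<^bsub>V\<^esub> \<and> q \<in> carrier W \<and> C c \<otimes>\<^bsub>W\<^esub> h = \<rho> \<otimes>\<^bsub>W\<^esub> q}"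
  have "\<exists>p. p \<in> A" using rels_divisible[OF hr] unfolding A_def by blast
  then obtain p where p: "p \<in> A" "\<And>p'. p' \<in> A \<Longrightarrow> deg F (fst p) \<le> deg F (fst p')"
    using ex_has_least_nat[of "\<lambda>p. p \<in> A" _ "\<lambda>p. deg F (fst p)"] by blast
  obtain c q where cq: "p = (c, q)" by force
  have c: "c \<in> carrier V" "c \<noteq> \<zero>\<^bsub>V\<^esub>" "q \<in> carrier W" "C c \<otimes>\<^bsub>W\<^esub> h = \<rho> \<otimes>\<^bsub>W\<^esub> q"
    using p(1) by (auto simp: cq A_def)
  note ev0 = up_eval_zero
  have "c 0 \<noteq> \<zero>\<^bsub>F\<^esub>"
  proof
    assume c0: "c 0 = \<zero>\<^bsub>F\<^esub>"
    let ?t = "content_at \<zero>\<^bsub>F\<^esub>"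
    note t = content_at[OF F.zero_closed]
    obtain c' where c': "c' \<in> carrier V" "c = ?t \<otimes>\<^bsub>V\<^esub> c'"
      using V.remainder_theorem[OF c(1) F.zero_closed F_nontrivial] ev0[OF c(1)] c0 t(1)
      by (auto simp: content_at_def up_eval_def)
    have c'n: "c' \<noteq> \<zero>\<^bsub>V\<^esub>" using c(2) c' t by auto
    have degc: "deg F c = Suc (deg F c')" using V.deg_mult[OF t(3) c'n t(1) c'(1)] c'(2) t(2) by simp
    have "\<exists>i. \<rho> i 0 \<noteq> \<zero>\<^bsub>F\<^esub>" using \<rho>(4)[OF F.zero_closed] ev0 coeff_W[OF \<rho>W] by simp
    then have \<rho>i: "\<rho> (LEAST i. \<rho> i 0 \<noteq> \<zero>\<^bsub>F\<^esub>) 0 \<noteq> \<zero>\<^bsub>F\<^esub>" by (rule LeastI_ex)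
    define i where "i = (LEAST i. \<rho> i 0 \<noteq> \<zero>\<^bsub>F\<^esub>)"
    have i: "\<rho> i 0 \<noteq> \<zero>\<^bsub>F\<^esub>" "\<And>k. k < i \<Longrightarrow> \<rho> k 0 = \<zero>\<^bsub>F\<^esub>"
      using \<rho>i not_less_Least unfolding i_def by blast+
    have prod0: "(\<rho> \<otimes>\<^bsub>W\<^esub> q) n 0 = \<zero>\<^bsub>F\<^esub>" for n
    proof -
      have "(C c \<otimes>\<^bsub>W\<^esub> h) n = c \<otimes>\<^bsub>V\<^esub> h n" by (rule C_mult_coeff[OF c(1) h(1)])
      then show ?thesis unfolding c(4)[symmetric] using c(1) coeff_W[OF h(1)] coeff_V c0 by simp
    qed
    \<comment> \<open>With \<open>i\<close> the first index at which the coefficient of \<rho> does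
      not vanish at 0, coefficient i + n of the product, taken at 0, leaves only \<rho>_i(0) q_n(0)
      once the earlier q_k(0) vanish.\<close>
    have q0: "q n 0 = \<zero>\<^bsub>F\<^esub>" for n
    proof (induction n rule: less_induct)
      case (less n)
      have cl: "\<rho> k 0 \<in> carrier F" "q k 0 \<in> carrier F" for k
        using coeff_W[OF \<rho>W] coeff_W[OF c(3)] coeff_V by auto
      have "(\<rho> \<otimes>\<^bsub>W\<^esub> q) (i + n) = (\<Oplus>\<^bsub>V\<^esub>k\<in>{..i + n}. \<rho> k \<otimes>\<^bsub>V\<^esub> q (i + n - k))"
        by (rule W_mult_coeff[OF \<rho>W c(3)])
      then have "(\<rho> \<otimes>\<^bsub>W\<^esub> q) (i + n) 0 = (\<Oplus>\<^bsub>F\<^esub>k\<in>{..i + n}. (\<rho> k \<otimes>\<^bsub>V\<^esub> q (i + n - k)) 0)"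
        using k.hom_finsum[of "\<lambda>k. \<rho> k \<otimes>\<^bsub>V\<^esub> q (i + n - k)" "{..i + n}"] coeff_W[OF \<rho>W] coeff_W[OF c(3)]
        by (simp add: o_def)
      also have "\<dots> = (\<Oplus>\<^bsub>F\<^esub>k\<in>{..i + n}. \<rho> k 0 \<otimes>\<^bsub>F\<^esub> q (i + n - k) 0)"
        using coeff_W[OF \<rho>W] coeff_W[OF c(3)] by simp
      also have "\<dots> = (\<Oplus>\<^bsub>F\<^esub>k\<in>{..i + n}. if i = k then \<rho> k 0 \<otimes>\<^bsub>F\<^esub> q (i + n - k) 0 else \<zero>\<^bsub>F\<^esub>)"
      proof (rule F.add.finprod_cong')
        show "\<rho> k 0 \<otimes>\<^bsub>F\<^esub> q (i + n - k) 0 = (if i = k then \<rho> k 0 \<otimes>\<^bsub>F\<^esub> q (i + n - k) 0 else \<zero>\<^bsub>F\<^esub>)"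
          if "k \<in> {..i + n}" for k
          using less[of "i + n - k"] i(2)[of k] cl that by (cases k i rule: linorder_cases) auto
      qed (use cl in auto)
      also have "\<dots> = \<rho> i 0 \<otimes>\<^bsub>F\<^esub> q n 0" using cl by (subst F.add.finprod_singleton) auto
      finally show ?case using prod0[of "i + n"] i(1) cl F.integral_iff by metis
    qed
    obtain q' where q': "q' \<in> carrier W" "q = C ?t \<otimes>\<^bsub>W\<^esub> q'"
      using divide_content[OF F.zero_closed c(3)] q0 ev0 coeff_W[OF c(3)] by auto
    have "C ?t \<otimes>\<^bsub>W\<^esub> (C c' \<otimes>\<^bsub>W\<^esub> h) = C ?t \<otimes>\<^bsub>W\<^esub> (\<rho> \<otimes>\<^bsub>W\<^esub> q')"
    proof -
      have "C c = C ?t \<otimes>\<^bsub>W\<^esub> C c'" unfolding c'(2) using W.monom_mult[OF t(1) c'(1), of 0 0] by simp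
      then have "C ?t \<otimes>\<^bsub>W\<^esub> (C c' \<otimes>\<^bsub>W\<^esub> h) = C c \<otimes>\<^bsub>W\<^esub> h" using t c' h(1) by (simp add: W.P.m_assoc)
      also have "\<dots> = C ?t \<otimes>\<^bsub>W\<^esub> (\<rho> \<otimes>\<^bsub>W\<^esub> q')" unfolding c(4) q'(2) using t q' \<rho>W by (simp add: W.P.m_lcomm)
      finally show ?thesis .
    qed
    then have "C c' \<otimes>\<^bsub>W\<^esub> h = \<rho> \<otimes>\<^bsub>W\<^esub> q'"
      using domain.m_lcancel[OF W.UP_domain, OF C_nonzero[OF t(1,3)]] t c' h(1) \<rho>W q'(1) by simp
    then have "(c', q') \<in> A" using c' c'n q' by (simp add: A_def)
    from p(2)[OF this] degc show False by (simp add: cq)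
  qed
  moreover have "(C c \<otimes>\<^bsub>W\<^esub> h) 1 0 = c 0 \<otimes>\<^bsub>F\<^esub> h 1 0"
    using W_mult_coeff1[of "C c" h] c(1) h(1) C_coeff[OF c(1)] coeff_V coeff_W[OF h(1)] by simp
  moreover have "(\<rho> \<otimes>\<^bsub>W\<^esub> q) 1 0 = \<rho> 1 0 \<otimes>\<^bsub>F\<^esub> q 0 0"
    using W_mult_coeff1[OF \<rho>W c(3)] \<rho>00 coeff_V coeff_W[OF \<rho>W] coeff_W[OF c(3)] by simp
  ultimately have "\<rho> 1 0 \<otimes>\<^bsub>F\<^esub> q 0 0 \<noteq> \<zero>\<^bsub>F\<^esub>"
    using c(1,4) h(3) coeff_V coeff_W[OF h(1)] F.integral_iff by metis
  then show "\<rho> 1 0 \<noteq> \<zero>\<^bsub>F\<^esub>" using coeff_V coeff_W[OF c(3)] by auto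
qed

lemma vertical_finite:
  assumes a: "a \<in> carrier F"
  shows "finite {b \<in> carrier F. eval2 F a b \<rho> = \<zero>\<^bsub>F\<^esub>}"
proof -
  obtain n where n: "\<And>i. i \<ge> n \<Longrightarrow> \<rho> i = \<zero>\<^bsub>V\<^esub>"
    using UP_cring.coeffs_obtain[OF W.is_UP_cring \<rho>W] by metis
  interpret a: ring_hom_cring V F "up_eval F a"
    by (intro ring_hom_cringI V.cring_axioms F.cring_axioms F.up_eval_hom a)
  define p where "p = (\<lambda>i. up_eval F a (\<rho> i))"
  have pc: "p i \<in> carrier F" for i using coeff_W[OF \<rho>W] by (simp add: p_def)
  have pn: "p i = \<zero>\<^bsub>F\<^esub>" if "i \<ge> n" for i using n[OF that] by (simp add: p_def)
  have "bound \<zero>\<^bsub>F\<^esub> n p" using pn by (auto simp: bound_def)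
  then have pV: "p \<in> carrier V" using pc by (auto simp: UP_def intro!: mem_upI)
  obtain i where i: "p i \<noteq> \<zero>\<^bsub>F\<^esub>" using \<rho>(4)[OF a] by (auto simp: p_def)
  have pnz: "p \<noteq> \<zero>\<^bsub>V\<^esub>" using i V_zero[of i] by auto
  have "eval2 F a b \<rho> = up_eval F b p" if b: "b \<in> carrier F" for b
  proof -
    have "eval2 F a b \<rho> = horner F (map p [0..<n]) b"
      unfolding p_def by (rule F.eval2_horner(1)[OF \<rho>W a b]) (rule n)
    also have "\<dots> = up_eval F b p"
      by (rule F.up_eval_horner(1)[OF pV b, symmetric]) (rule pn)
    finally show ?thesis .
  qed
  then have "{b \<in> carrier F. eval2 F a b \<rho> = \<zero>\<^bsub>F\<^esub>} = {b \<in> carrier F. up_eval F b p = \<zero>\<^bsub>F\<^esub>}"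
    by auto
  then show ?thesis using content_finite[OF pV pnz] by simp
qed

text \<open>The origin is a smooth zero of \<rho>, so largeness gives infinitely many zeros. No
  vertical line lies in the curve, so a finite set of abscissas accounts for only finitely many of
  them.\<close>

lemma infinite_points:
  assumes large: "large_field F" and A: "finite A"
  obtains a b where "a \<in> carrier F" "b \<in> carrier F" "a \<notin> A" "eval2 F a b \<rho> = \<zero>\<^bsub>F\<^esub>"
proof -
  obtain n where n: "\<And>i. i \<ge> n \<Longrightarrow> \<rho> i = \<zero>\<^bsub>V\<^esub>"
    using UP_cring.coeffs_obtain[OF W.is_UP_cring \<rho>W] by metis
  interpret z: ring_hom_cring V F "up_eval F \<zero>\<^bsub>F\<^esub>"
    by (intro ring_hom_cringI V.cring_axioms F.cring_axioms F.up_eval_hom F.zero_closed)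
  define p where "p = (\<lambda>i. up_eval F \<zero>\<^bsub>F\<^esub> (\<rho> i))"
  have pc: "p i \<in> carrier F" for i using coeff_W[OF \<rho>W] by (simp add: p_def)
  have ev0: "up_eval F \<zero>\<^bsub>F\<^esub> q = q 0" if qV: "q \<in> carrier V" for q
    by (rule up_eval_zero[OF qV])
  have p01: "p 0 = \<zero>\<^bsub>F\<^esub>" "p 1 \<noteq> \<zero>\<^bsub>F\<^esub>"
    using \<rho>_smooth coeff_W[OF \<rho>W] by (simp_all add: p_def ev0)
  \<comment> \<open>Two extra slots ensure that the coefficients of degree 0 and 1 can be split off
    whatever \<open>n\<close> is.\<close>
  have n': "\<rho> i = \<zero>\<^bsub>V\<^esub>" if "i \<ge> Suc (Suc n)" for i using n that by simp
  have split: "map p [0..<Suc (Suc n)] = p 0 # p 1 # map (\<lambda>i. p (Suc (Suc i))) [0..<n]"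
    by (simp add: upt_conv_Cons map_Suc_upt[symmetric] del: upt_Suc)
  have pcs: "set (map (\<lambda>i. p (Suc (Suc i))) [0..<n]) \<subseteq> carrier F" using pc by auto
  have e0: "eval2 F \<zero>\<^bsub>F\<^esub> \<zero>\<^bsub>F\<^esub> \<rho> = \<zero>\<^bsub>F\<^esub>"
  proof -
    have "eval2 F \<zero>\<^bsub>F\<^esub> \<zero>\<^bsub>F\<^esub> \<rho> = horner F (map p [0..<Suc (Suc n)]) \<zero>\<^bsub>F\<^esub>"
      unfolding p_def by (rule F.eval2_horner(1)[OF \<rho>W F.zero_closed F.zero_closed]) (rule n')
    then show ?thesis unfolding split using p01 pc pcs by simp
  qed
  have e1: "eval2 F \<zero>\<^bsub>F\<^esub> \<zero>\<^bsub>F\<^esub> (up_deriv V \<rho>) \<noteq> \<zero>\<^bsub>F\<^esub>"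
  proof -
    have "eval2 F \<zero>\<^bsub>F\<^esub> \<zero>\<^bsub>F\<^esub> (up_deriv V \<rho>) = dhorner F (map p [0..<Suc (Suc n)]) \<zero>\<^bsub>F\<^esub>"
      unfolding p_def by (rule F.eval2_horner(2)[OF \<rho>W F.zero_closed F.zero_closed]) (rule n')
    then show ?thesis unfolding split using p01 pc pcs by simp
  qed
  let ?Z = "{(a, b). a \<in> carrier F \<and> b \<in> carrier F \<and> eval2 F a b \<rho> = \<zero>\<^bsub>F\<^esub>}"
  have inf: "infinite ?Z"
    using large \<rho>W e0 e1 unfolding large_field_def by blast
  have "\<exists>p\<in>?Z. fst p \<notin> A"
  proof (rule ccontr)
    assume "\<not> ?thesis"
    then have "?Z \<subseteq> (\<Union>a\<in>A \<inter> carrier F. {a} \<times> {b \<in> carrier F. eval2 F a b \<rho> = \<zero>\<^bsub>F\<^esub>})" by force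
    moreover have "finite (\<Union>a\<in>A \<inter> carrier F. {a} \<times> {b \<in> carrier F. eval2 F a b \<rho> = \<zero>\<^bsub>F\<^esub>})"
      using A vertical_finite by auto
    ultimately show False using inf finite_subset by blast
  qed
  then show ?thesis using that by auto
qed

text \<open>Outside the roots of one polynomial \<open>c\<close>, the points of the curve behave
  generically with respect to \<open>Q\<close>. A relation satisfies c Q = \<rho> q, which forces Q
  to vanish there; for any other Q, c = Q p + \<rho> q forces it not to.\<close>

lemma generic_vanishing:
  assumes QW: "Q \<in> carrier W"
  shows "\<exists>c\<in>carrier V. c \<noteq> \<zero>\<^bsub>V\<^esub> \<and> (\<forall>a\<in>carrier F. \<forall>b\<in>carrier F. up_eval F a c \<noteq> \<zero>\<^bsub>F\<^esub> \<longrightarrow>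
      eval2 F a b \<rho> = \<zero>\<^bsub>F\<^esub> \<longrightarrow> (eval2 F a b Q = \<zero>\<^bsub>F\<^esub> \<longleftrightarrow> subst Q = \<zero>))"
proof (cases "Q \<in> rels")
  case True
  obtain c q where c: "c \<in> carrier V" "c \<noteq> \<zero>\<^bsub>V\<^esub>" "q \<in> carrier W" "C c \<otimes>\<^bsub>W\<^esub> Q = \<rho> \<otimes>\<^bsub>W\<^esub> q"
    by (rule rels_divisible[OF True])
  show ?thesis
  proof (intro bexI[OF _ c(1)] conjI c(2) ballI impI)
    fix a b assume ab: "a \<in> carrier F" "b \<in> carrier F"
      and nz: "up_eval F a c \<noteq> \<zero>\<^bsub>F\<^esub>" and r0: "eval2 F a b \<rho> = \<zero>\<^bsub>F\<^esub>"
    note hom = F.eval2_hom[OF ab]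
    have Qc: "eval2 F a b Q \<in> carrier F" and qc: "eval2 F a b q \<in> carrier F"
      using ring_hom_closed[OF hom] QW c(3) by blast+
    have cc: "up_eval F a c \<in> carrier F" by (rule ring_hom_closed[OF F.up_eval_hom[OF ab(1)] c(1)])
    have "up_eval F a c \<otimes>\<^bsub>F\<^esub> eval2 F a b Q = eval2 F a b (C c \<otimes>\<^bsub>W\<^esub> Q)"
      using ring_hom_mult[OF hom W.monom_closed[OF c(1), of 0] QW] unfolding eval2_C[OF ab c(1)] by (rule sym)
    also have "\<dots> = \<zero>\<^bsub>F\<^esub> \<otimes>\<^bsub>F\<^esub> eval2 F a b q"
      unfolding c(4) ring_hom_mult[OF hom \<rho>W c(3)] r0 ..
    finally have "up_eval F a c \<otimes>\<^bsub>F\<^esub> eval2 F a b Q = \<zero>\<^bsub>F\<^esub>" unfolding F.l_null[OF qc] .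
    then have "eval2 F a b Q = \<zero>\<^bsub>F\<^esub>" using nz F.integral[OF _ cc Qc] by blast
    then show "eval2 F a b Q = \<zero>\<^bsub>F\<^esub> \<longleftrightarrow> subst Q = \<zero>" using True by (simp add: rels_def)
  qed
next
  case False
  obtain c p q where c: "c \<in> carrier V" "c \<noteq> \<zero>\<^bsub>V\<^esub>" "p \<in> carrier W" "q \<in> carrier W"
      "C c = Q \<otimes>\<^bsub>W\<^esub> p \<oplus>\<^bsub>W\<^esub> \<rho> \<otimes>\<^bsub>W\<^esub> q"
    by (rule non_rels_coprime[OF QW False])
  show ?thesis
  proof (intro bexI[OF _ c(1)] conjI c(2) ballI impI)
    fix a b assume ab: "a \<in> carrier F" "b \<in> carrier F"
      and nz: "up_eval F a c \<noteq> \<zero>\<^bsub>F\<^esub>" and r0: "eval2 F a b \<rho> = \<zero>\<^bsub>F\<^esub>"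
    note hom = F.eval2_hom[OF ab]
    have cl: "eval2 F a b Q \<in> carrier F" "eval2 F a b p \<in> carrier F" "eval2 F a b q \<in> carrier F"
      using ring_hom_closed[OF hom] QW c(3,4) by blast+
    have "up_eval F a c = eval2 F a b (Q \<otimes>\<^bsub>W\<^esub> p \<oplus>\<^bsub>W\<^esub> \<rho> \<otimes>\<^bsub>W\<^esub> q)"
      unfolding c(5)[symmetric] by (rule eval2_C[OF ab c(1), symmetric])
    also have "\<dots> = eval2 F a b Q \<otimes>\<^bsub>F\<^esub> eval2 F a b p \<oplus>\<^bsub>F\<^esub> \<zero>\<^bsub>F\<^esub> \<otimes>\<^bsub>F\<^esub> eval2 F a b q"
      unfolding ring_hom_add[OF hom W.UP_mult_closed[OF QW c(3)] W.UP_mult_closed[OF \<rho>W c(4)]]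
        ring_hom_mult[OF hom QW c(3)] ring_hom_mult[OF hom \<rho>W c(4)] r0 ..
    finally have 1: "up_eval F a c = eval2 F a b Q \<otimes>\<^bsub>F\<^esub> eval2 F a b p \<oplus>\<^bsub>F\<^esub> \<zero>\<^bsub>F\<^esub> \<otimes>\<^bsub>F\<^esub> eval2 F a b q" .
    have "eval2 F a b Q \<noteq> \<zero>\<^bsub>F\<^esub>"
    proof
      assume "eval2 F a b Q = \<zero>\<^bsub>F\<^esub>"
      with 1 have "up_eval F a c = \<zero>\<^bsub>F\<^esub>" using F.l_null[OF cl(2)] F.l_null[OF cl(3)] by simp
      with nz show False ..
    qed
    moreover have "subst Q \<noteq> \<zero>" using False QW by (simp add: rels_def)
    ultimately show "eval2 F a b Q = \<zero>\<^bsub>F\<^esub> \<longleftrightarrow> subst Q = \<zero>" by simp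
  qed
qed

end

lemma generic_point:
  assumes large: "large_field F" and Qs: "finite Qs" "Qs \<subseteq> carrier W"
  obtains a b where "a \<in> carrier F" "b \<in> carrier F"
    "\<And>Q. Q \<in> Qs \<Longrightarrow> eval2 F a b Q = \<zero>\<^bsub>F\<^esub> \<longleftrightarrow> subst Q = \<zero>"
proof -
  obtain \<rho> where \<rho>: "\<rho> \<in> rels" "\<rho> \<noteq> \<zero>\<^bsub>W\<^esub>"
    "\<And>Q. Q \<in> rels \<Longrightarrow> Q \<noteq> \<zero>\<^bsub>W\<^esub> \<Longrightarrow> deg V \<rho> \<le> deg V Q"
    "\<And>a. a \<in> carrier F \<Longrightarrow> \<exists>i. up_eval F a (\<rho> i) \<noteq> \<zero>\<^bsub>F\<^esub>"
    using minimal_relation by blast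
  define good where "good Q c \<longleftrightarrow> c \<in> carrier V \<and> c \<noteq> \<zero>\<^bsub>V\<^esub> \<and> (\<forall>a\<in>carrier F. \<forall>b\<in>carrier F. up_eval F a c \<noteq> \<zero>\<^bsub>F\<^esub> \<longrightarrow>
      eval2 F a b \<rho> = \<zero>\<^bsub>F\<^esub> \<longrightarrow> (eval2 F a b Q = \<zero>\<^bsub>F\<^esub> \<longleftrightarrow> subst Q = \<zero>))" for Q c
  define c where "c Q = (SOME c. good Q c)" for Q
  have c: "good Q (c Q)" if Q: "Q \<in> Qs" for Q
  proof -
    have "Q \<in> carrier W" using Q Qs(2) by blast
    from generic_vanishing[OF \<rho> this] have "\<exists>c. good Q c" unfolding good_def by blast
    then show ?thesis unfolding c_def by (rule someI_ex)
  qed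
  define A where "A = (\<Union>Q\<in>Qs. {a \<in> carrier F. up_eval F a (c Q) = \<zero>\<^bsub>F\<^esub>})"
  have "finite A" unfolding A_def
  proof (rule finite_UN_I[OF Qs(1)])
    fix Q assume "Q \<in> Qs"
    from c[OF this] show "finite {a \<in> carrier F. up_eval F a (c Q) = \<zero>\<^bsub>F\<^esub>}"
      by (intro content_finite) (auto simp: good_def)
  qed
  from infinite_points[OF \<rho> large this] obtain a b where
    ab: "a \<in> carrier F" "b \<in> carrier F" "a \<notin> A" "eval2 F a b \<rho> = \<zero>\<^bsub>F\<^esub>" by blast
  show ?thesis
  proof (rule that[OF ab(1,2)])
    fix Q assume Q: "Q \<in> Qs"
    then have "up_eval F a (c Q) \<noteq> \<zero>\<^bsub>F\<^esub>" using ab(1,3) by (auto simp: A_def)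
    then show "eval2 F a b Q = \<zero>\<^bsub>F\<^esub> \<longleftrightarrow> subst Q = \<zero>"
      using c[OF Q] ab unfolding good_def by blast
  qed
qed

end

section \<open>Specialising algebraic power series\<close>

context power_series
begin

text \<open>Nakayama's lemma by elimination: the equation for the first generator has the unit 1 - b
  as its coefficient and can be solved; substituting the solution into the other equations leaves a
  shorter list of the same kind.\<close>

lemma nakayama:
  assumes A: "subring A P" and inv: "\<And>a. a \<in> A \<Longrightarrow> a 0 \<noteq> \<zero>\<^bsub>F\<^esub> \<Longrightarrow> \<exists>i\<in>A. a \<otimes> i = \<one>"
    and gs: "set gs \<subseteq> carrier P"
    and gen: "\<And>g. g \<in> set gs \<Longrightarrow> \<exists>a\<in>A. \<exists>s\<in>lin {a \<in> A. a 0 = \<zero>\<^bsub>F\<^esub>} gs. g = a \<oplus> s"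
  shows "set gs \<subseteq> A"
  using gs gen
proof (induction gs)
  case (Cons g gs)
  define m where "m = {a \<in> A. a 0 = \<zero>\<^bsub>F\<^esub>}"
  note S = subringE[OF A]
  have mc: "m \<subseteq> carrier P" using S(1) by (auto simp: m_def)
  have m0: "\<zero> \<in> m" using S(2) by (simp add: m_def)
  have madd: "a \<oplus> b \<in> m" if "a \<in> m" "b \<in> m" for a b
  proof -
    have "a \<in> carrier P" "b \<in> carrier P" using that mc by auto
    then show ?thesis using that S(7) by (auto simp: m_def)
  qed
  have mmult: "a \<otimes> b \<in> m" if "a \<in> A" "b \<in> m" for a b
  proof -
    have "a \<in> carrier P" "b \<in> carrier P" using that mc S(1) by auto
    then show ?thesis using that S(6) by (auto simp: m_def)
  qed
  have gsc: "set gs \<subseteq> carrier P" and gc: "g \<in> carrier P" using Cons.prems(1) by auto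
  have split: "\<exists>a b s. f = a \<oplus> (b \<otimes> g \<oplus> s) \<and> a \<in> A \<and> b \<in> m \<and> s \<in> lin m gs" if fg: "f \<in> set (g # gs)" for f
  proof -
    obtain a t where "a \<in> A" "t \<in> lin m (g # gs)" "f = a \<oplus> t"
      using Cons.prems(2)[OF fg] unfolding m_def by blast
    moreover then obtain b s where "t = b \<otimes> g \<oplus> s" "b \<in> m" "s \<in> lin m gs" by auto
    ultimately show ?thesis by blast
  qed
  obtain a b s where g: "g = a \<oplus> (b \<otimes> g \<oplus> s)" "a \<in> A" "b \<in> m" "s \<in> lin m gs"
    using split[of g] by auto
  have cl: "a \<in> carrier P" "b \<in> carrier P" "s \<in> carrier P"
    using g S(1) mc lin_closed[OF mc gsc] by auto
  have b1: "\<one> \<ominus> b \<in> A" using g(3) S(3,5,7) by (auto simp: m_def a_minus_def)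
  have "(\<one> \<ominus> b) 0 = \<one>\<^bsub>F\<^esub>" using g(3) cl by (simp add: m_def a_minus_def)
  then obtain i where i: "i \<in> A" "(\<one> \<ominus> b) \<otimes> i = \<one>" using inv[OF b1] by auto
  have ic: "i \<in> carrier P" using i S(1) by auto
  have "(\<one> \<ominus> b) \<otimes> g = g \<ominus> b \<otimes> g" using gc cl by algebra
  also have "\<dots> = a \<oplus> s"
  proof -
    have "(a \<oplus> (y \<oplus> s)) \<ominus> y = a \<oplus> s" if "y \<in> carrier P" for y using that cl by algebra
    from this[of "b \<otimes> g"] g(1) gc cl show ?thesis by simp
  qed
  finally have 1: "(\<one> \<ominus> b) \<otimes> g = a \<oplus> s" .
  have "g = i \<otimes> ((\<one> \<ominus> b) \<otimes> g)"
  proof -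
    have "i \<otimes> ((\<one> \<ominus> b) \<otimes> g) = ((\<one> \<ominus> b) \<otimes> i) \<otimes> g" using ic cl gc by algebra
    then show ?thesis using i(2) gc by simp
  qed
  also have "\<dots> = i \<otimes> a \<oplus> i \<otimes> s" unfolding 1 using ic cl by (simp add: r_distr)
  finally have g': "g = i \<otimes> a \<oplus> i \<otimes> s" .
  have ia: "i \<otimes> a \<in> A" using i g S(6) by simp
  have iS: "i \<otimes> s \<in> lin m gs" by (rule lin_mult[OF mc ic mmult[OF i(1)] gsc g(4)])
  have isc: "i \<otimes> s \<in> carrier P" using ic cl by simp
  have lin_m: "lin m gs' \<subseteq> A" if "set gs' \<subseteq> A" for gs'
    by (rule lin_least) (use that S in \<open>auto simp: m_def subset_iff\<close>)
  have "set gs \<subseteq> A"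
  proof (rule Cons.IH[OF gsc])
    fix f assume f: "f \<in> set gs"
    then obtain a1 b1 s1 where f': "f = a1 \<oplus> (b1 \<otimes> g \<oplus> s1)" "a1 \<in> A" "b1 \<in> m" "s1 \<in> lin m gs"
      using split[of f] by auto
    have cl1: "a1 \<in> carrier P" "b1 \<in> carrier P" "s1 \<in> carrier P" "i \<otimes> a \<in> carrier P"
      using f' S(1) mc lin_closed[OF mc gsc] ic cl by auto
    have "f = a1 \<oplus> (b1 \<otimes> (i \<otimes> a \<oplus> i \<otimes> s) \<oplus> s1)" using f'(1) g' by simp
    also have "\<dots> = (a1 \<oplus> b1 \<otimes> (i \<otimes> a)) \<oplus> (b1 \<otimes> (i \<otimes> s) \<oplus> s1)"
      using cl1 ic cl by algebra
    finally have "f = (a1 \<oplus> b1 \<otimes> (i \<otimes> a)) \<oplus> (b1 \<otimes> (i \<otimes> s) \<oplus> s1)" .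
    moreover have "b1 \<in> A" using f'(3) by (simp add: m_def)
    then have "a1 \<oplus> b1 \<otimes> (i \<otimes> a) \<in> A" using f'(2) ia S(6,7) by blast
    moreover have "b1 \<otimes> (i \<otimes> s) \<oplus> s1 \<in> lin m gs"
      using lin_mult[OF mc cl1(2) mmult[OF \<open>b1 \<in> A\<close>] gsc iS] f'(4) lin_add[OF mc madd gsc] by blast
    ultimately show "\<exists>a\<in>A. \<exists>s\<in>lin {a \<in> A. a 0 = \<zero>\<^bsub>F\<^esub>} gs. f = a \<oplus> s" unfolding m_def by blast
  qed
  moreover have "g \<in> A" using g' ia iS lin_m[OF calculation] S(7) by (metis subsetD)
  ultimately show ?case by simp
qed simp

end

section \<open>The local ring of a branch at the origin\<close>

context plane_param
begin

text \<open>The local ring at the origin of the plane curve parametrised by X and \<open>x\<close>,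
  realised as fractions inside the power series.\<close>

definition loc :: "(nat \<Rightarrow> 'a) set" where
  "loc = {f \<in> carrier P. \<exists>u\<in>carrier W. \<exists>w\<in>carrier W. subst w 0 \<noteq> \<zero>\<^bsub>F\<^esub> \<and> f \<otimes> subst w = subst u}"

lemma locI:
  "f \<in> carrier P \<Longrightarrow> u \<in> carrier W \<Longrightarrow> w \<in> carrier W \<Longrightarrow> subst w 0 \<noteq> \<zero>\<^bsub>F\<^esub> \<Longrightarrow> f \<otimes> subst w = subst u \<Longrightarrow> f \<in> loc"
  by (auto simp: loc_def)

lemma locE:
  assumes "f \<in> loc"
  obtains u w where "f \<in> carrier P" "u \<in> carrier W" "w \<in> carrier W" "subst w 0 \<noteq> \<zero>\<^bsub>F\<^esub>" "f \<otimes> subst w = subst u"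
  using assms by (auto simp: loc_def)

lemma subst_loc: "u \<in> carrier W \<Longrightarrow> subst u \<in> loc"
  by (rule locI[of _ u "\<one>\<^bsub>W\<^esub>"]) simp_all

lemma loc_subring: "subring loc P"
proof (rule subringI)
  show "loc \<subseteq> carrier P" by (auto simp: loc_def)
  show "\<one> \<in> loc" using subst_loc[of "\<one>\<^bsub>W\<^esub>"] by simp
  show "\<ominus> f \<in> loc" if fl: "f \<in> loc" for f
  proof -
    obtain u w where *: "f \<in> carrier P" "u \<in> carrier W" "w \<in> carrier W" "subst w 0 \<noteq> \<zero>\<^bsub>F\<^esub>" "f \<otimes> subst w = subst u"
      using locE[OF fl] .
    then show ?thesis by (intro locI[of _ "\<ominus>\<^bsub>W\<^esub> u" w]) (simp_all add: l_minus)
  qed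
  fix f g assume "f \<in> loc" "g \<in> loc"
  obtain u w where f: "f \<in> carrier P" "u \<in> carrier W" "w \<in> carrier W" "subst w 0 \<noteq> \<zero>\<^bsub>F\<^esub>" "f \<otimes> subst w = subst u"
    using locE[OF \<open>f \<in> loc\<close>] .
  obtain u' w' where g: "g \<in> carrier P" "u' \<in> carrier W" "w' \<in> carrier W" "subst w' 0 \<noteq> \<zero>\<^bsub>F\<^esub>" "g \<otimes> subst w' = subst u'"
    using locE[OF \<open>g \<in> loc\<close>] .
  have ww: "subst (w \<otimes>\<^bsub>W\<^esub> w') 0 \<noteq> \<zero>\<^bsub>F\<^esub>" using f g by (simp add: F.integral_iff)
  have c: "subst w \<in> carrier P" "subst w' \<in> carrier P" using f g by simp_all
  have "(f \<oplus> g) \<otimes> (subst w \<otimes> subst w') = (f \<otimes> subst w) \<otimes> subst w' \<oplus> (g \<otimes> subst w') \<otimes> subst w"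
    using f(1) g(1) c by algebra
  then show "f \<oplus> g \<in> loc"
    using f g ww by (intro locI[of _ "u \<otimes>\<^bsub>W\<^esub> w' \<oplus>\<^bsub>W\<^esub> u' \<otimes>\<^bsub>W\<^esub> w" "w \<otimes>\<^bsub>W\<^esub> w'"]) simp_all
  have "(f \<otimes> g) \<otimes> (subst w \<otimes> subst w') = (f \<otimes> subst w) \<otimes> (g \<otimes> subst w')"
    using f(1) g(1) c by algebra
  then show "f \<otimes> g \<in> loc"
    using f g ww by (intro locI[of _ "u \<otimes>\<^bsub>W\<^esub> u'" "w \<otimes>\<^bsub>W\<^esub> w'"]) simp_all
qed

lemma loc_inverse:
  assumes f: "f \<in> loc" "f 0 \<noteq> \<zero>\<^bsub>F\<^esub>"
  shows "\<exists>i\<in>loc. f \<otimes> i = \<one>"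
proof -
  obtain u w where *: "f \<in> carrier P" "u \<in> carrier W" "w \<in> carrier W" "subst w 0 \<noteq> \<zero>\<^bsub>F\<^esub>" "f \<otimes> subst w = subst u"
    using locE[OF f(1)] .
  obtain i where i: "i \<in> carrier P" "f \<otimes> i = \<one>" using unit_inverse[OF *(1) f(2)] .
  have c: "subst w \<in> carrier P" using * by simp
  have "i \<otimes> subst u = (f \<otimes> i) \<otimes> subst w" unfolding *(5)[symmetric] using *(1) i(1) c by algebra
  then have "i \<otimes> subst u = subst w" using i(2) c by simp
  moreover have "subst u 0 \<noteq> \<zero>\<^bsub>F\<^esub>"
    unfolding *(5)[symmetric] using *(1,4) f(2) c by (simp add: F.integral_iff)
  ultimately have "i \<in> loc" using i * by (intro locI[of _ w u])
  then show ?thesis using i by blast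
qed

lemma T_loc: "T \<subseteq> loc"
proof
  fix c assume "c \<in> T"
  then show "c \<in> loc" using subst_loc[of "C c"] by simp
qed

abbreviation "Y \<equiv> monom W \<one>\<^bsub>V\<^esub> 1"

lemma subst_Y: "subst Y = x"
  unfolding subst_def by (rule S.eval_monom1[OF x(1)])

lemma x_loc: "x \<in> loc"
  using subst_loc[of Y] subst_Y by simp

lemma Y_mult_coeff1: "g \<in> carrier W \<Longrightarrow> (Y \<otimes>\<^bsub>W\<^esub> g) 1 0 = g 0 0"
  using W_mult_coeff1[of Y g] W.coeff_eq[of Y 0] W.coeff_eq[of Y 1] coeff_W[of g] coeff_V
  by simp (simp add: UP_def[of F])

end

context power_series
begin

text \<open>
  The element \<open>1 - e\<close> vanishes at the origin and is \<open>1\<close> modulo \<open>X\<close> on all other components of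
  the fibre, so together with \<open>X\<close> it generates the maximal ideal of \<open>B\<close> at the origin.
\<close>

lemma etale_plane_branch:
  assumes B: "etale_at e B"
  obtains h where "plane_branch F (\<one> \<ominus> e) h" "B \<subseteq> plane_param.loc F (\<one> \<ominus> e)"
proof -
  define x where "x = \<one> \<ominus> e"
  from B have sB: "subring B P" and TB: "T \<subseteq> B" and e: "e \<in> B" "e 0 = \<one>\<^bsub>F\<^esub>"
    and et: "\<And>g. g \<in> B \<Longrightarrow> g 0 = \<zero>\<^bsub>F\<^esub> \<Longrightarrow> \<exists>b\<in>B. e \<otimes> g = X \<otimes> b"
    by (auto simp: etale_at_def)
  obtain gs where gs: "set gs \<subseteq> B" "B \<subseteq> lin T gs" using B by (auto simp: etale_at_def)
  note SB = subringE[OF sB]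
  have ec: "e \<in> carrier P" using e SB by auto
  have xB: "x \<in> B" using e SB by (simp add: x_def a_minus_def)
  have x: "x \<in> carrier P" "x 0 = \<zero>\<^bsub>F\<^esub>" using ec e by (simp_all add: x_def a_minus_def F.r_neg)
  interpret pp: plane_param F P x
    by unfold_locales (use x in \<open>simp_all add: P_def\<close>)
  note SL = subringE[OF pp.loc_subring]
  define m where "m = {a \<in> pp.loc. a 0 = \<zero>\<^bsub>F\<^esub>}"
  have mc: "m \<subseteq> carrier P" using SL(1) by (auto simp: m_def)
  have madd: "a \<oplus> b \<in> m" if "a \<in> m" "b \<in> m" for a b
  proof -
    have "a \<in> carrier P" "b \<in> carrier P" using that mc by auto
    then show ?thesis using that SL(7) by (auto simp: m_def)
  qed
  have gsc: "set gs \<subseteq> carrier P" using gs(1) SB(1) by auto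
  have gsA: "set gs \<subseteq> pp.loc"
  proof (rule nakayama[OF pp.loc_subring pp.loc_inverse gsc], assumption, assumption)
    fix g assume g: "g \<in> set gs"
    then have gB: "g \<in> B" and gc: "g \<in> carrier P" using gs(1) gsc by auto
    define k where "k = \<kappa> (g 0)"
    have k: "k \<in> T" "k \<in> carrier P" "k 0 = g 0" using gc const_T by (simp_all add: k_def)
    define y where "y = g \<ominus> k"
    have yB: "y \<in> B" using gB k TB SB by (auto simp: y_def a_minus_def)
    have yc: "y \<in> carrier P" using yB SB by auto
    have y0: "y 0 = \<zero>\<^bsub>F\<^esub>" using gc k by (simp add: y_def a_minus_def F.r_neg)
    obtain b where b: "b \<in> B" "e \<otimes> y = X \<otimes> b" using et[OF yB y0] by blast
    have bc: "b \<in> carrier P" using b SB by auto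
    \<comment> \<open>Since \<open>x\<close> is 1 - e and e y = X b, the element y = g - g(0) is a
      combination of \<open>gs\<close> with coefficients in the maximal ideal, as
      \<open>nakayama\<close> demands.\<close>
    have "y = x \<otimes> y \<oplus> e \<otimes> y" unfolding x_def using yc ec by algebra
    then have yeq: "y = x \<otimes> y \<oplus> X \<otimes> b" using b(2) by simp
    have Tm: "x \<otimes> p \<in> m" "X \<otimes> p \<in> m" if "p \<in> T" for p
    proof -
      have "p \<in> carrier P" using that T_subset by auto
      moreover have "x \<otimes> p \<in> pp.loc" "X \<otimes> p \<in> pp.loc"
        using that pp.T_loc pp.x_loc X_T SL(6) by blast+
      ultimately show "x \<otimes> p \<in> m" "X \<otimes> p \<in> m" using x by (simp_all add: m_def)
    qed
    have "x \<otimes> y \<in> lin m gs" "X \<otimes> b \<in> lin m gs"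
      using lin_mult[OF T_subset x(1) Tm(1) gsc, of y] lin_mult[OF T_subset X_closed Tm(2) gsc, of b]
        gs(2) yB b(1) by auto
    then have "y \<in> lin m gs" using lin_add[OF mc madd gsc] yeq by metis
    moreover have "g = k \<oplus> y" unfolding y_def using gc k(2) by algebra
    moreover have "k \<in> pp.loc" using k(1) pp.T_loc by auto
    ultimately show "\<exists>a\<in>pp.loc. \<exists>s\<in>lin {a \<in> pp.loc. a 0 = \<zero>\<^bsub>F\<^esub>} gs. g = a \<oplus> s"
      unfolding m_def by blast
  qed
  have BL: "B \<subseteq> pp.loc"
  proof -
    have "lin T gs \<subseteq> pp.loc"
    proof (rule lin_least)
      show "b \<otimes> g \<oplus> s \<in> pp.loc" if "b \<in> T" "g \<in> set gs" "s \<in> pp.loc" for b g s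
      proof -
        have "b \<in> pp.loc" "g \<in> pp.loc" using that pp.T_loc gsA by auto
        then show ?thesis using SL(6,7) that(3) by blast
      qed
    qed (rule SL(2))
    then show ?thesis using gs(2) by blast
  qed
  obtain b where b: "b \<in> B" "e \<otimes> x = X \<otimes> b" using et[OF xB x(2)] by blast
  have "e \<in> pp.loc" "b \<in> pp.loc" using e b BL by auto
  obtain u1 w1 where 1: "u1 \<in> carrier pp.W" "w1 \<in> carrier pp.W" "pp.subst w1 0 \<noteq> \<zero>\<^bsub>F\<^esub>" "e \<otimes> pp.subst w1 = pp.subst u1"
    using pp.locE[OF \<open>e \<in> pp.loc\<close>] .
  obtain u2 w2 where 2: "b \<in> carrier P" "u2 \<in> carrier pp.W" "w2 \<in> carrier pp.W" "pp.subst w2 0 \<noteq> \<zero>\<^bsub>F\<^esub>" "b \<otimes> pp.subst w2 = pp.subst u2"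
    using pp.locE[OF \<open>b \<in> pp.loc\<close>] .
  have c: "pp.subst w1 \<in> carrier P" "pp.subst w2 \<in> carrier P" using 1 2 by simp_all
  define f where "f = u1 \<otimes>\<^bsub>pp.W\<^esub> w2"
  define g where "g = u2 \<otimes>\<^bsub>pp.W\<^esub> w1"
  have fg: "f \<in> carrier pp.W" "g \<in> carrier pp.W" using 1 2 by (simp_all add: f_def g_def)
  \<comment> \<open>The relation e x = X b with denominators cleared, where e = u1/w1 and b = u2/w2.
    Its derivative in the second variable at the origin is f(0,0), a product of the nonzero values
    of e, w1 and w2 there.\<close>
  define h where "h = pp.Y \<otimes>\<^bsub>pp.W\<^esub> f \<ominus>\<^bsub>pp.W\<^esub> pp.C X \<otimes>\<^bsub>pp.W\<^esub> g"
  have CX: "pp.C X \<in> carrier pp.W" using X_T by simp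
  have hW: "h \<in> carrier pp.W" using fg CX by (simp add: h_def)
  have h0: "pp.subst h = \<zero>"
  proof -
    have "x \<otimes> (pp.subst u1 \<otimes> pp.subst w2) = (e \<otimes> x) \<otimes> (pp.subst w1 \<otimes> pp.subst w2)"
      unfolding 1(4)[symmetric] using x(1) ec c by algebra
    also have "\<dots> = X \<otimes> (pp.subst u2 \<otimes> pp.subst w1)"
      unfolding b(2) 2(5)[symmetric] using c 2(1) X_closed by algebra
    finally have "pp.subst (pp.Y \<otimes>\<^bsub>pp.W\<^esub> f) = pp.subst (pp.C X \<otimes>\<^bsub>pp.W\<^esub> g)"
      using 1 2 CX X_T by (simp add: f_def g_def pp.subst_Y[unfolded One_nat_def])
    moreover have "pp.subst (pp.C X \<otimes>\<^bsub>pp.W\<^esub> g) \<in> carrier P" using CX fg by (intro pp.s.hom_closed) simp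
    ultimately show ?thesis
      unfolding h_def using CX fg by (simp add: a_minus_def r_neg)
  qed
  have h1: "h 1 0 \<noteq> \<zero>\<^bsub>F\<^esub>"
  proof -
    have "pp.subst f 0 \<noteq> \<zero>\<^bsub>F\<^esub>"
      using 1 2 c e(2) ec by (simp add: f_def F.integral_iff 1(4)[symmetric])
    then have f00: "f 0 0 \<noteq> \<zero>\<^bsub>F\<^esub>" using pp.residue_subst[OF fg(1)] by simp
    have Yf: "pp.Y \<otimes>\<^bsub>pp.W\<^esub> f \<in> carrier pp.W" and Xg: "pp.C X \<otimes>\<^bsub>pp.W\<^esub> g \<in> carrier pp.W"
      using fg CX by simp_all
    have h1: "h 1 = (pp.Y \<otimes>\<^bsub>pp.W\<^esub> f) 1 \<ominus>\<^bsub>pp.V\<^esub> (pp.C X \<otimes>\<^bsub>pp.W\<^esub> g) 1"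
      using pp.W.coeff_minus[OF Yf Xg, of 1] pp.W.coeff_eq[OF hW] pp.W.coeff_eq[OF Yf] pp.W.coeff_eq[OF Xg]
      unfolding h_def[symmetric] by simp
    have Xg1: "(pp.C X \<otimes>\<^bsub>pp.W\<^esub> g) 1 0 = \<zero>\<^bsub>F\<^esub>"
      using pp.C_mult_coeff[OF X_T fg(2)] pp.coeff_W[OF fg(2)] pp.coeff_V X_T by simp
    have "h 1 0 = f 0 0 \<ominus>\<^bsub>F\<^esub> \<zero>\<^bsub>F\<^esub>"
      unfolding h1 using pp.k.hom_sub[OF pp.coeff_W[OF Yf] pp.coeff_W[OF Xg], of 1 1]
        pp.Y_mult_coeff1[OF fg(1)] Xg1 by simp
    then show ?thesis using f00 pp.coeff_W[OF fg(1)] pp.coeff_V by (simp add: F.minus_eq)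
  qed
  have "plane_branch F x h"
    using pp.plane_param_axioms hW h0 h1
    by (intro plane_branch.intro plane_branch_axioms.intro) (simp_all add: P_def)
  with BL show ?thesis by (intro that[of h]) (simp_all add: x_def)
qed

text \<open>The operations are respected only where their results stay in \<open>S\<close>, so that
  \<open>S\<close> may be finite and the conditions can be handed to saturation formula by formula.
  Nonvanishing is what later gives injectivity on a ring.\<close>

definition partial_hom :: "(nat \<Rightarrow> 'a) set \<Rightarrow> ((nat \<Rightarrow> 'a) \<Rightarrow> 'a) \<Rightarrow> bool" where
  "partial_hom S v \<longleftrightarrow> (\<forall>f\<in>S. v f \<in> carrier F) \<and>
     (\<forall>f\<in>S. \<forall>g\<in>S. f \<oplus> g \<in> S \<longrightarrow> v (f \<oplus> g) = v f \<oplus>\<^bsub>F\<^esub> v g) \<and>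
     (\<forall>f\<in>S. \<forall>g\<in>S. f \<otimes> g \<in> S \<longrightarrow> v (f \<otimes> g) = v f \<otimes>\<^bsub>F\<^esub> v g) \<and>
     (\<forall>c\<in>carrier F. \<kappa> c \<in> S \<longrightarrow> v (\<kappa> c) = c) \<and>
     (\<forall>f\<in>S. f \<noteq> \<zero> \<longrightarrow> v f \<noteq> \<zero>\<^bsub>F\<^esub>)"

end

text \<open>Each series of \<open>S\<close> is a quotient n/d of bivariate polynomials at (X, x). At
  a point of the curve where a finite set of polynomials vanishes exactly as it does along the
  branch, taking the value of n/d respects all operations within \<open>S\<close>.\<close>

lemma (in plane_branch) loc_partial_hom:
  assumes large: "large_field F" and S: "finite S" "S \<subseteq> loc"
  shows "\<exists>v. partial_hom S v"
proof -
  have "\<exists>p. fst p \<in> carrier W \<and> snd p \<in> carrier W \<and> subst (snd p) 0 \<noteq> \<zero>\<^bsub>F\<^esub> \<and> f \<otimes> subst (snd p) = subst (fst p)"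
    if f: "f \<in> S" for f
  proof -
    have "f \<in> loc" using f S(2) by blast
    then obtain u w where "u \<in> carrier W" "w \<in> carrier W" "subst w 0 \<noteq> \<zero>\<^bsub>F\<^esub>" "f \<otimes> subst w = subst u"
      by (rule locE)
    then show ?thesis by (intro exI[of _ "(u, w)"]) simp
  qed
  then obtain p where p: "\<And>f. f \<in> S \<Longrightarrow> fst (p f) \<in> carrier W \<and> snd (p f) \<in> carrier W \<and>
    subst (snd (p f)) 0 \<noteq> \<zero>\<^bsub>F\<^esub> \<and> f \<otimes> subst (snd (p f)) = subst (fst (p f))"
    using bchoice[of S "\<lambda>f p. fst p \<in> carrier W \<and> snd p \<in> carrier W \<and> subst (snd p) 0 \<noteq> \<zero>\<^bsub>F\<^esub> \<and>
      f \<otimes> subst (snd p) = subst (fst p)"] by blast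
  define n where "n f = fst (p f)" for f
  define d where "d f = snd (p f)" for f
  have nW: "n f \<in> carrier W" and dW: "d f \<in> carrier W" and d0: "subst (d f) 0 \<noteq> \<zero>\<^bsub>F\<^esub>"
    and eq: "subst (n f) = f \<otimes> subst (d f)" if "f \<in> S" for f
    using p[OF that] by (simp_all add: n_def d_def)
  have fc: "f \<in> carrier P" if "f \<in> S" for f using that S(2) by (auto simp: loc_def)
  have dn: "subst (d f) \<noteq> \<zero>" if "f \<in> S" for f
    using d0[OF that] by auto
  let ?add = "\<lambda>(f, g). n (f \<oplus> g) \<otimes>\<^bsub>W\<^esub> (d f \<otimes>\<^bsub>W\<^esub> d g) \<ominus>\<^bsub>W\<^esub> d (f \<oplus> g) \<otimes>\<^bsub>W\<^esub> (n f \<otimes>\<^bsub>W\<^esub> d g \<oplus>\<^bsub>W\<^esub> n g \<otimes>\<^bsub>W\<^esub> d f)"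
  let ?mult = "\<lambda>(f, g). n (f \<otimes> g) \<otimes>\<^bsub>W\<^esub> (d f \<otimes>\<^bsub>W\<^esub> d g) \<ominus>\<^bsub>W\<^esub> d (f \<otimes> g) \<otimes>\<^bsub>W\<^esub> (n f \<otimes>\<^bsub>W\<^esub> n g)"
  let ?const = "\<lambda>f. n f \<ominus>\<^bsub>W\<^esub> C (\<kappa> (f 0)) \<otimes>\<^bsub>W\<^esub> d f"
  \<comment> \<open>Denominators must not vanish at the point, numerators of nonzero series must not
    either, and the remaining entries are the required identities after
    cross-multiplication.\<close>
  define Qs where "Qs = n ` S \<union> d ` S \<union> ?add ` {(f, g) \<in> S \<times> S. f \<oplus> g \<in> S} \<union>
    ?mult ` {(f, g) \<in> S \<times> S. f \<otimes> g \<in> S} \<union> ?const ` S"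
  have CkW: "C (\<kappa> (f 0)) \<in> carrier W" if "f \<in> S" for f
    using const_T[of "f 0"] fc[OF that] by simp
  have "finite {(f, g) \<in> S \<times> S. f \<oplus> g \<in> S}" "finite {(f, g) \<in> S \<times> S. f \<otimes> g \<in> S}"
    by (rule finite_subset[OF _ finite_cartesian_product[OF S(1) S(1)]], auto)+
  then have "finite Qs" using S(1) by (simp add: Qs_def)
  moreover have "Qs \<subseteq> carrier W"
    using nW dW CkW by (auto simp: Qs_def)
  ultimately obtain a b where ab: "a \<in> carrier F" "b \<in> carrier F"
    "\<And>Q. Q \<in> Qs \<Longrightarrow> eval2 F a b Q = \<zero>\<^bsub>F\<^esub> \<longleftrightarrow> subst Q = \<zero>"
    using generic_point[OF large] by blast
  define E where "E = eval2 F a b"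
  have Ehom: "E \<in> ring_hom W F" unfolding E_def by (rule F.eval2_hom[OF ab(1,2)])
  interpret E: ring_hom_cring W F E
    by (intro ring_hom_cringI W.cring_axioms F.cring_axioms Ehom)
  have EQ: "E Q = \<zero>\<^bsub>F\<^esub> \<longleftrightarrow> subst Q = \<zero>" if "Q \<in> Qs" for Q using ab(3)[OF that] by (simp add: E_def)
  have Qs_mem: "?add (f, g) \<in> Qs" if "f \<in> S" "g \<in> S" "f \<oplus> g \<in> S" for f g
  proof -
    have "?add (f, g) \<in> ?add ` {(f, g) \<in> S \<times> S. f \<oplus> g \<in> S}" by (rule imageI) (use that in simp)
    then show ?thesis unfolding Qs_def by (rule UnI1[OF UnI1[OF UnI2]])
  qed
  have Qs_mem': "?mult (f, g) \<in> Qs" if "f \<in> S" "g \<in> S" "f \<otimes> g \<in> S" for f g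
  proof -
    have "?mult (f, g) \<in> ?mult ` {(f, g) \<in> S \<times> S. f \<otimes> g \<in> S}" by (rule imageI) (use that in simp)
    then show ?thesis unfolding Qs_def by (rule UnI1[OF UnI2])
  qed
  have Qs_mem'': "?const f \<in> Qs" if "f \<in> S" for f
  proof -
    have "?const f \<in> ?const ` S" by (rule imageI[OF that])
    then show ?thesis unfolding Qs_def by (rule UnI2)
  qed
  have Ed: "E (d f) \<noteq> \<zero>\<^bsub>F\<^esub>" if "f \<in> S" for f
    using EQ[of "d f"] dn[OF that] that by (auto simp: Qs_def)
  have Edc: "E (d f) \<in> carrier F" and Enc: "E (n f) \<in> carrier F" if "f \<in> S" for f
    using E.hom_closed nW dW that by blast+
  have Eadd: "E (n (f \<oplus> g)) \<otimes>\<^bsub>F\<^esub> (E (d f) \<otimes>\<^bsub>F\<^esub> E (d g)) =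
      E (d (f \<oplus> g)) \<otimes>\<^bsub>F\<^esub> (E (n f) \<otimes>\<^bsub>F\<^esub> E (d g) \<oplus>\<^bsub>F\<^esub> E (n g) \<otimes>\<^bsub>F\<^esub> E (d f))"
    if fg: "f \<in> S" "g \<in> S" "f \<oplus> g \<in> S" for f g
  proof -
    have c: "subst (d f) \<in> carrier P" "subst (d g) \<in> carrier P" "subst (d (f \<oplus> g)) \<in> carrier P"
      using dW fg by simp_all
    have "subst (?add (f, g)) = (f \<oplus> g) \<otimes> subst (d (f \<oplus> g)) \<otimes> (subst (d f) \<otimes> subst (d g)) \<ominus>
        subst (d (f \<oplus> g)) \<otimes> (f \<otimes> subst (d f) \<otimes> subst (d g) \<oplus> g \<otimes> subst (d g) \<otimes> subst (d f))"
      using nW dW fg by (simp add: eq a_minus_def)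
    also have "\<dots> = \<zero>" using fc fg c by algebra
    finally have "E (?add (f, g)) = \<zero>\<^bsub>F\<^esub>" using EQ[OF Qs_mem[OF fg]] by blast
    then have "E (n (f \<oplus> g)) \<otimes>\<^bsub>F\<^esub> (E (d f) \<otimes>\<^bsub>F\<^esub> E (d g)) \<ominus>\<^bsub>F\<^esub>
      E (d (f \<oplus> g)) \<otimes>\<^bsub>F\<^esub> (E (n f) \<otimes>\<^bsub>F\<^esub> E (d g) \<oplus>\<^bsub>F\<^esub> E (n g) \<otimes>\<^bsub>F\<^esub> E (d f)) = \<zero>\<^bsub>F\<^esub>"
      using nW dW fg by (simp add: a_minus_def)
    then show ?thesis using Edc Enc fg by (subst (asm) F.r_right_minus_eq) simp_all
  qed
  have Emult: "E (n (f \<otimes> g)) \<otimes>\<^bsub>F\<^esub> (E (d f) \<otimes>\<^bsub>F\<^esub> E (d g)) = E (d (f \<otimes> g)) \<otimes>\<^bsub>F\<^esub> (E (n f) \<otimes>\<^bsub>F\<^esub> E (n g))"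
    if fg: "f \<in> S" "g \<in> S" "f \<otimes> g \<in> S" for f g
  proof -
    have c: "subst (d f) \<in> carrier P" "subst (d g) \<in> carrier P" "subst (d (f \<otimes> g)) \<in> carrier P"
      using dW fg by simp_all
    have "subst (?mult (f, g)) = (f \<otimes> g) \<otimes> subst (d (f \<otimes> g)) \<otimes> (subst (d f) \<otimes> subst (d g)) \<ominus>
        subst (d (f \<otimes> g)) \<otimes> ((f \<otimes> subst (d f)) \<otimes> (g \<otimes> subst (d g)))"
      using nW dW fg by (simp add: eq a_minus_def)
    also have "\<dots> = \<zero>" using fc fg c by algebra
    finally have "E (?mult (f, g)) = \<zero>\<^bsub>F\<^esub>" using EQ[OF Qs_mem'[OF fg]] by blast
    then have "E (n (f \<otimes> g)) \<otimes>\<^bsub>F\<^esub> (E (d f) \<otimes>\<^bsub>F\<^esub> E (d g)) \<ominus>\<^bsub>F\<^esub>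
      E (d (f \<otimes> g)) \<otimes>\<^bsub>F\<^esub> (E (n f) \<otimes>\<^bsub>F\<^esub> E (n g)) = \<zero>\<^bsub>F\<^esub>"
      using nW dW fg by (simp add: a_minus_def)
    then show ?thesis using Edc Enc fg by (subst (asm) F.r_right_minus_eq) simp_all
  qed
  have Econst: "E (n (\<kappa> c)) = c \<otimes>\<^bsub>F\<^esub> E (d (\<kappa> c))" if c: "c \<in> carrier F" "\<kappa> c \<in> S" for c
  proof -
    have kV: "\<kappa> c \<in> carrier V" using const_T c by simp
    have cl: "\<kappa> c \<in> carrier P" "subst (d (\<kappa> c)) \<in> carrier P" using c dW by simp_all
    have "subst (?const (\<kappa> c)) = \<kappa> c \<otimes> subst (d (\<kappa> c)) \<ominus> \<kappa> c \<otimes> subst (d (\<kappa> c))"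
      using nW dW c kV by (simp add: eq a_minus_def)
    also have "\<dots> = \<zero>" using cl by algebra
    finally have "E (?const (\<kappa> c)) = \<zero>\<^bsub>F\<^esub>" using EQ[OF Qs_mem''[OF c(2)]] by blast
    moreover have "E (C (\<kappa> c)) = c"
    proof -
      have "up_eval F a (\<kappa> c) = horner F (map (\<kappa> c) [0..<1]) a"
        by (rule F.up_eval_horner(1)[OF kV ab(1)]) (simp add: ps_const_def)
      also have "\<dots> = c" using c(1) ab(1) by simp
      finally show ?thesis using eval2_C[OF ab(1,2) kV] by (simp add: E_def)
    qed
    ultimately have "E (n (\<kappa> c)) \<ominus>\<^bsub>F\<^esub> c \<otimes>\<^bsub>F\<^esub> E (d (\<kappa> c)) = \<zero>\<^bsub>F\<^esub>"
      using nW dW c kV by (simp add: a_minus_def)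
    then show ?thesis using Edc Enc c by (subst (asm) F.r_right_minus_eq) simp_all
  qed
  define v where "v f = E (n f) \<otimes>\<^bsub>F\<^esub> inv\<^bsub>F\<^esub> E (d f)" for f
  have Eu: "E (d f) \<in> Units F" if "f \<in> S" for f
    using Ed[OF that] Edc[OF that] F.field_Units by simp
  have vc: "v f \<in> carrier F" and vd: "v f \<otimes>\<^bsub>F\<^esub> E (d f) = E (n f)" if "f \<in> S" for f
    using Eu[OF that] Enc[OF that] Edc[OF that] by (simp_all add: v_def F.m_assoc)
  have cancel: "y = z" if "y \<otimes>\<^bsub>F\<^esub> E (d f) = z \<otimes>\<^bsub>F\<^esub> E (d f)" "f \<in> S" "y \<in> carrier F" "z \<in> carrier F" for y z f
    using F.m_rcancel[OF Ed[OF that(2)] Edc[OF that(2)] that(3,4)] that(1) by simp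
  show ?thesis
  proof (intro exI[of _ v], unfold partial_hom_def, intro conjI ballI impI)
    show "v f \<in> carrier F" if "f \<in> S" for f by (rule vc[OF that])
    show "v (\<kappa> c) = c" if "c \<in> carrier F" "\<kappa> c \<in> S" for c
      by (rule cancel[of _ "\<kappa> c"]) (use that vd vc Econst in simp_all)
    show "v f \<noteq> \<zero>\<^bsub>F\<^esub>" if f: "f \<in> S" "f \<noteq> \<zero>" for f
    proof
      assume "v f = \<zero>\<^bsub>F\<^esub>"
      then have "E (n f) = \<zero>\<^bsub>F\<^esub>" using vd[OF f(1)] Edc[OF f(1)] by simp
      then have "subst (n f) = \<zero>" using EQ[of "n f"] f by (auto simp: Qs_def)
      then show False using eq[OF f(1)] dn[OF f(1)] f fc[OF f(1)] dW[OF f(1)] by (simp add: integral_iff)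
    qed
    fix f g assume f: "f \<in> S" and g: "g \<in> S"
    note cl = vc[OF f] vc[OF g] Edc[OF f] Edc[OF g]
    show "v (f \<oplus> g) = v f \<oplus>\<^bsub>F\<^esub> v g" if fg: "f \<oplus> g \<in> S"
    proof -
      note cl' = cl vc[OF fg] Edc[OF fg]
      have "((v (f \<oplus> g) \<otimes>\<^bsub>F\<^esub> E (d f)) \<otimes>\<^bsub>F\<^esub> E (d g)) \<otimes>\<^bsub>F\<^esub> E (d (f \<oplus> g))
          = (v (f \<oplus> g) \<otimes>\<^bsub>F\<^esub> E (d (f \<oplus> g))) \<otimes>\<^bsub>F\<^esub> (E (d f) \<otimes>\<^bsub>F\<^esub> E (d g))"
        using cl' by (simp add: F.m_ac)
      also have "\<dots> = E (d (f \<oplus> g)) \<otimes>\<^bsub>F\<^esub> ((v f \<otimes>\<^bsub>F\<^esub> E (d f)) \<otimes>\<^bsub>F\<^esub> E (d g) \<oplus>\<^bsub>F\<^esub> (v g \<otimes>\<^bsub>F\<^esub> E (d g)) \<otimes>\<^bsub>F\<^esub> E (d f))"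
        unfolding vd[OF fg] vd[OF f] vd[OF g] by (rule Eadd[OF f g fg])
      also have "\<dots> = (((v f \<oplus>\<^bsub>F\<^esub> v g) \<otimes>\<^bsub>F\<^esub> E (d f)) \<otimes>\<^bsub>F\<^esub> E (d g)) \<otimes>\<^bsub>F\<^esub> E (d (f \<oplus> g))"
        using cl' by (simp add: F.m_ac F.l_distr F.r_distr)
      finally have "(v (f \<oplus> g) \<otimes>\<^bsub>F\<^esub> E (d f)) \<otimes>\<^bsub>F\<^esub> E (d g) = ((v f \<oplus>\<^bsub>F\<^esub> v g) \<otimes>\<^bsub>F\<^esub> E (d f)) \<otimes>\<^bsub>F\<^esub> E (d g)"
        by (rule cancel[OF _ fg]) (use cl' in simp_all)
      then have "v (f \<oplus> g) \<otimes>\<^bsub>F\<^esub> E (d f) = (v f \<oplus>\<^bsub>F\<^esub> v g) \<otimes>\<^bsub>F\<^esub> E (d f)"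
        by (rule cancel[OF _ g]) (use cl' in simp_all)
      then show ?thesis by (rule cancel[OF _ f]) (use cl' in simp_all)
    qed
    show "v (f \<otimes> g) = v f \<otimes>\<^bsub>F\<^esub> v g" if fg: "f \<otimes> g \<in> S"
    proof -
      note cl' = cl vc[OF fg] Edc[OF fg]
      have "((v (f \<otimes> g) \<otimes>\<^bsub>F\<^esub> E (d f)) \<otimes>\<^bsub>F\<^esub> E (d g)) \<otimes>\<^bsub>F\<^esub> E (d (f \<otimes> g))
          = (v (f \<otimes> g) \<otimes>\<^bsub>F\<^esub> E (d (f \<otimes> g))) \<otimes>\<^bsub>F\<^esub> (E (d f) \<otimes>\<^bsub>F\<^esub> E (d g))"
        using cl' by (simp add: F.m_ac)
      also have "\<dots> = E (d (f \<otimes> g)) \<otimes>\<^bsub>F\<^esub> ((v f \<otimes>\<^bsub>F\<^esub> E (d f)) \<otimes>\<^bsub>F\<^esub> (v g \<otimes>\<^bsub>F\<^esub> E (d g)))"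
        unfolding vd[OF fg] vd[OF f] vd[OF g] by (rule Emult[OF f g fg])
      also have "\<dots> = (((v f \<otimes>\<^bsub>F\<^esub> v g) \<otimes>\<^bsub>F\<^esub> E (d f)) \<otimes>\<^bsub>F\<^esub> E (d g)) \<otimes>\<^bsub>F\<^esub> E (d (f \<otimes> g))"
        using cl' by (simp add: F.m_ac)
      finally have "(v (f \<otimes> g) \<otimes>\<^bsub>F\<^esub> E (d f)) \<otimes>\<^bsub>F\<^esub> E (d g) = ((v f \<otimes>\<^bsub>F\<^esub> v g) \<otimes>\<^bsub>F\<^esub> E (d f)) \<otimes>\<^bsub>F\<^esub> E (d g)"
        by (rule cancel[OF _ fg]) (use cl' in simp_all)
      then have "v (f \<otimes> g) \<otimes>\<^bsub>F\<^esub> E (d f) = (v f \<otimes>\<^bsub>F\<^esub> v g) \<otimes>\<^bsub>F\<^esub> E (d f)"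
        by (rule cancel[OF _ g]) (use cl' in simp_all)
      then show ?thesis by (rule cancel[OF _ f]) (use cl' in simp_all)
    qed
  qed
qed

context power_series
begin

text \<open>A common algebra contains all the series up to one denominator, and that denominator is
  invertible in the local ring of the plane branch.\<close>

theorem alg_series_partial_hom:
  assumes large: "large_field F" and S: "finite S" "S \<subseteq> alg_series"
  shows "\<exists>v. partial_hom S v"
proof -
  obtain fs where fs: "set fs = S" using finite_list[OF S(1)] by blast
  obtain e B w where B: "etale_at e B" "w \<in> B" "w 0 = \<one>\<^bsub>F\<^esub>" "\<forall>f\<in>S. f \<otimes> w \<in> B"
    using alg_series_common[of fs] S(2) fs by auto
  obtain h where h: "plane_branch F (\<one> \<ominus> e) h" "B \<subseteq> plane_param.loc F (\<one> \<ominus> e)"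
    using etale_plane_branch[OF B(1)] .
  interpret b: plane_branch F P "\<one> \<ominus> e" h
    using h(1) by (simp_all add: P_def)
  note SL = subringE[OF b.loc_subring]
  have BL: "B \<subseteq> b.loc" by (rule h(2))
  have "S \<subseteq> b.loc"
  proof
    fix f assume f: "f \<in> S"
    have fc: "f \<in> carrier P" using f S(2) by (auto simp: alg_series_def)
    have wL: "w \<in> b.loc" and fw: "f \<otimes> w \<in> b.loc" using B(2,4) f BL by auto
    obtain i where i: "i \<in> b.loc" "w \<otimes> i = \<one>" using b.loc_inverse[OF wL] B(3) by auto
    have c: "w \<in> carrier P" "i \<in> carrier P" using wL i SL(1) by auto
    have "f = (f \<otimes> w) \<otimes> i" unfolding m_assoc[OF fc c] i(2) using fc by simp
    then show "f \<in> b.loc" using SL(6)[OF fw i(1)] by simp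
  qed
  then show ?thesis by (rule b.loc_partial_hom[OF large S(1)])
qed

end

section \<open>Elementary equivalence\<close>

lemma finite_tvars: "finite (tvars t)"
  by (induction t) auto

lemma finite_fvars: "finite (fvars p)"
  by (induction p) (auto simp: finite_tvars)

primrec exs :: "nat list \<Rightarrow> rform \<Rightarrow> rform" where
  "exs [] p = p"
| "exs (n # ns) p = Exists n (exs ns p)"

lemma fvars_exs: "fvars (exs ns p) = fvars p - set ns"
  by (induction ns) auto

lemma sat_exsI:
  "(\<And>i. i \<notin> set ns \<Longrightarrow> e' i = e i) \<Longrightarrow> (\<And>i. i \<in> set ns \<Longrightarrow> e' i \<in> carrier K) \<Longrightarrow> sat K e' p \<Longrightarrow> sat K e (exs ns p)"
proof (induction ns arbitrary: e)
  case Nil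
  then have "e' = e" by auto
  with Nil show ?case by simp
next
  case (Cons n ns)
  have "sat K (e(n := e' n)) (exs ns p)"
    by (rule Cons.IH) (use Cons.prems in auto)
  then show ?case using Cons.prems(2)[of n] by auto
qed

lemma sat_exsD:
  "sat K e (exs ns p) \<Longrightarrow> e \<in> UNIV \<rightarrow> carrier K \<Longrightarrow> \<exists>e'\<in>UNIV \<rightarrow> carrier K. sat K e' p"
proof (induction ns arbitrary: e)
  case (Cons n ns)
  then obtain x where "x \<in> carrier K" "sat K (e(n := x)) (exs ns p)" by auto
  moreover have "e(n := x) \<in> UNIV \<rightarrow> carrier K" using Cons.prems(2) \<open>x \<in> carrier K\<close> by auto
  ultimately show ?case using Cons.IH by blast
qed auto

text \<open>Elementary equivalence speaks of sentences; formulas with free variables are transferred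
  through their existential closure.\<close>

lemma elem_equiv_satisfiable:
  assumes eq: "elem_equiv K L" and L: "carrier L \<noteq> {}"
    and e: "e \<in> UNIV \<rightarrow> carrier K" "sat K e p"
  shows "\<exists>e\<in>UNIV \<rightarrow> carrier L. sat L e p"
proof -
  obtain ns where ns: "set ns = fvars p" using finite_list[OF finite_fvars] by blast
  let ?q = "exs ns p"
  have sq: "sentence ?q" by (simp add: sentence_def fvars_exs ns)
  have "sat K e ?q" by (rule sat_exsI[of _ e]) (use e in auto)
  then have "models K ?q" using models_iff_sat[OF sq e(1)] by simp
  then have mL: "models L ?q" using eq sq by (simp add: elem_equiv_def)
  obtain z where z: "z \<in> carrier L" using L by blast
  then have zL: "(\<lambda>_. z) \<in> UNIV \<rightarrow> carrier L" by auto
  have "sat L (\<lambda>_. z) ?q" using models_iff_sat[OF sq zL] mL by simp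
  then show ?thesis using sat_exsD[OF _ zL] by blast
qed

lemma elem_equiv_sym: "elem_equiv K L \<Longrightarrow> elem_equiv L K"
  by (auto simp: elem_equiv_def)

lemma elem_equiv_trans: "elem_equiv K L \<Longrightarrow> elem_equiv L M \<Longrightarrow> elem_equiv K M"
  by (auto simp: elem_equiv_def)

section \<open>First-order formulas for failure of largeness\<close>

primrec horner_term :: "rterm list \<Rightarrow> rterm \<Rightarrow> rterm" where
  "horner_term [] x = Zero"
| "horner_term (c # cs) x = Add c (Mult x (horner_term cs x))"

primrec dhorner_term :: "rterm list \<Rightarrow> rterm \<Rightarrow> rterm" where
  "dhorner_term [] x = Zero"
| "dhorner_term (c # cs) x = Add (horner_term cs x) (Mult x (dhorner_term cs x))"

lemma tval_horner_term: "tval K e (horner_term cs x) = horner K (map (tval K e) cs) (tval K e x)"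
  by (induction cs) auto

lemma tval_dhorner_term: "tval K e (dhorner_term cs x) = dhorner K (map (tval K e) cs) (tval K e x)"
  by (induction cs) (auto simp: tval_horner_term)

primrec conjs :: "rform list \<Rightarrow> rform" where
  "conjs [] = Eq Zero Zero"
| "conjs (p # ps) = Conj p (conjs ps)"

lemma sat_conjs: "sat K e (conjs ps) \<longleftrightarrow> (\<forall>p\<in>set ps. sat K e p)"
  by (induction ps) auto

definition idx :: "nat \<Rightarrow> nat \<Rightarrow> nat \<Rightarrow> nat" where
  "idx k i j = prod_encode (k, prod_encode (i, j))"

lemma idx_eq [simp]: "idx k i j = idx k' i' j' \<longleftrightarrow> k = k' \<and> i = i' \<and> j = j'"
  by (auto simp: idx_def)

text \<open>
  Over a structure with environment \<open>e\<close>, the value \<open>e (idx 0 i j)\<close> is the coefficient of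
  \<open>x\<^sup>jy\<^sup>i\<close>, the values at \<open>idx 1 0 0\<close> and \<open>idx 1 0 1\<close> form the given smooth point, those at
  \<open>idx 1 0 2\<close> and \<open>idx 1 0 3\<close> an arbitrary point, and \<open>idx 2 l _\<close> is the \<open>l\<close>-th point of a list of
  zeros.
\<close>

definition coeffs_env :: "nat list \<Rightarrow> (nat \<Rightarrow> 'a) \<Rightarrow> 'a list list" where
  "coeffs_env ms e = map (\<lambda>i. map (\<lambda>j. e (idx 0 i j)) [0..<ms ! i]) [0..<length ms]"

definition poly_terms :: "nat list \<Rightarrow> rterm \<Rightarrow> rterm list" where
  "poly_terms ms x = map (\<lambda>i. horner_term (map (\<lambda>j. Var (idx 0 i j)) [0..<ms ! i]) x) [0..<length ms]"

lemma tval_poly_terms: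
  "map (tval K e) (poly_terms ms x) = map (\<lambda>cs. horner K cs (tval K e x)) (coeffs_env ms e)"
  by (simp add: poly_terms_def coeffs_env_def tval_horner_term comp_def)

text \<open>A smooth point together with \<open>N\<close> points among which all zeros lie. For
  fixed list lengths \<open>ms\<close> and fixed \<open>N\<close> the failure of largeness is a
  single formula, whereas largeness itself would need infinitely many.\<close>

definition not_large_form :: "nat list \<Rightarrow> nat \<Rightarrow> rform" where
  "not_large_form ms N = (let x = idx 1 0 2; y = idx 1 0 3 in
     Conj (Eq (horner_term (poly_terms ms (Var (idx 1 0 0))) (Var (idx 1 0 1))) Zero)
    (Conj (Neg (Eq (dhorner_term (poly_terms ms (Var (idx 1 0 0))) (Var (idx 1 0 1))) Zero))
      (Neg (Exists x (Exists y (Conj (Eq (horner_term (poly_terms ms (Var x)) (Var y)) Zero)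
        (conjs (map (\<lambda>l. Neg (Conj (Eq (Var x) (Var (idx 2 l 0))) (Eq (Var y) (Var (idx 2 l 1))))) [0..<N]))))))))"

lemma sat_not_large_form:
  fixes K :: "('a, 'm) ring_scheme"
  shows "sat K e (not_large_form ms N) \<longleftrightarrow>
     horner2 K (coeffs_env ms e) (e (idx 1 0 0)) (e (idx 1 0 1)) = \<zero>\<^bsub>K\<^esub> \<and>
     dhorner2 K (coeffs_env ms e) (e (idx 1 0 0)) (e (idx 1 0 1)) \<noteq> \<zero>\<^bsub>K\<^esub> \<and>
     (\<forall>x\<in>carrier K. \<forall>y\<in>carrier K. horner2 K (coeffs_env ms e) x y = \<zero>\<^bsub>K\<^esub> \<longrightarrow>
        (\<exists>l<N. x = e (idx 2 l 0) \<and> y = e (idx 2 l 1)))"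
proof -
  have env: "coeffs_env ms (e(idx (Suc 0) i j := x)) = coeffs_env ms e" for e :: "nat \<Rightarrow> 'a" and i j x
    by (simp add: coeffs_env_def)
  show ?thesis
    by (auto simp: not_large_form_def Let_def tval_horner_term tval_dhorner_term tval_poly_terms
        sat_conjs env horner2_def dhorner2_def Bex_def)
qed

lemma not_large_fieldE:
  assumes "\<not> large_field L" "field L"
  obtains css a b where "set css \<subseteq> lists (carrier L)" "a \<in> carrier L" "b \<in> carrier L"
    "horner2 L css a b = \<zero>\<^bsub>L\<^esub>" "dhorner2 L css a b \<noteq> \<zero>\<^bsub>L\<^esub>"
    "finite {(x, y). x \<in> carrier L \<and> y \<in> carrier L \<and> horner2 L css x y = \<zero>\<^bsub>L\<^esub>}"
proof (rule ccontr)
  assume "\<not> thesis"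
  with that have "infinite {(x, y). x \<in> carrier L \<and> y \<in> carrier L \<and> horner2 L css x y = \<zero>\<^bsub>L\<^esub>}"
    if "set css \<subseteq> lists (carrier L)" "a \<in> carrier L" "b \<in> carrier L"
      "horner2 L css a b = \<zero>\<^bsub>L\<^esub>" "dhorner2 L css a b \<noteq> \<zero>\<^bsub>L\<^esub>" for css a b
    using that by meson
  then have "large_field L" using assms(2) by (simp add: large_field_iff_lists)
  with assms(1) show False ..
qed

lemma large_field_infinite:
  assumes "large_field K" "set css \<subseteq> lists (carrier K)" "a \<in> carrier K" "b \<in> carrier K"
    "horner2 K css a b = \<zero>\<^bsub>K\<^esub>" "dhorner2 K css a b \<noteq> \<zero>\<^bsub>K\<^esub>"
  shows "infinite {(x, y). x \<in> carrier K \<and> y \<in> carrier K \<and> horner2 K css x y = \<zero>\<^bsub>K\<^esub>}"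
  using assms(1)[unfolded large_field_iff_lists] assms(2-6) by blast

text \<open>A counterexample in \<open>L\<close> satisfies one of the formulas
  \<open>not_large_form\<close>; pulled back to \<open>K\<close> it would be a smooth point on a
  curve with finitely many points.\<close>

lemma large_field_elem_equiv:
  assumes K: "large_field K" and L: "field L" and eq: "elem_equiv K L"
  shows "large_field L"
proof (rule ccontr)
  interpret L: field L by fact
  interpret K: field K using K by (simp add: large_field_def)
  assume nl: "\<not> large_field L"
  obtain css a b where css: "set css \<subseteq> lists (carrier L)" and ab: "a \<in> carrier L" "b \<in> carrier L"
    and s: "horner2 L css a b = \<zero>\<^bsub>L\<^esub>" "dhorner2 L css a b \<noteq> \<zero>\<^bsub>L\<^esub>"
    and fin: "finite {(x, y). x \<in> carrier L \<and> y \<in> carrier L \<and> horner2 L css x y = \<zero>\<^bsub>L\<^esub>}" (is "finite ?Z")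
    by (rule not_large_fieldE[OF nl L])
  obtain zs where zs: "set zs = ?Z" using finite_list[OF fin] by blast
  define ms where "ms = map length css"
  \<comment> \<open>The assignment decodes a variable into its triple of indices; zero fills the
    variables without a meaning.\<close>
  define e where "e n = (case prod_decode n of (k, m) \<Rightarrow> case prod_decode m of (i, j) \<Rightarrow>
      if k = 0 then (if i < length css \<and> j < length (css ! i) then css ! i ! j else \<zero>\<^bsub>L\<^esub>)
      else if k = 1 then (if j = 0 then a else b)
      else if i < length zs then (if j = 0 then fst (zs ! i) else snd (zs ! i)) else \<zero>\<^bsub>L\<^esub>)" for n
  have e_idx: "e (idx k i j) = (if k = 0 then (if i < length css \<and> j < length (css ! i) then css ! i ! j else \<zero>\<^bsub>L\<^esub>)
      else if k = 1 then (if j = 0 then a else b)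
      else if i < length zs then (if j = 0 then fst (zs ! i) else snd (zs ! i)) else \<zero>\<^bsub>L\<^esub>)" for k i j
    by (simp add: e_def idx_def)
  have zsc: "fst (zs ! i) \<in> carrier L" "snd (zs ! i) \<in> carrier L" if "i < length zs" for i
    using nth_mem[OF that] unfolding zs by auto
  have cssc: "css ! i ! j \<in> carrier L" if "i < length css" "j < length (css ! i)" for i j
    using nth_mem[OF that(1)] nth_mem[OF that(2)] css by auto
  have ec: "e \<in> UNIV \<rightarrow> carrier L"
    using zsc cssc ab by (auto simp: e_def split: prod.split)
  have ce: "coeffs_env ms e = css"
  proof (rule nth_equalityI)
    show "length (coeffs_env ms e) = length css" by (simp add: coeffs_env_def ms_def)
    fix i assume "i < length (coeffs_env ms e)"
    then have i: "i < length css" by (simp add: coeffs_env_def ms_def)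
    then have "coeffs_env ms e ! i = map (\<lambda>j. e (idx 0 i j)) [0..<length (css ! i)]"
      by (simp add: coeffs_env_def ms_def)
    also have "\<dots> = css ! i" using i by (intro nth_equalityI) (simp_all add: e_idx)
    finally show "coeffs_env ms e ! i = css ! i" .
  qed
  have "sat L e (not_large_form ms (length zs))"
    unfolding sat_not_large_form ce
  proof (intro conjI ballI impI)
    have a: "e (idx 1 0 0) = a" and b: "e (idx 1 0 1) = b" by (simp_all add: e_idx)
    show "horner2 L css (e (idx 1 0 0)) (e (idx 1 0 1)) = \<zero>\<^bsub>L\<^esub>" unfolding a b by (rule s(1))
    show "dhorner2 L css (e (idx 1 0 0)) (e (idx 1 0 1)) \<noteq> \<zero>\<^bsub>L\<^esub>" unfolding a b by (rule s(2))
    fix x y assume "x \<in> carrier L" "y \<in> carrier L" "horner2 L css x y = \<zero>\<^bsub>L\<^esub>"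
    then have "(x, y) \<in> set zs" unfolding zs by blast
    then obtain l where l: "l < length zs" "zs ! l = (x, y)" unfolding in_set_conv_nth by blast
    have "x = e (idx 2 l 0)" "y = e (idx 2 l 1)" using l by (simp_all add: e_idx)
    then show "\<exists>l<length zs. x = e (idx 2 l 0) \<and> y = e (idx 2 l 1)" using l(1) by blast
  qed
  then obtain e' where e': "e' \<in> UNIV \<rightarrow> carrier K" "sat K e' (not_large_form ms (length zs))"
    using elem_equiv_satisfiable[OF elem_equiv_sym[OF eq] _ ec] K.carrier_not_empty by blast
  let ?css = "coeffs_env ms e'"
  have "set ?css \<subseteq> lists (carrier K)" using e'(1) by (auto simp: coeffs_env_def Pi_iff)
  then have "infinite {(x, y). x \<in> carrier K \<and> y \<in> carrier K \<and> horner2 K ?css x y = \<zero>\<^bsub>K\<^esub>}"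
  proof (rule large_field_infinite[OF K])
    show "e' (idx 1 0 0) \<in> carrier K" "e' (idx 1 0 1) \<in> carrier K" using e'(1) by auto
  qed (use e'(2)[unfolded sat_not_large_form] in blast)+
  moreover have "{(x, y). x \<in> carrier K \<and> y \<in> carrier K \<and> horner2 K ?css x y = \<zero>\<^bsub>K\<^esub>}
      \<subseteq> (\<lambda>l. (e' (idx 2 l 0), e' (idx 2 l 1))) ` {..<length zs}"
    using e'(2) unfolding sat_not_large_form by auto
  ultimately show False using finite_subset by blast
qed

section \<open>Ultrapowers\<close>

text \<open>Containing all tails rules out principal ultrafilters and provides the condition that
  the index be large, on which the diagonal argument for saturation rests.\<close>

definition free_ultrafilter :: "nat set set \<Rightarrow> bool" where
  "free_ultrafilter U \<longleftrightarrow> {} \<notin> U \<and> (\<forall>n. {n..} \<in> U) \<and> (\<forall>A B. A \<in> U \<longrightarrow> B \<in> U \<longrightarrow> A \<inter> B \<in> U) \<and>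
     (\<forall>A B. A \<in> U \<longrightarrow> A \<subseteq> B \<longrightarrow> B \<in> U) \<and> (\<forall>A. A \<in> U \<or> - A \<in> U)"

lemma free_ultrafilter_exists: "\<exists>U. free_ultrafilter U"
proof -
  define pf where "pf U \<longleftrightarrow> {} \<notin> U \<and> (\<forall>n. {n..} \<in> U) \<and> (\<forall>A B. A \<in> U \<longrightarrow> B \<in> U \<longrightarrow> A \<inter> B \<in> U) \<and>
     (\<forall>A B. A \<in> U \<longrightarrow> A \<subseteq> B \<longrightarrow> B \<in> U)" for U :: "nat set set"
  have pfI: "pf U" if "{} \<notin> U" "\<And>n. {n..} \<in> U" "\<And>A B. A \<in> U \<Longrightarrow> B \<in> U \<Longrightarrow> A \<inter> B \<in> U"
      "\<And>A B. A \<in> U \<Longrightarrow> A \<subseteq> B \<Longrightarrow> B \<in> U" for U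
    using that unfolding pf_def by simp
  have pfD: "{} \<notin> U" "\<And>n. {n..} \<in> U" "\<And>A B. A \<in> U \<Longrightarrow> B \<in> U \<Longrightarrow> A \<inter> B \<in> U"
      "\<And>A B. A \<in> U \<Longrightarrow> A \<subseteq> B \<Longrightarrow> B \<in> U" if "pf U" for U
    using that unfolding pf_def by simp_all
  have "pf {A. \<exists>n. {n..} \<subseteq> A}"
  proof (rule pfI)
    fix A B :: "nat set" assume "A \<in> {A. \<exists>n. {n..} \<subseteq> A}" "B \<in> {A. \<exists>n. {n..} \<subseteq> A}"
    then obtain n m where "{n..} \<subseteq> A" "{m..} \<subseteq> B" by auto
    then have "{max n m..} \<subseteq> A \<inter> B" by auto
    then show "A \<inter> B \<in> {A. \<exists>n. {n..} \<subseteq> A}" by blast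
  qed auto
  then have "Collect pf \<noteq> {}" by blast
  moreover have "\<Union>C \<in> Collect pf" if C: "C \<noteq> {}" "subset.chain (Collect pf) C" for C
  proof -
    have CF: "pf U" if "U \<in> C" for U using C(2) that unfolding subset.chain_def by blast
    obtain U0 where U0: "U0 \<in> C" using C(1) by blast
    have "pf (\<Union>C)"
    proof (rule pfI)
      show "{} \<notin> \<Union>C" using pfD(1)[OF CF] by blast
      show "{n..} \<in> \<Union>C" for n using pfD(2)[OF CF[OF U0]] U0 by blast
      fix A B assume A: "A \<in> \<Union>C"
      then obtain U where U: "U \<in> C" "A \<in> U" by blast
      show "B \<in> \<Union>C" if "A \<subseteq> B" using pfD(4)[OF CF[OF U(1)] U(2) that] U(1) by blast
      assume "B \<in> \<Union>C"
      then obtain V where V: "V \<in> C" "B \<in> V" by blast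
      have "U \<subseteq> V \<or> V \<subseteq> U" using C(2) U(1) V(1) unfolding subset.chain_def by blast
      then show "A \<inter> B \<in> \<Union>C"
      proof
        assume "U \<subseteq> V"
        then have "A \<inter> B \<in> V" using pfD(3)[OF CF[OF V(1)]] U V by blast
        then show ?thesis using V(1) by blast
      next
        assume "V \<subseteq> U"
        then have "A \<inter> B \<in> U" using pfD(3)[OF CF[OF U(1)]] U V by blast
        then show ?thesis using U(1) by blast
      qed
    qed
    then show ?thesis by simp
  qed
  ultimately obtain U where U: "pf U" "\<And>V. pf V \<Longrightarrow> U \<subseteq> V \<Longrightarrow> V = U"
    using subset_Zorn_nonempty[of "Collect pf"] by auto
  note PU = pfD[OF U(1)]
  have "A \<in> U \<or> - A \<in> U" for A
  proof (rule ccontr)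
    assume nA: "\<not> (A \<in> U \<or> - A \<in> U)"
    \<comment> \<open>The filter generated by \<open>U\<close> and \<open>A\<close>. It is proper
      because the complement of \<open>A\<close> is not in \<open>U\<close>, so maximality puts
      \<open>A\<close> into \<open>U\<close>.\<close>
    define V where "V = {B. \<exists>Z\<in>U. Z \<inter> A \<subseteq> B}"
    have UV: "U \<subseteq> V" unfolding V_def by blast
    have "pf V"
    proof (rule pfI)
      show "{} \<notin> V"
      proof
        assume "{} \<in> V"
        then obtain Z where "Z \<in> U" "Z \<subseteq> - A" unfolding V_def by blast
        then have "- A \<in> U" by (rule PU(4))
        with nA show False by blast
      qed
      show "{n..} \<in> V" for n using PU(2) UV by blast
      fix B B' assume "B \<in> V"
      then obtain Z where Z: "Z \<in> U" "Z \<inter> A \<subseteq> B" unfolding V_def by blast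
      show "B' \<in> V" if "B \<subseteq> B'" using Z that unfolding V_def by blast
      assume "B' \<in> V"
      then obtain Z' where Z': "Z' \<in> U" "Z' \<inter> A \<subseteq> B'" unfolding V_def by blast
      have "Z \<inter> Z' \<in> U" using PU(3) Z(1) Z'(1) .
      moreover have "(Z \<inter> Z') \<inter> A \<subseteq> B \<inter> B'" using Z(2) Z'(2) by blast
      ultimately show "B \<inter> B' \<in> V" unfolding V_def by blast
    qed
    then have "V = U" using U(2) UV by blast
    moreover have "UNIV \<in> U" using PU(4)[OF PU(2)[of 0]] by simp
    then have "A \<in> V" unfolding V_def by blast
    ultimately show False using nA by blast
  qed
  then have "free_ultrafilter U" using U(1) unfolding pf_def free_ultrafilter_def by simp
  then show ?thesis by blast
qed

section \<open>The ultrapower over the natural numbers\<close>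

locale ultrapower = K: field K for K :: "('a, 'm) ring_scheme" +
  fixes U
  assumes U: "free_ultrafilter U"
begin

definition ae :: "(nat \<Rightarrow> bool) \<Rightarrow> bool" where
  "ae P \<longleftrightarrow> {k. P k} \<in> U"

lemma ae_mono: "ae P \<Longrightarrow> (\<And>k. P k \<Longrightarrow> Q k) \<Longrightarrow> ae Q"
proof -
  assume "ae P" "\<And>k. P k \<Longrightarrow> Q k"
  moreover from this have "{k. P k} \<subseteq> {k. Q k}" by blast
  ultimately show "ae Q" using U unfolding ae_def free_ultrafilter_def by blast
qed

lemma ae_conj: "ae (\<lambda>k. P k \<and> Q k) \<longleftrightarrow> ae P \<and> ae Q"
proof
  assume "ae (\<lambda>k. P k \<and> Q k)"
  then show "ae P \<and> ae Q" using ae_mono[of "\<lambda>k. P k \<and> Q k"] by blast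
next
  assume "ae P \<and> ae Q"
  then have "{k. P k} \<inter> {k. Q k} \<in> U" using U unfolding ae_def free_ultrafilter_def by blast
  then show "ae (\<lambda>k. P k \<and> Q k)" by (simp add: ae_def Collect_conj_eq)
qed

lemma ae_not: "ae (\<lambda>k. \<not> P k) \<longleftrightarrow> \<not> ae P"
proof -
  have "ae P \<or> ae (\<lambda>k. \<not> P k)" using U unfolding ae_def free_ultrafilter_def Collect_neg_eq by blast
  moreover have "\<not> ae (\<lambda>k. False)" using U by (simp add: ae_def free_ultrafilter_def)
  then have "\<not> ae (\<lambda>k. P k \<and> \<not> P k)" by simp
  ultimately show ?thesis unfolding ae_conj by blast
qed

lemma ae_ge: "ae (\<lambda>k. n \<le> k)"
  using U by (simp add: ae_def free_ultrafilter_def atLeast_def)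

lemma ae_all: "(\<And>k. P k) \<Longrightarrow> ae P"
  by (rule ae_mono[OF ae_ge[of 0]])

lemma ae_mp2:
  assumes "ae P" "ae Q" "\<And>k. P k \<Longrightarrow> Q k \<Longrightarrow> R k"
  shows "ae R"
proof (rule ae_mono)
  show "ae (\<lambda>k. P k \<and> Q k)" using assms(1,2) by (simp add: ae_conj)
qed (use assms(3) in blast)

definition seqs :: "(nat \<Rightarrow> 'a) set" where
  "seqs = UNIV \<rightarrow> carrier K"

text \<open>A chosen representative stands for the class of \<open>f\<close>. The choice depends on
  the class only, and the ultrapower remains a set of sequences instead of a set of sets.\<close>

definition rep :: "(nat \<Rightarrow> 'a) \<Rightarrow> nat \<Rightarrow> 'a" where
  "rep f = (SOME g. g \<in> seqs \<and> ae (\<lambda>k. f k = g k))"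

lemma rep:
  assumes "f \<in> seqs"
  shows "rep f \<in> seqs" "ae (\<lambda>k. f k = rep f k)"
proof -
  have "ae (\<lambda>k. f k = f k)" by (rule ae_all) (rule refl)
  then have "\<exists>g. g \<in> seqs \<and> ae (\<lambda>k. f k = g k)" using assms by blast
  then have "rep f \<in> seqs \<and> ae (\<lambda>k. f k = rep f k)" unfolding rep_def by (rule someI_ex)
  then show "rep f \<in> seqs" "ae (\<lambda>k. f k = rep f k)" by blast+
qed

lemma rep_eq_iff:
  assumes "f \<in> seqs" "g \<in> seqs"
  shows "rep f = rep g \<longleftrightarrow> ae (\<lambda>k. f k = g k)"
proof
  assume "rep f = rep g"
  then show "ae (\<lambda>k. f k = g k)"
    by (intro ae_mp2[OF rep(2)[OF assms(1)] rep(2)[OF assms(2)]]) simp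
next
  assume fg: "ae (\<lambda>k. f k = g k)"
  have "ae (\<lambda>k. f k = h k) \<longleftrightarrow> ae (\<lambda>k. g k = h k)" for h
  proof
    show "ae (\<lambda>k. g k = h k)" if "ae (\<lambda>k. f k = h k)" by (rule ae_mp2[OF fg that]) simp
    show "ae (\<lambda>k. f k = h k)" if "ae (\<lambda>k. g k = h k)" by (rule ae_mp2[OF fg that]) simp
  qed
  then show "rep f = rep g" by (simp add: rep_def)
qed

lemma rep_rep:
  assumes "f \<in> seqs"
  shows "rep (rep f) = rep f"
  unfolding rep_eq_iff[OF rep(1)[OF assms] assms]
  by (rule ae_mono[OF rep(2)[OF assms]]) simp

definition upow :: "(nat \<Rightarrow> 'a) ring" where
  "upow = \<lparr>carrier = rep ` seqs,
     monoid.mult = (\<lambda>x y. rep (\<lambda>k. x k \<otimes>\<^bsub>K\<^esub> y k)), one = rep (\<lambda>k. \<one>\<^bsub>K\<^esub>),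
     zero = rep (\<lambda>k. \<zero>\<^bsub>K\<^esub>), add = (\<lambda>x y. rep (\<lambda>k. x k \<oplus>\<^bsub>K\<^esub> y k))\<rparr>"

lemma seqs_closed:
  "f \<in> seqs \<Longrightarrow> g \<in> seqs \<Longrightarrow> (\<lambda>k. f k \<otimes>\<^bsub>K\<^esub> g k) \<in> seqs"
  "f \<in> seqs \<Longrightarrow> g \<in> seqs \<Longrightarrow> (\<lambda>k. f k \<oplus>\<^bsub>K\<^esub> g k) \<in> seqs"
  "f \<in> seqs \<Longrightarrow> (\<lambda>k. \<ominus>\<^bsub>K\<^esub> f k) \<in> seqs"
  "c \<in> carrier K \<Longrightarrow> (\<lambda>k. c) \<in> seqs"
  by (auto simp: seqs_def)

lemma seqs_at: "f \<in> seqs \<Longrightarrow> f k \<in> carrier K"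
  by (auto simp: seqs_def)

lemma upow_rep:
  assumes "f \<in> seqs" "g \<in> seqs"
  shows "rep f \<otimes>\<^bsub>upow\<^esub> rep g = rep (\<lambda>k. f k \<otimes>\<^bsub>K\<^esub> g k)"
    and "rep f \<oplus>\<^bsub>upow\<^esub> rep g = rep (\<lambda>k. f k \<oplus>\<^bsub>K\<^esub> g k)"
proof -
  note r = rep(1)[OF assms(1)] rep(1)[OF assms(2)]
  have "rep (\<lambda>k. rep f k \<otimes>\<^bsub>K\<^esub> rep g k) = rep (\<lambda>k. f k \<otimes>\<^bsub>K\<^esub> g k)"
    unfolding rep_eq_iff[OF seqs_closed(1)[OF r] seqs_closed(1)[OF assms]]
    by (rule ae_mp2[OF rep(2)[OF assms(1)] rep(2)[OF assms(2)]]) simp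
  then show "rep f \<otimes>\<^bsub>upow\<^esub> rep g = rep (\<lambda>k. f k \<otimes>\<^bsub>K\<^esub> g k)" by (simp add: upow_def)
  have "rep (\<lambda>k. rep f k \<oplus>\<^bsub>K\<^esub> rep g k) = rep (\<lambda>k. f k \<oplus>\<^bsub>K\<^esub> g k)"
    unfolding rep_eq_iff[OF seqs_closed(2)[OF r] seqs_closed(2)[OF assms]]
    by (rule ae_mp2[OF rep(2)[OF assms(1)] rep(2)[OF assms(2)]]) simp
  then show "rep f \<oplus>\<^bsub>upow\<^esub> rep g = rep (\<lambda>k. f k \<oplus>\<^bsub>K\<^esub> g k)" by (simp add: upow_def)
qed

lemma upow_simps:
  "\<one>\<^bsub>upow\<^esub> = rep (\<lambda>k. \<one>\<^bsub>K\<^esub>)" "\<zero>\<^bsub>upow\<^esub> = rep (\<lambda>k. \<zero>\<^bsub>K\<^esub>)" "carrier upow = rep ` seqs"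
  by (simp_all add: upow_def)

lemma upow_cring: "cring upow"
proof (intro cringI abelian_groupI comm_monoidI)
  fix x y z assume "x \<in> carrier upow" "y \<in> carrier upow" "z \<in> carrier upow"
  then obtain f g h where f: "x = rep f" "f \<in> seqs" and g: "y = rep g" "g \<in> seqs" and h: "z = rep h" "h \<in> seqs"
    by (auto simp: upow_simps)
  note c = f(2) g(2) h(2)
  note s = c[THEN seqs_at]
  show "x \<oplus>\<^bsub>upow\<^esub> y \<oplus>\<^bsub>upow\<^esub> z = x \<oplus>\<^bsub>upow\<^esub> (y \<oplus>\<^bsub>upow\<^esub> z)"
    using c s by (simp add: f(1) g(1) h(1) upow_rep seqs_closed K.a_assoc)
  show "x \<otimes>\<^bsub>upow\<^esub> y \<otimes>\<^bsub>upow\<^esub> z = x \<otimes>\<^bsub>upow\<^esub> (y \<otimes>\<^bsub>upow\<^esub> z)"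
    using c s by (simp add: f(1) g(1) h(1) upow_rep seqs_closed K.m_assoc)
  show "(x \<oplus>\<^bsub>upow\<^esub> y) \<otimes>\<^bsub>upow\<^esub> z = x \<otimes>\<^bsub>upow\<^esub> z \<oplus>\<^bsub>upow\<^esub> y \<otimes>\<^bsub>upow\<^esub> z"
    using c s by (simp add: f(1) g(1) h(1) upow_rep seqs_closed K.l_distr)
next
  fix x y assume "x \<in> carrier upow" "y \<in> carrier upow"
  then obtain f g where f: "x = rep f" "f \<in> seqs" and g: "y = rep g" "g \<in> seqs"
    by (auto simp: upow_simps)
  note c = f(2) g(2)
  note s = c[THEN seqs_at]
  show "x \<oplus>\<^bsub>upow\<^esub> y \<in> carrier upow" "x \<otimes>\<^bsub>upow\<^esub> y \<in> carrier upow"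
    using c by (auto simp: f(1) g(1) upow_rep seqs_closed upow_simps)
  show "x \<oplus>\<^bsub>upow\<^esub> y = y \<oplus>\<^bsub>upow\<^esub> x" "x \<otimes>\<^bsub>upow\<^esub> y = y \<otimes>\<^bsub>upow\<^esub> x"
    using c s by (simp_all add: f(1) g(1) upow_rep K.a_comm K.m_comm)
next
  fix x assume "x \<in> carrier upow"
  then obtain f where f: "x = rep f" "f \<in> seqs" by (auto simp: upow_simps)
  note s = f(2)[THEN seqs_at]
  show "\<zero>\<^bsub>upow\<^esub> \<oplus>\<^bsub>upow\<^esub> x = x" "\<one>\<^bsub>upow\<^esub> \<otimes>\<^bsub>upow\<^esub> x = x"
    using f(2) s by (simp_all add: f(1) upow_simps upow_rep seqs_closed)
  have "rep (\<lambda>k. \<ominus>\<^bsub>K\<^esub> f k) \<oplus>\<^bsub>upow\<^esub> x = \<zero>\<^bsub>upow\<^esub>"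
    using f(2) s by (simp add: f(1) upow_simps upow_rep seqs_closed K.l_neg)
  then show "\<exists>y\<in>carrier upow. y \<oplus>\<^bsub>upow\<^esub> x = \<zero>\<^bsub>upow\<^esub>"
    using seqs_closed(3)[OF f(2)] by (auto simp: upow_simps)
qed (simp_all add: upow_simps seqs_closed)

lemma upow_field: "field upow"
proof (rule cring.cring_fieldI2[OF upow_cring])
  have "\<not> ae (\<lambda>k. \<zero>\<^bsub>K\<^esub> = \<one>\<^bsub>K\<^esub>)" using ae_not[of "\<lambda>k. \<zero>\<^bsub>K\<^esub> = \<one>\<^bsub>K\<^esub>"] ae_all[of "\<lambda>k. \<zero>\<^bsub>K\<^esub> \<noteq> \<one>\<^bsub>K\<^esub>"] K.zero_not_one by blast
  then show "\<zero>\<^bsub>upow\<^esub> \<noteq> \<one>\<^bsub>upow\<^esub>" by (simp add: upow_simps rep_eq_iff seqs_closed)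
  fix x assume x: "x \<in> carrier upow" "x \<noteq> \<zero>\<^bsub>upow\<^esub>"
  then obtain f where f: "x = rep f" "f \<in> seqs" by (auto simp: upow_simps)
  note s = f(2)[THEN seqs_at]
  have nz: "ae (\<lambda>k. f k \<noteq> \<zero>\<^bsub>K\<^esub>)"
    using x(2) unfolding ae_not by (simp add: f upow_simps rep_eq_iff seqs_closed)
  define g where "g k = (if f k = \<zero>\<^bsub>K\<^esub> then \<zero>\<^bsub>K\<^esub> else inv\<^bsub>K\<^esub> f k)" for k
  have u: "f k \<in> Units K" if "f k \<noteq> \<zero>\<^bsub>K\<^esub>" for k using that s K.field_Units by simp
  have g: "g \<in> seqs" using u by (auto simp: seqs_def g_def)
  have "ae (\<lambda>k. f k \<otimes>\<^bsub>K\<^esub> g k = \<one>\<^bsub>K\<^esub>)" by (rule ae_mono[OF nz]) (use u in \<open>simp add: g_def\<close>)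
  then have "x \<otimes>\<^bsub>upow\<^esub> rep g = \<one>\<^bsub>upow\<^esub>"
    using f g by (simp add: upow_rep upow_simps rep_eq_iff seqs_closed)
  then show "\<exists>y\<in>carrier upow. x \<otimes>\<^bsub>upow\<^esub> y = \<one>\<^bsub>upow\<^esub>" using g by (auto simp: upow_simps)
qed

lemma tval_upow:
  assumes "\<And>i. e i \<in> seqs"
  shows "tval upow (\<lambda>i. rep (e i)) t = rep (\<lambda>k. tval K (\<lambda>i. e i k) t) \<and> (\<lambda>k. tval K (\<lambda>i. e i k) t) \<in> seqs"
proof (induction t)
  case (Minus t)
  interpret P: cring upow by (rule upow_cring)
  let ?f = "\<lambda>k. tval K (\<lambda>i. e i k) t"
  from Minus have f: "?f \<in> seqs" "tval upow (\<lambda>i. rep (e i)) t = rep ?f" by auto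
  have "\<ominus>\<^bsub>upow\<^esub> rep ?f = rep (\<lambda>k. \<ominus>\<^bsub>K\<^esub> ?f k)"
  proof (rule P.minus_equality)
    show "rep (\<lambda>k. \<ominus>\<^bsub>K\<^esub> ?f k) \<oplus>\<^bsub>upow\<^esub> rep ?f = \<zero>\<^bsub>upow\<^esub>"
      using f(1) seqs_at[OF f(1)] by (simp add: upow_rep seqs_closed(3) upow_simps K.l_neg)
  qed (use f(1) seqs_closed(3)[OF f(1)] in \<open>auto simp: upow_simps\<close>)
  then show ?case using f seqs_closed(3)[OF f(1)] by simp
qed (use assms in \<open>auto simp: upow_simps upow_rep seqs_closed\<close>)

theorem los:
  assumes "\<And>i. e i \<in> seqs"
  shows "sat upow (\<lambda>i. rep (e i)) p \<longleftrightarrow> ae (\<lambda>k. sat K (\<lambda>i. e i k) p)"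
  using assms
proof (induction p arbitrary: e)
  case (Eq s t)
  show ?case using tval_upow[of e, OF Eq] by (simp add: rep_eq_iff)
next
  case (Neg p)
  then show ?case by (simp add: ae_not)
next
  case (Conj p q)
  then show ?case by (simp add: ae_conj)
next
  case (Exists n p)
  have upd: "(\<lambda>i. rep (e i))(n := rep g) = (\<lambda>i. rep ((e(n := g)) i))" for g by auto
  have upd': "(\<lambda>i. e i k)(n := g k) = (\<lambda>i. (e(n := g)) i k)" for g k by auto
  have IH: "sat upow ((\<lambda>i. rep (e i))(n := rep g)) p \<longleftrightarrow> ae (\<lambda>k. sat K ((\<lambda>i. e i k)(n := g k)) p)" if "g \<in> seqs" for g
    unfolding upd upd' by (rule Exists.IH) (use Exists.prems that in auto)
  show ?case
  proof
    assume "sat upow (\<lambda>i. rep (e i)) (Exists n p)"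
    then obtain g where g: "g \<in> seqs" "sat upow ((\<lambda>i. rep (e i))(n := rep g)) p" by (auto simp: upow_simps)
    then have "ae (\<lambda>k. sat K ((\<lambda>i. e i k)(n := g k)) p)" using IH by simp
    then show "ae (\<lambda>k. sat K (\<lambda>i. e i k) (Exists n p))"
      by (rule ae_mono) (use seqs_at[OF g(1)] in auto)
  next
    assume A: "ae (\<lambda>k. sat K (\<lambda>i. e i k) (Exists n p))"
    \<comment> \<open>Witnesses are chosen index by index; the default zero is used only on an index
      set outside the ultrafilter.\<close>
    define g where "g k = (if \<exists>x\<in>carrier K. sat K ((\<lambda>i. e i k)(n := x)) p
      then SOME x. x \<in> carrier K \<and> sat K ((\<lambda>i. e i k)(n := x)) p else \<zero>\<^bsub>K\<^esub>)" for k
    have g: "g k \<in> carrier K \<and> sat K ((\<lambda>i. e i k)(n := g k)) p"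
      if "\<exists>x\<in>carrier K. sat K ((\<lambda>i. e i k)(n := x)) p" for k
    proof -
      from that have "\<exists>x. x \<in> carrier K \<and> sat K ((\<lambda>i. e i k)(n := x)) p" by blast
      from someI_ex[OF this] show ?thesis using that by (simp add: g_def)
    qed
    have "g k \<in> carrier K" for k using g[of k] by (cases "\<exists>x\<in>carrier K. sat K ((\<lambda>i. e i k)(n := x)) p") (auto simp: g_def)
    then have gs: "g \<in> seqs" by (simp add: seqs_def)
    have "ae (\<lambda>k. sat K ((\<lambda>i. e i k)(n := g k)) p)" by (rule ae_mono[OF A]) (use g in simp)
    then have "sat upow ((\<lambda>i. rep (e i))(n := rep g)) p" using IH[OF gs] by simp
    then show "sat upow (\<lambda>i. rep (e i)) (Exists n p)" using gs by (auto simp: upow_simps)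
  qed
qed

lemma elem_equiv_upow: "elem_equiv K upow"
  unfolding elem_equiv_def
proof (intro allI impI)
  fix p assume p: "sentence p"
  let ?z = "\<lambda>k::nat. \<zero>\<^bsub>K\<^esub>"
  have z: "?z \<in> seqs" by (simp add: seqs_closed)
  have 1: "(\<lambda>i. \<zero>\<^bsub>K\<^esub>) \<in> UNIV \<rightarrow> carrier K" by simp
  have 2: "(\<lambda>i::nat. rep ?z) \<in> UNIV \<rightarrow> carrier upow" using z by (simp add: upow_simps)
  have "sat upow (\<lambda>i. rep ?z) p \<longleftrightarrow> ae (\<lambda>k. sat K (\<lambda>i. \<zero>\<^bsub>K\<^esub>) p)" using los[of "\<lambda>i. ?z" p] z by simp
  also have "\<dots> \<longleftrightarrow> sat K (\<lambda>i. \<zero>\<^bsub>K\<^esub>) p"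
    using ae_all[of "\<lambda>k. sat K (\<lambda>i. \<zero>\<^bsub>K\<^esub>) p"] ae_all[of "\<lambda>k. \<not> sat K (\<lambda>i. \<zero>\<^bsub>K\<^esub>) p"] ae_not[of "\<lambda>k. sat K (\<lambda>i. \<zero>\<^bsub>K\<^esub>) p"] by blast
  finally show "models K p \<longleftrightarrow> models upow p"
    using models_iff_sat[OF p 1] models_iff_sat[OF p 2] by simp
qed

end

text \<open>Countable saturation for countably many unknowns at once: the variables in
  \<open>A\<close> are parameters with values prescribed by \<open>e\<close>, all others are
  unknowns, and finite satisfiability is stated for initial segments of the sequence of
  formulas.\<close>

definition saturated :: "('a, 'm) ring_scheme \<Rightarrow> bool" where
  "saturated F \<longleftrightarrow> (\<forall>e\<in>UNIV \<rightarrow> carrier F. \<forall>A. \<forall>\<Phi>::nat \<Rightarrow> rform.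
     (\<forall>n. \<exists>e'\<in>UNIV \<rightarrow> carrier F. (\<forall>i\<in>A. e' i = e i) \<and> (\<forall>j<n. sat F e' (\<Phi> j))) \<longrightarrow>
     (\<exists>e'\<in>UNIV \<rightarrow> carrier F. (\<forall>i\<in>A. e' i = e i) \<and> (\<forall>j. sat F e' (\<Phi> j))))"

context ultrapower
begin

text \<open>Diagonalisation: \<open>E n\<close> solves the first n formulas, and coordinate
  \<open>k\<close> of the limit is taken from the best solution that coordinate can confirm.\<close>

lemma saturated_upow: "saturated upow"
  unfolding saturated_def
proof (intro ballI allI impI)
  fix e :: "nat \<Rightarrow> nat \<Rightarrow> 'a" and A and \<Phi> :: "nat \<Rightarrow> rform"
  assume e: "e \<in> UNIV \<rightarrow> carrier upow"
    and fin: "\<forall>n. \<exists>e'\<in>UNIV \<rightarrow> carrier upow. (\<forall>i\<in>A. e' i = e i) \<and> (\<forall>j<n. sat upow e' (\<Phi> j))"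
  have cs: "x \<in> seqs" "rep x = x" if "x \<in> carrier upow" for x
    using that rep(1) rep_rep by (auto simp: upow_simps)
  obtain E where E: "\<And>n. E n \<in> UNIV \<rightarrow> carrier upow" "\<And>n i. i \<in> A \<Longrightarrow> E n i = e i"
    "\<And>n j. j < n \<Longrightarrow> sat upow (E n) (\<Phi> j)"
    using fin by metis
  have Es: "E n i \<in> seqs" "rep (E n i) = E n i" for n i using cs E(1)[of n] by (auto simp: Pi_iff)
  define T where "T n k \<longleftrightarrow> (\<forall>j<n. sat K (\<lambda>i. E n i k) (\<Phi> j))" for n k
  have "ae (\<lambda>k. \<forall>j<m. sat K (\<lambda>i. E n i k) (\<Phi> j))" if "m \<le> n" for m n
    using that
  proof (induction m)
    case 0
    show ?case by (rule ae_all) simp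
  next
    case (Suc m)
    have "ae (\<lambda>k. sat K (\<lambda>i. E n i k) (\<Phi> m))"
      using los[of "E n" "\<Phi> m"] Es E(3)[of m n] Suc.prems by simp
    moreover have "ae (\<lambda>k. \<forall>j<m. sat K (\<lambda>i. E n i k) (\<Phi> j))" using Suc by simp
    ultimately show ?case by (rule ae_mp2) (auto simp: less_Suc_eq)
  qed
  then have Tae: "ae (T n)" for n unfolding T_def by blast
  \<comment> \<open>The bound n <= k makes the maximum exist, and n = 0 always qualifies. On the set
    of k >= n at which \<open>T n\<close> holds, which belongs to \<open>U\<close>,
    \<open>N k\<close> is at least n.\<close>
  define N where "N k = Max {n. n \<le> k \<and> T n k}" for k
  have fin_N: "finite {n. n \<le> k \<and> T n k}" for k by (rule finite_subset[of _ "{..k}"]) auto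
  have "0 \<in> {n. n \<le> k \<and> T n k}" for k by (simp add: T_def)
  then have N: "T (N k) k" for k using Max_in[OF fin_N[of k]] unfolding N_def by blast
  have Nge: "n \<le> N k" if "n \<le> k" "T n k" for n k
    unfolding N_def by (rule Max_ge[OF fin_N]) (use that in simp)
  define e' where "e' i k = E (N k) i k" for i k
  have e's: "e' i \<in> seqs" for i using seqs_at[OF Es(1)] by (auto simp: e'_def seqs_def)
  show "\<exists>e'\<in>UNIV \<rightarrow> carrier upow. (\<forall>i\<in>A. e' i = e i) \<and> (\<forall>j. sat upow e' (\<Phi> j))"
  proof (intro bexI[of _ "\<lambda>i. rep (e' i)"] conjI ballI allI)
    show "(\<lambda>i. rep (e' i)) \<in> UNIV \<rightarrow> carrier upow" using e's by (simp add: upow_simps)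
    show "rep (e' i) = e i" if "i \<in> A" for i
    proof -
      have "e' i = e i" using E(2)[OF that] by (auto simp: e'_def)
      then show ?thesis using cs(2)[of "e i"] e by auto
    qed
    fix j
    have "ae (\<lambda>k. sat K (\<lambda>i. e' i k) (\<Phi> j))"
    proof (rule ae_mp2[OF Tae[of "Suc j"] ae_ge[of "Suc j"]])
      fix k assume k: "T (Suc j) k" "Suc j \<le> k"
      then have "Suc j \<le> N k" using Nge by blast
      then show "sat K (\<lambda>i. e' i k) (\<Phi> j)" using N[of k] unfolding T_def e'_def by simp
    qed
    then show "sat upow (\<lambda>i. rep (e' i)) (\<Phi> j)" using los[of e' "\<Phi> j"] e's by simp
  qed
qed

end

theorem saturated_extension:
  assumes "field K"
  obtains F :: "(nat \<Rightarrow> 'a) ring" where "field F" "elem_equiv (K :: ('a, 'm) ring_scheme) F" "saturated F"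
proof -
  obtain U where U: "free_ultrafilter U" using free_ultrafilter_exists by blast
  interpret ultrapower K U by (intro ultrapower.intro ultrapower_axioms.intro assms U)
  show ?thesis by (rule that[OF upow_field elem_equiv_upow saturated_upow])
qed

section \<open>Countable elementary substructures\<close>

text \<open>Countably many finitary operations are iterated countably often. The entries of a list
  always lie in a common stage, so the union is closed.\<close>

lemma countable_closure:
  fixes op :: "'i :: countable \<Rightarrow> 'x list \<Rightarrow> 'x"
  assumes S: "countable S" "S \<subseteq> U" and op: "\<And>i xs. set xs \<subseteq> U \<Longrightarrow> op i xs \<in> U"
  obtains C where "S \<subseteq> C" "C \<subseteq> U" "countable C" "\<And>i xs. set xs \<subseteq> C \<Longrightarrow> op i xs \<in> C"
proof -
  define D where "D n = ((\<lambda>C. C \<union> (\<Union>i. op i ` lists C)) ^^ n) S" for n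
  have D_Suc: "D (Suc n) = D n \<union> (\<Union>i. op i ` lists (D n))" for n by (simp add: D_def)
  have D0: "D 0 = S" by (simp add: D_def)
  have DU: "D n \<subseteq> U" for n
    by (induction n) (use S op in \<open>auto simp: D0 D_Suc lists_eq_set\<close>)
  have Dc: "countable (D n)" for n
    by (induction n) (use S in \<open>auto simp: D0 D_Suc\<close>)
  have mono: "D m \<subseteq> D n" if "m \<le> n" for m n
    by (rule lift_Suc_mono_le[OF _ that]) (simp add: D_Suc)
  have list_in: "\<exists>n. set xs \<subseteq> D n" if "set xs \<subseteq> (\<Union>n. D n)" for xs
    using that
  proof (induction xs)
    case (Cons x xs)
    then obtain m n where "set xs \<subseteq> D m" "x \<in> D n" by auto
    then have "set (x # xs) \<subseteq> D (max m n)" using mono[of m "max m n"] mono[of n "max m n"] by auto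
    then show ?case by blast
  qed simp
  show ?thesis
  proof (rule that[of "\<Union>n. D n"])
    show "op i xs \<in> (\<Union>n. D n)" if "set xs \<subseteq> (\<Union>n. D n)" for i xs
    proof -
      obtain n where "set xs \<subseteq> D n" using list_in[OF \<open>set xs \<subseteq> _\<close>] by blast
      then have "op i xs \<in> D (Suc n)" by (auto simp: D_Suc)
      then show ?thesis by blast
    qed
  qed (use D0 DU Dc in auto)
qed

instance rterm :: countable
  by countable_datatype

instance rform :: countable
  by countable_datatype

text \<open>By the Tarski--Vaught test, this says that \<open>C\<close> is an elementary substructure of \<open>F\<close>.\<close>

definition elementary :: "('a, 'm) ring_scheme \<Rightarrow> 'a set \<Rightarrow> bool" where
  "elementary F C \<longleftrightarrow> C \<subseteq> carrier F \<and> C \<noteq> {} \<and> (\<forall>p n. \<forall>e\<in>UNIV \<rightarrow> C.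
     (\<exists>x\<in>carrier F. sat F (e(n := x)) p) \<longrightarrow> (\<exists>x\<in>C. sat F (e(n := x)) p))"

lemma elementaryD:
  "elementary F C \<Longrightarrow> e \<in> UNIV \<rightarrow> C \<Longrightarrow> x \<in> carrier F \<Longrightarrow> sat F (e(n := x)) p \<Longrightarrow> \<exists>x\<in>C. sat F (e(n := x)) p"
  unfolding elementary_def by blast

lemma fvars_bound: "\<exists>N. fvars p \<subseteq> {..<N}"
  using finite_fvars[of p] finite_nat_set_iff_bounded[of "fvars p"] by (auto simp: subset_iff)

text \<open>Downward Loewenheim-Skolem: the closure of \<open>S\<close> under one Skolem function
  for each formula and variable.\<close>

lemma countable_elementary:
  assumes S: "countable S" "S \<subseteq> carrier F" and z: "z \<in> carrier F"
  obtains C where "countable C" "S \<subseteq> C" "elementary F C"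
proof -
  \<comment> \<open>A Skolem function takes the values of finitely many variables; the remaining
    ones, which do not matter for the formula, are set to \<open>z\<close>.\<close>
  define env where "env xs i = (if i < length xs then xs ! i else z)" for xs and i :: nat
  define op where "op = (\<lambda>(p, n) xs. if \<exists>x\<in>carrier F. sat F ((env xs)(n := x)) p
     then SOME x. x \<in> carrier F \<and> sat F ((env xs)(n := x)) p else z)"
  have op: "op (p, n) xs \<in> carrier F \<and> sat F ((env xs)(n := op (p, n) xs)) p"
    if "\<exists>x\<in>carrier F. sat F ((env xs)(n := x)) p" for p n xs
  proof -
    from that have "\<exists>x. x \<in> carrier F \<and> sat F ((env xs)(n := x)) p" by blast
    from someI_ex[OF this] show ?thesis using that by (simp add: op_def)
  qed
  have opc: "op i xs \<in> carrier F" for i xs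
  proof (cases i)
    case (Pair p n)
    then show ?thesis using op[where p = p and n = n and xs = xs] z
      by (cases "\<exists>x\<in>carrier F. sat F ((env xs)(n := x)) p") (auto simp: op_def)
  qed
  obtain C where C: "insert z S \<subseteq> C" "C \<subseteq> carrier F" "countable C" "\<And>i xs. set xs \<subseteq> C \<Longrightarrow> op i xs \<in> C"
    using countable_closure[of "insert z S" "carrier F" op] S z opc by auto
  have "elementary F C"
    unfolding elementary_def
  proof (intro conjI allI ballI impI C(2))
    show "C \<noteq> {}" using C(1) by auto
    fix p n e assume e: "e \<in> UNIV \<rightarrow> C" and ex: "\<exists>x\<in>carrier F. sat F (e(n := x)) p"
    obtain N where N: "fvars p \<subseteq> {..<N}" using fvars_bound by blast
    define xs where "xs = map e [0..<N]"
    have xs: "set xs \<subseteq> C" using e by (auto simp: xs_def)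
    have eq: "sat F (e(n := x)) p \<longleftrightarrow> sat F ((env xs)(n := x)) p" for x
      by (rule sat_cong) (use N in \<open>auto simp: env_def xs_def\<close>)
    have "sat F ((env xs)(n := op (p, n) xs)) p" using op ex unfolding eq by blast
    then show "\<exists>x\<in>C. sat F (e(n := x)) p" unfolding eq using C(4)[OF xs] by blast
  qed
  then show ?thesis using that C by auto
qed

lemma elementary_Union:
  assumes C: "\<And>n::nat. elementary F (C n)" and mono: "\<And>n. C n \<subseteq> C (Suc n)"
  shows "elementary F (\<Union>n. C n)"
  unfolding elementary_def
proof (intro conjI allI ballI impI)
  have le: "C m \<subseteq> C n" if "m \<le> n" for m n by (rule lift_Suc_mono_le[of C, OF mono that])
  show "(\<Union>n. C n) \<subseteq> carrier F" using C unfolding elementary_def by blast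
  show "(\<Union>n. C n) \<noteq> {}" using C[of 0] unfolding elementary_def by blast
  fix p n e assume e: "e \<in> UNIV \<rightarrow> (\<Union>n. C n)" and ex: "\<exists>x\<in>carrier F. sat F (e(n := x)) p"
  obtain N where N: "fvars p \<subseteq> {..<N}" using fvars_bound by blast
  obtain k where k: "\<And>i. e i \<in> C (k i)" using e by (auto simp: Pi_iff) metis
  \<comment> \<open>\<open>Suc N\<close> guarantees that index 0 is covered even when
    \<open>N\<close> is 0, as \<open>e 0\<close> is the default value in \<open>e'\<close>.\<close>
  define m where "m = Max (k ` {..<Suc N})"
  have km: "e i \<in> C m" if "i < Suc N" for i
  proof -
    have "k i \<le> m" unfolding m_def by (rule Max_ge) (use that in auto)
    then show ?thesis using k le by blast
  qed
  define e' where "e' i = (if i < N then e i else e 0)" for i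
  have e': "e' \<in> UNIV \<rightarrow> C m" using km by (auto simp: e'_def)
  have eq: "sat F (e(n := x)) p \<longleftrightarrow> sat F (e'(n := x)) p" for x
    by (rule sat_cong) (use N in \<open>auto simp: e'_def\<close>)
  obtain x where "x \<in> C m" "sat F (e'(n := x)) p"
    using elementaryD[OF C[of m] e'] ex unfolding eq by blast
  then show "\<exists>x\<in>(\<Union>n. C n). sat F (e(n := x)) p" unfolding eq by blast
qed

context field
begin

text \<open>The Tarski-Vaught condition is applied to the formula equating a fresh variable with a
  term, whose only solution is the value of the term; for inverses the formula states that a product
  is 1.\<close>

lemma elementary_closed:
  assumes C: "elementary R C" and x: "x \<in> C" "y \<in> C"
  shows "x \<oplus> y \<in> C" "x \<otimes> y \<in> C" "\<ominus> x \<in> C" "\<one> \<in> C" "\<zero> \<in> C"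
    and "x \<noteq> \<zero> \<Longrightarrow> inv x \<in> C"
proof -
  define e where "e i = (if i = 0 then x else y)" for i :: nat
  have e: "e \<in> UNIV \<rightarrow> C" using x by (auto simp: e_def)
  have xc: "x \<in> carrier R" "y \<in> carrier R" using C x by (auto simp: elementary_def)
  have tm: "tval R (e(2 := z)) t \<in> C" if "tval R (e(2 := z)) t \<in> carrier R" "2 \<notin> tvars t" for t z
  proof -
    have t: "tval R (e(2 := z')) t = tval R (e(2 := z)) t" for z'
      by (rule tval_cong) (use that(2) in auto)
    have sat: "sat R (e(2 := z')) (Eq (Var 2) t) \<longleftrightarrow> z' = tval R (e(2 := z)) t" for z'
      using t[of z'] by simp
    from elementaryD[OF C e that(1), of 2 "Eq (Var 2) t"] show ?thesis unfolding sat by blast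
  qed
  show "x \<oplus> y \<in> C" using tm[of \<zero> "Add (Var 0) (Var 1)"] xc by (simp add: e_def)
  show "x \<otimes> y \<in> C" using tm[of \<zero> "Mult (Var 0) (Var 1)"] xc by (simp add: e_def)
  show "\<ominus> x \<in> C" using tm[of \<zero> "Minus (Var 0)"] xc by (simp add: e_def)
  show "\<one> \<in> C" using tm[of \<zero> One] by simp
  show "\<zero> \<in> C" using tm[of \<zero> Zero] by simp
  assume nz: "x \<noteq> \<zero>"
  then have u: "x \<in> Units R" using xc field_Units by simp
  have "sat R (e(2 := inv x)) (Eq (Mult (Var 0) (Var 2)) One)" using u by (simp add: e_def)
  from elementaryD[OF C e _ this] u obtain w where w: "w \<in> C" "x \<otimes> w = \<one>" by (auto simp: e_def)
  then have "w \<in> carrier R" using C by (auto simp: elementary_def)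
  then show "inv x \<in> C" using w comm_inv_char[OF xc(1) _ w(2)] by simp
qed

lemma elementary_subring: "elementary R C \<Longrightarrow> subring C R"
proof (rule subringI)
  assume C: "elementary R C"
  then obtain x where "x \<in> C" by (auto simp: elementary_def)
  then show "\<one> \<in> C" using elementary_closed(4)[OF C] by blast
qed (auto simp: elementary_closed, auto simp: elementary_def)

lemma elementary_elem_equiv:
  assumes C: "elementary R C"
  shows "elem_equiv (R\<lparr>carrier := C\<rparr>) R"
proof -
  let ?C = "R\<lparr>carrier := C\<rparr>"
  note sub = elementary_subring[OF C]
  note S = subringE[OF sub]
  interpret C: cring ?C by (rule subring_cring[OF sub])
  have minus: "\<ominus>\<^bsub>?C\<^esub> x = \<ominus> x" if "x \<in> C" for x
    by (rule C.minus_equality) (use that S(1,5) in \<open>auto simp: l_neg\<close>)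
  have tv: "tval ?C e t = tval R e t \<and> tval R e t \<in> C" if "e \<in> UNIV \<rightarrow> C" for e t
    using that S minus by (induction t) auto
  have sat: "sat ?C e p \<longleftrightarrow> sat R e p" if "e \<in> UNIV \<rightarrow> C" for e p
    using that
  proof (induction p arbitrary: e)
    case (Exists n p)
    have "sat ?C (e(n := x)) p \<longleftrightarrow> sat R (e(n := x)) p" if "x \<in> C" for x
      by (rule Exists.IH) (use Exists.prems that in auto)
    then show ?case using elementaryD[OF C Exists.prems] S(1) by auto
  qed (simp_all add: tv)
  show ?thesis
    unfolding elem_equiv_def
  proof (intro allI impI)
    fix p assume p: "sentence p"
    have 1: "(\<lambda>_. \<one>) \<in> UNIV \<rightarrow> C" using S(3) by simp
    have 2: "(\<lambda>_. \<one>) \<in> UNIV \<rightarrow> carrier ?C" "(\<lambda>_. \<one>) \<in> UNIV \<rightarrow> carrier R" using S(3) by simp_all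
    show "models ?C p \<longleftrightarrow> models R p"
      using models_iff_sat[OF p 2(1)] models_iff_sat[OF p 2(2)] sat[OF 1] by simp
  qed
qed

end

section \<open>Constructions with henselian subrings\<close>

context henselian_subring
begin

lemma S_minus: "x \<in> S \<Longrightarrow> y \<in> S \<Longrightarrow> x \<ominus> y \<in> S"
  using S(5,7) by (simp add: a_minus_def)

lemma S_carrier: "x \<in> S \<Longrightarrow> x \<in> carrier A"
  using S(1) by auto

text \<open>Congruent arguments give congruent values; a root refined modulo \<open>M\<close>
  therefore stays simple.\<close>

lemma horner_congruent:
  assumes x: "x \<in> S" and y: "y \<in> S" and xy: "x \<ominus> y \<in> M"
  shows "set cs \<subseteq> S \<Longrightarrow> horner A cs x \<ominus> horner A cs y \<in> M \<and> dhorner A cs x \<ominus> dhorner A cs y \<in> M"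
proof (induction cs)
  case Nil
  then show ?case using M_zero by (simp add: a_minus_def)
next
  case (Cons c cs)
  have csS: "set cs \<subseteq> S" using Cons.prems by simp
  let ?hx = "horner A cs x" and ?hy = "horner A cs y" and ?dx = "dhorner A cs x" and ?dy = "dhorner A cs y"
  have hS: "?hx \<in> S" "?hy \<in> S" "?dx \<in> S" "?dy \<in> S"
    by (rule horner_subring[OF sub csS x] horner_subring[OF sub csS y]
      dhorner_subring[OF sub csS x] dhorner_subring[OF sub csS y])+
  have IH: "?hx \<ominus> ?hy \<in> M" "?dx \<ominus> ?dy \<in> M" using Cons.IH[OF csS] by simp_all
  note c = x[THEN S_carrier] y[THEN S_carrier] hS[THEN S_carrier]
  have cc: "c \<in> carrier A" using Cons.prems S_carrier by simp
  have mult: "x \<otimes> u \<ominus> y \<otimes> v \<in> M" if "u \<in> S" "v \<in> S" "u \<ominus> v \<in> M" for u v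
  proof -
    have "u \<in> carrier A" "v \<in> carrier A" using that S_carrier by auto
    then have "x \<otimes> u \<ominus> y \<otimes> v = u \<otimes> (x \<ominus> y) \<oplus> y \<otimes> (u \<ominus> v)" using c(1,2) by algebra
    then show ?thesis using M_add[OF M_mult[OF that(1) xy] M_mult[OF y that(3)]] by simp
  qed
  have gen: "p \<oplus> u \<ominus> (q \<oplus> v) = (p \<ominus> q) \<oplus> (u \<ominus> v)"
    if "p \<in> carrier A" "q \<in> carrier A" "u \<in> carrier A" "v \<in> carrier A" for p q u v
    using that by algebra
  have "c \<ominus> c \<in> M" using cc M_zero by (simp add: a_minus_def r_neg)
  then have "horner A (c # cs) x \<ominus> horner A (c # cs) y \<in> M"
    using gen[of c c "x \<otimes> ?hx" "y \<otimes> ?hy"] c cc mult[OF hS(1,2) IH(1)] M_add by simp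
  moreover have "dhorner A (c # cs) x \<ominus> dhorner A (c # cs) y \<in> M"
    using gen[of ?hx ?hy "x \<otimes> ?dx" "y \<otimes> ?dy"] c IH(1) mult[OF hS(3,4) IH(2)] M_add by simp
  ultimately show ?case by blast
qed

text \<open>Closing under the ring operations, inverses of units and one chosen Hensel root per
  polynomial and approximate root keeps the set countable and makes it henselian.\<close>

lemma countable_henselian_subring:
  assumes S0: "countable S0" "S0 \<subseteq> S"
  obtains Q where "countable Q" "S0 \<subseteq> Q" "Q \<subseteq> S" "henselian_subring A Q (M \<inter> Q)"
proof -
  define inve where "inve x = (SOME y. y \<in> S \<and> x \<otimes> y = \<one>)" for x
  define root where "root cs r = (SOME a. a \<in> S \<and> horner A cs a = \<zero> \<and> a \<ominus> r \<in> M)" for cs r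
  have inve: "inve x \<in> S \<and> x \<otimes> inve x = \<one>" if "x \<in> S" "x \<notin> M" for x
    unfolding inve_def by (rule someI_ex) (use unit[OF that] in blast)
  have root: "root cs r \<in> S \<and> horner A cs (root cs r) = \<zero> \<and> root cs r \<ominus> r \<in> M"
    if "set cs \<subseteq> S" "r \<in> S" "horner A cs r \<in> M" "dhorner A cs r \<notin> M" for cs r
    unfolding root_def by (rule someI_ex) (use hensel[OF that] in blast)
  \<comment> \<open>The number selects the operation. In the last case the head of the list is the
    approximate root and the tail is the polynomial; inapplicable cases return 1.\<close>
  define op where "op i xs =
    (if i = (0::nat) then \<one>
     else if xs = [] then \<one>
     else if i = 1 then \<ominus> hd xs
     else if i = 2 then hd xs \<oplus> last xs
     else if i = 3 then hd xs \<otimes> last xs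
     else if i = 4 then (if hd xs \<in> M then \<one> else inve (hd xs))
     else if horner A (tl xs) (hd xs) \<in> M \<and> dhorner A (tl xs) (hd xs) \<notin> M then root (tl xs) (hd xs) else \<one>)" for i xs
  have "op i xs \<in> S" if xs: "set xs \<subseteq> S" for i xs
  proof (cases "xs = []")
    case True
    then show ?thesis using S(3) by (simp add: op_def)
  next
    case False
    have in_S: "hd xs \<in> S" "last xs \<in> S" "set (tl xs) \<subseteq> S"
      using xs hd_in_set[OF False] last_in_set[OF False] list.set_sel(2)[OF False] by auto
    show ?thesis
      using False in_S S(3) S(5)[OF in_S(1)] S(6,7)[OF in_S(1,2)] inve[OF in_S(1)] root[OF in_S(3,1)]
      by (simp add: op_def)
  qed
  then obtain Q where Q: "S0 \<subseteq> Q" "Q \<subseteq> S" "countable Q" "\<And>i xs. set xs \<subseteq> Q \<Longrightarrow> op i xs \<in> Q"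
    by (rule countable_closure[OF S0, of op]) blast+
  have "henselian_subring A Q (M \<inter> Q)"
  proof (intro henselian_subring.intro henselian_subring_axioms.intro)
    show "cring A" by (rule is_cring)
    show sQ: "subring Q A"
    proof (rule subringI)
      show "Q \<subseteq> carrier A" using Q(2) S(1) by blast
      show "\<one> \<in> Q" using Q(4)[of "[]" 0] by (simp add: op_def)
      show "\<ominus> x \<in> Q" if "x \<in> Q" for x using Q(4)[of "[x]" 1] that by (simp add: op_def)
      show "x \<otimes> y \<in> Q" if "x \<in> Q" "y \<in> Q" for x y using Q(4)[of "[x, y]" 3] that by (simp add: op_def)
      show "x \<oplus> y \<in> Q" if "x \<in> Q" "y \<in> Q" for x y using Q(4)[of "[x, y]" 2] that by (simp add: op_def)
    qed
    note SQ = subringE[OF sQ]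
    show "\<zero> \<in> M \<inter> Q" using M_zero SQ(2) by simp
    show "\<exists>y\<in>Q. x \<otimes> y = \<one>" if "x \<in> Q" "x \<notin> M \<inter> Q" for x
    proof -
      have x: "x \<in> S" "x \<notin> M" using that Q(2) by auto
      have "inve x \<in> Q" using Q(4)[of "[x]" 4] that x by (simp add: op_def)
      then show ?thesis using inve[OF x] by blast
    qed
    show "\<exists>a\<in>Q. horner A cs a = \<zero> \<and> a \<ominus> r \<in> M \<inter> Q"
      if cs: "set cs \<subseteq> Q" and r: "r \<in> Q" and h: "horner A cs r \<in> M \<inter> Q" "dhorner A cs r \<notin> M \<inter> Q" for cs r
    proof -
      have "dhorner A cs r \<in> Q" by (rule dhorner_subring[OF sQ cs r])
      then have h': "horner A cs r \<in> M" "dhorner A cs r \<notin> M" using h by auto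
      have "root cs r \<in> Q" using Q(4)[of "r # cs" 5] cs r h' by (simp add: op_def)
      moreover have "root cs r \<ominus> r \<in> Q"
        using SQ(7)[OF \<open>root cs r \<in> Q\<close> SQ(5)[OF r]] by (simp add: a_minus_def)
      moreover have "horner A cs (root cs r) = \<zero> \<and> root cs r \<ominus> r \<in> M"
        using root[of cs r] cs r h' Q(2) by blast
      ultimately show ?thesis by blast
    qed
    show "x \<otimes> y \<in> M \<inter> Q" if "x \<in> Q" "y \<in> M \<inter> Q" for x y
      using that Q(2) M_mult SQ(6) by blast
    show "M \<inter> Q \<subseteq> Q" by blast
    show "\<one> \<notin> M \<inter> Q" using one_notin_M by blast
    show "x \<oplus> y \<in> M \<inter> Q" if "x \<in> M \<inter> Q" "y \<in> M \<inter> Q" for x y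
      using that M_add SQ(7) by blast
  qed
  with Q that show ?thesis by blast
qed

end

text \<open>The condition on the traces of the ideals means that membership in the maximal ideal is
  decided at any stage containing the element. Every instance of the axioms then takes place at a
  single stage.\<close>

lemma henselian_subring_Union:
  fixes A (structure)
  assumes h: "\<And>n::nat. henselian_subring A (S n) (M n)"
    and S: "\<And>n. S n \<subseteq> S (Suc n)" and M: "\<And>n. M (Suc n) \<inter> S n = M n"
  shows "henselian_subring A (\<Union>n. S n) (\<Union>n. M n)"
proof -
  interpret cring A using h[of 0] by (rule henselian_subring.axioms(1))
  interpret H: henselian_subring A "S n" "M n" for n by (rule h)
  have S_le: "S m \<subseteq> S n" if "m \<le> n" for m n by (rule lift_Suc_mono_le[of S, OF S that])
  have M_le: "M n \<inter> S m = M m" if "m \<le> n" for m n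
    using that
  proof (induction n rule: dec_induct)
    case base
    show ?case using H.M_subset by blast
  next
    case (step n)
    have "M (Suc n) \<inter> S m = M (Suc n) \<inter> S n \<inter> S m" using S_le[OF step.hyps(1)] by blast
    then show ?case using M step.IH by simp
  qed
  have M_mono: "M m \<subseteq> M n" if "m \<le> n" for m n using M_le[OF that] by blast
  have in_M: "x \<in> M n" if x: "x \<in> (\<Union>n. M n)" "x \<in> S n" for x n
  proof -
    obtain m where "x \<in> M m" using x(1) by blast
    then have "x \<in> M (max m n)" using M_mono[of m "max m n"] by auto
    then show ?thesis using M_le[of n "max m n"] x(2) by auto
  qed
  have list_in: "\<exists>n. set xs \<subseteq> S n" if "set xs \<subseteq> (\<Union>n. S n)" for xs
    using that
  proof (induction xs)
    case (Cons x xs)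
    then obtain m n where "set xs \<subseteq> S m" "x \<in> S n" by auto
    then have "set (x # xs) \<subseteq> S (max m n)" using S_le[of m "max m n"] S_le[of n "max m n"] by auto
    then show ?case by blast
  qed simp
  have two: "\<exists>n. x \<in> S n \<and> y \<in> S n" if "x \<in> (\<Union>n. S n)" "y \<in> (\<Union>n. S n)" for x y
    using list_in[of "[x, y]"] that by simp
  have MS: "(\<Union>n. M n) \<subseteq> (\<Union>n. S n)" using H.M_subset by blast
  show ?thesis
  proof (intro henselian_subring.intro henselian_subring_axioms.intro cring_axioms)
    show "subring (\<Union>n. S n) A"
    proof (rule subringI)
      show "(\<Union>n. S n) \<subseteq> carrier A" using H.S(1) by blast
      show "\<one> \<in> (\<Union>n. S n)" using H.S(3) by blast
      show "\<ominus> x \<in> (\<Union>n. S n)" if "x \<in> (\<Union>n. S n)" for x using that by (auto intro: H.S(5))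
      show "x \<otimes> y \<in> (\<Union>n. S n)" if xy: "x \<in> (\<Union>n. S n)" "y \<in> (\<Union>n. S n)" for x y
      proof -
        obtain n where "x \<in> S n" "y \<in> S n" using two[OF xy] by blast
        then show ?thesis by (intro UN_I[of n] H.S(6)) simp_all
      qed
      show "x \<oplus> y \<in> (\<Union>n. S n)" if xy: "x \<in> (\<Union>n. S n)" "y \<in> (\<Union>n. S n)" for x y
      proof -
        obtain n where "x \<in> S n" "y \<in> S n" using two[OF xy] by blast
        then show ?thesis by (intro UN_I[of n] H.S(7)) simp_all
      qed
    qed
    show "(\<Union>n. M n) \<subseteq> (\<Union>n. S n)" by (rule MS)
    show "\<zero> \<in> (\<Union>n. M n)" using H.M_zero by blast
    show "\<one> \<notin> (\<Union>n. M n)" using H.one_notin_M by blast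
    show "x \<oplus> y \<in> (\<Union>n. M n)" if xy: "x \<in> (\<Union>n. M n)" "y \<in> (\<Union>n. M n)" for x y
    proof -
      obtain n where "x \<in> S n" "y \<in> S n" using two[of x y] xy MS by blast
      then show ?thesis using in_M xy by (intro UN_I[of n] H.M_add) simp_all
    qed
    show "x \<otimes> y \<in> (\<Union>n. M n)" if xy: "x \<in> (\<Union>n. S n)" "y \<in> (\<Union>n. M n)" for x y
    proof -
      obtain n where "x \<in> S n" "y \<in> S n" using two[of x y] xy MS by blast
      then show ?thesis using in_M xy by (intro UN_I[of n] H.M_mult) simp_all
    qed
    show "\<exists>y\<in>(\<Union>n. S n). x \<otimes> y = \<one>" if x: "x \<in> (\<Union>n. S n)" "x \<notin> (\<Union>n. M n)" for x
    proof -
      obtain n where n: "x \<in> S n" "x \<notin> M n" using x by blast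
      from H.unit[OF n] show ?thesis by blast
    qed
    show "\<exists>a\<in>(\<Union>n. S n). horner A cs a = \<zero> \<and> a \<ominus> r \<in> (\<Union>n. M n)"
      if cs: "set cs \<subseteq> (\<Union>n. S n)" and r: "r \<in> (\<Union>n. S n)"
        and hr: "horner A cs r \<in> (\<Union>n. M n)" "dhorner A cs r \<notin> (\<Union>n. M n)" for cs r
    proof -
      obtain n where n: "r \<in> S n" "set cs \<subseteq> S n" using list_in[of "r # cs"] cs r by auto
      have "horner A cs r \<in> M n" by (rule in_M[OF hr(1) horner_subring[OF H.sub n(2,1)]])
      moreover have "dhorner A cs r \<notin> M n" using hr(2) by blast
      ultimately show ?thesis using H.hensel[OF n(2,1)] by blast
    qed
  qed
qed

section \<open>Embedding algebraic power series into a saturated field\<close>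

context power_series
begin

text \<open>The values of a partial homomorphism on a countable set are the unknowns of a countable
  system of formulas. Finitely many formulas involve finitely many series, for which
  \<open>alg_series_partial_hom\<close> supplies a solution.\<close>

lemma alg_series_saturated_hom:
  assumes large: "large_field F" and sat: "saturated F" and D: "countable D" "D \<subseteq> alg_series"
  shows "\<exists>v. partial_hom D v"
proof (cases "D = {}")
  case True
  then show ?thesis by (simp add: partial_hom_def)
next
  case ne: False
  define ix where "ix = to_nat_on D"
  define el where "el = from_nat_into D"
  have el_ix: "el (ix f) = f" if "f \<in> D" for f
    using that D(1) by (simp add: el_def ix_def)
  have elD: "el n \<in> D" for n by (simp add: el_def from_nat_into ne)
  have Dc: "D \<subseteq> carrier P" using D(2) by (auto simp: alg_series_def)
  \<comment> \<open>Even variables are parameters holding constant terms, which are needed to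
    express that constants are fixed; odd variables hold the unknown values.\<close>
  define e where "e i = (if even i then el (i div 2) 0 else \<zero>\<^bsub>F\<^esub>)" for i :: nat
  have ec: "e \<in> UNIV \<rightarrow> carrier F"
  proof (rule funcsetI)
    fix i :: nat
    have "el (i div 2) \<in> carrier P" using elD Dc by blast
    then show "e i \<in> carrier F" by (simp add: e_def)
  qed
  define env where "env S v i = (if even i then e i else if el (i div 2) \<in> S then v (el (i div 2)) else \<zero>\<^bsub>F\<^esub>)"
    for S and v :: "(nat \<Rightarrow> 'a) \<Rightarrow> 'a" and i :: nat
  define u where "u f = Suc (2 * ix f)" for f
  have env_u: "env S v (u f) = v f" if "f \<in> S" "S \<subseteq> D" for S v f
    using that el_ix[of f] by (auto simp: env_def u_def)
  have env_p: "env S v (2 * ix f) = f 0" "e (2 * ix f) = f 0" if "f \<in> D" for S v f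
    using el_ix[OF that] by (auto simp: env_def e_def)
  \<comment> \<open>The trivial first formula makes the set nonempty, so that it can be enumerated
    by all natural numbers.\<close>
  define \<Phi> where "\<Phi> = {Eq Zero Zero}
    \<union> {Eq (Var (u (f \<oplus> g))) (Add (Var (u f)) (Var (u g))) | f g. f \<in> D \<and> g \<in> D \<and> f \<oplus> g \<in> D}
    \<union> {Eq (Var (u (f \<otimes> g))) (Mult (Var (u f)) (Var (u g))) | f g. f \<in> D \<and> g \<in> D \<and> f \<otimes> g \<in> D}
    \<union> {Eq (Var (u (\<kappa> c))) (Var (2 * ix (\<kappa> c))) | c. c \<in> carrier F \<and> \<kappa> c \<in> D}
    \<union> {Neg (Eq (Var (u f)) Zero) | f. f \<in> D \<and> f \<noteq> \<zero>}"
  have fin: "\<exists>S. finite S \<and> S \<subseteq> D \<and> (\<forall>S' v. S \<subseteq> S' \<longrightarrow> S' \<subseteq> D \<longrightarrow> partial_hom S' v \<longrightarrow> sat F (env S' v) \<phi>)"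
    if "\<phi> \<in> \<Phi>" for \<phi>
    using that unfolding \<Phi>_def Un_iff mem_Collect_eq singleton_iff
  proof (elim disjE exE conjE)
    assume "\<phi> = Eq Zero Zero"
    then show ?thesis by (intro exI[of _ "{}"]) simp
  next
    fix f g assume 2: "f \<in> D" "g \<in> D" "f \<oplus> g \<in> D" "\<phi> = Eq (Var (u (f \<oplus> g))) (Add (Var (u f)) (Var (u g)))"
    have "sat F (env S v) \<phi>" if S: "{f, g, f \<oplus> g} \<subseteq> S" "S \<subseteq> D" and v: "partial_hom S v" for S v
    proof -
      have "v (f \<oplus> g) = v f \<oplus>\<^bsub>F\<^esub> v g" using v S(1) unfolding partial_hom_def by blast
      then show ?thesis using env_u[OF _ S(2), of _ v] S(1) 2(4) by simp
    qed
    then show ?thesis using 2(1-3) by (intro exI[of _ "{f, g, f \<oplus> g}"]) blast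
  next
    fix f g assume 3: "f \<in> D" "g \<in> D" "f \<otimes> g \<in> D" "\<phi> = Eq (Var (u (f \<otimes> g))) (Mult (Var (u f)) (Var (u g)))"
    have "sat F (env S v) \<phi>" if S: "{f, g, f \<otimes> g} \<subseteq> S" "S \<subseteq> D" and v: "partial_hom S v" for S v
    proof -
      have "v (f \<otimes> g) = v f \<otimes>\<^bsub>F\<^esub> v g" using v S(1) unfolding partial_hom_def by blast
      then show ?thesis using env_u[OF _ S(2), of _ v] S(1) 3(4) by simp
    qed
    then show ?thesis using 3(1-3) by (intro exI[of _ "{f, g, f \<otimes> g}"]) blast
  next
    fix c assume 4: "c \<in> carrier F" "\<kappa> c \<in> D" "\<phi> = Eq (Var (u (\<kappa> c))) (Var (2 * ix (\<kappa> c)))"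
    have "sat F (env S v) \<phi>" if S: "{\<kappa> c} \<subseteq> S" "S \<subseteq> D" and v: "partial_hom S v" for S v
    proof -
      have "v (\<kappa> c) = c" using v S(1) 4(1) unfolding partial_hom_def by blast
      moreover have "\<kappa> c 0 = c" by (simp add: F.ps_const_0)
      ultimately show ?thesis using env_u[OF _ S(2), of _ v] env_p(1)[OF 4(2), of S v] S(1) 4(3) by simp
    qed
    then show ?thesis using 4(2) by (intro exI[of _ "{\<kappa> c}"]) blast
  next
    fix f assume 5: "f \<in> D" "f \<noteq> \<zero>" "\<phi> = Neg (Eq (Var (u f)) Zero)"
    have "sat F (env S v) \<phi>" if S: "{f} \<subseteq> S" "S \<subseteq> D" and v: "partial_hom S v" for S v
    proof -
      have "v f \<noteq> \<zero>\<^bsub>F\<^esub>" using v S(1) 5(2) unfolding partial_hom_def by blast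
      then show ?thesis using env_u[OF _ S(2), of _ v] S(1) 5(3) by simp
    qed
    then show ?thesis using 5(1) by (intro exI[of _ "{f}"]) blast
  qed
  have c\<Phi>: "countable \<Phi>" "\<Phi> \<noteq> {}" by (simp_all add: \<Phi>_def)
  define \<phi> where "\<phi> = from_nat_into \<Phi>"
  have \<phi>: "\<phi> j \<in> \<Phi>" for j by (simp add: \<phi>_def from_nat_into c\<Phi>)
  have \<phi>_onto: "\<exists>j. \<psi> = \<phi> j" if "\<psi> \<in> \<Phi>" for \<psi>
    using from_nat_into_to_nat_on[OF c\<Phi>(1) that] unfolding \<phi>_def by metis
  define Sf where "Sf j = (SOME S. finite S \<and> S \<subseteq> D \<and>
    (\<forall>S' v. S \<subseteq> S' \<longrightarrow> S' \<subseteq> D \<longrightarrow> partial_hom S' v \<longrightarrow> sat F (env S' v) (\<phi> j)))" for j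
  have Sf: "finite (Sf j) \<and> Sf j \<subseteq> D \<and>
    (\<forall>S' v. Sf j \<subseteq> S' \<longrightarrow> S' \<subseteq> D \<longrightarrow> partial_hom S' v \<longrightarrow> sat F (env S' v) (\<phi> j))" for j
    unfolding Sf_def by (rule someI_ex) (rule fin[OF \<phi>])
  have "\<exists>e'\<in>UNIV \<rightarrow> carrier F. (\<forall>i\<in>{i. even i}. e' i = e i) \<and> (\<forall>j<n. sat F e' (\<phi> j))" for n
  proof -
    define S where "S = (\<Union>j<n. Sf j)"
    have S: "finite S" "S \<subseteq> D" using Sf by (auto simp: S_def)
    obtain v where v: "partial_hom S v" using alg_series_partial_hom[OF large S(1)] S(2) D(2) by blast
    have "env S v \<in> UNIV \<rightarrow> carrier F" using ec v by (auto simp: env_def partial_hom_def)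
    moreover have "sat F (env S v) (\<phi> j)" if "j < n" for j
    proof -
      have "Sf j \<subseteq> S" using that by (auto simp: S_def)
      then show ?thesis using Sf[of j] S(2) v by blast
    qed
    moreover have "\<forall>i\<in>{i. even i}. env S v i = e i" by (simp add: env_def)
    ultimately show ?thesis by blast
  qed
  then obtain e' where e': "e' \<in> UNIV \<rightarrow> carrier F" "\<forall>i\<in>{i. even i}. e' i = e i" "\<forall>j. sat F e' (\<phi> j)"
    using sat[unfolded saturated_def, rule_format, of e "{i. even i}" \<phi>, OF ec] by blast
  have all: "sat F e' \<psi>" if \<psi>: "\<psi> \<in> \<Phi>" for \<psi> using \<phi>_onto[OF \<psi>] e'(3) by fastforce
  have "partial_hom D (\<lambda>f. e' (u f))"
    unfolding partial_hom_def
  proof (intro conjI ballI impI)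
    show "e' (u f) \<in> carrier F" for f using e'(1) by blast
    fix f assume f: "f \<in> D"
    show "e' (u f) \<noteq> \<zero>\<^bsub>F\<^esub>" if "f \<noteq> \<zero>"
    proof -
      have "Neg (Eq (Var (u f)) Zero) \<in> \<Phi>" unfolding \<Phi>_def Un_iff mem_Collect_eq using f that by blast
      from all[OF this] show ?thesis by simp
    qed
    fix g assume g: "g \<in> D"
    show "e' (u (f \<oplus> g)) = e' (u f) \<oplus>\<^bsub>F\<^esub> e' (u g)" if "f \<oplus> g \<in> D"
    proof -
      have "Eq (Var (u (f \<oplus> g))) (Add (Var (u f)) (Var (u g))) \<in> \<Phi>" unfolding \<Phi>_def Un_iff mem_Collect_eq using f g that by blast
      from all[OF this] show ?thesis by simp
    qed
    show "e' (u (f \<otimes> g)) = e' (u f) \<otimes>\<^bsub>F\<^esub> e' (u g)" if "f \<otimes> g \<in> D"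
    proof -
      have "Eq (Var (u (f \<otimes> g))) (Mult (Var (u f)) (Var (u g))) \<in> \<Phi>" unfolding \<Phi>_def Un_iff mem_Collect_eq using f g that by blast
      from all[OF this] show ?thesis by simp
    qed
  next
    fix c assume c: "c \<in> carrier F" "\<kappa> c \<in> D"
    have "Eq (Var (u (\<kappa> c))) (Var (2 * ix (\<kappa> c))) \<in> \<Phi>" unfolding \<Phi>_def Un_iff mem_Collect_eq using c by blast
    from all[OF this] show "e' (u (\<kappa> c)) = c" using e'(2) env_p(2)[OF c(2)] by simp
  qed
  then show ?thesis by blast
qed

text \<open>Composing the place \<open>X \<mapsto> 0\<close> of the algebraic power series with a henselian subring of \<open>F\<close>.\<close>

lemma composite_henselian:
  assumes "henselian_subring F R M"
  shows "henselian_subring P {f \<in> alg_series. f 0 \<in> R} {f \<in> alg_series. f 0 \<in> M}"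
proof -
  interpret H: henselian_subring F R M by fact
  interpret B: henselian_subring P alg_series "{f \<in> alg_series. f 0 = \<zero>\<^bsub>F\<^esub>}"
    by (rule alg_series_henselian)
  have kB: "\<kappa> c \<in> alg_series" if "c \<in> carrier F" for c
    using etale_alg_series[OF etale_T] const_T[OF that] by blast
  show ?thesis
  proof (intro henselian_subring.intro henselian_subring_axioms.intro is_cring)
    show "subring {f \<in> alg_series. f 0 \<in> R} P"
    proof (rule subringI)
      show "{f \<in> alg_series. f 0 \<in> R} \<subseteq> carrier P" using B.S(1) by blast
      show "\<one> \<in> {f \<in> alg_series. f 0 \<in> R}" using B.S(3) H.S(3) by simp
      show "\<ominus> f \<in> {f \<in> alg_series. f 0 \<in> R}" if "f \<in> {f \<in> alg_series. f 0 \<in> R}" for f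
        using that B.S(5) H.S(5) B.S_carrier by auto
      show "f \<otimes> g \<in> {f \<in> alg_series. f 0 \<in> R}"
        if "f \<in> {f \<in> alg_series. f 0 \<in> R}" "g \<in> {f \<in> alg_series. f 0 \<in> R}" for f g
        using that B.S(6) H.S(6) B.S_carrier by auto
      show "f \<oplus> g \<in> {f \<in> alg_series. f 0 \<in> R}"
        if "f \<in> {f \<in> alg_series. f 0 \<in> R}" "g \<in> {f \<in> alg_series. f 0 \<in> R}" for f g
        using that B.S(7) H.S(7) B.S_carrier by auto
    qed
    show "{f \<in> alg_series. f 0 \<in> M} \<subseteq> {f \<in> alg_series. f 0 \<in> R}" using H.M_subset by blast
    show "\<zero> \<in> {f \<in> alg_series. f 0 \<in> M}" using B.S(2) H.M_zero by simp
    show "\<one> \<notin> {f \<in> alg_series. f 0 \<in> M}" using H.one_notin_M by simp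
    show "f \<oplus> g \<in> {f \<in> alg_series. f 0 \<in> M}"
      if "f \<in> {f \<in> alg_series. f 0 \<in> M}" "g \<in> {f \<in> alg_series. f 0 \<in> M}" for f g
      using that B.S(7) H.M_add B.S_carrier by auto
    show "f \<otimes> g \<in> {f \<in> alg_series. f 0 \<in> M}"
      if "f \<in> {f \<in> alg_series. f 0 \<in> R}" "g \<in> {f \<in> alg_series. f 0 \<in> M}" for f g
      using that B.S(6) H.M_mult B.S_carrier by auto
    show "\<exists>g\<in>{f \<in> alg_series. f 0 \<in> R}. f \<otimes> g = \<one>"
      if f: "f \<in> {f \<in> alg_series. f 0 \<in> R}" "f \<notin> {f \<in> alg_series. f 0 \<in> M}" for f
    proof -
      have f': "f \<in> alg_series" "f 0 \<in> R" "f 0 \<notin> M" using f by auto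
      then have "f 0 \<noteq> \<zero>\<^bsub>F\<^esub>" using H.M_zero by auto
      then obtain g where g: "g \<in> alg_series" "f \<otimes> g = \<one>" using alg_series_inverse[OF f'(1)] by blast
      obtain y where y: "y \<in> R" "f 0 \<otimes>\<^bsub>F\<^esub> y = \<one>\<^bsub>F\<^esub>" using H.unit[OF f'(2,3)] by blast
      have c: "f 0 \<in> carrier F" "g 0 \<in> carrier F" "y \<in> carrier F" "f \<in> carrier P" "g \<in> carrier P"
        using f' g y B.S_carrier H.S_carrier by auto
      have "f 0 \<otimes>\<^bsub>F\<^esub> g 0 = \<one>\<^bsub>F\<^esub>" using arg_cong[OF g(2), of "\<lambda>h. h 0"] c by simp
      then have "g 0 = y" using y(2) F.m_lcancel[OF \<open>f 0 \<noteq> \<zero>\<^bsub>F\<^esub>\<close> c(1-3)] by simp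
      then show ?thesis using g y(1) by blast
    qed
    show "\<exists>a\<in>{f \<in> alg_series. f 0 \<in> R}. horner P cs a = \<zero> \<and> a \<ominus> r \<in> {f \<in> alg_series. f 0 \<in> M}"
      if cs: "set cs \<subseteq> {f \<in> alg_series. f 0 \<in> R}" and r: "r \<in> {f \<in> alg_series. f 0 \<in> R}"
        and h: "horner P cs r \<in> {f \<in> alg_series. f 0 \<in> M}" "dhorner P cs r \<notin> {f \<in> alg_series. f 0 \<in> M}" for cs r
    proof -
      let ?cs = "map (\<lambda>f. f 0) cs"
      have csB: "set cs \<subseteq> alg_series" and csR: "set ?cs \<subseteq> R" and rB: "r \<in> alg_series" and rR: "r 0 \<in> R"
        using cs r by auto
      have csc: "set cs \<subseteq> carrier P" and rc: "r \<in> carrier P" using csB rB B.S(1) by auto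
      have "horner F ?cs (r 0) \<in> M" using h(1) res.hom_horner[OF csc rc] by simp
      moreover have d: "dhorner F ?cs (r 0) \<notin> M"
        using h(2) res.hom_dhorner[OF csc rc] dhorner_subring[OF B.sub csB rB] by simp
      \<comment> \<open>The root is lifted in two stages: first modulo X inside the given ring of
        constants, then from constants to algebraic series.\<close>
      ultimately obtain \<rho> where \<rho>: "\<rho> \<in> R" "horner F ?cs \<rho> = \<zero>\<^bsub>F\<^esub>" "\<rho> \<ominus>\<^bsub>F\<^esub> r 0 \<in> M"
        using H.hensel[OF csR rR] by blast
      have \<rho>c: "\<rho> \<in> carrier F" using \<rho>(1) H.S_carrier by simp
      have kc: "\<kappa> \<rho> \<in> carrier P" and kO: "\<kappa> \<rho> \<in> alg_series" using \<rho>c kB by simp_all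
      have dd: "dhorner F ?cs \<rho> \<ominus>\<^bsub>F\<^esub> dhorner F ?cs (r 0) \<in> M"
        using H.horner_congruent[OF \<rho>(1) rR \<rho>(3) csR] by blast
      \<comment> \<open>The derivative at \<rho> is congruent modulo \<open>M\<close> to the one at
        \<open>r 0\<close>, which lies outside \<open>M\<close>; so \<rho> is a simple root over
        \<open>F\<close> itself.\<close>
      have dn: "dhorner F ?cs \<rho> \<noteq> \<zero>\<^bsub>F\<^esub>"
      proof
        assume "dhorner F ?cs \<rho> = \<zero>\<^bsub>F\<^esub>"
        moreover have dc: "dhorner F ?cs (r 0) \<in> carrier F" by (rule H.S_carrier[OF F.dhorner_subring[OF H.sub csR rR]])
        ultimately have "\<ominus>\<^bsub>F\<^esub> dhorner F ?cs (r 0) \<in> M" using dd by (simp add: a_minus_def)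
        from H.M_uminus[OF this] show False using d dc by simp
      qed
      have "horner P cs (\<kappa> \<rho>) \<in> {f \<in> alg_series. f 0 = \<zero>\<^bsub>F\<^esub>}"
        using horner_subring[OF B.sub csB kO] res.hom_horner[OF csc kc] \<rho>(2) by simp
      moreover have "dhorner P cs (\<kappa> \<rho>) \<notin> {f \<in> alg_series. f 0 = \<zero>\<^bsub>F\<^esub>}"
        using res.hom_dhorner[OF csc kc] dn by simp
      ultimately obtain a where a: "a \<in> alg_series" "horner P cs a = \<zero>" "(a \<ominus> \<kappa> \<rho>) 0 = \<zero>\<^bsub>F\<^esub>"
        using B.hensel[OF csB kO] by blast
      have ac: "a \<in> carrier P" using a B.S_carrier by simp
      have "a 0 \<ominus>\<^bsub>F\<^esub> \<rho> = \<zero>\<^bsub>F\<^esub>" using a(3) ac kc by (simp add: a_minus_def)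
      then have a0: "a 0 = \<rho>" using ac \<rho>c by simp
      have "(a \<ominus> r) 0 \<in> M" using \<rho>(3) a0 ac rc by (simp add: a_minus_def)
      moreover have "a \<ominus> r \<in> alg_series" by (rule B.S_minus[OF a(1) rB])
      ultimately show ?thesis using a a0 \<rho>(1) by blast
    qed
  qed
qed

text \<open>The series with constant term in \<open>R\<close> contain every multiple of X by an
  element of \<open>L\<close>, although \<open>L\<close> need not lie in \<open>R\<close>.
  Specialising a countable part of them sends X to a nonzero element of \<open>F\<close>, which
  becomes a common denominator for all of \<open>L\<close>; then \<open>L'\<close> is chosen to
  contain the image.\<close>

lemma henselian_extension:
  assumes large: "large_field F" and sat: "saturated F"
    and L: "countable L" "elementary F L" and R: "R \<subseteq> L" "henselian_subring F R M"
  obtains L' R' M' where "countable L'" "elementary F L'" "R' \<subseteq> L'" "henselian_subring F R' M'"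
    "L \<subseteq> L'" "R \<subseteq> R'" "M' \<inter> R = M" "\<And>x. x \<in> L \<Longrightarrow> \<exists>d\<in>R'. d \<noteq> \<zero>\<^bsub>F\<^esub> \<and> d \<otimes>\<^bsub>F\<^esub> x \<in> R'"
    "\<exists>m\<in>M'. m \<noteq> \<zero>\<^bsub>F\<^esub>"
proof -
  interpret H: henselian_subring F R M by fact
  define S where "S = {f \<in> alg_series. f 0 \<in> R}"
  define N where "N = {f \<in> alg_series. f 0 \<in> M}"
  interpret C: henselian_subring P S N unfolding S_def N_def by (rule composite_henselian[OF R(2)])
  note B = subringE[OF alg_series_subring]
  have TB: "T \<subseteq> alg_series" by (rule etale_alg_series[OF etale_T])
  have Lc: "L \<subseteq> carrier F" using L(2) by (simp add: elementary_def)
  have kB: "\<kappa> c \<in> alg_series" if "c \<in> carrier F" for c using const_T[OF that] TB by blast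
  have XB: "X \<in> alg_series" using X_T TB by blast
  have X0: "X 0 = \<zero>\<^bsub>F\<^esub>" by (rule F.ps_X_0)
  have XN: "X \<in> N" using XB H.M_zero by (simp add: N_def X0)
  define S0 where "S0 = \<kappa> ` R \<union> {X} \<union> (\<lambda>x. X \<otimes> \<kappa> x) ` L"
  have "countable R" using L(1) R(1) countable_subset by blast
  then have "countable S0" using L(1) by (simp add: S0_def)
  moreover have "S0 \<subseteq> S"
  proof -
    have "\<kappa> c \<in> S" if "c \<in> R" for c using kB[OF H.S_carrier[OF that]] that by (simp add: S_def)
    moreover have "X \<in> S" using XN C.M_subset by blast
    moreover have "X \<otimes> \<kappa> x \<in> S" if "x \<in> L" for x
    proof -
      have "x \<in> carrier F" using that Lc by auto
      then show ?thesis using B(6)[OF XB kB] H.S(2) by (simp add: S_def X0)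
    qed
    ultimately show ?thesis by (auto simp: S0_def)
  qed
  ultimately obtain Q where Q: "countable Q" "S0 \<subseteq> Q" "Q \<subseteq> S" "henselian_subring P Q (N \<inter> Q)"
    by (rule C.countable_henselian_subring)
  interpret Q: henselian_subring P Q "N \<inter> Q" by (rule Q(4))
  \<comment> \<open>For \<open>x\<close> in \<open>L\<close> the constant \<open>\<kappa> x\<close>
    may be missing from \<open>Q\<close>. With it in the domain, \<open>v\<close> is multiplicative
    on \<open>X \<otimes> \<kappa> x\<close> and gives the product of \<open>v X\<close> and
    \<open>x\<close>.\<close>
  define D where "D = Q \<union> \<kappa> ` L"
  have "countable D" using Q(1) L(1) by (simp add: D_def)
  moreover have "D \<subseteq> alg_series" using Q(3) kB Lc by (auto simp: D_def S_def)
  ultimately obtain v where v: "partial_hom D v" using alg_series_saturated_hom[OF large sat] by blast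
  have QD: "Q \<subseteq> D" by (simp add: D_def)
  have vc: "v f \<in> carrier F" if "f \<in> D" for f using v that by (simp add: partial_hom_def)
  have vadd: "v (f \<oplus> g) = v f \<oplus>\<^bsub>F\<^esub> v g" if "f \<in> D" "g \<in> D" "f \<oplus> g \<in> D" for f g
    using v that by (simp add: partial_hom_def)
  have vmult: "v (f \<otimes> g) = v f \<otimes>\<^bsub>F\<^esub> v g" if "f \<in> D" "g \<in> D" "f \<otimes> g \<in> D" for f g
    using v that by (simp add: partial_hom_def)
  have vconst: "v (\<kappa> c) = c" if "c \<in> carrier F" "\<kappa> c \<in> D" for c
    using v that by (simp add: partial_hom_def)
  have vnz: "v f \<noteq> \<zero>\<^bsub>F\<^esub>" if "f \<in> D" "f \<noteq> \<zero>" for f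
    using v that by (simp add: partial_hom_def)
  have RQ: "\<kappa> c \<in> Q" if "c \<in> R" for c using that Q(2) by (auto simp: S0_def)
  have hom: "ring_hom_cring (P\<lparr>carrier := Q\<rparr>) F v"
  proof (intro ring_hom_cringI subring_cring[OF Q.sub] F.cring_axioms ring_hom_memI)
    show "v \<one>\<^bsub>P\<lparr>carrier := Q\<rparr>\<^esub> = \<one>\<^bsub>F\<^esub>"
      using vconst[OF F.one_closed] RQ[OF H.S(3)] QD by auto
  qed (use vc vadd vmult QD Q.S(6,7) in \<open>auto simp: subset_iff\<close>)
  have inj: "inj_on v Q"
  proof (rule inj_onI)
    fix f g assume fg: "f \<in> Q" "g \<in> Q" "v f = v g"
    have c: "f \<in> carrier P" "g \<in> carrier P" using fg Q.S_carrier by auto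
    have m: "f \<ominus> g \<in> Q" by (rule Q.S_minus[OF fg(1,2)])
    have "f = (f \<ominus> g) \<oplus> g" using c by algebra
    then have "v f = v (f \<ominus> g) \<oplus>\<^bsub>F\<^esub> v g" using vadd[of "f \<ominus> g" g] m fg QD by auto
    then have "v (f \<ominus> g) = \<zero>\<^bsub>F\<^esub>"
      using fg(3) vc[of g] vc[of "f \<ominus> g"] m fg(2) QD F.add.r_cancel_one'[of "v g" "v (f \<ominus> g)"] by (metis subsetD)
    then have "f \<ominus> g = \<zero>" using vnz[of "f \<ominus> g"] m QD by blast
    then show "f = g" using c by simp
  qed
  have hens: "henselian_subring F (v ` Q) (v ` (N \<inter> Q))"
    by (rule henselian_subring_image[OF Q(4) F.cring_axioms hom inj])
  have XQ: "X \<in> Q" using Q(2) by (simp add: S0_def)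
  have Xnz: "X \<noteq> \<zero>"
  proof
    assume "X = \<zero>"
    then have "X 1 = \<zero> 1" by simp
    then show False by (simp add: ps_X_def P_def PS_simps)
  qed
  obtain L' where L': "countable L'" "L \<union> v ` Q \<subseteq> L'" "elementary F L'"
  proof (rule countable_elementary)
    show "countable (L \<union> v ` Q)" using L(1) Q(1) by simp
    show "L \<union> v ` Q \<subseteq> carrier F" using Lc vc QD by auto
  qed (rule F.zero_closed)
  show ?thesis
  proof (rule that[OF L'(1,3) _ hens])
    show "v ` Q \<subseteq> L'" "L \<subseteq> L'" using L'(2) by auto
    show "R \<subseteq> v ` Q"
    proof
      fix c assume c: "c \<in> R"
      have "v (\<kappa> c) = c" by (rule vconst) (use c H.S_carrier RQ QD in auto)
      then show "c \<in> v ` Q" using RQ[OF c] by (metis image_eqI)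
    qed
    show "v ` (N \<inter> Q) \<inter> R = M"
    proof
      show "v ` (N \<inter> Q) \<inter> R \<subseteq> M"
      proof
        fix c assume "c \<in> v ` (N \<inter> Q) \<inter> R"
        then obtain f where f: "f \<in> N" "f \<in> Q" "c = v f" "c \<in> R" by auto
        have cc: "c \<in> carrier F" using f(4) H.S_carrier by simp
        \<comment> \<open>Both \<open>f\<close> and the constant series are sent to
          \<open>c\<close>, so injectivity identifies them and the constant term of \<open>f\<close>
          decides membership in \<open>M\<close>.\<close>
        have "v (\<kappa> c) = v f" using vconst[OF cc] RQ[OF f(4)] QD f(3) by auto
        then have "\<kappa> c = f" using inj RQ[OF f(4)] f(2) by (simp add: inj_on_eq_iff)
        then have "f 0 = c" by (metis F.ps_const_0)
        then show "c \<in> M" using f(1) by (simp add: N_def)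
      qed
      show "M \<subseteq> v ` (N \<inter> Q) \<inter> R"
      proof
        fix c assume c: "c \<in> M"
        have cR: "c \<in> R" using c H.M_subset by auto
        have cc: "c \<in> carrier F" using cR H.S_carrier by simp
        have "\<kappa> c \<in> N \<inter> Q" using c kB[OF cc] RQ[OF cR] by (simp add: N_def)
        moreover have "v (\<kappa> c) = c" using vconst[OF cc] RQ[OF cR] QD by auto
        ultimately show "c \<in> v ` (N \<inter> Q) \<inter> R" using cR by (metis IntI image_eqI)
      qed
    qed
    have vX: "v X \<noteq> \<zero>\<^bsub>F\<^esub>" using vnz[of X] XQ QD Xnz by blast
    show "\<exists>d\<in>v ` Q. d \<noteq> \<zero>\<^bsub>F\<^esub> \<and> d \<otimes>\<^bsub>F\<^esub> x \<in> v ` Q" if x: "x \<in> L" for x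
    proof -
      have xc: "x \<in> carrier F" using x Lc by auto
      have kD: "\<kappa> x \<in> D" using x by (simp add: D_def)
      have XkQ: "X \<otimes> \<kappa> x \<in> Q" using x Q(2) by (auto simp: S0_def)
      have "v (X \<otimes> \<kappa> x) = v X \<otimes>\<^bsub>F\<^esub> x"
        using vmult[of X "\<kappa> x"] vconst[OF xc kD] kD XQ XkQ QD by auto
      then have "v X \<otimes>\<^bsub>F\<^esub> x \<in> v ` Q" using XkQ by (metis image_eqI)
      then show ?thesis using vX XQ by blast
    qed
    show "\<exists>m\<in>v ` (N \<inter> Q). m \<noteq> \<zero>\<^bsub>F\<^esub>" using vX XN XQ by blast
  qed
qed

end

section \<open>Fraction fields of henselian domains\<close>

lemma elem_equiv_iso:
  assumes h: "ring_hom_cring K L h" and inj: "inj_on h (carrier K)" and surj: "h ` carrier K = carrier L"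
  shows "elem_equiv K L"
proof -
  interpret ring_hom_cring K L h by fact
  have tv: "tval L (\<lambda>i. h (e i)) t = h (tval K e t) \<and> tval K e t \<in> carrier K" if "e \<in> UNIV \<rightarrow> carrier K" for e t
    using that by (induction t) auto
  have sat: "sat L (\<lambda>i. h (e i)) p \<longleftrightarrow> sat K e p" if "e \<in> UNIV \<rightarrow> carrier K" for e p
    using that
  proof (induction p arbitrary: e)
    case (Eq s t)
    then show ?case using tv[OF Eq] inj by (simp add: inj_on_eq_iff)
  next
    case (Exists n p)
    have "sat L ((\<lambda>i. h (e i))(n := h x)) p \<longleftrightarrow> sat K (e(n := x)) p" if x: "x \<in> carrier K" for x
    proof -
      have upd: "(\<lambda>i. h (e i))(n := h x) = (\<lambda>i. h ((e(n := x)) i))" by (rule ext) simp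
      show ?thesis unfolding upd by (rule Exists.IH) (use Exists.prems x in auto)
    qed
    then show ?case unfolding sat.simps surj[symmetric] by blast
  qed simp_all
  show ?thesis
    unfolding elem_equiv_def
  proof (intro allI impI)
    fix p assume p: "sentence p"
    have 1: "(\<lambda>_. \<zero>\<^bsub>K\<^esub>) \<in> UNIV \<rightarrow> carrier K" by simp
    have 2: "(\<lambda>_. h \<zero>\<^bsub>K\<^esub>) \<in> UNIV \<rightarrow> carrier L" by simp
    show "models K p \<longleftrightarrow> models L p"
      using models_iff_sat[OF p 1] models_iff_sat[OF p 2] sat[OF 1] by simp
  qed
qed

text \<open>If the maximal ideal were zero, every nonzero element would be a unit; a ring that is
  not a field thus provides the nonzero \<open>m\<close> needed for \<open>large\<close>.\<close>

theorem large_field_frac_field: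
  assumes dom: "domain R" and hens: "henselian_local_ring R" and nf: "\<not> field R"
  shows "large_field (frac_field R)"
proof -
  interpret domain R by fact
  let ?F = "frac_field R"
  interpret F: field ?F by (rule frac_field_is_field)
  obtain M where M: "henselian_subring R (carrier R) M" using henselian_local_ringD[OF hens] by blast
  interpret M: henselian_subring R "carrier R" M by (rule M)
  let ?\<iota> = "\<lambda>r. Defs.frac R r \<one>\<^bsub>R\<^esub>"
  have hom: "ring_hom_cring (R\<lparr>carrier := carrier R\<rparr>) ?F ?\<iota>"
    by (intro ring_hom_cringI ring_hom_memI F.cring_axioms)
      (simp_all add: frac_closed frac_mult frac_add frac_field_one is_cring)
  have inj: "inj_on ?\<iota> (carrier R)" by (rule inj_onI) (simp add: frac_eq_iff)
  interpret henselian_fractions ?F "?\<iota> ` carrier R" "?\<iota> ` M"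
  proof (intro henselian_fractions.intro henselian_fractions_axioms.intro F.field_axioms)
    show "henselian_subring ?F (?\<iota> ` carrier R) (?\<iota> ` M)"
      by (rule henselian_subring_image[OF M F.cring_axioms hom inj])
    fix x assume "x \<in> carrier ?F"
    then obtain a b where ab: "a \<in> carrier R" "b \<in> carrier R" "b \<noteq> \<zero>\<^bsub>R\<^esub>" "x = Defs.frac R a b"
      by (rule frac_cases)
    have "?\<iota> b \<otimes>\<^bsub>?F\<^esub> x = ?\<iota> a" using ab by (simp add: frac_mult frac_eq_iff m_comm)
    moreover have "?\<iota> b \<noteq> \<zero>\<^bsub>?F\<^esub>" using ab by (simp add: frac_field_zero frac_eq_iff)
    ultimately show "\<exists>d\<in>?\<iota> ` carrier R. d \<noteq> \<zero>\<^bsub>?F\<^esub> \<and> d \<otimes>\<^bsub>?F\<^esub> x \<in> ?\<iota> ` carrier R"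
      using ab by auto
  qed
  obtain m where m: "m \<in> M" "m \<noteq> \<zero>\<^bsub>R\<^esub>"
  proof (rule ccontr)
    assume "\<not> thesis"
    then have M0: "M \<subseteq> {\<zero>\<^bsub>R\<^esub>}" using that by blast
    have "field R" by (rule cring_fieldI2) (use M.unit M0 in auto)
    then show False using nf by blast
  qed
  have "m \<in> carrier R" using m M.M_subset by blast
  then have "?\<iota> m \<noteq> \<zero>\<^bsub>?F\<^esub>" using m by (simp add: frac_field_zero frac_eq_iff)
  then show ?thesis using large[of "?\<iota> m"] m by blast
qed

context henselian_fractions
begin

text \<open>Only \<open>S\<close> has to be injected into the new type: the fraction field is
  rebuilt from the copy by \<open>frac_field\<close>, and \<open>A\<close> is identified with it
  through x = (d x)/d.\<close>

lemma fraction_field_copy: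
  fixes g :: "'a \<Rightarrow> 'c"
  assumes g: "inj_on g S" and m: "m \<in> M" "m \<noteq> \<zero>"
  obtains Q :: "'c ring" where "domain Q" "henselian_local_ring Q" "\<not> field Q" "elem_equiv A (frac_field Q)"
proof -
  define h where "h = inv_into S g"
  have hg: "h (g x) = x" if "x \<in> S" for x using that g by (simp add: h_def)
  define Q where "Q = \<lparr>carrier = g ` S, monoid.mult = (\<lambda>x y. g (h x \<otimes> h y)), one = g \<one>,
    zero = g \<zero>, add = (\<lambda>x y. g (h x \<oplus> h y))\<rparr>"
  have carrier_Q: "carrier Q = g ` S" and zero_Q: "\<zero>\<^bsub>Q\<^esub> = g \<zero>"
    by (simp_all add: Q_def)
  have gmult: "g x \<otimes>\<^bsub>Q\<^esub> g y = g (x \<otimes> y)" if "x \<in> S" "y \<in> S" for x y using that by (simp add: Q_def hg)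
  have gadd: "g x \<oplus>\<^bsub>Q\<^esub> g y = g (x \<oplus> y)" if "x \<in> S" "y \<in> S" for x y using that by (simp add: Q_def hg)
  have gone: "\<one>\<^bsub>Q\<^esub> = g \<one>" by (simp add: Q_def)
  note SS = H.S
  have hom: "g \<in> ring_hom (A\<lparr>carrier := S\<rparr>) Q"
    by (rule ring_hom_memI) (simp_all add: carrier_Q gmult gadd gone)
  have "g \<in> ring_iso (A\<lparr>carrier := S\<rparr>) Q"
    using hom g by (simp add: ring_iso_def bij_betw_def carrier_Q)
  \<comment> \<open>The transport lemma overwrites the zero of the target; here it is the zero
    already chosen.\<close>
  then have "domain (Q\<lparr>zero := g \<zero>\<rparr>)"
    using domain.ring_iso_imp_img_domain[OF subring_is_domain[OF H.sub]] by simp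
  moreover have "Q\<lparr>zero := g \<zero>\<rparr> = Q" by (simp add: Q_def)
  ultimately interpret Q: domain Q by simp
  have hQ: "henselian_subring Q (g ` S) (g ` M)"
    by (rule henselian_subring_image[OF H.henselian_subring_axioms Q.is_cring _ g])
      (intro ring_hom_cringI subring_cring[OF H.sub] Q.is_cring hom)
  interpret hQ: henselian_subring Q "g ` S" "g ` M" by (rule hQ)
  have gS: "g x \<in> carrier Q" if "x \<in> S" for x using that by (simp add: carrier_Q)
  have gnz: "g x \<in> carrier Q - {\<zero>\<^bsub>Q\<^esub>}" if "x \<in> S" "x \<noteq> \<zero>" for x
    using that SS(2) g by (auto simp: carrier_Q zero_Q inj_on_eq_iff)
  have nf: "\<not> field Q"
  proof
    assume "field Q"
    then interpret QF: field Q .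
    have mS: "m \<in> S" using m(1) H.M_subset by auto
    have "g m \<in> Units Q" using gnz[OF mS m(2)] QF.field_Units by simp
    then obtain y where "y \<in> carrier Q" "y \<otimes>\<^bsub>Q\<^esub> g m = \<one>\<^bsub>Q\<^esub>" by (auto simp: Units_def)
    then show False using hQ.M_mult[of y "g m"] m(1) hQ.one_notin_M by (simp add: carrier_Q)
  qed
  let ?F = "frac_field Q"
  interpret F: field ?F by (rule Q.frac_field_is_field)
  have fracs: "\<exists>d. d \<in> S \<and> d \<noteq> \<zero> \<and> d \<otimes> x \<in> S" if "x \<in> carrier A" for x
    using fractions[OF that] by blast
  \<comment> \<open>A denominator is chosen once for each element; \<open>eq_iff\<close> shows that
    the fraction does not depend on it.\<close>
  define den where "den x = (SOME d. d \<in> S \<and> d \<noteq> \<zero> \<and> d \<otimes> x \<in> S)" for x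
  have den: "den x \<in> S" "den x \<noteq> \<zero>" "den x \<otimes> x \<in> S" if "x \<in> carrier A" for x
    using someI_ex[OF fracs[OF that]] unfolding den_def by blast+
  define \<psi> where "\<psi> x = Defs.frac Q (g (den x \<otimes> x)) (g (den x))" for x
  have eq_iff: "Defs.frac Q (g (d \<otimes> x)) (g d) = Defs.frac Q (g (d' \<otimes> y)) (g d') \<longleftrightarrow> x = y"
    if d: "d \<in> S" "d \<noteq> \<zero>" "d \<otimes> x \<in> S" and d': "d' \<in> S" "d' \<noteq> \<zero>" "d' \<otimes> y \<in> S"
      and xy: "x \<in> carrier A" "y \<in> carrier A" for d d' x y
  proof -
    have dc: "d \<in> carrier A" "d' \<in> carrier A" using d d' SS(1) by auto
    have "Defs.frac Q (g (d \<otimes> x)) (g d) = Defs.frac Q (g (d' \<otimes> y)) (g d')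
        \<longleftrightarrow> g (d \<otimes> x) \<otimes>\<^bsub>Q\<^esub> g d' = g (d' \<otimes> y) \<otimes>\<^bsub>Q\<^esub> g d"
      by (rule Q.frac_eq_iff[OF gS gnz gS gnz]) (use d d' in auto)
    also have "\<dots> \<longleftrightarrow> (d \<otimes> x) \<otimes> d' = (d' \<otimes> y) \<otimes> d"
      using d d' SS(6) by (simp add: gmult inj_on_eq_iff[OF g])
    also have "\<dots> \<longleftrightarrow> (d \<otimes> d') \<otimes> x = (d \<otimes> d') \<otimes> y"
      using dc xy by (simp add: m_ac)
    also have "\<dots> \<longleftrightarrow> x = y"
      using dc xy d(2) d'(2) by (simp add: m_lcancel integral_iff)
    finally show ?thesis .
  qed
  have \<psi>: "\<psi> x = Defs.frac Q (g (d \<otimes> x)) (g d)" if "d \<in> S" "d \<noteq> \<zero>" "d \<otimes> x \<in> S" "x \<in> carrier A" for d x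
    unfolding \<psi>_def using eq_iff[OF den[OF that(4)] that(1-3) that(4,4)] by simp
  have \<psi>_hom: "\<psi> x \<otimes>\<^bsub>?F\<^esub> \<psi> y = \<psi> (x \<otimes> y)" "\<psi> x \<oplus>\<^bsub>?F\<^esub> \<psi> y = \<psi> (x \<oplus> y)"
    if xy: "x \<in> carrier A" "y \<in> carrier A" for x y
  proof -
    let ?d = "den x" and ?e = "den y"
    note d = den[OF xy(1)] and e = den[OF xy(2)]
    have c: "?d \<in> carrier A" "?e \<in> carrier A" using d e SS(1) by auto
    have de: "?d \<otimes> ?e \<in> S" "?d \<otimes> ?e \<noteq> \<zero>" using SS(6) d e c by (auto simp: integral_iff)
    have m: "(?d \<otimes> ?e) \<otimes> (x \<otimes> y) = (?d \<otimes> x) \<otimes> (?e \<otimes> y)"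
      using c xy by (simp add: m_ac)
    have a: "(?d \<otimes> ?e) \<otimes> (x \<oplus> y) = (?d \<otimes> x) \<otimes> ?e \<oplus> (?e \<otimes> y) \<otimes> ?d"
      using c xy by algebra
    have mS: "(?d \<otimes> x) \<otimes> (?e \<otimes> y) \<in> S" using SS(6) d e by simp
    have aS: "(?d \<otimes> x) \<otimes> ?e \<oplus> (?e \<otimes> y) \<otimes> ?d \<in> S" using SS(6,7) d e by simp
    show "\<psi> x \<otimes>\<^bsub>?F\<^esub> \<psi> y = \<psi> (x \<otimes> y)"
    proof -
      have "\<psi> (x \<otimes> y) = Defs.frac Q (g ((?d \<otimes> x) \<otimes> (?e \<otimes> y))) (g (?d \<otimes> ?e))"
        using \<psi>[OF de, of "x \<otimes> y"] m mS xy by simp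
      also have "\<dots> = \<psi> x \<otimes>\<^bsub>?F\<^esub> \<psi> y"
        unfolding \<psi>_def Q.frac_mult[OF gS[OF d(3)] gnz[OF d(1,2)] gS[OF e(3)] gnz[OF e(1,2)]]
        using gmult d e by simp
      finally show ?thesis by simp
    qed
    show "\<psi> x \<oplus>\<^bsub>?F\<^esub> \<psi> y = \<psi> (x \<oplus> y)"
    proof -
      have "\<psi> (x \<oplus> y) = Defs.frac Q (g ((?d \<otimes> x) \<otimes> ?e \<oplus> (?e \<otimes> y) \<otimes> ?d)) (g (?d \<otimes> ?e))"
        using \<psi>[OF de, of "x \<oplus> y"] a aS xy by simp
      also have "\<dots> = \<psi> x \<oplus>\<^bsub>?F\<^esub> \<psi> y"
        unfolding \<psi>_def Q.frac_add[OF gS[OF d(3)] gnz[OF d(1,2)] gS[OF e(3)] gnz[OF e(1,2)]]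
        using gmult gadd SS(6) d e by simp
      finally show ?thesis by simp
    qed
  qed
  have \<psi>_closed: "\<psi> x \<in> carrier ?F" if "x \<in> carrier A" for x
    unfolding \<psi>_def by (rule Q.frac_closed[OF gS gnz]) (use den[OF that] in auto)
  have \<psi>_one: "\<psi> \<one> = \<one>\<^bsub>?F\<^esub>"
    using \<psi>[of \<one> \<one>] SS(3) by (simp add: Q.frac_field_one gone)
  have "elem_equiv A ?F"
  proof (rule elem_equiv_iso)
    show "ring_hom_cring A ?F \<psi>"
      by (intro ring_hom_cringI is_cring F.is_cring ring_hom_memI) (simp_all add: \<psi>_closed \<psi>_hom \<psi>_one)
    show "inj_on \<psi> (carrier A)"
    proof (rule inj_onI)
      fix x y assume xy: "x \<in> carrier A" "y \<in> carrier A" "\<psi> x = \<psi> y"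
      then show "x = y" using eq_iff[OF den[OF xy(1)] den[OF xy(2)] xy(1,2)] by (simp add: \<psi>_def)
    qed
    show "\<psi> ` carrier A = carrier ?F"
    proof
      show "\<psi> ` carrier A \<subseteq> carrier ?F" using \<psi>_closed by auto
      show "carrier ?F \<subseteq> \<psi> ` carrier A"
      proof
        fix z assume "z \<in> carrier ?F"
        then obtain a' b' where z: "a' \<in> carrier Q" "b' \<in> carrier Q" "b' \<noteq> \<zero>\<^bsub>Q\<^esub>" "z = Defs.frac Q a' b'"
          by (rule Q.frac_cases)
        obtain a b where ab: "a \<in> S" "b \<in> S" "a' = g a" "b' = g b" using z(1,2) by (auto simp: carrier_Q)
        have b: "b \<noteq> \<zero>" using z(3) ab(4) by (auto simp: zero_Q)
        have c: "a \<in> carrier A" "b \<in> carrier A" using ab SS(1) by auto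
        then have u: "b \<in> Units A" using b field_Units by simp
        have ba: "b \<otimes> (inv b \<otimes> a) = a" using u c by (simp add: m_assoc[symmetric])
        have "\<psi> (inv b \<otimes> a) = z" using \<psi>[OF ab(2) b, of "inv b \<otimes> a"] ba ab z(4) u c by simp
        then show "z \<in> \<psi> ` carrier A" using u c by auto
      qed
    qed
  qed
  moreover have "henselian_local_ring Q"
    by (rule henselian_local_ringI[of Q "g ` M"]) (use hQ carrier_Q in simp)
  ultimately show ?thesis using that Q.domain_axioms nf by blast
qed

end

section \<open>The union of the chain\<close>

lemma (in field) elementary_field:
  assumes C: "elementary R C"
  shows "field (R\<lparr>carrier := C\<rparr>)"
proof (rule cring.cring_fieldI2)
  show "cring (R\<lparr>carrier := C\<rparr>)" by (rule subring_cring[OF elementary_subring[OF C]])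
  show "\<zero>\<^bsub>R\<lparr>carrier := C\<rparr>\<^esub> \<noteq> \<one>\<^bsub>R\<lparr>carrier := C\<rparr>\<^esub>" by simp
  fix x assume x: "x \<in> carrier (R\<lparr>carrier := C\<rparr>)" "x \<noteq> \<zero>\<^bsub>R\<lparr>carrier := C\<rparr>\<^esub>"
  have "x \<in> carrier R" using C x by (auto simp: elementary_def)
  then have "x \<otimes> inv x = \<one>" using x field_Units by simp
  moreover have "inv x \<in> C" using elementary_closed(6)[OF C, of x x] x by simp
  ultimately show "\<exists>y\<in>carrier (R\<lparr>carrier := C\<rparr>). x \<otimes>\<^bsub>R\<lparr>carrier := C\<rparr>\<^esub> y = \<one>\<^bsub>R\<lparr>carrier := C\<rparr>\<^esub>"
    by auto
qed

text \<open>The start of the chain: with maximal ideal zero, an approximate root is already a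
  root.\<close>

lemma (in field) henselian_subring_field:
  assumes C: "elementary R C"
  shows "henselian_subring R C {\<zero>}"
proof (intro henselian_subring.intro henselian_subring_axioms.intro is_cring)
  note sub = elementary_subring[OF C]
  note S = subringE[OF sub]
  have c: "x \<in> carrier R" if "x \<in> C" for x using that S(1) by auto
  show "subring C R" by (rule sub)
  show "{\<zero>} \<subseteq> C" using S(2) by simp
  show "\<exists>y\<in>C. x \<otimes> y = \<one>" if "x \<in> C" "x \<notin> {\<zero>}" for x
    using elementary_closed(6)[OF C that(1,1)] that c[of x] field_Units by (intro bexI[of _ "inv x"]) simp_all
  show "\<exists>a\<in>C. horner R cs a = \<zero> \<and> a \<ominus> r \<in> {\<zero>}" if "r \<in> C" "horner R cs r \<in> {\<zero>}" for cs r
    using that c[of r] by (intro bexI[of _ r]) (auto simp: a_minus_def r_neg)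
  show "x \<otimes> y \<in> {\<zero>}" if "x \<in> C" "y \<in> {\<zero>}" for x y using that c by simp
qed simp_all

context power_series
begin

text \<open>At stage n the field L_n only lies in the fractions of R_(n+1), which lies in L_(n+1).
  In the union the inclusions close up, so the elementary subfield consists of fractions over the
  henselian ring.\<close>

lemma henselian_chain:
  assumes large: "large_field F" and sat: "saturated F"
  obtains L R M where "countable L" "elementary F L" "R \<subseteq> L" "henselian_subring F R M"
    "\<And>x. x \<in> L \<Longrightarrow> \<exists>d\<in>R. d \<noteq> \<zero>\<^bsub>F\<^esub> \<and> d \<otimes>\<^bsub>F\<^esub> x \<in> R" "\<exists>m\<in>M. m \<noteq> \<zero>\<^bsub>F\<^esub>"
proof -
  define good where "good = (\<lambda>(L, R, M). countable L \<and> elementary F L \<and> R \<subseteq> L \<and> henselian_subring F R M)"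
  define ext where "ext = (\<lambda>(L, R, M) (L', R', M'). L \<subseteq> L' \<and> R \<subseteq> R' \<and> M' \<inter> R = M \<and>
    (\<forall>x\<in>L. \<exists>d\<in>R'. d \<noteq> \<zero>\<^bsub>F\<^esub> \<and> d \<otimes>\<^bsub>F\<^esub> x \<in> R') \<and> (\<exists>m\<in>M'. m \<noteq> \<zero>\<^bsub>F\<^esub>))"
  have "\<exists>s. good s"
  proof -
    obtain C where C: "countable C" "elementary F C"
      using countable_elementary[of "{}" F, OF _ _ F.zero_closed] by blast
    then have "good (C, C, {\<zero>\<^bsub>F\<^esub>})" using F.henselian_subring_field by (simp add: good_def)
    then show ?thesis by blast
  qed
  moreover have "\<exists>t. good t \<and> ext s t" if "good s" for s
  proof -
    obtain L R M where s: "s = (L, R, M)" by (cases s)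
    have g: "countable L" "elementary F L" "R \<subseteq> L" "henselian_subring F R M" using that by (simp_all add: good_def s)
    show ?thesis
    proof (rule henselian_extension[OF large sat g])
      fix L' R' M'
      assume "countable L'" "elementary F L'" "R' \<subseteq> L'" "henselian_subring F R' M'"
        "L \<subseteq> L'" "R \<subseteq> R'" "M' \<inter> R = M" "\<And>x. x \<in> L \<Longrightarrow> \<exists>d\<in>R'. d \<noteq> \<zero>\<^bsub>F\<^esub> \<and> d \<otimes>\<^bsub>F\<^esub> x \<in> R'"
        "\<exists>m\<in>M'. m \<noteq> \<zero>\<^bsub>F\<^esub>"
      then show ?thesis by (intro exI[of _ "(L', R', M')"]) (simp add: good_def ext_def s)
    qed
  qed
  ultimately obtain f :: "nat \<Rightarrow> _" where f: "\<And>n. good (f n)" "\<And>n. ext (f n) (f (Suc n))"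
    using dependent_nat_choice[of "\<lambda>_. good" "\<lambda>_. ext"] by blast
  define L R M where "L n = fst (f n)" and "R n = fst (snd (f n))" and "M n = snd (snd (f n))" for n
  have fn: "f n = (L n, R n, M n)" for n by (simp add: L_def R_def M_def)
  have g: "countable (L n)" "elementary F (L n)" "R n \<subseteq> L n" "henselian_subring F (R n) (M n)" for n
    using f(1)[of n] by (simp_all add: fn good_def)
  have e: "L n \<subseteq> L (Suc n)" "R n \<subseteq> R (Suc n)" "M (Suc n) \<inter> R n = M n" "\<exists>m\<in>M (Suc n). m \<noteq> \<zero>\<^bsub>F\<^esub>" for n
    using f(2)[of n] by (simp_all add: fn ext_def)
  have d: "\<exists>d\<in>R (Suc n). d \<noteq> \<zero>\<^bsub>F\<^esub> \<and> d \<otimes>\<^bsub>F\<^esub> x \<in> R (Suc n)" if "x \<in> L n" for n x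
    using f(2)[of n] that by (simp add: fn ext_def)
  show ?thesis
  proof (rule that)
    show "countable (\<Union>n. L n)" using g(1) by blast
    show "elementary F (\<Union>n. L n)" by (rule elementary_Union) (rule g(2), rule e(1))
    show "(\<Union>n. R n) \<subseteq> (\<Union>n. L n)" using g(3) by blast
    show "henselian_subring F (\<Union>n. R n) (\<Union>n. M n)" by (rule henselian_subring_Union) (rule g(4), rule e(2), rule e(3))
    show "\<exists>d\<in>(\<Union>n. R n). d \<noteq> \<zero>\<^bsub>F\<^esub> \<and> d \<otimes>\<^bsub>F\<^esub> x \<in> (\<Union>n. R n)" if "x \<in> (\<Union>n. L n)" for x
      using that d by blast
    show "\<exists>m\<in>(\<Union>n. M n). m \<noteq> \<zero>\<^bsub>F\<^esub>" using e(4)[of 0] by blast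
  qed
qed

end

text \<open>The type of \<open>R\<close> is independent of that of \<open>K\<close>, so the
  constructed ring must fit every infinite type; it is countable for this reason. On a finite type
  every domain would be a field.\<close>

theorem theoremA:
  fixes K :: "('a, 'm) ring_scheme"
  assumes "field K"
    and "infinite (UNIV :: 'b set)"
  shows "large_field K \<longleftrightarrow>
    (\<exists>R :: 'b ring. domain R \<and> henselian_local_ring R \<and> \<not> field R \<and>
       elem_equiv K (frac_field R))"
proof
  assume "\<exists>R :: 'b ring. domain R \<and> henselian_local_ring R \<and> \<not> field R \<and> elem_equiv K (frac_field R)"
  then obtain R :: "'b ring" where R: "domain R" "henselian_local_ring R" "\<not> field R" "elem_equiv K (frac_field R)"
    by blast
  show "large_field K"
    by (rule large_field_elem_equiv[OF large_field_frac_field[OF R(1-3)] assms(1) elem_equiv_sym[OF R(4)]])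
next
  assume large: "large_field K"
  obtain F :: "(nat \<Rightarrow> 'a) ring" where F: "field F" "elem_equiv K F" "saturated F"
    by (rule saturated_extension[OF assms(1)])
  interpret power_series F "PS F" by (intro power_series.intro F(1)) 
  have "large_field F" by (rule large_field_elem_equiv[OF large F(1,2)])
  then obtain L S M where L: "countable L" "elementary F L" "S \<subseteq> L" "henselian_subring F S M"
      and frac: "\<And>x. x \<in> L \<Longrightarrow> \<exists>d\<in>S. d \<noteq> \<zero>\<^bsub>F\<^esub> \<and> d \<otimes>\<^bsub>F\<^esub> x \<in> S" and m: "\<exists>m\<in>M. m \<noteq> \<zero>\<^bsub>F\<^esub>"
    using henselian_chain[OF _ F(3)] by blast
  let ?L = "F\<lparr>carrier := L\<rparr>"
  interpret H: henselian_subring F S M by (rule L(4))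
  interpret L: field ?L by (rule F.elementary_field[OF L(2)])
  \<comment> \<open>The subsets stay the same; the identity map only replaces the ambient ring
    \<open>F\<close> by the subfield on \<open>L\<close>.\<close>
  have "henselian_subring ?L (id ` S) (id ` M)"
  proof (rule henselian_subring_image[OF L(4) L.is_cring])
    show "ring_hom_cring (F\<lparr>carrier := S\<rparr>) ?L id"
      by (intro ring_hom_cringI F.subring_cring[OF H.sub] L.is_cring ring_hom_memI) (use L(3) in auto)
  qed simp
  then interpret henselian_fractions ?L S M
    by (intro henselian_fractions.intro henselian_fractions_axioms.intro L.field_axioms) (use frac in simp_all)
  \<comment> \<open>An enumeration of \<open>L\<close> followed by \<beta> injects the countable
    field, and with it \<open>S\<close>, into the target type.\<close>
  obtain \<beta> :: "nat \<Rightarrow> 'b" where \<beta>: "inj \<beta>" using assms(2) infinite_countable_subset by blast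
  have "inj_on (\<beta> \<circ> to_nat_on L) L"
    by (intro comp_inj_on inj_on_to_nat_on[OF L(1)] inj_on_subset[OF \<beta> subset_UNIV])
  then have inj: "inj_on (\<beta> \<circ> to_nat_on L) S" using L(3) by (rule inj_on_subset)
  obtain m0 where m0: "m0 \<in> M" "m0 \<noteq> \<zero>\<^bsub>?L\<^esub>" using m by auto
  obtain R :: "'b ring" where R: "domain R" "henselian_local_ring R" "\<not> field R" "elem_equiv ?L (frac_field R)"
    by (rule fraction_field_copy[OF inj m0])
  have "elem_equiv K (frac_field R)"
    by (rule elem_equiv_trans[OF F(2) elem_equiv_trans[OF elem_equiv_sym[OF F.elementary_elem_equiv[OF L(2)]] R(4)]])
  then show "\<exists>R :: 'b ring. domain R \<and> henselian_local_ring R \<and> \<not> field R \<and> elem_equiv K (frac_field R)"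
    using R by blast
qed

end
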